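(* Let $\mathbb{H}$ be the real separable infinite dimensional Hilbert space. For every integer $p \ge 0$ there exist smooth diffeomorphisms $$\Psi^p_{[0,2\pi]}: G_0\times\mathbb{H} \to H^p([0,2\pi]) \quad\text{and}\quad \Psi^p_{\mathbb{S}^1}: G_0\times\mathbb{H}\to H^p(\mathbb{S}^1)$$ such that both compositions $\mu\circ\Psi^p_{[0,2\pi]}$ and $\mu\circ\Psi^p_{\mathbb{S}^1}$ are the projection $G_0\times\mathbb{H}\to G_0$ on the first coordinate, where $\mu$ is the monodromy map (restricted to the respective space).
   Context: $H^p([0,2\pi])$, $p\ge 0$, is the Sobolev space of real functions on $[0,2\pi]$ whose $p$-th derivative is in $H^0([0,2\pi])=L^2([0,2\pi])$. $H^p(\mathbb{S}^1)\subset H^p([0,2\pi])$ is the closed subspace (of codimension $p$) of functions $u$ with $u^{(j)}(0)=u^{(j)}(2\pi)$ for $0\le j\le p-1$. Let $\Pi: G = \widetilde{SL(2,\mathbb{R})} \to SL(2,\mathbb{R})$ be the universal cover, a Lie group with identity denoted $I$. Monodromy: for $q \in H^0([0,2\pi])$ let $\Phi: [0,2\pi] \to SL(2,\mathbb{R})$ be the solution of $\Phi(0) = I$, $\Phi'(t) = \begin{pmatrix} 0 & 1 \\ q(t) & 0 \end{pmatrix}\Phi(t)$. Let $\tilde\Phi: [0,2\pi] \to G$ be its continuous lift with $\tilde\Phi(0) = I$, $\Pi\circ\tilde\Phi = \Phi$. Then $\mu(q) = \tilde\Phi(2\pi) \in G$. The set $G_0$: let $\phi_L: \mathbb{R} \times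 (0,\infty) \times \mathbb{R} \to G$ be the diffeomorphism (left Iwasawa decomposition) determined by continuity, $\phi_L(0,1,0) = I$ and $$(\Pi \circ \phi_L)(\theta,\rho,\nu) = \begin{pmatrix} \cos\theta & \sin\theta \\ -\sin\theta & \cos\theta \end{pmatrix} \begin{pmatrix} \sqrt{\rho} & 0 \\ 0 & 1/\sqrt{\rho} \end{pmatrix} \begin{pmatrix} 1 & 0 \\ \nu/2 & 1 \end{pmatrix}.$$ Then $G_0 = \phi_L((0,+\infty)\times(0,+\infty)\times\mathbb{R})$, an open subset of $G$. *)

theory Defs
  imports "HOL-Analysis.Analysis" "HOL-Algebra.Group"
begin

abbreviation leb_int :: "real measure" where
  "leb_int \<equiv> lebesgue_on {0..2 * pi}"

definition square_int :: "(real \<Rightarrow> real) \<Rightarrow> bool" where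
  "square_int f \<longleftrightarrow> f \<in> borel_measurable leb_int \<and> integrable leb_int (\<lambda>x. (f x)\<^sup>2)"

definition ltwo_rel :: "(real \<Rightarrow> real) \<Rightarrow> (real \<Rightarrow> real) \<Rightarrow> bool" where
  "ltwo_rel f g \<longleftrightarrow> square_int f \<and> square_int g \<and> (AE x in leb_int. f x = g x)"

lemma square_int_mult:
  assumes "square_int f" "square_int g"
  shows "integrable leb_int (\<lambda>x. f x * g x)"
proof (rule Bochner_Integration.integrable_bound)
  show "integrable leb_int (\<lambda>x. (f x)\<^sup>2 + (g x)\<^sup>2)"
    using assms by (auto simp: square_int_def)
  show "(\<lambda>x. f x * g x) \<in> borel_measurable leb_int"
    using assms by (auto simp: square_int_def)
  have "\<bar>a * b\<bar> \<le> a\<^sup>2 + b\<^sup>2" for a b :: real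
  proof -
    have "2 * (\<bar>a\<bar> * \<bar>b\<bar>) \<le> a\<^sup>2 + b\<^sup>2"
      using sum_squares_bound[of "\<bar>a\<bar>" "\<bar>b\<bar>"] by (simp add: mult.assoc)
    moreover have "0 \<le> \<bar>a\<bar> * \<bar>b\<bar>" by simp
    ultimately show ?thesis unfolding abs_mult by linarith
  qed
  then show "AE x in leb_int. norm (f x * g x) \<le> norm ((f x)\<^sup>2 + (g x)\<^sup>2)"
    by simp
qed

lemma square_int_zero: "square_int (\<lambda>_. 0)"
  by (simp add: square_int_def)

lemma square_int_scale: "square_int f \<Longrightarrow> square_int (\<lambda>x. c * f x)"
  by (auto simp: square_int_def power_mult_distrib)

lemma square_int_add:
  assumes "square_int f" "square_int g"
  shows "square_int (\<lambda>x. f x + g x)"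
proof -
  have "(\<lambda>x. (f x + g x)\<^sup>2) = (\<lambda>x. (f x)\<^sup>2 + (g x)\<^sup>2 + 2 * (f x * g x))"
    by (auto simp: power2_eq_square algebra_simps)
  then show ?thesis
    using assms square_int_mult[OF assms] by (auto simp: square_int_def)
qed

quotient_type ltwo = "real \<Rightarrow> real" / partial: ltwo_rel
proof (rule part_equivpI)
  show "\<exists>f. ltwo_rel f f"
    by (rule exI[of _ "\<lambda>_. 0"]) (simp add: ltwo_rel_def square_int_zero)
  show "symp ltwo_rel"
    by (auto simp: symp_def ltwo_rel_def eq_commute)
  show "transp ltwo_rel"
    by (auto simp: transp_def ltwo_rel_def elim: AE_mp)
qed

instantiation ltwo :: real_inner
begin

lift_definition zero_ltwo :: ltwo is "\<lambda>_. 0"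
  by (simp add: ltwo_rel_def square_int_zero)

lift_definition plus_ltwo :: "ltwo \<Rightarrow> ltwo \<Rightarrow> ltwo" is "\<lambda>f g x. f x + g x"
  by (auto simp: ltwo_rel_def intro: square_int_add elim: AE_mp)

lift_definition scaleR_ltwo :: "real \<Rightarrow> ltwo \<Rightarrow> ltwo" is "\<lambda>c f x. c * f x"
  by (auto simp: ltwo_rel_def intro: square_int_scale elim: AE_mp)

lift_definition uminus_ltwo :: "ltwo \<Rightarrow> ltwo" is "\<lambda>f x. - f x"
  using square_int_scale[of _ "-1"] by (auto simp: ltwo_rel_def elim: AE_mp)

definition minus_ltwo :: "ltwo \<Rightarrow> ltwo \<Rightarrow> ltwo" where
  "minus_ltwo u v = u + - v"

lift_definition inner_ltwo :: "ltwo \<Rightarrow> ltwo \<Rightarrow> real" is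
  "\<lambda>f g. integral\<^sup>L leb_int (\<lambda>x. f x * g x)"
  by (rule integral_cong_AE) (auto simp: ltwo_rel_def square_int_def elim: AE_mp)

definition norm_ltwo :: "ltwo \<Rightarrow> real" where
  "norm_ltwo u = sqrt (u \<bullet> u)"

definition dist_ltwo :: "ltwo \<Rightarrow> ltwo \<Rightarrow> real" where
  "dist_ltwo u v = norm (u - v)"

definition sgn_ltwo :: "ltwo \<Rightarrow> ltwo" where
  "sgn_ltwo u = inverse (norm u) *\<^sub>R u"

definition uniformity_ltwo :: "(ltwo \<times> ltwo) filter" where
  "uniformity_ltwo = (INF e\<in>{0<..}. principal {(x, y). dist x y < e})"

definition open_ltwo :: "ltwo set \<Rightarrow> bool" where
  "open_ltwo U \<longleftrightarrow> (\<forall>x\<in>U. eventually (\<lambda>(x', y). x' = x \<longrightarrow> y \<in> U) uniformity)"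

instance
proof
  fix u v w :: ltwo and a b :: real
  show "u + v + w = u + (v + w)"
    by transfer (auto simp: ltwo_rel_def add.assoc intro!: square_int_add)
  show "u + v = v + u"
    by transfer (auto simp: ltwo_rel_def add.commute intro!: square_int_add)
  show "0 + u = u"
    by transfer (auto simp: ltwo_rel_def)
  show "- u + u = 0"
    by transfer (auto simp: ltwo_rel_def square_int_zero)
  show "u - v = u + - v"
    by (rule minus_ltwo_def)
  show "a *\<^sub>R (u + v) = a *\<^sub>R u + a *\<^sub>R v"
    by transfer (auto simp: ltwo_rel_def distrib_left intro!: square_int_add square_int_scale)
  show "(a + b) *\<^sub>R u = a *\<^sub>R u + b *\<^sub>R u"
    by transfer (auto simp: ltwo_rel_def distrib_right intro!: square_int_add square_int_scale)
  show "a *\<^sub>R b *\<^sub>R u = (a * b) *\<^sub>R u"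
    by transfer (auto simp: ltwo_rel_def mult.assoc intro!: square_int_scale)
  show "1 *\<^sub>R u = u"
    by transfer (auto simp: ltwo_rel_def)
  show "dist u v = norm (u - v)"
    by (rule dist_ltwo_def)
  show "sgn u = inverse (norm u) *\<^sub>R u"
    by (rule sgn_ltwo_def)
  show "uniformity = (INF e\<in>{0<..}. principal {(x, y). dist (x::ltwo) y < e})"
    by (rule uniformity_ltwo_def)
  show "open U = (\<forall>x\<in>U. \<forall>\<^sub>F (x', y) in uniformity. x' = x \<longrightarrow> y \<in> U)" for U :: "ltwo set"
    by (rule open_ltwo_def)
  show "norm u = sqrt (u \<bullet> u)"
    by (rule norm_ltwo_def)
  show "u \<bullet> v = v \<bullet> u"
    by transfer (simp add: mult.commute)
  show "(u + v) \<bullet> w = u \<bullet> w + v \<bullet> w"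
    by transfer (simp add: ltwo_rel_def distrib_right square_int_mult)
  show "a *\<^sub>R u \<bullet> v = a * (u \<bullet> v)"
    by transfer (simp add: mult.assoc)
  show "0 \<le> u \<bullet> u"
    by transfer simp
  show "u \<bullet> u = 0 \<longleftrightarrow> u = 0"
  proof transfer
    fix f assume f: "ltwo_rel f f"
    then have "integrable leb_int (\<lambda>x. f x * f x)"
      by (simp add: ltwo_rel_def square_int_mult)
    then have "integral\<^sup>L leb_int (\<lambda>x. f x * f x) = 0 \<longleftrightarrow> (AE x in leb_int. f x * f x = 0)"
      by (intro integral_nonneg_eq_0_iff_AE) auto
    then show "(integral\<^sup>L leb_int (\<lambda>x. f x * f x) = 0) = ltwo_rel f (\<lambda>_. 0)"
      using f by (simp add: ltwo_rel_def square_int_zero)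
  qed
qed

end

text \<open>\<open>v\<close> is the derivative of \<open>u\<close>: some representative of \<open>u\<close> is absolutely continuous and is a
  primitive of a representative of \<open>v\<close>.\<close>

definition has_weak_deriv :: "ltwo \<Rightarrow> ltwo \<Rightarrow> bool" where
  "has_weak_deriv u v \<longleftrightarrow> (\<exists>f g. square_int f \<and> square_int g \<and> u = abs_ltwo f \<and> v = abs_ltwo g \<and>
     (\<forall>t\<in>{0..2 * pi}. (g has_integral (f t - f 0)) {0..t}))"

definition weak_deriv :: "ltwo \<Rightarrow> ltwo" where
  "weak_deriv u = (THE v. has_weak_deriv u v)"

primrec sobolev :: "nat \<Rightarrow> ltwo set" where
  "sobolev 0 = UNIV"
| "sobolev (Suc p) = {u. \<exists>v\<in>sobolev p. has_weak_deriv u v}"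

definition sobolev_norm :: "nat \<Rightarrow> ltwo \<Rightarrow> real" where
  "sobolev_norm p u = sqrt (\<Sum>j\<le>p. (norm ((weak_deriv ^^ j) u))\<^sup>2)"

text \<open>The continuous representative, used to give a meaning to the boundary values of the
  derivatives of order less than \<open>p\<close> of an element of \<open>sobolev p\<close>.\<close>

definition cont_rep :: "ltwo \<Rightarrow> real \<Rightarrow> real" where
  "cont_rep u = (SOME f. continuous_on {0..2 * pi} f \<and> square_int f \<and> u = abs_ltwo f)"

definition sobolev_circle :: "nat \<Rightarrow> ltwo set" where
  "sobolev_circle p = {u \<in> sobolev p. \<forall>j<p.
     cont_rep ((weak_deriv ^^ j) u) 0 = cont_rep ((weak_deriv ^^ j) u) (2 * pi)}"

text \<open>A normed space is given by a linear subspace \<open>E\<close> of a real vector space and a norm \<open>nE\<close> on it;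
  this is needed because \<open>sobolev p\<close> does not carry the norm of the ambient type.
  Multilinear maps of \<open>k\<close> arguments are functions on lists of length \<open>k\<close>.\<close>

definition bounded_multilinear ::
  "'a::real_vector set \<Rightarrow> ('a \<Rightarrow> real) \<Rightarrow> 'b::real_vector set \<Rightarrow> ('b \<Rightarrow> real) \<Rightarrow> nat \<Rightarrow>
   ('a list \<Rightarrow> 'b) \<Rightarrow> bool" where
  "bounded_multilinear E nE F nF k T \<longleftrightarrow>
     (\<forall>vs. set vs \<subseteq> E \<and> length vs = k \<longrightarrow> T vs \<in> F) \<and>
     (\<forall>vs i v w a b. set vs \<subseteq> E \<and> length vs = k \<and> i < k \<and> v \<in> E \<and> w \<in> E \<longrightarrow>
        T (vs[i := a *\<^sub>R v + b *\<^sub>R w]) = a *\<^sub>R T (vs[i := v]) + b *\<^sub>R T (vs[i := w])) \<and>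
     (\<exists>C. \<forall>vs. set vs \<subseteq> E \<and> length vs = k \<longrightarrow> nF (T vs) \<le> C * prod_list (map nE vs))"

text \<open>\<open>f\<close> is infinitely Frechet differentiable on the open subset \<open>U\<close> of \<open>E\<close>, with values in \<open>F\<close>:
  \<open>D k x\<close> is the derivative of order \<open>k\<close> at \<open>x\<close>, and \<open>D (Suc k)\<close> is the Frechet derivative of
  \<open>D k\<close> for the operator norm on \<open>k\<close>-linear maps.\<close>

definition smooth_map ::
  "'a::real_vector set \<Rightarrow> ('a \<Rightarrow> real) \<Rightarrow> 'b::real_vector set \<Rightarrow> ('b \<Rightarrow> real) \<Rightarrow> 'a set \<Rightarrow>
   ('a \<Rightarrow> 'b) \<Rightarrow> bool" where
  "smooth_map E nE F nF U f \<longleftrightarrow> (\<exists>D :: nat \<Rightarrow> 'a \<Rightarrow> 'a list \<Rightarrow> 'b.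
     (\<forall>x\<in>U. D 0 x [] = f x) \<and>
     (\<forall>k. \<forall>x\<in>U. bounded_multilinear E nE F nF k (D k x)) \<and>
     (\<forall>k. \<forall>x\<in>U. \<forall>e>0. \<exists>d>0. \<forall>h\<in>E. nE h < d \<and> x + h \<in> U \<longrightarrow>
        (\<forall>vs. set vs \<subseteq> E \<and> length vs = k \<longrightarrow>
           nF (D k (x + h) vs - D k x vs - D (Suc k) x (h # vs))
             \<le> e * nE h * prod_list (map nE vs))))"

definition SL2 :: "(real^2^2) monoid" where
  "SL2 = \<lparr>carrier = {A. det A = 1}, monoid.mult = (**), one = mat 1\<rparr>"

definition universal_cover_SL2 ::
  "('g::topological_space, 'm) monoid_scheme \<Rightarrow> ('g \<Rightarrow> real^2^2) \<Rightarrow> bool" where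
  "universal_cover_SL2 G pr \<longleftrightarrow>
     group_hom G SL2 pr \<and>
     continuous_on (carrier G \<times> carrier G) (\<lambda>(x, y). x \<otimes>\<^bsub>G\<^esub> y) \<and>
     continuous_on (carrier G) (\<lambda>x. inv\<^bsub>G\<^esub> x) \<and>
     simply_connected (carrier G) \<and>
     covering_space (carrier G) pr (carrier SL2)"

definition iwasawa :: "real \<times> real \<times> real \<Rightarrow> real^2^2" where
  "iwasawa = (\<lambda>(\<theta>, \<rho>, \<nu>).
     (vector [vector [cos \<theta>, sin \<theta>], vector [- sin \<theta>, cos \<theta>]] :: real^2^2) **
     (vector [vector [sqrt \<rho>, 0], vector [0, 1 / sqrt \<rho>]] :: real^2^2) **
     (vector [vector [1, 0], vector [\<nu> / 2, 1]] :: real^2^2))"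

definition phi_L ::
  "('g::topological_space, 'm) monoid_scheme \<Rightarrow> ('g \<Rightarrow> real^2^2) \<Rightarrow> real \<times> real \<times> real \<Rightarrow> 'g" where
  "phi_L G pr = (SOME \<phi>. continuous_on (UNIV \<times> {0<..} \<times> UNIV) \<phi> \<and>
     \<phi> ` (UNIV \<times> {0<..} \<times> UNIV) \<subseteq> carrier G \<and> \<phi> (0, 1, 0) = \<one>\<^bsub>G\<^esub> \<and>
     (\<forall>x \<in> UNIV \<times> {0<..} \<times> UNIV. pr (\<phi> x) = iwasawa x))"

definition G0 :: "('g::topological_space, 'm) monoid_scheme \<Rightarrow> ('g \<Rightarrow> real^2^2) \<Rightarrow> 'g set" where
  "G0 G pr = phi_L G pr ` ({0<..} \<times> {0<..} \<times> UNIV)"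

text \<open>Since \<open>q\<close> is only square-integrable, solutions are understood in the sense of Caratheodory,
  i.e. through the integral equation.\<close>

definition fundamental_solution :: "ltwo \<Rightarrow> real \<Rightarrow> real^2^2" where
  "fundamental_solution q = (SOME \<Phi>. continuous_on {0..2 * pi} \<Phi> \<and>
     (\<forall>t\<in>{0..2 * pi}.
        ((\<lambda>s. (vector [vector [0, 1], vector [rep_ltwo q s, 0]] :: real^2^2) ** \<Phi> s)
           has_integral (\<Phi> t - mat 1)) {0..t}))"

definition lifted_solution ::
  "('g::topological_space, 'm) monoid_scheme \<Rightarrow> ('g \<Rightarrow> real^2^2) \<Rightarrow> ltwo \<Rightarrow> real \<Rightarrow> 'g" where
  "lifted_solution G pr q = (SOME \<Phi>. continuous_on {0..2 * pi} \<Phi> \<and>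
     \<Phi> ` {0..2 * pi} \<subseteq> carrier G \<and> \<Phi> 0 = \<one>\<^bsub>G\<^esub> \<and>
     (\<forall>t\<in>{0..2 * pi}. pr (\<Phi> t) = fundamental_solution q t))"

definition monodromy ::
  "('g::topological_space, 'm) monoid_scheme \<Rightarrow> ('g \<Rightarrow> real^2^2) \<Rightarrow> ltwo \<Rightarrow> 'g" where
  "monodromy G pr q = lifted_solution G pr q (2 * pi)"

text \<open>The smooth structure of \<open>G\<close> is the one that makes \<open>pr\<close> a local diffeomorphism onto
  \<open>SL(2,\<real>)\<close>, which in turn is a submanifold of the space of matrices. Hence a map out of an open
  subset \<open>M\<close> of \<open>G\<close> (times \<open>H\<close>) is smooth iff, locally, it is the composition of \<open>pr\<close> with a smooth
  map defined on an open set of matrices, and a map into \<open>M\<close> is smooth iff it is continuous and its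
  composition with \<open>pr\<close> is smooth as a map into the space of matrices.\<close>

definition smooth_from_cover ::
  "('g::topological_space \<Rightarrow> real^2^2) \<Rightarrow> 'g set \<Rightarrow> 'b::real_vector set \<Rightarrow> ('b \<Rightarrow> real) \<Rightarrow>
   ('g \<times> 'h::real_inner \<Rightarrow> 'b) \<Rightarrow> bool" where
  "smooth_from_cover pr M F nF f \<longleftrightarrow> (\<forall>g\<in>M. \<forall>h. \<exists>U V W k.
     openin (top_of_set M) U \<and> g \<in> U \<and> open V \<and> h \<in> V \<and> open W \<and> pr ` U \<subseteq> W \<and>
     smooth_map UNIV norm F nF (W \<times> V) k \<and>
     (\<forall>g'\<in>U. \<forall>h'\<in>V. f (g', h') = k (pr g', h')))"

definition smooth_to_cover ::
  "('g::topological_space \<Rightarrow> real^2^2) \<Rightarrow> 'g set \<Rightarrow> 'b::real_vector set \<Rightarrow> ('b \<Rightarrow> real) \<Rightarrow>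
   ('b \<Rightarrow> 'g \<times> 'h::real_inner) \<Rightarrow> bool" where
  "smooth_to_cover pr M E nE f \<longleftrightarrow>
     continuous_map (Metric_space.mtopology E (\<lambda>x y. nE (x - y))) (top_of_set M) (\<lambda>x. fst (f x)) \<and>
     smooth_map E nE UNIV norm E (\<lambda>x. pr (fst (f x))) \<and>
     smooth_map E nE UNIV norm E (\<lambda>x. snd (f x))"

definition smooth_diffeo ::
  "('g::topological_space \<Rightarrow> real^2^2) \<Rightarrow> 'g set \<Rightarrow> 'b::real_vector set \<Rightarrow> ('b \<Rightarrow> real) \<Rightarrow>
   ('g \<times> 'h::real_inner \<Rightarrow> 'b) \<Rightarrow> bool" where
  "smooth_diffeo pr M E nE \<Psi> \<longleftrightarrow>
     bij_betw \<Psi> (M \<times> UNIV) E \<and>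
     smooth_from_cover pr M E nE \<Psi> \<and>
     smooth_to_cover pr M E nE (inv_into (M \<times> UNIV) \<Psi>)"

end

theory Submission
 imports Defs
begin

text \<open>
 The Kepler transform \<open>x \<mapsto> F x\<close> parametrizes the potentials: with \<open>W x\<close> the second primitive of \<open>x\<close>, the
 first row of the fundamental solution for \<open>F x\<close> has length \<open>exp (- W x / 2)\<close> and angle \<open>\<integral> exp (W x)\<close>.
 Hence the lifted monodromy depends only on \<open>(\<integral> exp (W x), W x, (W x)')\<close> at \<open>2\<pi>\<close>. Two of these are linear in
 \<open>x\<close>; adding to \<open>x\<close> a multiple \<open>s\<close> of the second derivative of a positive bump makes the third one strictly
 increasing in \<open>s\<close>, so it can be solved for \<open>s\<close> smoothly. The remaining freedom is a closed subspace of finite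
 codimension, isometric to the given Hilbert space.
 Up to the factor \<open>-1/2\<close>, \<open>F\<close> is the identity plus an operator that gains one derivative. In the periodic
 case the boundary conditions on \<open>F x\<close> therefore determine the jumps of the derivatives of \<open>x\<close> one after the
 other, by an iteration which is stationary after \<open>p\<close> steps.
\<close>

text \<open>The transform is forced by the equation. Write the first row of the solution as r (cos
  \<theta>, sin \<theta>). The Wronskian is 1, so r^2 \<theta>' = 1 (equal areas in equal times),
  and the row solves v'' = q v exactly when q = r''/r - 1/r^4. With r = exp (- W / 2) and W'' = x
  this reads q = - x / 2 + W'^2 / 4 - exp (2 W). Conversely every q arises, from the logarithm of
  its own radius. The analytic obstacle is that the Sobolev norm is not the norm of the type of L2
  classes, so calculus of every order is set up on pairs of a subspace and a norm. No implicit
  function theorem is used in it: the exponential, the inverse, the resolvent and the solved angle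
  each have a derivative that is a smooth expression in the function itself, and this raises the
  order of differentiability step by step. The topological obstacle is that \<open>G0\<close> is
  defined by the angle of the left Iwasawa decomposition, which is visible in the second column of
  the matrix, while the transform controls the angle of the first row. The two angles differ, but
  their positivity describes the same part of the group.\<close>

section \<open>Normed subspaces and derivatives of multilinear families\<close>

type_synonym 'a nsp = "'a set \<times> ('a => real)"

text \<open>The norm axioms are required on the subspace only: \<open>sobolev_norm\<close> has no
  reason to satisfy them where \<open>weak_deriv\<close> is a default value.\<close>

definition nspace :: "'a::real_vector nsp => bool" where
 "nspace X \<longleftrightarrow> subspace (fst X) \<and> (\<forall>x\<in>fst X. 0 \<le> snd X x \<and> (snd X x = 0 --> x = 0)) \<and>
   (\<forall>x\<in>fst X. \<forall>y\<in>fst X. snd X (x + y) \<le> snd X x + snd X y) \<and>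
   (\<forall>c. \<forall>x\<in>fst X. snd X (c *\<^sub>R x) = \<bar>c\<bar> * snd X x)"

definition nopen :: "'a::real_vector nsp => 'a set => bool" where
 "nopen X U \<longleftrightarrow> U \<subseteq> fst X \<and> (\<forall>x\<in>U. \<exists>d>0. \<forall>h\<in>fst X. snd X h < d --> x + h \<in> U)"

abbreviation bml :: "'a::real_vector nsp => 'b::real_vector nsp => nat => ('a list => 'b) => bool" where
 "bml X Y \<equiv> bounded_multilinear (fst X) (snd X) (fst Y) (snd Y)"

abbreviation args :: "'a nsp => nat => 'a list => bool" where
 "args X k vs \<equiv> set vs \<subseteq> fst X \<and> length vs = k"

abbreviation pn :: "'a nsp => 'a list => real" where
 "pn X vs \<equiv> prod_list (map (snd X) vs)"

text \<open>This is the Frechet derivative for the operator norm of k-linear maps, written out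
  uniformly in the arguments so that spaces of multilinear maps never have to be formed. The new
  direction becomes the head of the argument list.\<close>

definition has_mderiv :: "'a::real_vector nsp => 'b::real_vector nsp => 'a set => nat =>
  ('a => 'a list => 'b) => ('a => 'a list => 'b) => bool" where
 "has_mderiv X Y U k M M' \<longleftrightarrow> (\<forall>x\<in>U. \<forall>e>0. \<exists>d>0. \<forall>h\<in>fst X. snd X h < d \<and> x + h \<in> U -->
   (\<forall>vs. args X k vs -->
    snd Y (M (x + h) vs - M x vs - M' x (h # vs)) \<le> e * snd X h * pn X vs))"

text \<open>A finite order of differentiability for a family of k-linear maps; finite orders are
  what the chain rule and the bootstrap argument can induct on. Order 0 asks for bounded
  multilinearity at each point and not for continuity.\<close>

primrec cdiff :: "'a::real_vector nsp => 'b::real_vector nsp => 'a set => nat => nat =>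
  ('a => 'a list => 'b) => bool" where
 "cdiff X Y U 0 k M \<longleftrightarrow> (\<forall>x\<in>U. bml X Y k (M x))"
| "cdiff X Y U (Suc n) k M \<longleftrightarrow> (\<forall>x\<in>U. bml X Y k (M x)) \<and>
   (\<exists>M'. has_mderiv X Y U k M M' \<and> cdiff X Y U n (Suc k) M')"

lemma nspaceD:
 assumes "nspace X"
 shows "subspace (fst X)" "x \<in> fst X ==> 0 \<le> snd X x" "x \<in> fst X ==> snd X x = 0 ==> x = 0"
  "x \<in> fst X ==> y \<in> fst X ==> snd X (x + y) \<le> snd X x + snd X y"
  "x \<in> fst X ==> snd X (c *\<^sub>R x) = \<bar>c\<bar> * snd X x"
 using assms by (auto simp: nspace_def)

lemma nspace_mem:
 assumes "nspace X"
 shows "0 \<in> fst X" "x \<in> fst X ==> y \<in> fst X ==> x + y \<in> fst X" "x \<in> fst X ==> y \<in> fst X ==> x - y \<in> fst X"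
  "x \<in> fst X ==> c *\<^sub>R x \<in> fst X" "x \<in> fst X ==> - x \<in> fst X"
 using nspaceD(1)[OF assms] subspace_add subspace_diff subspace_scale subspace_neg subspace_0 by metis+

lemma nspace_sum:
 assumes "nspace X" "!!i. i \<in> I ==> f i \<in> fst X"
 shows "sum f I \<in> fst X"
 using nspaceD(1)[OF assms(1)] assms(2) by (rule subspace_sum)

lemma nspace_norm0: "nspace X ==> snd X 0 = 0"
 using nspaceD(5)[of X 0 0] nspace_mem(1)[of X] by simp

lemma nspace_minus: "nspace X ==> x \<in> fst X ==> snd X (- x) = snd X x"
 using nspaceD(5)[of X x "-1"] by simp

lemma nspace_diff: "nspace X ==> x \<in> fst X ==> y \<in> fst X ==> snd X (x - y) \<le> snd X x + snd X y"
 using nspaceD(4)[of X x "-y"] nspace_minus[of X y] nspace_mem(5)[of X y] by simp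

lemma nspace_sum_le:
 assumes X: "nspace X" and f: "!!i. i \<in> I ==> f i \<in> fst X"
 shows "snd X (sum f I) \<le> (\<Sum>i\<in>I. snd X (f i))"
 using f
proof (induction I rule: infinite_finite_induct)
 case (insert x F)
 have "snd X (sum f (insert x F)) = snd X (f x + sum f F)"
  using insert by simp
 also have "\<dots> \<le> snd X (f x) + snd X (sum f F)"
  using insert by (intro nspaceD(4)[OF X] nspace_sum[OF X]) auto
 finally show ?case using insert by force
qed (auto simp: nspace_norm0[OF X])

lemma pn_nonneg: "nspace X ==> set vs \<subseteq> fst X ==> 0 \<le> pn X vs"
 by (induction vs) (auto intro!: mult_nonneg_nonneg simp: nspaceD)

lemma bmlD:
 assumes "bml X Y k T"
 shows "args X k vs ==> T vs \<in> fst Y"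
  and "args X k vs ==> i < k ==> v \<in> fst X ==> w \<in> fst X ==>
    T (vs[i := a *\<^sub>R v + b *\<^sub>R w]) = a *\<^sub>R T (vs[i := v]) + b *\<^sub>R T (vs[i := w])"
  and "\<exists>C. \<forall>vs. args X k vs --> snd Y (T vs) \<le> C * pn X vs"
 using assms unfolding bounded_multilinear_def by auto

lemma bmlI:
 assumes "!!vs. args X k vs ==> T vs \<in> fst Y"
  and "!!vs i v w a b. args X k vs ==> i < k ==> v \<in> fst X ==> w \<in> fst X ==>
    T (vs[i := a *\<^sub>R v + b *\<^sub>R w]) = a *\<^sub>R T (vs[i := v]) + b *\<^sub>R T (vs[i := w])"
  and "!!vs. args X k vs ==> snd Y (T vs) \<le> C * pn X vs"
 shows "bml X Y k T"
 unfolding bounded_multilinear_def using assms by blast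

lemma bml_bound:
 assumes "nspace X" "bml X Y k T"
 obtains C where "C \<ge> 0" "!!vs. args X k vs ==> snd Y (T vs) \<le> C * pn X vs"
proof -
 obtain C where C: "\<forall>vs. args X k vs --> snd Y (T vs) \<le> C * pn X vs"
  using bmlD(3)[OF assms(2)] by blast
 have "snd Y (T vs) \<le> max C 0 * pn X vs" if "args X k vs" for vs
 proof -
  have "C * pn X vs \<le> max C 0 * pn X vs"
   using pn_nonneg[OF assms(1)] that by (intro mult_right_mono) auto
  then show ?thesis using C that by fastforce
 qed
 then show ?thesis using that[of "max C 0"] by auto
qed

lemma bml_cong:
 assumes X: "nspace X" and eq: "!!vs. args X k vs ==> S vs = T vs" and T: "bml X Y k T"
 shows "bml X Y k S"
proof -
 obtain C where C: "!!vs. args X k vs ==> snd Y (T vs) \<le> C * pn X vs"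
  using bml_bound[OF X T] by blast
 have up: "args X k (vs[i := u])" if "args X k vs" "u \<in> fst X" for vs i u
  using that set_update_subset_insert[of vs i u] by auto
 show ?thesis
 proof (rule bmlI[where C = C])
  fix vs i v w a b assume "args X k vs" "i < k" "v \<in> fst X" "w \<in> fst X"
  then show "S (vs[i := a *\<^sub>R v + b *\<^sub>R w]) = a *\<^sub>R S (vs[i := v]) + b *\<^sub>R S (vs[i := w])"
   using bmlD(2)[OF T, of vs i v w a b] eq up nspace_mem[OF X] by metis
 qed (use eq bmlD(1)[OF T] C in auto)
qed

lemma bml_lin:
 assumes X: "nspace X" and T: "bml X Y (Suc k) T" and vs: "args X k vs" and v: "v \<in> fst X" "w \<in> fst X"
 shows "T ((a *\<^sub>R v + b *\<^sub>R w) # vs) = a *\<^sub>R T (v # vs) + b *\<^sub>R T (w # vs)"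
 using bmlD(2)[OF T, of "0 # vs" 0 v w a b] vs v nspace_mem(1)[OF X] by simp

lemma bml_Cons:
 assumes X: "nspace X" and T: "bml X Y (Suc k) T" and w: "w \<in> fst X"
 shows "bml X Y k (%vs. T (w # vs))"
proof -
 obtain C where C: "!!vs. args X (Suc k) vs ==> snd Y (T vs) \<le> C * pn X vs"
  using bml_bound[OF X T] by blast
 show ?thesis
 proof (rule bmlI[where C = "C * snd X w"])
  fix vs i v u a b assume "args X k vs" "i < k" "v \<in> fst X" "u \<in> fst X"
  then show "T (w # vs[i := a *\<^sub>R v + b *\<^sub>R u]) = a *\<^sub>R T (w # vs[i := v]) + b *\<^sub>R T (w # vs[i := u])"
   using bmlD(2)[OF T, of "w # vs" "Suc i" v u a b] w by simp
 next
  fix vs assume "args X k vs"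
  then show "snd Y (T (w # vs)) \<le> C * snd X w * pn X vs"
   using C[of "w # vs"] w by (simp add: mult.assoc)
 qed (use bmlD(1)[OF T] w in auto)
qed

lemma bml_diff:
 assumes X: "nspace X" and T: "bml X Y (Suc k) T" and "args X k vs" "v \<in> fst X" "w \<in> fst X"
 shows "T ((v - w) # vs) = T (v # vs) - T (w # vs)"
 using bml_lin[OF X T, of vs v w 1 "-1"] assms by simp

lemma bml_add:
 assumes X: "nspace X" and T: "bml X Y (Suc k) T" and "args X k vs" "v \<in> fst X" "w \<in> fst X"
 shows "T ((v + w) # vs) = T (v # vs) + T (w # vs)"
 using bml_lin[OF X T, of vs v w 1 1] assms by simp

lemma bml_scale:
 assumes X: "nspace X" and T: "bml X Y (Suc k) T" and "args X k vs" "v \<in> fst X"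
 shows "T ((c *\<^sub>R v) # vs) = c *\<^sub>R T (v # vs)"
 using bml_lin[OF X T, of vs v v c 0] assms by simp

lemma cdiff_bml: "cdiff X Y U n k M ==> x \<in> U ==> bml X Y k (M x)"
 by (cases n) auto

lemma cdiff_Suc_imp: "cdiff X Y U (Suc n) k M ==> cdiff X Y U n k M"
 by (induction n arbitrary: k M) auto

lemma has_mderiv_subset: "has_mderiv X Y U k M M' ==> V \<subseteq> U ==> has_mderiv X Y V k M M'"
 unfolding has_mderiv_def by (meson subsetD)

lemma cdiff_subset: "cdiff X Y U n k M ==> V \<subseteq> U ==> cdiff X Y V n k M"
 by (induction n arbitrary: k M) (auto intro: has_mderiv_subset)

lemma has_mderiv_cong:
 assumes eq: "!!x vs. x \<in> U ==> args X k vs ==> M x vs = N x vs"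
  and eq': "!!x vs. x \<in> U ==> args X (Suc k) vs ==> M' x vs = N' x vs"
  and d: "has_mderiv X Y U k M M'"
 shows "has_mderiv X Y U k N N'"
 unfolding has_mderiv_def
proof (intro ballI allI impI)
 fix x and e :: real assume "x \<in> U" "e > 0"
 then obtain d where "d > 0" and d: "!!h vs. h\<in>fst X ==> snd X h < d ==> x + h \<in> U ==> args X k vs ==>
    snd Y (M (x + h) vs - M x vs - M' x (h # vs)) \<le> e * snd X h * pn X vs"
  using d unfolding has_mderiv_def by metis
 show "\<exists>d>0. \<forall>h\<in>fst X. snd X h < d \<and> x + h \<in> U -->
   (\<forall>vs. args X k vs -->
    snd Y (N (x + h) vs - N x vs - N' x (h # vs)) \<le> e * snd X h * pn X vs)"
 proof (intro exI conjI ballI impI allI)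
  fix h vs assume "h \<in> fst X" "snd X h < d \<and> x + h \<in> U" "args X k vs"
  then show "snd Y (N (x + h) vs - N x vs - N' x (h # vs)) \<le> e * snd X h * pn X vs"
   using d[of h vs] eq[of x vs] eq[of "x+h" vs] eq'[of x "h#vs"] \<open>x \<in> U\<close> by auto
 qed (use \<open>d > 0\<close> in auto)
qed

lemma cdiff_cong:
 assumes X: "nspace X" and eq: "!!x vs. x \<in> U ==> args X k vs ==> M x vs = N x vs" and N: "cdiff X Y U n k N"
 shows "cdiff X Y U n k M"
proof -
 have *: "\<forall>x\<in>U. bml X Y k (M x)"
  using bml_cong[OF X, of k] eq cdiff_bml[OF N] by blast
 show ?thesis
 proof (cases n)
  case (Suc m)
  then obtain N' where N': "has_mderiv X Y U k N N'" "cdiff X Y U m (Suc k) N'"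
   using N by auto
  have "has_mderiv X Y U k M N'"
   by (rule has_mderiv_cong[OF _ _ N'(1)]) (auto simp: eq)
  then show ?thesis using Suc * N' by auto
 qed (use * in auto)
qed

text \<open>On an open set every direction v can be tested with t v for small t. The difference of
  the two derivatives is homogeneous in t and at the same time o(t), hence 0.\<close>

lemma mderiv_unique:
 assumes X: "nspace X" and Y: "nspace Y" and U: "nopen X U"
  and M1: "has_mderiv X Y U k M M1" "!!x. x \<in> U ==> bml X Y (Suc k) (M1 x)"
  and M2: "has_mderiv X Y U k M M2" "!!x. x \<in> U ==> bml X Y (Suc k) (M2 x)"
  and M: "!!x. x \<in> U ==> bml X Y k (M x)"
  and x: "x \<in> U" and vs: "args X (Suc k) vs"
 shows "M1 x vs = M2 x vs"
proof -
 obtain v ws where vs': "vs = v # ws" and v: "v \<in> fst X" and ws: "args X k ws"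
  using vs by (cases vs) auto
 let ?u = "M1 x vs - M2 x vs"
 have uY: "?u \<in> fst Y"
  using bmlD(1)[OF M1(2)[OF x]] bmlD(1)[OF M2(2)[OF x]] vs nspace_mem[OF Y] by auto
 have le: "snd Y ?u \<le> e * (2 * snd X v * pn X ws)" if e: "e > 0" for e
 proof -
  obtain d1 where d1: "d1 > 0" "!!h. h\<in>fst X ==> snd X h < d1 ==> x + h \<in> U ==>
    snd Y (M (x + h) ws - M x ws - M1 x (h # ws)) \<le> e * snd X h * pn X ws"
   using M1(1) x e ws unfolding has_mderiv_def by metis
  obtain d2 where d2: "d2 > 0" "!!h. h\<in>fst X ==> snd X h < d2 ==> x + h \<in> U ==>
    snd Y (M (x + h) ws - M x ws - M2 x (h # ws)) \<le> e * snd X h * pn X ws"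
   using M2(1) x e ws unfolding has_mderiv_def by metis
  obtain d3 where d3: "d3 > 0" "!!h. h\<in>fst X ==> snd X h < d3 ==> x + h \<in> U"
   using U x unfolding nopen_def by metis
  \<comment> \<open>The step keeps t v within the three radii; the summand 1 in the denominator
    covers directions of norm 0.\<close>
  define t where "t = min d1 (min d2 d3) / 2 / (snd X v + 1)"
  have nv: "snd X v \<ge> 0" using nspaceD(2)[OF X v] .
  have t: "t > 0" using d1 d2 d3 nv by (simp add: t_def)
  have "t * snd X v \<le> t * (snd X v + 1)" using t by simp
  also have "\<dots> = min d1 (min d2 d3) / 2"
   unfolding t_def using add_nonneg_pos[OF nv zero_less_one] by (metis less_irrefl nonzero_eq_divide_eq)
  also have "\<dots> < min d1 (min d2 d3)" using d1(1) d2(1) d3(1) by (simp add: min_def)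
  finally have tv: "t * snd X v < min d1 (min d2 d3)" .
  let ?h = "t *\<^sub>R v"
  have h: "?h \<in> fst X" "snd X ?h = t * snd X v"
   using nspace_mem[OF X] v nspaceD(5)[OF X v] t by auto
  have hU: "x + ?h \<in> U" using d3(2)[OF h(1)] h tv by auto
  define A where "A = M (x + ?h) ws - M x ws"
  have AY: "A \<in> fst Y"
   unfolding A_def using bmlD(1)[OF M[OF hU] ws] bmlD(1)[OF M[OF x] ws] nspace_mem[OF Y] by auto
  have Yi: "M1 x (?h # ws) \<in> fst Y" "M2 x (?h # ws) \<in> fst Y"
   using bmlD(1)[OF M1(2)[OF x]] bmlD(1)[OF M2(2)[OF x]] ws h by auto
  have "t *\<^sub>R ?u = (A - M2 x (?h # ws)) - (A - M1 x (?h # ws))"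
   unfolding vs' using bml_scale[OF X M1(2)[OF x] ws v] bml_scale[OF X M2(2)[OF x] ws v]
   by (simp add: algebra_simps)
  then have "t * snd Y ?u = snd Y ((A - M2 x (?h # ws)) - (A - M1 x (?h # ws)))"
   using nspaceD(5)[OF Y uY, of t] t by auto
  also have "\<dots> \<le> snd Y (A - M2 x (?h # ws)) + snd Y (A - M1 x (?h # ws))"
   using AY Yi by (intro nspace_diff[OF Y] nspace_mem[OF Y])
  also have "\<dots> \<le> e * snd X ?h * pn X ws + e * snd X ?h * pn X ws"
   unfolding A_def using d1(2)[OF h(1) _ hU] d2(2)[OF h(1) _ hU] h tv by (intro add_mono) auto
  also have "\<dots> = t * (e * (2 * snd X v * pn X ws))" using h by (simp add: algebra_simps)
  finally show ?thesis using t by simp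
 qed
 have "snd Y ?u \<le> 0"
 proof (rule field_le_epsilon)
  fix e :: real assume e: "e > 0"
  let ?c = "2 * snd X v * pn X ws"
  have c: "?c \<ge> 0" using nspaceD(2)[OF X v] pn_nonneg[OF X] ws by simp
  have "snd Y ?u \<le> e / (?c + 1) * ?c" using le[of "e / (?c+1)"] e c by simp
  also have "\<dots> \<le> e" using e c by (simp add: field_simps)
  finally show "snd Y ?u \<le> 0 + e" by simp
 qed
 then have "snd Y ?u = 0" using nspaceD(2)[OF Y uY] by simp
 then show ?thesis using nspaceD(3)[OF Y uY] by simp
qed

definition smooth :: "'a::real_vector nsp => 'b::real_vector nsp => 'a set => ('a => 'b) => bool" where
 "smooth X Y U f \<longleftrightarrow> (\<forall>n. cdiff X Y U n 0 (%x vs. f x))"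

text \<open>Each order n comes with its own choice of first derivative. Uniqueness identifies these
  choices, so that one derivative serves all orders; iterating this yields the single tower that
  \<open>smooth_map\<close> demands.\<close>

lemma cdiff_all_deriv:
 assumes X: "nspace X" and Y: "nspace Y" and U: "nopen X U" and M: "\<forall>n. cdiff X Y U n k M"
 shows "\<exists>M'. has_mderiv X Y U k M M' \<and> (\<forall>n. cdiff X Y U n (Suc k) M')"
proof -
 have "\<forall>n. \<exists>M'. has_mderiv X Y U k M M' \<and> cdiff X Y U n (Suc k) M'"
  using M cdiff.simps(2) by blast
 then obtain D where D: "!!n. has_mderiv X Y U k M (D n)" "!!n. cdiff X Y U n (Suc k) (D n)"
  by metis
 have "cdiff X Y U n (Suc k) (D 0)" for n
 proof (rule cdiff_cong[OF X _ D(2)[of n]])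
  fix x vs assume "x \<in> U" "args X (Suc k) vs"
  then show "D 0 x vs = D n x vs"
   using M cdiff_bml by (intro mderiv_unique[OF X Y U D(1) _ D(1)] cdiff_bml[OF D(2)]) blast+
 qed
 then show ?thesis using D(1) by blast
qed

lemma smooth_imp_smooth_map:
 assumes X: "nspace X" and Y: "nspace Y" and U: "nopen X U" and f: "smooth X Y U f"
 shows "smooth_map (fst X) (snd X) (fst Y) (snd Y) U f"
proof -
 have "\<exists>D. \<forall>k. ((\<forall>n. cdiff X Y U n k (D k)) \<and> (k = 0 --> D k = (%x vs. f x))) \<and> has_mderiv X Y U k (D k) (D (Suc k))"
 proof (rule dependent_nat_choice)
  show "\<exists>M. (\<forall>n. cdiff X Y U n 0 M) \<and> (0 = 0 --> M = (%x vs. f x))"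
   using f unfolding smooth_def by auto
  fix M k assume "(\<forall>n. cdiff X Y U n k M) \<and> (k = 0 --> M = (%x vs. f x))"
  then show "\<exists>M'. ((\<forall>n. cdiff X Y U n (Suc k) M') \<and> (Suc k = 0 --> M' = (%x vs. f x))) \<and> has_mderiv X Y U k M M'"
   using cdiff_all_deriv[OF X Y U, of k M] by auto
 qed
 then obtain D where D: "!!k n. cdiff X Y U n k (D k)" "D 0 = (%x vs. f x)" "!!k. has_mderiv X Y U k (D k) (D (Suc k))"
  by metis
 show ?thesis unfolding smooth_map_def
 proof (intro exI[of _ D] conjI)
  show "\<forall>k. \<forall>x\<in>U. bml X Y k (D k x)"
   using cdiff_bml[OF D(1)] by blast
  show "\<forall>k. \<forall>x\<in>U. \<forall>e>0. \<exists>d>0. \<forall>h\<in>fst X. snd X h < d \<and> x + h \<in> U -->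
    (\<forall>vs. args X k vs -->
      snd Y (D k (x + h) vs - D k x vs - D (Suc k) x (h # vs)) \<le> e * snd X h * pn X vs)"
   using D(3) unfolding has_mderiv_def by auto
 qed (simp add: D(2))
qed

text \<open>The bound for a product of norms in which one factor is replaced by its increment; it
  controls the first-order terms in \<open>telescope\<close>.\<close>

lemma prod_list_update_le:
 fixes as cs :: "real list"
 assumes "length cs = length as" "i < length as" "!!j. j < length as ==> 0 \<le> cs ! j \<and> cs ! j \<le> as ! j"
  and "0 \<le> c" "c \<le> e * as ! i"
 shows "prod_list (cs[i := c]) \<le> e * prod_list as"
 using assms
proof (induction as arbitrary: cs i)
 case (Cons a as)
 obtain c0 cs' where cs: "cs = c0 # cs'" "length cs' = length as"
  using Cons.prems(1) by (cases cs) auto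
 have h: "0 \<le> c0 \<and> c0 \<le> a" "!!j. j < length as ==> 0 \<le> cs' ! j \<and> cs' ! j \<le> as ! j"
  using Cons.prems(3)[of 0] Cons.prems(3)[of "Suc _"] cs by auto
 have le: "0 \<le> prod_list cs' \<and> prod_list cs' \<le> prod_list as"
  using cs(2) h(2)
 proof (induction cs' as rule: list_induct2)
  case (Cons x xs y ys)
  have "0 \<le> x \<and> x \<le> y" "0 \<le> prod_list xs \<and> prod_list xs \<le> prod_list ys"
   using Cons.prems[of 0] Cons.IH Cons.prems[of "Suc _"] by auto
  then show ?case by (auto intro: mult_mono)
 qed simp
 show ?case
 proof (cases i)
  case 0
  have "c * prod_list cs' \<le> (e * a) * prod_list as"
   using Cons.prems 0 le by (intro mult_mono) auto
  then show ?thesis using 0 cs by (simp add: mult.assoc)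
 next
  case (Suc i')
  have IH: "prod_list (cs'[i' := c]) \<le> e * prod_list as"
   using Cons.IH[OF cs(2), of i'] h Cons.prems Suc by auto
  have "0 \<le> e * as ! i'" using Cons.prems(4,5) Suc by simp
  have "0 \<le> prod_list (cs'[i' := c])"
  proof (rule prod_list_nonneg)
   fix x assume "x \<in> set (cs'[i' := c])"
   then have "x = c \<or> x \<in> set cs'" using set_update_subset_insert by fast
   then show "0 \<le> x" using h(2) cs(2) Cons.prems(4) by (metis in_set_conv_nth)
  qed
  then have "c0 * prod_list (cs'[i' := c]) \<le> a * (e * prod_list as)"
   using h IH by (intro mult_mono) auto
  then show ?thesis using Suc cs by (simp add: algebra_simps)
 qed
qed simp

text \<open>Leibniz rule with remainder. \<open>\<eta>\<close> measures the first-order increments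
  \<open>ds\<close>, \<open>\<epsilon>\<close> the error made in them, both relative to the sizes
  \<open>as\<close>; the remainder is quadratic in the increments up to a term linear in
  \<open>\<epsilon>\<close>. The proof changes the first argument and applies induction to the
  others. The factor \<open>4 ^ m\<close> is crude but absorbs both the doubled size of the new head
  and the m cross terms.\<close>

lemma telescope:
 assumes Y: "nspace Y" and Z: "nspace Z" and eta: "0 \<le> \<eta>" "0 \<le> \<epsilon>" "\<eta> + \<epsilon> \<le> 1"
 shows "bml Y Z m T ==> 0 \<le> C ==> (!!us. args Y m us ==> snd Z (T us) \<le> C * pn Y us) ==>
  args Y m ws ==> args Y m ws' ==> args Y m ds ==> length as = m ==>
  (!!i. i < m ==> snd Y (ws ! i) \<le> as ! i \<and> snd Y (ds ! i) \<le> \<eta> * as ! i \<and>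
    snd Y (ws' ! i - ws ! i - ds ! i) \<le> \<epsilon> * as ! i) ==>
  snd Z (T ws' - T ws - (\<Sum>i<m. T (ws[i := ds ! i]))) \<le> C * prod_list as * 4 ^ m * (\<eta> * (\<eta> + \<epsilon>) + \<epsilon>)"
proof (induction m arbitrary: T C ws ws' ds as)
 case 0
 have "0 \<le> \<eta> * (\<eta> + \<epsilon>) + \<epsilon>" using eta by simp
 then show ?case using 0 by (simp add: nspace_norm0[OF Z])
next
 case (Suc m)
 obtain w u where ws: "ws = w # u" "w \<in> fst Y" "args Y m u" using Suc.prems(4) by (cases ws) auto
 obtain w' u' where ws': "ws' = w' # u'" "w' \<in> fst Y" "args Y m u'" using Suc.prems(5) by (cases ws') auto
 obtain d e where ds: "ds = d # e" "d \<in> fst Y" "args Y m e" using Suc.prems(6) by (cases ds) auto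
 obtain a b where as: "as = a # b" "length b = m" using Suc.prems(7) by (cases as) auto
 have h0: "snd Y w \<le> a" "snd Y d \<le> \<eta> * a" "snd Y (w' - w - d) \<le> \<epsilon> * a"
  using Suc.prems(8)[of 0] ws ws' ds as by auto
 have hS: "snd Y (u ! i) \<le> b ! i \<and> snd Y (e ! i) \<le> \<eta> * b ! i \<and> snd Y (u' ! i - u ! i - e ! i) \<le> \<epsilon> * b ! i" if "i < m" for i
  using Suc.prems(8)[of "Suc i"] ws ws' ds as that by auto
 let ?s = "\<eta> + \<epsilon>" let ?X = "\<eta> * ?s + \<epsilon>" let ?P = "prod_list b"
 note mem = nspace_mem[OF Y]
 have a0: "0 \<le> a" using h0(1) nspaceD(2)[OF Y ws(2)] by simp
 have ei: "e ! i \<in> fst Y" "u ! i \<in> fst Y" if "i < m" for i using ds ws that by auto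
 have b0: "0 \<le> b ! i" if "i < m" for i using hS[OF that] nspaceD(2)[OF Y ei(2)[OF that]] by simp
 have P0: "0 \<le> ?P"
  by (rule prod_list_nonneg) (metis b0 as(2) in_set_conv_nth)
 have X0: "0 \<le> ?X" using eta by simp
 have dw: "snd Y (w' - w) \<le> ?s * a"
 proof -
  have "snd Y (w' - w) = snd Y ((w' - w - d) + d)" by simp
  also have "\<dots> \<le> snd Y (w' - w - d) + snd Y d" using ws ws' ds by (intro nspaceD(4)[OF Y] mem)
  finally show ?thesis using h0 by (simp add: algebra_simps)
 qed
 have w'2: "snd Y w' \<le> 2 * a"
 proof -
  have "snd Y w' = snd Y ((w' - w) + w)" by simp
  also have "\<dots> \<le> snd Y (w' - w) + snd Y w" using ws ws' ds by (intro nspaceD(4)[OF Y] mem)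
  also have "\<dots> \<le> 1 * a + a" using dw h0 mult_right_mono[OF eta(3) a0] by linarith
  finally show ?thesis by simp
 qed
 have bT: "bml Y Z m (%vs. T (z # vs))" if "z \<in> fst Y" for z
  by (rule bml_Cons[OF Y Suc.prems(1) that])
 have bd: "snd Z (T (z # us)) \<le> C * snd Y z * pn Y us" if "z \<in> fst Y" "args Y m us" for z us
  using Suc.prems(3)[of "z # us"] that by (simp add: mult.assoc)
 have pu: "pn Y u \<le> ?P"
  using prod_list_update_le[of "map (snd Y) u" b]
 proof -
  have "length u = length b" using ws as by simp
  then show ?thesis using hS ei as(2)
  proof (induction u b arbitrary: m e u' rule: list_induct2)
   case (Cons x xs y ys)
   have x: "snd Y x \<le> y" "x \<in> fst Y" using Cons.prems(1)[of 0] Cons.prems(3)[of 0] Cons.prems(4) by auto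
   have "snd Y (xs ! i) \<le> ys ! i \<and> xs ! i \<in> fst Y" if "i < length ys" for i
    using Cons.prems(1)[of "Suc i"] Cons.prems(3)[of "Suc i"] Cons.prems(4) that by auto
   then have "pn Y xs \<le> prod_list ys \<and> 0 \<le> pn Y xs" using Cons.hyps
   proof (induction xs ys rule: list_induct2')
    case (4 x xs y ys)
    have "snd Y x \<le> y \<and> x \<in> fst Y" using 4(2)[of 0] by simp
    moreover have "pn Y xs \<le> prod_list ys \<and> 0 \<le> pn Y xs" using 4(1) 4(2)[of "Suc _"] 4(3) by auto
    ultimately show ?case using nspaceD(2)[OF Y, of x] order_trans[of 0 "snd Y x" y] by (auto intro!: mult_mono)
   qed auto
   then show ?case using x nspaceD(2)[OF Y x(2)] by (auto intro!: mult_mono)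
  qed simp
 qed
 have pue: "pn Y (u[i := e ! i]) \<le> \<eta> * ?P" if i: "i < m" for i
  unfolding map_update
  by (rule prod_list_update_le) (use i hS ei ws as nspaceD(2)[OF Y] in auto)
 have ue: "args Y m (u[i := e ! i])" if "i < m" for i
  using ws ei[OF that] set_update_subset_insert[of u i "e!i"] by auto
 have 1: "snd Z (T (w' # u') - T (w' # u) - (\<Sum>i<m. T (w' # u[i := e ! i]))) \<le> C * snd Y w' * ?P * 4 ^ m * ?X"
  by (rule Suc.IH[OF bT[OF ws'(2)] _ bd[OF ws'(2)] ws(3) ws'(3) ds(3) as(2) hS])
    (use Suc.prems(2) nspaceD(2)[OF Y ws'(2)] in auto)
 have 2: "snd Z (\<Sum>i<m. T ((w' - w) # u[i := e ! i])) \<le> (\<Sum>i<m. C * (?s * a) * (\<eta> * ?P))"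
 proof (rule order_trans[OF nspace_sum_le[OF Z] sum_mono])
  fix i assume i: "i \<in> {..<m}"
  then show "T ((w' - w) # u[i := e ! i]) \<in> fst Z"
   using bmlD(1)[OF bT[of "w'-w"] ue] mem ws ws' by auto
  have "snd Z (T ((w' - w) # u[i := e ! i])) \<le> C * snd Y (w' - w) * pn Y (u[i := e ! i])"
   using i ue mem ws ws' by (intro bd) auto
  also have "\<dots> \<le> C * (?s * a) * (\<eta> * ?P)"
   using dw pue i Suc.prems(2) a0 eta pn_nonneg[OF Y] ue by (intro mult_mono mult_left_mono) auto
  finally show "snd Z (T ((w' - w) # u[i := e ! i])) \<le> C * (?s * a) * (\<eta> * ?P)" .
 qed
 have 3: "snd Z (T ((w' - w - d) # u)) \<le> C * (\<epsilon> * a) * ?P"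
 proof -
  have "snd Z (T ((w' - w - d) # u)) \<le> C * snd Y (w' - w - d) * pn Y u"
   using mem ws ws' ds by (intro bd) auto
  also have "\<dots> \<le> C * (\<epsilon> * a) * ?P"
   using h0 pu Suc.prems(2) a0 eta pn_nonneg[OF Y] ws by (intro mult_mono mult_left_mono) auto
  finally show ?thesis .
 qed
 have split: "T ((w' - w) # us) = T (w' # us) - T (w # us)" if "args Y m us" for us
  by (rule bml_diff[OF Y Suc.prems(1) that]) (use ws ws' in auto)
 have split2: "T ((w' - w - d) # u) = T (w' # u) - T (w # u) - T (d # u)"
  using bml_diff[OF Y Suc.prems(1) ws(3), of "w'-w" d] split[OF ws(3)] mem ws ws' ds by simp
 have "(\<Sum>i<Suc m. T (ws[i := ds ! i])) = T (d # u) + (\<Sum>i<m. T (w # u[i := e ! i]))"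
  unfolding sum.lessThan_Suc_shift using ws ds by simp
 \<comment> \<open>Three sources of error: the other arguments with the new head in place, the new
   head inside the first-order terms, and the error of the head itself.\<close>
 then have eq: "T ws' - T ws - (\<Sum>i<Suc m. T (ws[i := ds ! i])) =
   (T (w' # u') - T (w' # u) - (\<Sum>i<m. T (w' # u[i := e ! i]))) + (\<Sum>i<m. T ((w' - w) # u[i := e ! i])) + T ((w' - w - d) # u)"
  using ws ws' split2 ue by (simp add: split sum_subtractf)
 have memZ: "T (z # us) \<in> fst Z" if "z \<in> fst Y" "args Y m us" for z us
  using bmlD(1)[OF bT] that by auto
 have "snd Z (T ws' - T ws - (\<Sum>i<Suc m. T (ws[i := ds ! i]))) \<le>
   C * snd Y w' * ?P * 4 ^ m * ?X + (\<Sum>i<m. C * (?s * a) * (\<eta> * ?P)) + C * (\<epsilon> * a) * ?P"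
  unfolding eq
  by (rule order_trans[OF nspaceD(4)[OF Z] add_mono[OF order_trans[OF nspaceD(4)[OF Z] add_mono[OF 1 2]] 3]])
    (use memZ ue mem ws ws' ds nspace_mem[OF Z] in \<open>auto intro!: nspace_mem[OF Z] nspace_sum[OF Z]\<close>)
 also have "C * snd Y w' * ?P * 4 ^ m * ?X \<le> C * (2 * a) * ?P * 4 ^ m * ?X"
  using w'2 Suc.prems(2) P0 X0 by (intro mult_right_mono mult_left_mono) auto
 also have "C * (2 * a) * ?P * 4 ^ m * ?X + (\<Sum>i<m. C * (?s * a) * (\<eta> * ?P)) + C * (\<epsilon> * a) * ?P
   = (C * a * ?P) * (2 * 4 ^ m * ?X + real m * (\<eta> * ?s) + \<epsilon>)" by (simp add: algebra_simps)
 also have "\<dots> \<le> (C * a * ?P) * (4 ^ Suc m * ?X)"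
 proof (rule mult_left_mono)
  have m: "real (Suc m) \<le> 2 * 4 ^ m"
   by (induction m) auto
  have "real m * (\<eta> * ?s) + \<epsilon> \<le> real (Suc m) * ?X"
   using eta by (simp add: algebra_simps)
  also have "\<dots> \<le> 2 * 4 ^ m * ?X" using m X0 by (rule mult_right_mono)
  finally show "2 * 4 ^ m * ?X + real m * (\<eta> * ?s) + \<epsilon> \<le> 4 ^ Suc m * ?X" by (simp add: algebra_simps)
  show "0 \<le> C * a * ?P" using Suc.prems(2) a0 P0 by simp
 qed
 finally show ?case using as by (simp add: algebra_simps)
qed

section \<open>The chain rule of all orders\<close>

definition pick :: "nat list => 'a list => 'a list" where
 "pick B vs = map ((!) vs) B"

text \<open>A partition of the argument positions as in the formula of Faa di Bruno, with numbered
  and possibly empty blocks.\<close>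

definition blocks :: "nat => nat => (nat => nat list) => bool" where
 "blocks a m B \<longleftrightarrow> (\<forall>i<m. distinct (B i)) \<and> (\<Union>i<m. set (B i)) = {..<a} \<and>
   (\<forall>i<m. \<forall>j<m. i \<noteq> j --> set (B i) \<inter> set (B j) = {})"

text \<open>The general term of the formula of Faa di Bruno: the m-linear derivative
  \<open>N\<close> of the outer map at \<open>f x\<close>, fed with the factors
  \<open>A i x\<close>, each of which receives the arguments of its own block.\<close>

definition plug :: "nat => ('b => 'b list => 'c) => ('a => 'b) => (nat => nat list) => (nat => 'a => 'a list => 'b) =>
  'a => 'a list => 'c" where
 "plug m N f B A x vs = N (f x) (map (%i. A i x (pick (B i) vs)) [0..<m])"

lemma pick_args: "args X a vs ==> set B \<subseteq> {..<a} ==> args X (length B) (pick B vs)"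
 unfolding pick_def by (auto simp: subset_iff)

lemma blocks_sub: "blocks a m B ==> i < m ==> set (B i) \<subseteq> {..<a}"
 unfolding blocks_def by blast

lemma pn_pick: "distinct B ==> pn X (pick B vs) = (\<Prod>j\<in>set B. snd X (vs ! j))"
 unfolding pick_def by (simp add: prod.distinct_set_conv_list comp_def)

lemma pn_blocks:
 assumes "blocks a m B" "length vs = a"
 shows "(\<Prod>i<m. pn X (pick (B i) vs)) = pn X vs"
proof -
 have "(\<Prod>i<m. pn X (pick (B i) vs)) = (\<Prod>i<m. \<Prod>j\<in>set (B i). snd X (vs ! j))"
  using assms by (intro prod.cong) (auto simp: blocks_def pn_pick)
 also have "\<dots> = (\<Prod>j\<in>(\<Union>i<m. set (B i)). snd X (vs ! j))"
  using assms by (intro prod.UNION_disjoint[symmetric]) (auto simp: blocks_def)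
 also have "\<dots> = (\<Prod>j<a. snd X (vs ! j))"
  using assms by (simp add: blocks_def)
 also have "\<dots> = pn X vs"
  using assms by (simp add: prod.list_conv_set_nth lessThan_atLeast0)
 finally show ?thesis .
qed

lemma prod_list_upt: "prod_list (map f [0..<m]) = (\<Prod>i<m. f i)" for f :: "nat => real"
 by (simp add: prod.distinct_set_conv_list[symmetric] lessThan_atLeast0)

lemma uniform_bound:
 assumes X: "nspace X" and T: "!!i. i < (m::nat) ==> bml X Y (k i) (T i)"
 shows "\<exists>K\<ge>1. \<forall>i<m. \<forall>vs. args X (k i) vs --> snd Y (T i vs) \<le> K * pn X vs"
 using T
proof (induction m)
 case (Suc m)
 obtain K where K: "K \<ge> 1" "!!i vs. i < m ==> args X (k i) vs ==> snd Y (T i vs) \<le> K * pn X vs"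
  using Suc by force
 obtain C where C: "!!vs. args X (k m) vs ==> snd Y (T m vs) \<le> C * pn X vs"
  using bml_bound[OF X Suc.prems[OF lessI]] by blast
 show ?case
 proof (intro exI[of _ "max K C"] conjI allI impI)
  fix i vs assume i: "i < Suc m" and vs: "args X (k i) vs"
  have p: "0 \<le> pn X vs" using pn_nonneg[OF X] vs by auto
  then have "K * pn X vs \<le> max K C * pn X vs" "C * pn X vs \<le> max K C * pn X vs"
   by (auto intro: mult_right_mono)
  then show "snd Y (T i vs) \<le> max K C * pn X vs"
   using K(2)[of i vs] C[of vs] i vs by (cases "i = m") force+
 qed (use K in auto)
qed auto

lemma plug_bml:
 assumes X: "nspace X" and Y: "nspace Y" and B: "blocks a m B"
  and N: "bml Y Z m (N (f x))" and A: "!!i. i < m ==> bml X Y (length (B i)) (A i x)"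
 shows "bml X Z a (plug m N f B A x)"
proof -
 obtain C where C: "C \<ge> 0" "!!vs. args Y m vs ==> snd Z (N (f x) vs) \<le> C * pn Y vs"
  using bml_bound[OF Y N] by blast
 obtain K where K: "K \<ge> 1" "!!i vs. i < m ==> args X (length (B i)) vs ==> snd Y (A i x vs) \<le> K * pn X vs"
  using uniform_bound[OF X, of m Y "%i. length (B i)" "%i. A i x"] A by auto
 let ?ws = "%vs. map (%i. A i x (pick (B i) vs)) [0..<m]"
 have ws: "args Y m (?ws vs)" if vs: "args X a vs" for vs
  using bmlD(1)[OF A pick_args[OF vs blocks_sub[OF B]]] by auto
 show ?thesis
 proof (rule bmlI[where C = "C * K ^ m"])
  fix vs assume vs: "args X a vs"
  then show "plug m N f B A x vs \<in> fst Z"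
   unfolding plug_def using bmlD(1)[OF N ws] by auto
  have "snd Z (plug m N f B A x vs) \<le> C * pn Y (?ws vs)"
   unfolding plug_def by (rule C(2)[OF ws[OF vs]])
  also have "pn Y (?ws vs) = (\<Prod>i<m. snd Y (A i x (pick (B i) vs)))"
   by (simp add: comp_def prod_list_upt)
  also have "\<dots> \<le> (\<Prod>i<m. K * pn X (pick (B i) vs))"
  proof (rule prod_mono)
   fix i assume i: "i \<in> {..<m}"
   then show "0 \<le> snd Y (A i x (pick (B i) vs)) \<and> snd Y (A i x (pick (B i) vs)) \<le> K * pn X (pick (B i) vs)"
    using K(2) pick_args[OF vs blocks_sub[OF B]] nspaceD(2)[OF Y] bmlD(1)[OF A] by auto
  qed
  also have "\<dots> = K ^ m * pn X vs"
   using pn_blocks[OF B, of vs X] vs by (simp add: prod.distrib)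
  finally show "snd Z (plug m N f B A x vs) \<le> C * K ^ m * pn X vs"
   using C(1) by (simp add: mult_left_mono mult.assoc)
 next
  fix vs i v w c d assume vs: "args X a vs" and i: "i < a" and v: "v \<in> fst X" "w \<in> fst X"
  obtain j where j: "j < m" "i \<in> set (B j)" using B i unfolding blocks_def by blast
  obtain l where l: "l < length (B j)" "B j ! l = i" using j by (metis in_set_conv_nth)
  let ?us = "pick (B j) vs"
  have us: "args X (length (B j)) ?us" using pick_args[OF vs blocks_sub[OF B j(1)]] .
  have *: "?ws (vs[i := z]) = (?ws vs)[j := A j x (?us[l := z])]" for z
  proof (rule nth_equalityI)
   fix p assume "p < length (?ws (vs[i := z]))"
   then have p: "p < m" by simp
   show "?ws (vs[i := z]) ! p = (?ws vs)[j := A j x (?us[l := z])] ! p"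
   proof (cases "p = j")
    case True
    have "pick (B j) (vs[i := z]) = ?us[l := z]"
    proof (rule nth_equalityI)
     fix r assume "r < length (pick (B j) (vs[i := z]))"
     then have r: "r < length (B j)" by (simp add: pick_def)
     have "B j ! r = i \<longleftrightarrow> r = l" using B j(1) l r nth_eq_iff_index_eq unfolding blocks_def by metis
     then show "pick (B j) (vs[i := z]) ! r = ?us[l := z] ! r"
      using r l vs i by (auto simp: pick_def nth_list_update)
    qed (simp add: pick_def)
    then show ?thesis using True p by simp
   next
    case False
    then have "i \<notin> set (B p)" using B j p unfolding blocks_def by blast
    then have "pick (B p) (vs[i := z]) = pick (B p) vs" by (auto simp: pick_def) (metis nth_list_update_neq)
    then show ?thesis using False p by simp
   qed
  qed simp
  have up: "args X (length (B j)) (?us[l := z])" if "z \<in> fst X" for z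
   using us that set_update_subset_insert[of ?us l z] by auto
  have Az: "A j x (?us[l := z]) \<in> fst Y" if "z \<in> fst X" for z
   using bmlD(1)[OF A[OF j(1)] up[OF that]] .
  show "plug m N f B A x (vs[i := c *\<^sub>R v + d *\<^sub>R w]) = c *\<^sub>R plug m N f B A x (vs[i := v]) + d *\<^sub>R plug m N f B A x (vs[i := w])"
   unfolding plug_def * bmlD(2)[OF A[OF j(1)] us l(1) v]
   by (rule bmlD(2)[OF N ws[OF vs] j(1)]) (use Az v in auto)
 qed
qed

lemma finite_uniform_delta:
 assumes "!!i. i < (m::nat) ==> \<exists>d>0::real. P i d" "!!i d d'. P i d ==> 0 < d' ==> d' \<le> d ==> P i d'"
 shows "\<exists>d>0. \<forall>i<m. P i d"
 using assms(1)
proof (induction m)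
 case (Suc m)
 obtain d1 d2 where d: "d1 > 0" "\<forall>i<m. P i d1" "d2 > 0" "P m d2" using Suc by force
 have "\<forall>i<Suc m. P i (min d1 d2)"
 proof (intro allI impI)
  fix i assume "i < Suc m"
  then show "P i (min d1 d2)" using d by (cases "i = m") (auto intro: assms(2)[of i d1] assms(2)[of m d2])
 qed
 then show ?case using d by (intro exI[of _ "min d1 d2"]) auto
qed (auto intro: exI[of _ 1])

text \<open>The derivative of such a term. Either the outer family is differentiated, which adds a
  factor \<open>f'\<close> with the block [0], or one of the factors is, which adds position 0 to
  its block. All old positions move up by one since the new direction is put in front.\<close>

definition plugD :: "nat => ('b => 'b list => 'c::real_vector) => ('b => 'b list => 'c) => ('a => 'b) => ('a => 'a list => 'b) =>
  (nat => nat list) => (nat => 'a => 'a list => 'b) => (nat => 'a => 'a list => 'b) => 'a => 'a list => 'c" where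
 "plugD m N N' f f' B A A' x vs =
   plug (Suc m) N' f (%i. case i of 0 => [0] | Suc j => map Suc (B j)) (%i. case i of 0 => f' | Suc j => A j) x vs
  + (\<Sum>i<m. plug m N f ((%j. map Suc (B j))(i := 0 # map Suc (B i))) (A(i := A' i)) x vs)"

lemma pick_Suc: "pick (map Suc B) (h # vs) = pick B vs"
 by (simp add: pick_def comp_def)

lemma plugD_eq:
 "plugD m N N' f f' B A A' x (h # vs) =
   N' (f x) (f' x [h] # map (%i. A i x (pick (B i) vs)) [0..<m])
  + (\<Sum>i<m. N (f x) ((map (%i. A i x (pick (B i) vs)) [0..<m])[i := A' i x (h # pick (B i) vs)]))"
proof -
 have 1: "map (%i. (case i of 0 => f' | Suc j => A j) x (pick (case i of 0 => [0] | Suc j => map Suc (B j)) (h # vs))) [0..<Suc m]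
  = f' x [h] # map (%i. A i x (pick (B i) vs)) [0..<m]"
  unfolding upt_conv_Cons[OF zero_less_Suc] map_Suc_upt[symmetric]
  by (simp add: pick_Suc comp_def) (simp add: pick_def)
 have 2: "map (%j. (A(i := A' i)) j x (pick (((%j. map Suc (B j))(i := 0 # map Suc (B i))) j) (h # vs))) [0..<m]
  = (map (%i. A i x (pick (B i) vs)) [0..<m])[i := A' i x (h # pick (B i) vs)]" if "i < m" for i
  using that by (intro nth_equalityI) (auto simp: pick_def nth_list_update comp_def)
 show ?thesis unfolding plugD_def plug_def 1
  by (intro arg_cong2[where f = "(+)"] refl sum.cong arg_cong[where f = "N (f x)"]) (rule 2, simp)
qed

lemma blocks_first: "blocks a m B ==> blocks (Suc a) (Suc m) (%i. case i of 0 => [0] | Suc j => map Suc (B j))"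
proof -
 assume B: "blocks a m B"
 have "(\<Union>i<Suc m. set (case i of 0 => [0] | Suc j => map Suc (B j))) = {0} \<union> Suc ` (\<Union>i<m. set (B i))"
  unfolding lessThan_Suc_eq_insert_0 by auto
 then have 1: "(\<Union>i<Suc m. set (case i of 0 => [0] | Suc j => map Suc (B j))) = {..<Suc a}"
  using B by (simp add: blocks_def lessThan_Suc_eq_insert_0)
 show ?thesis unfolding blocks_def 1 using B
  by (auto simp: blocks_def distinct_map split: nat.splits) (metis IntI empty_iff)
qed

lemma blocks_aug:
 assumes B: "blocks a m B" and i: "i < m"
 shows "blocks (Suc a) m ((%j. map Suc (B j))(i := 0 # map Suc (B i)))"
proof -
 have "(\<Union>j<m. set (((%j. map Suc (B j))(i := 0 # map Suc (B i))) j)) = {0} \<union> Suc ` (\<Union>i<m. set (B i))"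
  using i by (auto simp: image_iff split: if_splits)
 then have 1: "(\<Union>j<m. set (((%j. map Suc (B j))(i := 0 # map Suc (B i))) j)) = {..<Suc a}"
  using B by (simp add: blocks_def lessThan_Suc_eq_insert_0)
 have d: "distinct (map Suc (B j))" if "j < m" for j using B that by (simp add: blocks_def distinct_map)
 have dj: "Suc ` set (B j) \<inter> Suc ` set (B k) = {}" if "j < m" "k < m" "j \<noteq> k" for j k
  using B that unfolding blocks_def by (metis image_Int image_empty inj_Suc)
 show ?thesis unfolding blocks_def 1 using d dj i by auto
qed


text \<open>Chain and product rule in one. The remainder has three parts: moving the base point of
  \<open>N\<close> with the new arguments already in place, replacing direction and arguments in
  \<open>N'\<close>, and replacing the arguments in \<open>N\<close>. The first is small by
  \<open>Nd\<close>, the other two by \<open>telescope\<close>.\<close>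

lemma plug_mderiv:
 assumes X: "nspace X" and Y: "nspace Y" and Z: "nspace Z" and B: "blocks a m B" and fV: "f ` U \<subseteq> V"
  and Nb: "!!y. y \<in> V ==> bml Y Z m (N y)" and N'b: "!!y. y \<in> V ==> bml Y Z (Suc m) (N' y)"
  and Nd: "has_mderiv Y Z V m N N'"
  and fb: "!!x. x \<in> U ==> f x \<in> fst Y" and f'b: "!!x. x \<in> U ==> bml X Y 1 (f' x)"
  and fd: "has_mderiv X Y U 0 (%x vs. f x) f'"
  and Ab: "!!i x. i < m ==> x \<in> U ==> bml X Y (length (B i)) (A i x)"
  and A'b: "!!i x. i < m ==> x \<in> U ==> bml X Y (Suc (length (B i))) (A' i x)"
  and Ad: "!!i. i < m ==> has_mderiv X Y U (length (B i)) (A i) (A' i)"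
 shows "has_mderiv X Z U a (plug m N f B A) (plugD m N N' f f' B A A')"
 unfolding has_mderiv_def
proof (intro ballI allI impI)
 fix x and e :: real assume x: "x \<in> U" and e: "e > 0"
 have yV: "f x \<in> V" using fV x by auto
 obtain C where C: "C \<ge> 0" "!!vs. args Y m vs ==> snd Z (N (f x) vs) \<le> C * pn Y vs"
  using bml_bound[OF Y Nb[OF yV]] by blast
 obtain C' where C': "C' \<ge> 0" "!!vs. args Y (Suc m) vs ==> snd Z (N' (f x) vs) \<le> C' * pn Y vs"
  using bml_bound[OF Y N'b[OF yV]] by blast
 obtain K1 where K1: "K1 \<ge> 1" "!!i vs. i < m ==> args X (length (B i)) vs ==> snd Y (A i x vs) \<le> K1 * pn X vs"
  using uniform_bound[OF X, of m Y "%i. length (B i)" "%i. A i x"] Ab x by auto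
 obtain K2 where K2: "K2 \<ge> 1" "!!i vs. i < m ==> args X (Suc (length (B i))) vs ==> snd Y (A' i x vs) \<le> K2 * pn X vs"
  using uniform_bound[OF X, of m Y "%i. Suc (length (B i))" "%i. A' i x"] A'b x by auto
 obtain K3 where K3: "!!vs. args X 1 vs ==> snd Y (f' x vs) \<le> K3 * pn X vs"
  using bml_bound[OF X f'b[OF x]] by metis
 define K where "K = max K1 (max K2 K3)"
 have K: "K \<ge> 1" "K1 \<le> K" "K2 \<le> K" "K3 \<le> K" using K1(1) by (auto simp: K_def)
 have KA: "snd Y (A i x vs) \<le> K * pn X vs" if "i < m" "args X (length (B i)) vs" for i vs
  using K1(2)[OF that] mult_right_mono[OF K(2) pn_nonneg[OF X, of vs]] that by auto
 have KA': "snd Y (A' i x vs) \<le> K * pn X vs" if "i < m" "args X (Suc (length (B i))) vs" for i vs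
  using K2(2)[OF that] mult_right_mono[OF K(3) pn_nonneg[OF X, of vs]] that by auto
 have Kf: "snd Y (f' x [h]) \<le> K * snd X h" if "h \<in> fst X" for h
  using K3[of "[h]"] mult_right_mono[OF K(4), of "snd X h"] nspaceD(2)[OF X that] that by auto
 \<comment> \<open>\<open>Q\<close> collects the constants of the three estimates and fixes the
   tolerance t below; the summand 1 keeps it positive.\<close>
 define Q where "Q = K ^ m * ((K + 1) * 2 ^ m + C' * K * 4 ^ Suc m + C * 4 ^ m) + 1"
 have Q1: "Q \<ge> 1" unfolding Q_def using K C(1) C'(1) by simp
 define t where "t = min (1/2) (e / (4 * Q))"
 have t: "t > 0" "t \<le> 1/2" "4 * t * Q \<le> e"
  using e Q1 by (auto simp: t_def min_def field_simps)
 obtain dN where dN: "dN > 0" "!!k us. k \<in> fst Y ==> snd Y k < dN ==> f x + k \<in> V ==> args Y m us ==>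
   snd Z (N (f x + k) us - N (f x) us - N' (f x) (k # us)) \<le> t * snd Y k * pn Y us"
  using Nd yV t(1) unfolding has_mderiv_def by metis
 obtain df where df: "df > 0" "!!h. h \<in> fst X ==> snd X h < df ==> x + h \<in> U ==>
   snd Y (f (x + h) - f x - f' x [h]) \<le> t * snd X h"
  using fd x t(1) unfolding has_mderiv_def by (force simp del: length_0_conv)
 have "\<exists>dA>0. \<forall>i<m. \<forall>h us. h \<in> fst X --> snd X h < dA --> x + h \<in> U --> args X (length (B i)) us -->
   snd Y (A i (x + h) us - A i x us - A' i x (h # us)) \<le> t * snd X h * pn X us"
 proof (rule finite_uniform_delta)
  fix i assume "i < m"
  then show "\<exists>dA>0. \<forall>h us. h \<in> fst X --> snd X h < dA --> x + h \<in> U --> args X (length (B i)) us -->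
   snd Y (A i (x + h) us - A i x us - A' i x (h # us)) \<le> t * snd X h * pn X us"
   using Ad[of i] x t(1) unfolding has_mderiv_def by metis
 qed (meson order_less_le_trans)
 then obtain dA where dA: "dA > 0" "!!i h us. i < m ==> h \<in> fst X ==> snd X h < dA ==> x + h \<in> U ==> args X (length (B i)) us ==>
   snd Y (A i (x + h) us - A i x us - A' i x (h # us)) \<le> t * snd X h * pn X us"
  by blast
 \<comment> \<open>The bound \<open>t / 2\<close> turns terms quadratic in the increment into
   first-order terms of size t; the last bound keeps the increment of \<open>f\<close> below
   \<open>dN\<close>.\<close>
 define d where "d = min (min dA df) (min (t / 2) (dN / (K + 1)))"
 have d: "d > 0" "d \<le> dA" "d \<le> df" "d \<le> t / 2" "d \<le> dN / (K + 1)"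
 proof -
  have "dN / (K + 1) > 0" using dN K by simp
  then show "d > 0" using dA df t by (simp add: d_def)
  show "d \<le> dA" "d \<le> df" "d \<le> t / 2" "d \<le> dN / (K + 1)"
   unfolding d_def by linarith+
 qed
 show "\<exists>d>0. \<forall>h\<in>fst X. snd X h < d \<and> x + h \<in> U --> (\<forall>vs. args X a vs -->
   snd Z (plug m N f B A (x + h) vs - plug m N f B A x vs - plugD m N N' f f' B A A' x (h # vs))
   \<le> e * snd X h * pn X vs)"
 proof (intro exI[of _ d] conjI d(1) ballI impI allI)
  fix h vs assume h: "h \<in> fst X" and h2: "snd X h < d \<and> x + h \<in> U" and vs: "args X a vs"
  have hU: "x + h \<in> U" and hd: "snd X h < d" using h2 by auto
  have nh: "0 \<le> snd X h" using nspaceD(2)[OF X h] .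
  let ?ws = "map (%i. A i x (pick (B i) vs)) [0..<m]"
  let ?ws' = "map (%i. A i (x + h) (pick (B i) vs)) [0..<m]"
  let ?ds = "map (%i. A' i x (h # pick (B i) vs)) [0..<m]"
  let ?as = "map (%i. K * pn X (pick (B i) vs)) [0..<m]"
  define k where "k = f (x + h) - f x"
  have pa: "args X (length (B i)) (pick (B i) vs)" if "i < m" for i
   using pick_args[OF vs blocks_sub[OF B that]] .
  have ws: "args Y m ?ws" using bmlD(1)[OF Ab[OF _ x] pa] by auto
  have ws': "args Y m ?ws'" using bmlD(1)[OF Ab[OF _ hU] pa] by auto
  have ds: "args Y m ?ds" using bmlD(1)[OF A'b[OF _ x]] pa h by auto
  have kY: "k \<in> fst Y" unfolding k_def using fb x hU nspace_mem[OF Y] by auto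
  have f'Y: "f' x [h] \<in> fst Y" using bmlD(1)[OF f'b[OF x], of "[h]"] h by auto
  have kf: "snd Y (k - f' x [h]) \<le> t * snd X h" unfolding k_def using df(2)[OF h _ hU] hd d by auto
  have "snd Y k = snd Y ((k - f' x [h]) + f' x [h])" by simp
  also have "\<dots> \<le> snd Y (k - f' x [h]) + snd Y (f' x [h])"
   using kY f'Y by (intro nspaceD(4)[OF Y] nspace_mem[OF Y])
  also have "\<dots> \<le> (K + 1) * snd X h"
   using kf Kf[OF h] mult_right_mono[of t 1 "snd X h"] t nh by (simp add: algebra_simps)
  finally have nk: "snd Y k \<le> (K + 1) * snd X h" .
  also have "\<dots> < (K + 1) * (dN / (K + 1))" using hd d K by (intro mult_strict_left_mono) auto
  also have "\<dots> = dN" using K by simp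
  finally have kdN: "snd Y k < dN" .
  have pP: "prod_list ?as = K ^ m * pn X vs"
   using pn_blocks[OF B, of vs X] vs by (simp add: prod_list_upt prod.distrib)
  have nP: "0 \<le> pn X vs" using pn_nonneg[OF X] vs by auto
  have pi: "0 \<le> pn X (pick (B i) vs)" if "i < m" for i using pn_nonneg[OF X] pa[OF that] by auto
  have A1: "snd Y (A i (x + h) (pick (B i) vs) - A i x (pick (B i) vs) - A' i x (h # pick (B i) vs))
    \<le> t * snd X h * (K * pn X (pick (B i) vs))" if "i < m" for i
  proof -
   have "pn X (pick (B i) vs) \<le> K * pn X (pick (B i) vs)"
    using mult_right_mono[OF K(1) pi[OF that]] by simp
   then show ?thesis
    using dA(2)[OF that h _ hU pa[OF that]] hd d t nh
    by (smt (verit) mult_left_mono mult_nonneg_nonneg)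
  qed
  have A2: "snd Y (A' i x (h # pick (B i) vs)) \<le> snd X h * (K * pn X (pick (B i) vs))" if "i < m" for i
   using KA'[OF that, of "h # pick (B i) vs"] pa[OF that] h by (simp add: algebra_simps)
  have th: "t * snd X h \<le> snd X h" using mult_right_mono[of t 1 "snd X h"] t nh by simp
  have bnd: "snd Y (?ws ! i) \<le> ?as ! i \<and> snd Y (?ds ! i) \<le> snd X h * ?as ! i \<and>
    snd Y (?ws' ! i - ?ws ! i - ?ds ! i) \<le> (t * snd X h) * ?as ! i" if "i < m" for i
   using that A1[OF that] A2[OF that] KA[OF that pa[OF that]] by simp
  have hs: "snd X h + t * snd X h \<le> 1" using th hd d t by simp
  have T1: "snd Z (N (f x) ?ws' - N (f x) ?ws - (\<Sum>i<m. N (f x) (?ws[i := ?ds ! i])))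
   \<le> C * prod_list ?as * 4 ^ m * (snd X h * (snd X h + t * snd X h) + t * snd X h)"
   by (rule telescope[OF Y Z nh _ hs Nb[OF yV] C ws ws' ds _ bnd]) (use t nh in auto)
  have cons_bnd: "snd Y ((0 # ?ws) ! i) \<le> (K # ?as) ! i \<and> snd Y ((f' x [h] # ?ds) ! i) \<le> snd X h * (K # ?as) ! i \<and>
    snd Y ((k # ?ws') ! i - (0 # ?ws) ! i - (f' x [h] # ?ds) ! i) \<le> (t * snd X h) * (K # ?as) ! i"
   if "i < Suc m" for i
  proof (cases i)
   case 0
   have "t * snd X h * 1 \<le> t * snd X h * K" using K t nh by (intro mult_left_mono) auto
   then show ?thesis using 0 kf Kf[OF h] K nspace_norm0[OF Y] by (simp add: mult.commute)
  next
   case (Suc j)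
   then show ?thesis using bnd[of j] that by simp
  qed
  \<comment> \<open>The expansion of \<open>N'\<close> starts from a list with head 0. By linearity
    every term that still has this head vanishes, and only the one in which the head is replaced
    survives.\<close>
  have T2': "snd Z (N' (f x) (k # ?ws') - N' (f x) (0 # ?ws) - (\<Sum>i<Suc m. N' (f x) ((0 # ?ws)[i := (f' x [h] # ?ds) ! i])))
   \<le> C' * prod_list (K # ?as) * 4 ^ Suc m * (snd X h * (snd X h + t * snd X h) + t * snd X h)"
   by (rule telescope[OF Y Z nh _ hs N'b[OF yV] C'])
     (use t nh ws ws' ds kY f'Y nspace_mem[OF Y] cons_bnd in \<open>auto simp del: nth_Cons_Suc\<close>)
  have zero: "N' (f x) (0 # us) = 0" if "args Y m us" for us
   using bml_scale[OF Y N'b[OF yV] that, of 0 0] nspace_mem[OF Y] by simp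
  have wsu: "args Y m (?ws[i := ?ds ! i])" if "i < m" for i
  proof -
   have "?ds ! i \<in> fst Y" using bmlD(1)[OF A'b[OF that x]] pa[OF that] h that by auto
   then have "insert (?ds ! i) (set ?ws) \<subseteq> fst Y" using ws by simp
   then have "set (?ws[i := ?ds ! i]) \<subseteq> fst Y" using set_update_subset_insert by (rule subset_trans[rotated])
   then show ?thesis by simp
  qed
  have "(\<Sum>i<Suc m. N' (f x) ((0 # ?ws)[i := (f' x [h] # ?ds) ! i])) = N' (f x) (f' x [h] # ?ws)"
   unfolding sum.lessThan_Suc_shift using zero[OF wsu] by simp
  then have T2: "snd Z (N' (f x) (k # ?ws') - N' (f x) (f' x [h] # ?ws))
   \<le> C' * prod_list (K # ?as) * 4 ^ Suc m * (snd X h * (snd X h + t * snd X h) + t * snd X h)"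
   using T2' zero[OF ws] by simp
  have pw': "pn Y ?ws' \<le> 2 ^ m * prod_list ?as"
  proof -
   have "pn Y ?ws' = (\<Prod>i<m. snd Y (A i (x + h) (pick (B i) vs)))" by (simp add: comp_def prod_list_upt)
   also have "\<dots> \<le> (\<Prod>i<m. 2 * (K * pn X (pick (B i) vs)))"
   proof (rule prod_mono)
    fix i assume "i \<in> {..<m}"
    then have i: "i < m" by simp
    let ?u = "A i (x + h) (pick (B i) vs)" let ?v = "A i x (pick (B i) vs)" let ?w = "A' i x (h # pick (B i) vs)"
    have m: "?u \<in> fst Y" "?v \<in> fst Y" "?w \<in> fst Y" using i ws ws' ds by auto
    have "snd Y ?u = snd Y ((?u - ?v - ?w) + (?v + ?w))" by simp
    also have "\<dots> \<le> snd Y (?u - ?v - ?w) + (snd Y ?v + snd Y ?w)"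
     using nspaceD(4)[OF Y, of "?u - ?v - ?w" "?v + ?w"] nspaceD(4)[OF Y, of ?v ?w] m nspace_mem[OF Y] by auto
    also have "\<dots> \<le> t * snd X h * (K * pn X (pick (B i) vs)) + (K * pn X (pick (B i) vs) + snd X h * (K * pn X (pick (B i) vs)))"
     using A1[OF i] A2[OF i] KA[OF i pa[OF i]] by (intro add_mono)
    also have "\<dots> = (1 + (snd X h + t * snd X h)) * (K * pn X (pick (B i) vs))" by (simp add: algebra_simps)
    also have "\<dots> \<le> 2 * (K * pn X (pick (B i) vs))" using hs K pi[OF i] by (intro mult_right_mono) auto
    finally show "0 \<le> snd Y ?u \<and> snd Y ?u \<le> 2 * (K * pn X (pick (B i) vs))"
     using nspaceD(2)[OF Y m(1)] by simp
   qed
   also have "\<dots> = 2 ^ m * prod_list ?as" by (simp add: prod_list_upt prod.distrib)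
   finally show ?thesis .
  qed
  have T3: "snd Z (N (f x + k) ?ws' - N (f x) ?ws' - N' (f x) (k # ?ws')) \<le> t * ((K + 1) * snd X h) * (2 ^ m * prod_list ?as)"
  proof -
   have "snd Z (N (f x + k) ?ws' - N (f x) ?ws' - N' (f x) (k # ?ws')) \<le> t * snd Y k * pn Y ?ws'"
    by (rule dN(2)[OF kY kdN _ ws']) (use fV hU in \<open>auto simp: k_def\<close>)
   also have "\<dots> \<le> t * ((K + 1) * snd X h) * (2 ^ m * prod_list ?as)"
    using nk pw' t nh K pn_nonneg[OF Y, of ?ws'] ws' nspaceD(2)[OF Y kY]
    by (intro mult_mono mult_left_mono) auto
   finally show ?thesis .
  qed
  define R where "R = plug m N f B A (x + h) vs - plug m N f B A x vs - plugD m N N' f f' B A A' x (h # vs)"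
  have Req: "R = (N (f x + k) ?ws' - N (f x) ?ws' - N' (f x) (k # ?ws')) + (N' (f x) (k # ?ws') - N' (f x) (f' x [h] # ?ws))
    + (N (f x) ?ws' - N (f x) ?ws - (\<Sum>i<m. N (f x) (?ws[i := ?ds ! i])))"
   unfolding R_def plugD_eq by (simp add: plug_def k_def)
  note mN = bmlD(1)[OF Nb[OF yV]] and mN' = bmlD(1)[OF N'b[OF yV]]
  have fkV: "f x + k \<in> V" using fV hU by (auto simp: k_def)
  have memR: "N (f x + k) ?ws' \<in> fst Z" "N (f x) ?ws' \<in> fst Z" "N (f x) ?ws \<in> fst Z" "N' (f x) (k # ?ws') \<in> fst Z"
   "N' (f x) (f' x [h] # ?ws) \<in> fst Z" "(\<Sum>i<m. N (f x) (?ws[i := ?ds ! i])) \<in> fst Z"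
   using bmlD(1)[OF Nb[OF fkV] ws'] mN[OF ws'] mN[OF ws] mN'[of "k # ?ws'"] mN'[of "f' x [h] # ?ws"] ws ws' kY f'Y
    mN[OF wsu] by (auto intro!: nspace_sum[OF Z])
  let ?X = "snd X h * (snd X h + t * snd X h) + t * snd X h"
  have "snd Z R \<le> t * ((K + 1) * snd X h) * (2 ^ m * prod_list ?as) + C' * prod_list (K # ?as) * 4 ^ Suc m * ?X + C * prod_list ?as * 4 ^ m * ?X"
   unfolding Req
   by (rule order_trans[OF nspaceD(4)[OF Z] add_mono[OF order_trans[OF nspaceD(4)[OF Z] add_mono[OF T3 T2]] T1]])
     (intro nspace_mem[OF Z] memR)+
  also have "\<dots> = snd X h * prod_list ?as * (t * ((K + 1) * 2 ^ m)) + (C' * K * 4 ^ Suc m + C * 4 ^ m) * prod_list ?as * ?X"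
   by (simp add: algebra_simps)
  also have "\<dots> \<le> snd X h * prod_list ?as * (2 * t * ((K + 1) * 2 ^ m)) + (C' * K * 4 ^ Suc m + C * 4 ^ m) * prod_list ?as * (snd X h * (2 * t))"
  proof (intro add_mono mult_left_mono)
   have P0: "0 \<le> prod_list ?as" unfolding pP using K nP by simp
   have "snd X h * (snd X h + t * snd X h) \<le> snd X h * t"
    using th hd d nh by (intro mult_left_mono) auto
   then show "?X \<le> snd X h * (2 * t)" by (simp add: algebra_simps)
   show "0 \<le> (C' * K * 4 ^ Suc m + C * 4 ^ m) * prod_list ?as" "0 \<le> snd X h * prod_list ?as"
    using P0 C(1) C'(1) K nh by auto
   show "t * ((K + 1) * 2 ^ m) \<le> 2 * t * ((K + 1) * 2 ^ m)" using t K by (intro mult_right_mono) auto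
  qed
  also have "\<dots> = snd X h * pn X vs * (2 * t * (K ^ m * ((K + 1) * 2 ^ m + C' * K * 4 ^ Suc m + C * 4 ^ m)))"
   unfolding pP by (simp add: algebra_simps)
  also have "\<dots> \<le> snd X h * pn X vs * e"
  proof (rule mult_left_mono)
   have "2 * t * (K ^ m * ((K + 1) * 2 ^ m + C' * K * 4 ^ Suc m + C * 4 ^ m)) \<le> 2 * t * Q"
    using t by (intro mult_left_mono) (auto simp: Q_def)
   also have "\<dots> \<le> 4 * t * Q" using t Q1 by (intro mult_right_mono) auto
   finally show "2 * t * (K ^ m * ((K + 1) * 2 ^ m + C' * K * 4 ^ Suc m + C * 4 ^ m)) \<le> e" using t(3) by (rule order_trans)
  qed (use nh nP in simp)
  finally show "snd Z (plug m N f B A (x + h) vs - plug m N f B A x vs - plugD m N N' f f' B A A' x (h # vs)) \<le> e * snd X h * pn X vs"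
   unfolding R_def by (simp add: algebra_simps)
 qed
qed

lemma bml_zero: "nspace Y ==> bml X Y k (%vs. 0)"
 by (rule bmlI[where C = 0]) (auto simp: nspace_mem nspace_norm0)

lemma bml_plus:
 assumes X: "nspace X" and Y: "nspace Y" and S: "bml X Y k S" and T: "bml X Y k T"
 shows "bml X Y k (%vs. S vs + T vs)"
proof -
 obtain C where C: "!!vs. args X k vs ==> snd Y (S vs) \<le> C * pn X vs" using bml_bound[OF X S] by blast
 obtain D where D: "!!vs. args X k vs ==> snd Y (T vs) \<le> D * pn X vs" using bml_bound[OF X T] by blast
 show ?thesis
 proof (rule bmlI[where C = "C + D"])
  fix vs assume vs: "args X k vs"
  show "S vs + T vs \<in> fst Y" using bmlD(1)[OF S vs] bmlD(1)[OF T vs] by (rule nspace_mem(2)[OF Y])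
  have "snd Y (S vs + T vs) \<le> snd Y (S vs) + snd Y (T vs)"
   using bmlD(1)[OF S vs] bmlD(1)[OF T vs] by (rule nspaceD(4)[OF Y])
  then show "snd Y (S vs + T vs) \<le> (C + D) * pn X vs"
   using C[OF vs] D[OF vs] by (simp add: algebra_simps)
 next
  fix vs i v w a b assume "args X k vs" "i < k" "v \<in> fst X" "w \<in> fst X"
  then show "S (vs[i := a *\<^sub>R v + b *\<^sub>R w]) + T (vs[i := a *\<^sub>R v + b *\<^sub>R w]) =
    a *\<^sub>R (S (vs[i := v]) + T (vs[i := v])) + b *\<^sub>R (S (vs[i := w]) + T (vs[i := w]))"
   using bmlD(2)[OF S, of vs i v w a b] bmlD(2)[OF T, of vs i v w a b] by (simp add: algebra_simps)
 qed
qed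

lemma has_mderiv_add:
 assumes X: "nspace X" and Y: "nspace Y"
  and M: "has_mderiv X Y U k M M'" "!!x. x \<in> U ==> bml X Y k (M x)" "!!x. x \<in> U ==> bml X Y (Suc k) (M' x)"
  and N: "has_mderiv X Y U k N N'" "!!x. x \<in> U ==> bml X Y k (N x)" "!!x. x \<in> U ==> bml X Y (Suc k) (N' x)"
 shows "has_mderiv X Y U k (%x vs. M x vs + N x vs) (%x vs. M' x vs + N' x vs)"
 unfolding has_mderiv_def
proof (intro ballI allI impI)
 fix x and e :: real assume x: "x \<in> U" and e: "e > 0"
 then have e2: "e / 2 > 0" by simp
 obtain d1 where d1: "d1 > 0" "!!h vs. h\<in>fst X ==> snd X h < d1 ==> x + h \<in> U ==> args X k vs ==>
    snd Y (M (x + h) vs - M x vs - M' x (h # vs)) \<le> e / 2 * snd X h * pn X vs"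
  using M(1) x e2 unfolding has_mderiv_def by metis
 obtain d2 where d2: "d2 > 0" "!!h vs. h\<in>fst X ==> snd X h < d2 ==> x + h \<in> U ==> args X k vs ==>
    snd Y (N (x + h) vs - N x vs - N' x (h # vs)) \<le> e / 2 * snd X h * pn X vs"
  using N(1) x e2 unfolding has_mderiv_def by metis
 show "\<exists>d>0. \<forall>h\<in>fst X. snd X h < d \<and> x + h \<in> U --> (\<forall>vs. args X k vs -->
   snd Y (M (x + h) vs + N (x + h) vs - (M x vs + N x vs) - (M' x (h # vs) + N' x (h # vs)))
     \<le> e * snd X h * pn X vs)"
 proof (intro exI[of _ "min d1 d2"] conjI ballI impI allI)
  fix h vs assume h: "h \<in> fst X" "snd X h < min d1 d2 \<and> x + h \<in> U" and vs: "args X k vs"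
  have "snd Y (M (x + h) vs + N (x + h) vs - (M x vs + N x vs) - (M' x (h # vs) + N' x (h # vs)))
    = snd Y ((M (x + h) vs - M x vs - M' x (h # vs)) + (N (x + h) vs - N x vs - N' x (h # vs)))"
   by (simp add: algebra_simps)
  also have "\<dots> \<le> snd Y (M (x + h) vs - M x vs - M' x (h # vs)) + snd Y (N (x + h) vs - N x vs - N' x (h # vs))"
   using h vs x by (intro nspaceD(4)[OF Y] nspace_mem[OF Y] bmlD(1)[OF M(2)] bmlD(1)[OF M(3)] bmlD(1)[OF N(2)] bmlD(1)[OF N(3)]) auto
  also have "\<dots> \<le> e * snd X h * pn X vs"
   using d1(2)[of h vs] d2(2)[of h vs] h vs by simp
  finally show "snd Y (M (x + h) vs + N (x + h) vs - (M x vs + N x vs) - (M' x (h # vs) + N' x (h # vs))) \<le> e * snd X h * pn X vs" .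
 qed (use d1 d2 in auto)
qed

lemma cdiff_add:
 assumes X: "nspace X" and Y: "nspace Y"
 shows "cdiff X Y U n k M ==> cdiff X Y U n k N ==> cdiff X Y U n k (%x vs. M x vs + N x vs)"
proof (induction n arbitrary: k M N)
 case (Suc n)
 obtain M' where M': "has_mderiv X Y U k M M'" "cdiff X Y U n (Suc k) M'" using Suc.prems by auto
 obtain N' where N': "has_mderiv X Y U k N N'" "cdiff X Y U n (Suc k) N'" using Suc.prems by auto
 have "has_mderiv X Y U k (%x vs. M x vs + N x vs) (%x vs. M' x vs + N' x vs)"
  using Suc.prems cdiff_bml[OF M'(2)] cdiff_bml[OF N'(2)]
  by (intro has_mderiv_add[OF X Y M'(1) _ _ N'(1)]) auto
 then show ?case using Suc.IH[OF M'(2) N'(2)] bml_plus[OF X Y] Suc.prems by auto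
qed (use bml_plus[OF X Y] in auto)

lemma cdiff_const:
 assumes X: "nspace X" and Y: "nspace Y"
 shows "bml X Y k T ==> cdiff X Y U n k (%x. T)"
proof (induction n arbitrary: k T)
 case (Suc n)
 have "has_mderiv X Y U k (%x. T) (%x vs. 0)"
  unfolding has_mderiv_def using nspaceD(2)[OF X] pn_nonneg[OF X] by (auto simp: nspace_norm0[OF Y] intro!: exI[of _ 1])
 then show ?case using Suc.IH[OF bml_zero[OF Y]] Suc.prems by auto
qed simp

lemma cdiff_sum:
 assumes X: "nspace X" and Y: "nspace Y"
 shows "(!!i. i < m ==> cdiff X Y U n k (M i)) ==> cdiff X Y U n k (%x vs. \<Sum>i<(m::nat). M i x vs)"
proof (induction m)
 case 0 then show ?case using cdiff_const[OF X Y bml_zero[OF Y]] by simp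
next
 case (Suc m)
 then show ?case using cdiff_add[OF X Y, of U n k "%x vs. \<Sum>i<m. M i x vs" "M m"] by simp
qed

text \<open>Terms of this shape are closed under differentiation: the derivative is a sum of terms
  of the same shape with one more argument. So the order can be inducted on while blocks and factors
  vary.\<close>

theorem cdiff_plug:
 assumes X: "nspace X" and Y: "nspace Y" and Z: "nspace Z" and fV: "f ` U \<subseteq> V"
 shows "blocks a m B ==> cdiff Y Z V n m N ==> cdiff X Y U n 0 (%x vs. f x) ==>
  (!!i. i < m ==> cdiff X Y U n (length (B i)) (A i)) ==> cdiff X Z U n a (plug m N f B A)"
proof (induction n arbitrary: a m B N A)
 case 0
 show ?case unfolding cdiff.simps
  by (intro ballI plug_bml[OF X Y 0(1)]) (use 0 fV in auto)
next
 case (Suc n)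
 note B = Suc.prems(1)
 obtain N' where N': "has_mderiv Y Z V m N N'" "cdiff Y Z V n (Suc m) N'" using Suc.prems(2) by auto
 obtain f' where f': "has_mderiv X Y U 0 (%x vs. f x) f'" "cdiff X Y U n (Suc 0) f'" using Suc.prems(3) by auto
 have "\<forall>i. \<exists>A'. i < m --> has_mderiv X Y U (length (B i)) (A i) A' \<and> cdiff X Y U n (Suc (length (B i))) A'"
  using Suc.prems(4) by fastforce
 then obtain A' where A': "!!i. i < m ==> has_mderiv X Y U (length (B i)) (A i) (A' i)"
   "!!i. i < m ==> cdiff X Y U n (Suc (length (B i))) (A' i)" by metis
 have bmls: "bml Y Z m (N y)" "bml Y Z (Suc m) (N' y)" if "y \<in> V" for y
  using cdiff_bml[OF Suc.prems(2) that] cdiff_bml[OF N'(2) that] .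
 have fb: "f x \<in> fst Y" "bml X Y 1 (f' x)" if "x \<in> U" for x
  using bmlD(1)[OF cdiff_bml[OF Suc.prems(3) that], of "[]"] cdiff_bml[OF f'(2) that] by auto
 have Ab: "bml X Y (length (B i)) (A i x)" "bml X Y (Suc (length (B i))) (A' i x)" if "i < m" "x \<in> U" for i x
  using cdiff_bml[OF Suc.prems(4)[OF that(1)] that(2)] cdiff_bml[OF A'(2)[OF that(1)] that(2)] .
 have d: "has_mderiv X Z U a (plug m N f B A) (plugD m N N' f f' B A A')"
  by (rule plug_mderiv[OF X Y Z B fV bmls N'(1) fb f'(1) Ab A'(1)])
 have f0: "cdiff X Y U n 0 (%x vs. f x)" using cdiff_Suc_imp[OF Suc.prems(3)] .
 have A0: "cdiff X Y U n (length (B i)) (A i)" if "i < m" for i using cdiff_Suc_imp[OF Suc.prems(4)[OF that]] .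
 have 1: "cdiff X Z U n (Suc a) (plug (Suc m) N' f (%i. case i of 0 => [0] | Suc j => map Suc (B j)) (%i. case i of 0 => f' | Suc j => A j))"
  by (rule Suc.IH[OF blocks_first[OF B] N'(2) f0]) (use f'(2) A0 in \<open>auto split: nat.split\<close>)
 have 2: "cdiff X Z U n (Suc a) (plug m N f ((%j. map Suc (B j))(i := 0 # map Suc (B i))) (A(i := A' i)))" if i: "i < m" for i
  by (rule Suc.IH[OF blocks_aug[OF B i] cdiff_Suc_imp[OF Suc.prems(2)] f0]) (use A'(2) A0 i in auto)
 have 3: "cdiff X Z U n (Suc a) (plugD m N N' f f' B A A')"
  unfolding plugD_def[abs_def]
  by (intro cdiff_add[OF X Z] cdiff_sum[OF X Z] 1 2)
 have "\<forall>x\<in>U. bml X Z a (plug m N f B A x)"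
  by (intro ballI plug_bml[OF X Y B]) (use bmls Ab fV in auto)
 then show ?case using d 3 by auto
qed

lemma cdiff_compose:
 assumes "nspace X" "nspace Y" "nspace Z" and fV: "f ` U \<subseteq> V"
  and "cdiff Y Z V n 0 (%x vs. g x)" "cdiff X Y U n 0 (%x vs. f x)"
 shows "cdiff X Z U n 0 (%x vs. g (f x))"
 using cdiff_plug[OF assms(1-3) fV, of 0 0 "%_. []" n "%x vs. g x"] assms(5,6)
 by (simp add: blocks_def plug_def[abs_def])

lemma smooth_compose:
 assumes "nspace X" "nspace Y" "nspace Z"
  and "smooth Y Z V g" "smooth X Y U f" "f ` U \<subseteq> V"
 shows "smooth X Z U (%x. g (f x))"
 unfolding smooth_def
proof
 fix n show "cdiff X Z U n 0 (%x vs. g (f x))"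
  using assms(4,5) unfolding smooth_def by (intro cdiff_compose[OF assms(1-3,6)]) blast+
qed

lemma smooth_subset: "smooth X Y V f ==> U \<subseteq> V ==> smooth X Y U f"
 unfolding smooth_def using cdiff_subset by blast

lemma smooth_mem: "smooth X Y U f ==> x \<in> U ==> f x \<in> fst Y"
proof -
 assume *: "smooth X Y U f" "x \<in> U"
 then have "cdiff X Y U 0 0 (%x vs. f x)" unfolding smooth_def by blast
 from bmlD(1)[OF cdiff_bml[OF this *(2)], of "[]"] show ?thesis by simp
qed

lemma smooth_cong: "nspace X ==> (!!x. x \<in> U ==> f x = g x) ==> smooth X Y U g ==> smooth X Y U f"
 unfolding smooth_def using cdiff_cong[of X U 0 "%x vs. f x" "%x vs. g x"] by blast

lemma smooth_add:
 assumes "nspace X" "nspace Y" "smooth X Y U f" "smooth X Y U g"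
 shows "smooth X Y U (%x. f x + g x)"
 using assms cdiff_add[OF assms(1,2), of U _ 0 "%x vs. f x" "%x vs. g x"] unfolding smooth_def by blast

lemma bml_0: "y \<in> fst Y ==> bml X Y 0 (%vs. y)"
 by (rule bmlI[where C = "snd Y y"]) auto

lemma smooth_const: "nspace X ==> nspace Y ==> y \<in> fst Y ==> smooth X Y U (%x. y)"
 unfolding smooth_def using cdiff_const bml_0 by blast

section \<open>Linear and bilinear maps, products, parameter families\<close>

definition nlinear :: "'a::real_vector nsp => 'b::real_vector nsp => ('a => 'b) => bool" where
 "nlinear X Y f \<longleftrightarrow> (\<forall>x\<in>fst X. f x \<in> fst Y) \<and>
   (\<forall>x\<in>fst X. \<forall>y\<in>fst X. \<forall>a b. f (a *\<^sub>R x + b *\<^sub>R y) = a *\<^sub>R f x + b *\<^sub>R f y) \<and>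
   (\<exists>C. \<forall>x\<in>fst X. snd Y (f x) \<le> C * snd X x)"

lemma bml_hd:
 assumes "nlinear X Y f"
 shows "bml X Y (Suc 0) (%vs. f (hd vs))"
proof -
 obtain C where C: "!!x. x \<in> fst X ==> snd Y (f x) \<le> C * snd X x" using assms unfolding nlinear_def by blast
 show ?thesis
 proof (rule bmlI[where C = C])
  fix vs i v w a b assume "args X (Suc 0) vs" "i < Suc 0" "v \<in> fst X" "w \<in> fst X"
  then show "f (hd (vs[i := a *\<^sub>R v + b *\<^sub>R w])) = a *\<^sub>R f (hd (vs[i := v])) + b *\<^sub>R f (hd (vs[i := w]))"
   using assms unfolding nlinear_def by (cases vs) auto
 next
  fix vs assume "args X (Suc 0) vs"
  then show "f (hd vs) \<in> fst Y" "snd Y (f (hd vs)) \<le> C * pn X vs"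
   using assms C unfolding nlinear_def by (cases vs; auto)+
 qed
qed

text \<open>A map linear in the base point has the constant family \<open>T\<close> as derivative,
  and every further derivative is 0.\<close>

lemma cdiff_lin:
 assumes X: "nspace X" and Y: "nspace Y" and T: "bml X Y (Suc k) T" and U: "U \<subseteq> fst X"
 shows "cdiff X Y U n k (%x vs. T (x # vs))"
proof (cases n)
 case 0 then show ?thesis using bml_Cons[OF X T] U by auto
next
 case (Suc m)
 have "has_mderiv X Y U k (%x vs. T (x # vs)) (%x. T)"
  unfolding has_mderiv_def
 proof (intro ballI allI impI exI[of _ 1] conjI)
  fix x and e :: real and h vs assume *: "x \<in> U" "e > 0" "h \<in> fst X" "args X k vs"
  have "T ((x + h) # vs) - T (x # vs) - T (h # vs) = 0"
   using bml_add[OF X T *(4), of x h] * U by auto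
  then show "snd Y (T ((x + h) # vs) - T (x # vs) - T (h # vs)) \<le> e * snd X h * pn X vs"
   using * nspaceD(2)[OF X *(3)] pn_nonneg[OF X, of vs] by (simp add: nspace_norm0[OF Y])
 qed simp
 then show ?thesis using Suc cdiff_const[OF X Y T] bml_Cons[OF X T] U by auto
qed

lemma smooth_linear:
 assumes X: "nspace X" and Y: "nspace Y" and f: "nlinear X Y f" and U: "U \<subseteq> fst X"
 shows "smooth X Y U f"
 unfolding smooth_def using cdiff_lin[OF X Y bml_hd[OF f] U] by simp

definition nprod :: "'a nsp => 'b nsp => ('a \<times> 'b) nsp" (infixr "\<otimes>\<^sub>n" 75) where
 "X \<otimes>\<^sub>n Y = (fst X \<times> fst Y, %(x, y). snd X x + snd Y y)"

lemma nprod_simps [simp]: "fst (X \<otimes>\<^sub>n Y) = fst X \<times> fst Y" "snd (X \<otimes>\<^sub>n Y) (x, y) = snd X x + snd Y y"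
 by (auto simp: nprod_def)

lemma nspace_nprod:
 assumes X: "nspace X" and Y: "nspace Y"
 shows "nspace (X \<otimes>\<^sub>n Y)"
 unfolding nspace_def
proof (intro conjI ballI allI impI)
 show "subspace (fst (X \<otimes>\<^sub>n Y))"
  using nspace_mem[OF X] nspace_mem[OF Y] by (auto simp: subspace_def zero_prod_def)
 fix z assume z: "z \<in> fst (X \<otimes>\<^sub>n Y)"
 obtain x y where xy: "z = (x, y)" "x \<in> fst X" "y \<in> fst Y" using z by auto
 have nn: "0 \<le> snd X x" "0 \<le> snd Y y" using nspaceD(2)[OF X xy(2)] nspaceD(2)[OF Y xy(3)] .
 then show "0 \<le> snd (X \<otimes>\<^sub>n Y) z" using xy by simp
 show "snd (X \<otimes>\<^sub>n Y) (c *\<^sub>R z) = \<bar>c\<bar> * snd (X \<otimes>\<^sub>n Y) z" for c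
  using xy nspaceD(5)[OF X xy(2)] nspaceD(5)[OF Y xy(3)] by (simp add: algebra_simps)
 show "z = 0" if "snd (X \<otimes>\<^sub>n Y) z = 0"
  using that xy nn nspaceD(3)[OF X xy(2)] nspaceD(3)[OF Y xy(3)] by (simp add: zero_prod_def)
 fix w assume w: "w \<in> fst (X \<otimes>\<^sub>n Y)"
 obtain a b where ab: "w = (a, b)" "a \<in> fst X" "b \<in> fst Y" using w by auto
 then show "snd (X \<otimes>\<^sub>n Y) (z + w) \<le> snd (X \<otimes>\<^sub>n Y) z + snd (X \<otimes>\<^sub>n Y) w"
  using nspaceD(4)[OF X xy(2) ab(2)] nspaceD(4)[OF Y xy(3) ab(3)] xy by simp
qed

lemma nlinear_Pair1: "nspace X ==> nspace Y ==> nlinear X (X \<otimes>\<^sub>n Y) (%x. (x, 0))"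
 unfolding nlinear_def by (auto simp: nspace_mem nspace_norm0 intro!: exI[of _ 1])

lemma nlinear_Pair2: "nspace X ==> nspace Y ==> nlinear Y (X \<otimes>\<^sub>n Y) (%y. (0, y))"
 unfolding nlinear_def by (auto simp: nspace_mem nspace_norm0 intro!: exI[of _ 1])

lemma nlinear_fst: "nspace X ==> nspace Y ==> nlinear (X \<otimes>\<^sub>n Y) X fst"
 unfolding nlinear_def by (auto simp: nspaceD(2) intro!: exI[of _ 1])

lemma nlinear_snd: "nspace X ==> nspace Y ==> nlinear (X \<otimes>\<^sub>n Y) Y snd"
 unfolding nlinear_def by (auto simp: nspaceD(2) intro!: exI[of _ 1])

lemma cdiff_pair:
 assumes X: "nspace X" and Y: "nspace Y" "nspace Z" and f: "cdiff X Y U n 0 (%x vs. f x)" and g: "cdiff X Z U n 0 (%x vs. g x)"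
 shows "cdiff X (Y \<otimes>\<^sub>n Z) U n 0 (%x vs. (f x, g x))"
proof -
 note P = nspace_nprod[OF Y]
 have fY: "f ` U \<subseteq> fst Y" using bmlD(1)[OF cdiff_bml[OF f], of _ "[]"] by auto
 have gZ: "g ` U \<subseteq> fst Z" using bmlD(1)[OF cdiff_bml[OF g], of _ "[]"] by auto
 have 1: "cdiff X (Y \<otimes>\<^sub>n Z) U n 0 (%x vs. (f x, 0))"
  using smooth_linear[OF Y(1) P nlinear_Pair1[OF Y], of "fst Y"]
  by (intro cdiff_compose[OF X Y(1) P fY, of n "%y. (y, 0)"] f) (auto simp: smooth_def)
 have 2: "cdiff X (Y \<otimes>\<^sub>n Z) U n 0 (%x vs. (0, g x))"
  using smooth_linear[OF Y(2) P nlinear_Pair2[OF Y], of "fst Z"]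
  by (intro cdiff_compose[OF X Y(2) P gZ, of n "%y. (0, y)"] g) (auto simp: smooth_def)
 show ?thesis using cdiff_add[OF X P 1 2] by simp
qed

lemma smooth_pair:
 assumes "nspace X" "nspace Y" "nspace Z" "smooth X Y U f" "smooth X Z U g"
 shows "smooth X (Y \<otimes>\<^sub>n Z) U (%x. (f x, g x))"
 unfolding smooth_def
proof
 fix n show "cdiff X (Y \<otimes>\<^sub>n Z) U n 0 (%x vs. (f x, g x))"
  using assms(4,5) unfolding smooth_def by (intro cdiff_pair[OF assms(1-3)]) blast+
qed

definition nbilinear :: "'a::real_vector nsp => 'b::real_vector nsp => 'c::real_vector nsp => ('a => 'b => 'c) => bool" where
 "nbilinear X Y Z b \<longleftrightarrow> (\<forall>x\<in>fst X. \<forall>y\<in>fst Y. b x y \<in> fst Z) \<and>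
   (\<forall>x\<in>fst X. \<forall>x'\<in>fst X. \<forall>y\<in>fst Y. \<forall>r s. b (r *\<^sub>R x + s *\<^sub>R x') y = r *\<^sub>R b x y + s *\<^sub>R b x' y) \<and>
   (\<forall>x\<in>fst X. \<forall>y\<in>fst Y. \<forall>y'\<in>fst Y. \<forall>r s. b x (r *\<^sub>R y + s *\<^sub>R y') = r *\<^sub>R b x y + s *\<^sub>R b x y') \<and>
   (\<exists>C. \<forall>x\<in>fst X. \<forall>y\<in>fst Y. snd Z (b x y) \<le> C * snd X x * snd Y y)"

text \<open>The derivative at z in direction h is \<open>T [z, h]\<close> with the symmetrized form
  \<open>T\<close>, hence linear in z, and the remainder is \<open>b\<close> applied to the two
  increments.\<close>

lemma smooth_bilinear_prod:
 assumes X: "nspace X" and Y: "nspace Y" and Z: "nspace Z" and b: "nbilinear X Y Z b"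
 shows "smooth (X \<otimes>\<^sub>n Y) Z (fst X \<times> fst Y) (%z. b (fst z) (snd z))"
proof -
 let ?P = "X \<otimes>\<^sub>n Y"
 note P = nspace_nprod[OF X Y]
 obtain C0 where C0: "!!x y. x \<in> fst X ==> y \<in> fst Y ==> snd Z (b x y) \<le> C0 * snd X x * snd Y y"
  using b unfolding nbilinear_def by blast
 define C where "C = max C0 0"
 have C: "C \<ge> 0" by (simp add: C_def)
 have Cb: "snd Z (b x y) \<le> C * (snd X x * snd Y y)" if "x \<in> fst X" "y \<in> fst Y" for x y
  using C0[OF that] nspaceD(2)[OF X that(1)] nspaceD(2)[OF Y that(2)]
   mult_right_mono[of C0 C "snd X x * snd Y y"] by (simp add: C_def mult.assoc)
 have mem: "b x y \<in> fst Z" if "x \<in> fst X" "y \<in> fst Y" for x y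
  using b that unfolding nbilinear_def by blast
 have l: "b (r *\<^sub>R x + s *\<^sub>R x') y = r *\<^sub>R b x y + s *\<^sub>R b x' y" if "x \<in> fst X" "x' \<in> fst X" "y \<in> fst Y" for x x' y r s
  using b that unfolding nbilinear_def by blast
 have r: "b x (r *\<^sub>R y + s *\<^sub>R y') = r *\<^sub>R b x y + s *\<^sub>R b x y'" if "x \<in> fst X" "y \<in> fst Y" "y' \<in> fst Y" for x y y' r s
  using b that unfolding nbilinear_def by blast
 define T where "T vs = (let u = vs ! 0; v = vs ! 1 in b (fst u) (snd v) + b (fst v) (snd u))" for vs :: "('a \<times> 'b) list"
 have T: "bml ?P Z (Suc (Suc 0)) T"
 proof (rule bmlI[where C = "2 * C"])
  fix vs :: "('a \<times> 'b) list" assume "args ?P (Suc (Suc 0)) vs"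
  then obtain x y x' y' where vs: "vs = [(x, y), (x', y')]" and m: "x \<in> fst X" "y \<in> fst Y" "x' \<in> fst X" "y' \<in> fst Y"
   by (auto simp: length_Suc_conv)
  show "T vs \<in> fst Z" unfolding T_def vs using m by (simp add: mem nspace_mem[OF Z])
  have n: "0 \<le> snd X x" "0 \<le> snd X x'" "0 \<le> snd Y y" "0 \<le> snd Y y'" using m nspaceD(2)[OF X] nspaceD(2)[OF Y] by auto
  have "snd Z (T vs) \<le> snd Z (b x y') + snd Z (b x' y)"
   unfolding T_def vs using m by (simp add: nspaceD(4)[OF Z] mem)
  also have "\<dots> \<le> C * (snd X x * snd Y y') + C * (snd X x' * snd Y y)"
   using m by (intro add_mono Cb)
  also have "\<dots> \<le> 2 * C * ((snd X x + snd Y y) * (snd X x' + snd Y y'))"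
   using n C by (simp add: algebra_simps)
  finally show "snd Z (T vs) \<le> 2 * C * pn ?P vs" unfolding vs by simp
  fix i v w and p q :: real assume i: "i < Suc (Suc 0)" and vw: "v \<in> fst ?P" "w \<in> fst ?P"
  obtain v1 v2 w1 w2 where vw': "v = (v1, v2)" "w = (w1, w2)" "v1 \<in> fst X" "v2 \<in> fst Y" "w1 \<in> fst X" "w2 \<in> fst Y"
   using vw by auto
  have "i = 0 \<or> i = 1" using i by auto
  then show "T (vs[i := p *\<^sub>R v + q *\<^sub>R w]) = p *\<^sub>R T (vs[i := v]) + q *\<^sub>R T (vs[i := w])"
   using m vw' unfolding T_def vs by (elim disjE) (simp_all add: l r scaleR_right_distrib)
 qed
 have d: "has_mderiv ?P Z (fst X \<times> fst Y) 0 (%z vs. b (fst z) (snd z)) (%z vs. T (z # vs))"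
  unfolding has_mderiv_def
 proof (intro ballI allI impI)
  fix z and e :: real assume z: "z \<in> fst X \<times> fst Y" and e: "e > 0"
  show "\<exists>d>0. \<forall>h\<in>fst ?P. snd ?P h < d \<and> z + h \<in> fst X \<times> fst Y --> (\<forall>vs. args ?P 0 vs -->
    snd Z (b (fst (z + h)) (snd (z + h)) - b (fst z) (snd z) - T (z # h # vs)) \<le> e * snd ?P h * pn ?P vs)"
  proof (intro exI[of _ "e / (C + 1)"] conjI ballI impI allI)
   fix h vs assume h: "h \<in> fst ?P" "snd ?P h < e / (C + 1) \<and> z + h \<in> fst X \<times> fst Y" and vs: "args ?P 0 vs"
   obtain x y where xy: "z = (x, y)" "x \<in> fst X" "y \<in> fst Y" using z by auto
   obtain u v where uv: "h = (u, v)" "u \<in> fst X" "v \<in> fst Y" using h by auto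
   have e1: "b (x + u) (y + v) = b x y + b x v + (b u y + b u v)"
    using l[of x u "y+v" 1 1] r[of x y v 1 1] r[of u y v 1 1] xy uv nspace_mem(2)[OF Y xy(3) uv(3)] by simp
   have n: "0 \<le> snd X u" "0 \<le> snd Y v" using uv nspaceD(2)[OF X] nspaceD(2)[OF Y] by auto
   have "snd Z (b (fst (z + h)) (snd (z + h)) - b (fst z) (snd z) - T (z # h # vs)) = snd Z (b u v)"
    unfolding T_def xy uv using e1 by (simp add: Let_def)
   also have "\<dots> \<le> C * (snd X u * snd Y v)" by (rule Cb[OF uv(2,3)])
   also have "\<dots> \<le> (C + 1) * ((snd X u + snd Y v) * (snd X u + snd Y v))"
    using n C by (intro mult_mono) auto
   also have "\<dots> = (C + 1) * snd ?P h * snd ?P h" unfolding uv by simp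
   also have "\<dots> \<le> e * snd ?P h"
    using h C n unfolding uv by (intro mult_right_mono) (auto simp: field_simps)
   finally show "snd Z (b (fst (z + h)) (snd (z + h)) - b (fst z) (snd z) - T (z # h # vs)) \<le> e * snd ?P h * pn ?P vs"
    using vs by simp
  qed (use e C in auto)
 qed
 have "cdiff ?P Z (fst X \<times> fst Y) (Suc n) 0 (%z vs. b (fst z) (snd z))" for n
  unfolding cdiff.simps(2)
 proof (intro conjI ballI exI)
  show "bml ?P Z 0 (%vs. b (fst z) (snd z))" if "z \<in> fst X \<times> fst Y" for z
   using that mem by (intro bml_0) auto
  show "cdiff ?P Z (fst X \<times> fst Y) n (Suc 0) (%z vs. T (z # vs))"
   by (rule cdiff_lin[OF P Z T]) simp
 qed (rule d)
 then show ?thesis unfolding smooth_def using cdiff_Suc_imp by blast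
qed

lemma smooth_bilinear:
 assumes W: "nspace W" and X: "nspace X" and Y: "nspace Y" and Z: "nspace Z" and b: "nbilinear X Y Z b"
  and f: "smooth W X U f" and g: "smooth W Y U g"
 shows "smooth W Z U (%x. b (f x) (g x))"
 using smooth_compose[OF W nspace_nprod[OF X Y] Z smooth_bilinear_prod[OF X Y Z b] smooth_pair[OF W X Y f g]]
  smooth_mem[OF f] smooth_mem[OF g] by auto

text \<open>Joint smoothness of \<open>g\<close> has to be turned into differentiability in the
  operator norm of the family of its linear parts. Being linear in h, \<open>g p h\<close> equals
  the derivative of \<open>g\<close> at (p, 0) in direction (0, h); that derivative is an
  operator-norm object by definition, and the family is obtained from it by
  \<open>cdiff_plug\<close>.\<close>

lemma cdiff_lin_family:
 assumes X: "nspace X" and P: "nspace P" and Y: "nspace Y" and V: "nopen P V"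
  and g: "smooth (P \<otimes>\<^sub>n X) Y (V \<times> fst X) (%z. g (fst z) (snd z))"
  and lin: "!!p h c. p \<in> V ==> h \<in> fst X ==> g p (c *\<^sub>R h) = c *\<^sub>R g p h"
  and \<gamma>: "cdiff X P U n 0 (%x vs. \<gamma> x)" "\<gamma> ` U \<subseteq> V"
 shows "cdiff X Y U n 1 (%x vs. g (\<gamma> x) (hd vs))"
proof -
 let ?Q = "P \<otimes>\<^sub>n X"
 note Q = nspace_nprod[OF P X]
 have VP: "V \<subseteq> fst P" using V by (auto simp: nopen_def)
 have "cdiff ?Q Y (V \<times> fst X) (Suc n) 0 (%z vs. g (fst z) (snd z))" using g unfolding smooth_def by (rule spec)
 then obtain G where G: "has_mderiv ?Q Y (V \<times> fst X) 0 (%z vs. g (fst z) (snd z)) G" "cdiff ?Q Y (V \<times> fst X) n (Suc 0) G"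
  by auto
 \<comment> \<open>Here g p is compared with the derivative along t h: both are homogeneous in t, so
   the o(t) estimate forces equality.\<close>
 have key: "G (p, 0) [(0, h)] = g p h" if p: "p \<in> V" and h: "h \<in> fst X" for p h
 proof -
  have p0: "(p, 0) \<in> V \<times> fst X" using p nspace_mem[OF X] by auto
  let ?u = "g p h - G (p, 0) [(0, h)]"
  have G0: "bml ?Q Y (Suc 0) (G (p, 0))" using cdiff_bml[OF G(2) p0] .
  have G0m: "G (p, 0) [(0, k)] \<in> fst Y" if "k \<in> fst X" for k
   using bmlD(1)[OF G0, of "[(0, k)]"] that nspace_mem[OF P] by auto
  have gm: "g p k \<in> fst Y" if "k \<in> fst X" for k using smooth_mem[OF g, of "(p, k)"] that p by auto
  have uY: "?u \<in> fst Y" using G0m gm h nspace_mem[OF Y] by auto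
  have nh: "0 \<le> snd X h" using nspaceD(2)[OF X h] .
  have le: "snd Y ?u \<le> e * snd X h" if e: "e > 0" for e
  proof -
   obtain d where d: "d > 0" "!!k. k \<in> fst ?Q ==> snd ?Q k < d ==> (p, 0) + k \<in> V \<times> fst X ==>
     snd Y (g (fst ((p, 0) + k)) (snd ((p, 0) + k)) - g p 0 - G (p, 0) [k]) \<le> e * snd ?Q k"
    using G(1) p0 e unfolding has_mderiv_def by (force simp del: length_0_conv)
   define t where "t = d / 2 / (snd X h + 1)"
   have t: "t > 0" using d nh by (simp add: t_def)
   have "t * snd X h \<le> t * (snd X h + 1)" using t by simp
   also have "\<dots> = d / 2" unfolding t_def using add_nonneg_pos[OF nh zero_less_one] by (metis less_irrefl nonzero_eq_divide_eq)
   also have "\<dots> < d" using d by simp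
   finally have td: "t * snd X h < d" .
   let ?k = "(0, t *\<^sub>R h)"
   have kQ: "?k \<in> fst ?Q" using nspace_mem[OF P] nspace_mem[OF X] h by auto
   have nk: "snd ?Q ?k = t * snd X h" using nspaceD(5)[OF X h] t by (simp add: nspace_norm0[OF P])
   have g0: "g p 0 = 0" using lin[OF p h, of 0] by simp
   have "G (p, 0) [t *\<^sub>R (0, h)] = t *\<^sub>R G (p, 0) [(0, h)]"
    by (rule bml_scale[OF Q G0]) (use h nspace_mem[OF P] in auto)
   then have "t *\<^sub>R ?u = g (fst ((p, 0) + ?k)) (snd ((p, 0) + ?k)) - g p 0 - G (p, 0) [?k]"
    using lin[OF p h, of t] g0 by (simp add: algebra_simps)
   then have "t * snd Y ?u = snd Y (g (fst ((p, 0) + ?k)) (snd ((p, 0) + ?k)) - g p 0 - G (p, 0) [?k])"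
    using nspaceD(5)[OF Y uY, of t] t by simp
   also have "\<dots> \<le> e * snd ?Q ?k" by (rule d(2)[OF kQ]) (use nk td p nspace_mem[OF X] h in auto)
   also have "\<dots> = t * (e * snd X h)" using nk by simp
   finally show ?thesis using t by simp
  qed
  have "snd Y ?u \<le> 0"
  proof (rule field_le_epsilon)
   fix e :: real assume e: "e > 0"
   have "snd Y ?u \<le> e / (snd X h + 1) * snd X h" using le[of "e / (snd X h + 1)"] e nh by simp
   also have "\<dots> \<le> e" using e nh by (simp add: field_simps)
   finally show "snd Y ?u \<le> 0 + e" by simp
  qed
  then have "?u = 0" using nspaceD(2)[OF Y uY] nspaceD(3)[OF Y uY] by simp
  then show ?thesis by simp
 qed
 have f: "cdiff X ?Q U n 0 (%x vs. (\<gamma> x, 0))"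
  using smooth_const[OF X X nspace_mem(1)[OF X]] by (intro cdiff_pair[OF X P X \<gamma>(1)]) (auto simp: smooth_def)
 have A: "cdiff X ?Q U n (Suc 0) (%x vs. (0, hd vs))"
  by (rule cdiff_const[OF X Q bml_hd[OF nlinear_Pair2[OF P X]]])
 have main: "cdiff X Y U n 1 (plug 1 G (%x. (\<gamma> x, 0)) (%_. [0]) (%_ x vs. (0, hd vs)))"
 proof (rule cdiff_plug[OF X Q Y _ _ _ f])
  show "(%x. (\<gamma> x, 0)) ` U \<subseteq> V \<times> fst X" using \<gamma>(2) nspace_mem(1)[OF X] by auto
  show "blocks 1 1 (%_. [0])" by (auto simp: blocks_def)
  show "cdiff ?Q Y (V \<times> fst X) n 1 G" using G(2) unfolding One_nat_def .
  show "cdiff X ?Q U n (length [0]) (%x vs. (0, hd vs))" using A by (simp del: cdiff.simps)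
 qed
 have "g (\<gamma> x) (hd vs) = plug 1 G (%x. (\<gamma> x, 0)) (%_. [0]) (%_ x vs. (0, hd vs)) x vs"
  if x: "x \<in> U" and vs: "args X 1 vs" for x vs
 proof -
  obtain h where h: "vs = [h]" "h \<in> fst X" using vs by (cases vs) auto
  have gx: "\<gamma> x \<in> V" using \<gamma>(2) x by blast
  show ?thesis unfolding plug_def pick_def h using key[OF gx h(2)] by simp
 qed
 from cdiff_cong[OF X this main] show ?thesis .
qed

text \<open>A function whose derivative is a smooth expression in the function itself is smooth.\<close>

theorem smooth_bootstrap:
 assumes X: "nspace X" and P: "nspace P" and Y: "nspace Y" and V: "nopen P V"
  and g: "smooth (P \<otimes>\<^sub>n X) Y (V \<times> fst X) (%z. g (fst z) (snd z))"
  and lin: "!!p h c. p \<in> V ==> h \<in> fst X ==> g p (c *\<^sub>R h) = c *\<^sub>R g p h"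
  and \<gamma>: "!!n. cdiff X Y U n 0 (%x vs. s x) ==> cdiff X P U n 0 (%x vs. \<gamma> x)" "\<gamma> ` U \<subseteq> V"
  and s: "s ` U \<subseteq> fst Y" "has_mderiv X Y U 0 (%x vs. s x) (%x vs. g (\<gamma> x) (hd vs))"
 shows "smooth X Y U s"
 unfolding smooth_def
proof
 fix n show "cdiff X Y U n 0 (%x vs. s x)"
 proof (induction n)
  case (Suc n)
  have "cdiff X Y U n 1 (%x vs. g (\<gamma> x) (hd vs))"
   by (rule cdiff_lin_family[OF X P Y V g lin \<gamma>(1)[OF Suc] \<gamma>(2)])
  then show ?case unfolding cdiff.simps(2) One_nat_def using s by (blast intro: bml_0)
 qed (use s in \<open>auto intro!: bml_0\<close>)
qed

section \<open>Isometry of separable Hilbert spaces\<close>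

text \<open>A Hilbert space given by a subspace of a real vector space and an inner product on it, together
 with countably many bounded functionals that separate its points.\<close>

locale hilbert_sub =
 fixes E :: "'a::real_vector set" and ip :: "'a => 'a => real"
 assumes sub: "subspace E"
  and comm: "x \<in> E ==> y \<in> E ==> ip x y = ip y x"
  and add: "x \<in> E ==> y \<in> E ==> z \<in> E ==> ip (x + y) z = ip x z + ip y z"
  and scale: "x \<in> E ==> z \<in> E ==> ip (c *\<^sub>R x) z = c * ip x z"
  and pos: "x \<in> E ==> 0 \<le> ip x x"
  and definite: "x \<in> E ==> ip x x = 0 ==> x = 0"
  and complete: "(\<forall>n. u n \<in> E) ==> (\<forall>e>0. \<exists>N. \<forall>m\<ge>N. \<forall>n\<ge>N. sqrt (ip (u m - u n) (u m - u n)) < e) ==>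
    \<exists>l\<in>E. (%n. sqrt (ip (u n - l) (u n - l))) \<longlonglongrightarrow> 0"
  and separating: "\<exists>\<phi> :: nat => 'a => real. (\<forall>n. (\<forall>x\<in>E. \<forall>y\<in>E. \<phi> n (x + y) = \<phi> n x + \<phi> n y) \<and>
    (\<forall>c. \<forall>x\<in>E. \<phi> n (c *\<^sub>R x) = c * \<phi> n x) \<and> (\<exists>C. \<forall>x\<in>E. \<bar>\<phi> n x\<bar> \<le> C * sqrt (ip x x))) \<and>
    (\<forall>x\<in>E. (\<forall>n. \<phi> n x = 0) --> x = 0)"
  and infinite_dim: "finite B ==> B \<subseteq> E ==> span B \<noteq> E"
begin

definition nm :: "'a => real" where "nm x = sqrt (ip x x)"

lemma mem: "0 \<in> E" "x \<in> E ==> y \<in> E ==> x + y \<in> E" "x \<in> E ==> y \<in> E ==> x - y \<in> E" "x \<in> E ==> c *\<^sub>R x \<in> E"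
 using sub subspace_0 subspace_add subspace_diff subspace_scale by blast+

lemma sum_mem: "(!!i. i \<in> A ==> f i \<in> E) ==> sum f A \<in> E"
 using sub by (rule subspace_sum)

lemma add2: "x \<in> E ==> y \<in> E ==> z \<in> E ==> ip z (x + y) = ip z x + ip z y"
 using add comm mem by metis

lemma scale2: "x \<in> E ==> z \<in> E ==> ip z (c *\<^sub>R x) = c * ip z x"
 using scale comm mem by metis

lemma diff1: "x \<in> E ==> y \<in> E ==> z \<in> E ==> ip (x - y) z = ip x z - ip y z"
 using add[of x "(-1) *\<^sub>R y" z] scale[of y z "-1"] mem(4)[of y "-1"] by simp

lemma diff2: "x \<in> E ==> y \<in> E ==> z \<in> E ==> ip z (x - y) = ip z x - ip z y"
 using diff1 comm mem by metis

lemma zero1: "z \<in> E ==> ip 0 z = 0"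
 using scale[of 0 z 0] mem(1) by simp

lemma sum1: "(!!i. i \<in> A ==> f i \<in> E) ==> z \<in> E ==> ip (sum f A) z = (\<Sum>i\<in>A. ip (f i) z)"
proof (induction A rule: infinite_finite_induct)
 case (insert a A)
 then show ?case using add[of "f a" "sum f A" z] sum_mem[of A f] by simp
qed (auto simp: zero1)

lemma nm_nonneg: "0 \<le> nm x" if "x \<in> E" using pos[OF that] by (simp add: nm_def)

lemma nm_square: "x \<in> E ==> (nm x)\<^sup>2 = ip x x" using pos by (simp add: nm_def)

lemma cauchy_schwarz: "x \<in> E ==> y \<in> E ==> \<bar>ip x y\<bar> \<le> nm x * nm y"
proof -
 assume x: "x \<in> E" and y: "y \<in> E"
 have q: "0 \<le> ip x x - 2 * t * ip x y + t\<^sup>2 * ip y y" for t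
  using pos[of "x - t *\<^sub>R y"] x y mem comm[OF x y]
  by (simp add: diff1 diff2 scale scale2 power2_eq_square algebra_simps)
 have "(ip x y)\<^sup>2 \<le> ip x x * ip y y"
 proof (cases "ip y y = 0")
  case True
  then have "y = 0" using definite y by simp
  then have "ip x y = 0" using zero1[OF x] comm[OF x y] by simp
  then show ?thesis using True by simp
 next
  case False
  then have "ip y y > 0" using pos[OF y] by simp
  then show ?thesis using q[of "ip x y / ip y y"] by (simp add: field_simps power2_eq_square)
 qed
 then have "(ip x y)\<^sup>2 \<le> (nm x * nm y)\<^sup>2" using x y by (simp add: power_mult_distrib nm_square)
 then show ?thesis using nm_nonneg[OF x] nm_nonneg[OF y] by (simp add: abs_le_square_iff[symmetric] abs_mult)
qed

lemma nm_triangle: "x \<in> E ==> y \<in> E ==> nm (x + y) \<le> nm x + nm y"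
proof (rule power2_le_imp_le)
 assume x: "x \<in> E" and y: "y \<in> E"
 have "(nm (x + y))\<^sup>2 = ip x x + 2 * ip x y + ip y y"
  using x y mem comm[OF x y] by (simp add: nm_square add add2)
 also have "\<dots> \<le> (nm x)\<^sup>2 + 2 * (nm x * nm y) + (nm y)\<^sup>2"
  using cauchy_schwarz[OF x y] x y by (simp add: nm_square)
 finally show "(nm (x + y))\<^sup>2 \<le> (nm x + nm y)\<^sup>2" by (simp add: power2_eq_square algebra_simps)
 show "0 \<le> nm x + nm y" using nm_nonneg x y by simp
qed

definition orthonormal :: "'a set => bool" where
 "orthonormal T \<longleftrightarrow> T \<subseteq> E \<and> (\<forall>x\<in>T. ip x x = 1) \<and> (\<forall>x\<in>T. \<forall>y\<in>T. x \<noteq> y --> ip x y = 0)"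

lemma ex_maximal: "\<exists>T. orthonormal T \<and> (\<forall>x\<in>E. (\<forall>y\<in>T. ip x y = 0) --> x = 0)"
proof -
 have "\<exists>M\<in>{T. orthonormal T}. \<forall>T\<in>{T. orthonormal T}. M \<subseteq> T --> T = M"
 proof (rule subset_Zorn_nonempty)
  show "{T. orthonormal T} \<noteq> {}" by (auto simp: orthonormal_def intro!: exI[of _ "{}"])
  fix \<C> assume C: "\<C> \<noteq> {}" "subset.chain {T. orthonormal T} \<C>"
  then have o: "orthonormal T" if "T \<in> \<C>" for T using that by (auto simp: subset.chain_def)
  show "\<Union>\<C> \<in> {T. orthonormal T}"
   unfolding mem_Collect_eq orthonormal_def
  proof (intro conjI ballI impI)
   fix x y assume "x \<in> \<Union>\<C>" "y \<in> \<Union>\<C>" "x \<noteq> y"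
   then obtain A B where AB: "A \<in> \<C>" "B \<in> \<C>" "x \<in> A" "y \<in> B" by blast
   then have "A \<subseteq> B \<or> B \<subseteq> A" using C(2) by (auto simp: subset.chain_def)
   then obtain D where "D \<in> \<C>" "x \<in> D" "y \<in> D" using AB by blast
   then show "ip x y = 0" using o[of D] \<open>x \<noteq> y\<close> unfolding orthonormal_def by simp
  next
   have "D \<subseteq> E" if "D \<in> \<C>" for D using o[OF that] unfolding orthonormal_def by (rule conjunct1)
   then show "\<Union>\<C> \<subseteq> E" by (rule Union_least)
  next
   fix x assume "x \<in> \<Union>\<C>"
   then obtain D where "D \<in> \<C>" "x \<in> D" by blast
   then show "ip x x = 1" using o[of D] unfolding orthonormal_def by simp
  qed
 qed
 then obtain T where T: "orthonormal T" "!!T'. orthonormal T' ==> T \<subseteq> T' ==> T' = T" by blast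
 have "x = 0" if x: "x \<in> E" "\<forall>y\<in>T. ip x y = 0" for x
 proof (rule ccontr)
  assume "x \<noteq> 0"
  then have p: "ip x x > 0" using pos[OF x(1)] definite[OF x(1)] by force
  let ?x = "(1 / nm x) *\<^sub>R x"
  have n: "nm x > 0" using p by (simp add: nm_def)
  have xE: "?x \<in> E" using mem x by auto
  have 1: "ip ?x ?x = 1" using n p x mem nm_square[OF x(1)] by (simp add: scale scale2 power2_eq_square field_simps)
  have 0: "ip ?x y = 0" "ip y ?x = 0" if "y \<in> T" for y
  proof -
   have yE: "y \<in> E" using T(1) that by (auto simp: orthonormal_def)
   then show "ip ?x y = 0" using x that by (simp add: scale)
   then show "ip y ?x = 0" using comm[OF xE yE] by simp
  qed
  have "orthonormal (insert ?x T)" using T(1) xE 1 0 unfolding orthonormal_def by auto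
  then have "?x \<in> T" using T(2)[of "insert ?x T"] by blast
  then show False using 0[of ?x] 1 by simp
 qed
 then show ?thesis using T(1) by blast
qed

lemma orthonormal_sum:
 assumes T: "orthonormal T" and A: "finite A" "A \<subseteq> T" and y: "y \<in> T"
 shows "ip (\<Sum>x\<in>A. c x *\<^sub>R x) y = (if y \<in> A then c y else 0)"
proof -
 have E: "T \<subseteq> E" using T by (simp add: orthonormal_def)
 have "ip (\<Sum>x\<in>A. c x *\<^sub>R x) y = (\<Sum>x\<in>A. ip (c x *\<^sub>R x) y)"
  using A E y by (intro sum1 mem) auto
 also have "\<dots> = (\<Sum>x\<in>A. if x = y then c y else 0)"
  using T A y E by (intro sum.cong) (auto simp: scale orthonormal_def subset_iff)
 finally show ?thesis using A by simp
qed

lemma orthonormal_sum_norm: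
 assumes T: "orthonormal T" and A: "finite A" "A \<subseteq> T"
 shows "ip (\<Sum>x\<in>A. c x *\<^sub>R x) (\<Sum>x\<in>A. c x *\<^sub>R x) = (\<Sum>x\<in>A. (c x)\<^sup>2)"
proof -
 have E: "T \<subseteq> E" using T by (simp add: orthonormal_def)
 have sE: "(\<Sum>x\<in>A. c x *\<^sub>R x) \<in> E" using A E by (intro sum_mem mem) auto
 have "ip (\<Sum>x\<in>A. c x *\<^sub>R x) (\<Sum>x\<in>A. c x *\<^sub>R x) = (\<Sum>y\<in>A. ip (c y *\<^sub>R y) (\<Sum>x\<in>A. c x *\<^sub>R x))"
  using A E sE by (intro sum1 mem) auto
 also have "\<dots> = (\<Sum>y\<in>A. (c y)\<^sup>2)"
 proof (rule sum.cong)
  fix y assume y: "y \<in> A"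
  then have yE: "y \<in> E" "y \<in> T" using A E by auto
  have "ip y (\<Sum>x\<in>A. c x *\<^sub>R x) = c y" using comm[OF yE(1) sE] orthonormal_sum[OF T A yE(2), of c] y by simp
  then show "ip (c y *\<^sub>R y) (\<Sum>x\<in>A. c x *\<^sub>R x) = (c y)\<^sup>2" using scale[OF yE(1) sE] by (simp add: power2_eq_square)
 qed simp
 finally show ?thesis .
qed

text \<open>A maximal orthonormal set is infinite, since otherwise it would span the space. It is
  countable because each of the countably many separating functionals exceeds 1/(k+1) in absolute
  value on finitely many of its members only, by the Bessel argument, and each member is nonzero for
  some functional.\<close>

lemma ex_basis: "\<exists>e :: nat => 'a. (\<forall>n. e n \<in> E) \<and> (\<forall>m n. ip (e m) (e n) = (if m = n then 1 else 0)) \<and>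
  (\<forall>x\<in>E. (\<forall>n. ip x (e n) = 0) --> x = 0)"
proof -
 obtain T where T: "orthonormal T" and tot: "!!x. x \<in> E ==> (\<forall>y\<in>T. ip x y = 0) ==> x = 0" using ex_maximal by blast
 have TE: "T \<subseteq> E" using T by (simp add: orthonormal_def)
 have infT: "infinite T"
 proof
  assume fin: "finite T"
  have "x \<in> span T" if x: "x \<in> E" for x
  proof -
   let ?s = "\<Sum>y\<in>T. ip x y *\<^sub>R y"
   have sE: "?s \<in> E" using TE by (intro sum_mem mem) auto
   have "x - ?s = 0"
   proof (rule tot)
    show "x - ?s \<in> E" using mem x sE by auto
    show "\<forall>y\<in>T. ip (x - ?s) y = 0"
     using TE x sE orthonormal_sum[OF T fin order_refl] by (auto simp: diff1 subset_iff)
   qed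
   then have "x = ?s" by simp
   moreover have "?s \<in> span T" by (intro span_sum span_scale span_base)
   ultimately show ?thesis by simp
  qed
  moreover have "span T \<subseteq> E" using TE sub by (rule span_minimal)
  ultimately show False using infinite_dim[OF fin TE] by blast
 qed
 have cT: "countable T"
 proof -
  obtain \<phi> :: "nat => 'a => real" where \<phi>: "!!n x y. x \<in> E ==> y \<in> E ==> \<phi> n (x + y) = \<phi> n x + \<phi> n y"
   "!!n c x. x \<in> E ==> \<phi> n (c *\<^sub>R x) = c * \<phi> n x" "!!n. \<exists>C. \<forall>x\<in>E. \<bar>\<phi> n x\<bar> \<le> C * sqrt (ip x x)"
   "!!x. x \<in> E ==> (\<forall>n. \<phi> n x = 0) ==> x = 0" using separating by metis
  have cnt: "finite {x \<in> T. \<bar>\<phi> n x\<bar> \<ge> 1 / Suc k}" for n k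
  proof (rule ccontr)
   assume inf: "infinite {x \<in> T. \<bar>\<phi> n x\<bar> \<ge> 1 / Suc k}"
   obtain C where C: "!!x. x \<in> E ==> \<bar>\<phi> n x\<bar> \<le> C * sqrt (ip x x)" using \<phi>(3) by blast
   \<comment> \<open>At most C^2 (k+1)^2 members of an orthonormal set can have a value of this size
     under a functional of bound C; \<open>m\<close> exceeds that number.\<close>
   define m where "m = Suc (nat \<lceil>C\<^sup>2 * (real (Suc k))\<^sup>2\<rceil>)"
   obtain A where A: "finite A" "card A = m" "A \<subseteq> {x \<in> T. \<bar>\<phi> n x\<bar> \<ge> 1 / Suc k}"
    using infinite_arbitrarily_large[OF inf] by blast
   then have AT: "A \<subseteq> T" by auto
   let ?s = "\<Sum>x\<in>A. \<phi> n x *\<^sub>R x" let ?q = "\<Sum>x\<in>A. (\<phi> n x)\<^sup>2"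
   have sE: "?s \<in> E" using AT TE by (intro sum_mem mem) auto
   have z: "\<phi> n 0 = 0" using \<phi>(2)[OF mem(1), of n 0] by simp
   have lin: "\<phi> n (sum f B) = (\<Sum>i\<in>B. \<phi> n (f i))" if "!!i. i \<in> B ==> f i \<in> E" for f :: "'a => 'a" and B
    using that by (induction B rule: infinite_finite_induct) (auto simp: z \<phi>(1) sum_mem)
   have "\<phi> n ?s = (\<Sum>x\<in>A. \<phi> n (\<phi> n x *\<^sub>R x))" by (rule lin, rule mem(4)) (use AT TE in blast)
   also have "\<dots> = ?q" using AT TE by (intro sum.cong) (auto simp: \<phi>(2) power2_eq_square subset_iff)
   finally have "?q \<le> C * sqrt ?q" using C[OF sE] orthonormal_sum_norm[OF T A(1) AT, of "\<phi> n"] by simp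
   moreover have lo: "real m * (1 / Suc k)\<^sup>2 \<le> ?q"
   proof -
    have "(\<Sum>x\<in>A. (1 / real (Suc k))\<^sup>2) \<le> ?q"
    proof (rule sum_mono)
     fix x assume "x \<in> A"
     then have "\<bar>1 / real (Suc k)\<bar> \<le> \<bar>\<phi> n x\<bar>" using A(3) by auto
     then show "(1 / real (Suc k))\<^sup>2 \<le> (\<phi> n x)\<^sup>2" by (simp only: abs_le_square_iff)
    qed
    then show ?thesis using A(2) by simp
   qed
   moreover have q0: "?q > 0"
   proof -
    have "0 < real m" unfolding m_def by (simp only: of_nat_0_less_iff zero_less_Suc)
    then have "0 < real m * (1 / Suc k)\<^sup>2" by (intro mult_pos_pos) auto
    then show ?thesis using lo by linarith
   qed
   ultimately have "sqrt ?q * sqrt ?q \<le> C * sqrt ?q" by simp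
   moreover have "sqrt ?q > 0" using q0 by (rule real_sqrt_gt_zero)
   ultimately have "sqrt ?q \<le> C" by (rule mult_right_le_imp_le)
   then have "?q \<le> C\<^sup>2" using q0 by (metis less_imp_le power_mono real_sqrt_ge_zero real_sqrt_pow2)
   then have "real m * (1 / Suc k)\<^sup>2 \<le> C\<^sup>2" using lo by linarith
   moreover have "real m \<le> C\<^sup>2 * s\<^sup>2" if "s > 0" "real m * (1 / s)\<^sup>2 \<le> C\<^sup>2" for s :: real
    using that by (simp add: power_divide pos_divide_le_eq)
   ultimately have "real m \<le> C\<^sup>2 * (real (Suc k))\<^sup>2" by (metis of_nat_0_less_iff zero_less_Suc)
   moreover have "C\<^sup>2 * (real (Suc k))\<^sup>2 < real m"
    unfolding m_def using of_nat_ceiling[of "C\<^sup>2 * (real (Suc k))\<^sup>2"] by linarith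
   ultimately show False by simp
  qed
  have "T \<subseteq> (\<Union>n. \<Union>k. {x \<in> T. \<bar>\<phi> n x\<bar> \<ge> 1 / Suc k})"
  proof
   fix x assume x: "x \<in> T"
   then have "x \<in> E" "x \<noteq> 0" using T TE zero1[OF mem(1)] unfolding orthonormal_def by force+
   then obtain n where n: "\<phi> n x \<noteq> 0" using \<phi>(4) by blast
   then obtain k where "1 / Suc k < \<bar>\<phi> n x\<bar>" using nat_approx_posE[of "\<bar>\<phi> n x\<bar>"] by auto
   then show "x \<in> (\<Union>n. \<Union>k. {x \<in> T. \<bar>\<phi> n x\<bar> \<ge> 1 / Suc k})" using x by (auto intro: less_imp_le)
  qed
  then show ?thesis by (rule countable_subset) (intro countable_UN countable_finite cnt countableI_type)
 qed
 obtain b :: "'a => nat" where "bij_betw b T UNIV" using countableE_infinite[OF cT infT] by blast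
 then have "bij_betw (inv_into T b) UNIV T" by (rule bij_betw_inv_into)
 then obtain e :: "nat => 'a" where e: "bij_betw e UNIV T" by blast
 then have eT: "e n \<in> T" for n by (auto simp: bij_betw_def)
 have "e m = e n \<longleftrightarrow> m = n" for m n using e by (auto simp: bij_betw_def inj_on_def)
 then have "ip (e m) (e n) = (if m = n then 1 else 0)" for m n using T eT[of m] eT[of n] unfolding orthonormal_def by metis
 moreover have "x = 0" if "x \<in> E" "\<forall>n. ip x (e n) = 0" for x
  using tot[OF that(1)] that(2) e unfolding bij_betw_def by (metis imageE)
 ultimately show ?thesis using eT TE by blast
qed

end

text \<open>\<open>\<Sum> c n e n\<close> converges iff \<open>c\<close> is square-summable.\<close>

locale hilbert_basis = hilbert_sub +
 fixes e :: "nat => 'a"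
 assumes eE: "e n \<in> E" and on: "ip (e m) (e n) = (if m = n then 1 else 0)"
  and total: "x \<in> E ==> (\<forall>n. ip x (e n) = 0) ==> x = 0"
begin

definition psum :: "(nat => real) => nat set => 'a" where "psum c A = (\<Sum>n\<in>A. c n *\<^sub>R e n)"

lemma psum_mem: "psum c A \<in> E"
 unfolding psum_def by (intro sum_mem mem eE)

lemma psum_ip: "finite A ==> ip (psum c A) (e k) = (if k \<in> A then c k else 0)"
proof -
 assume A: "finite A"
 have "ip (psum c A) (e k) = (\<Sum>n\<in>A. ip (c n *\<^sub>R e n) (e k))"
  unfolding psum_def by (intro sum1 mem eE)
 also have "\<dots> = (\<Sum>n\<in>A. if n = k then c k else 0)" by (intro sum.cong) (auto simp: scale eE on)
 finally show ?thesis using A by simp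
qed

lemma psum_ip2: "finite A ==> x \<in> E ==> ip (psum c A) x = (\<Sum>n\<in>A. c n * ip x (e n))"
proof -
 assume "finite A" and x: "x \<in> E"
 have "ip (psum c A) x = (\<Sum>n\<in>A. ip (c n *\<^sub>R e n) x)" unfolding psum_def by (intro sum1 mem eE x)
 then show ?thesis by (simp add: scale eE x comm[OF eE x])
qed

lemma psum_norm: "finite A ==> ip (psum c A) (psum c A) = (\<Sum>n\<in>A. (c n)\<^sup>2)"
 by (simp add: psum_ip2 psum_mem psum_ip power2_eq_square)

lemma bessel: "x \<in> E ==> summable (%n. (ip x (e n))\<^sup>2)"
proof -
 assume x: "x \<in> E"
 have le: "(\<Sum>n<N. (ip x (e n))\<^sup>2) \<le> ip x x" for N
 proof -
  let ?c = "%n. ip x (e n)"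
  have "0 \<le> ip (x - psum ?c {..<N}) (x - psum ?c {..<N})" using mem x psum_mem by (intro pos) auto
  also have "\<dots> = ip x x - ip (psum ?c {..<N}) x"
   using x psum_mem[of ?c "{..<N}"] psum_ip2[of "{..<N}" x ?c] psum_norm[of "{..<N}" ?c] comm[OF x psum_mem[of ?c "{..<N}"]] mem
   by (simp add: diff1 diff2 power2_eq_square)
  finally show ?thesis using psum_ip2[of "{..<N}" x ?c] x by (simp add: power2_eq_square)
 qed
 show ?thesis by (rule bounded_imp_summable[where B = "ip x x"]) (use le in \<open>auto simp: lessThan_Suc_atMost[symmetric] simp del: sum.lessThan_Suc\<close>)
qed

text \<open>The partial sums form a Cauchy sequence; by the Cauchy-Schwarz inequality coefficients
  and norm pass to the limit.\<close>

lemma riesz_fischer: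
 assumes c: "summable (%n. (c n)\<^sup>2)"
 shows "\<exists>x\<in>E. (\<forall>n. ip x (e n) = c n) \<and> ip x x = (\<Sum>n. (c n)\<^sup>2)"
proof -
 let ?u = "%N. psum c {..<N}"
 have diff: "ip (?u m - ?u n) (?u m - ?u n) = (\<Sum>k\<in>{n..<m}. (c k)\<^sup>2)" if "n \<le> m" for m n
 proof -
  have "?u m - ?u n = psum c {n..<m}"
   unfolding psum_def using that by (simp add: sum_diff_nat_ivl lessThan_atLeast0)
  then show ?thesis using psum_norm[of "{n..<m}" c] by simp
 qed
 have symm: "ip (?u m - ?u n) (?u m - ?u n) = ip (?u n - ?u m) (?u n - ?u m)" for m n
  using psum_mem mem by (simp add: diff1 diff2)
 have "\<exists>l\<in>E. (%n. sqrt (ip (?u n - l) (?u n - l))) \<longlonglongrightarrow> 0"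
 proof (rule complete)
  show "\<forall>e>0. \<exists>N. \<forall>m\<ge>N. \<forall>n\<ge>N. sqrt (ip (?u m - ?u n) (?u m - ?u n)) < e"
  proof (intro allI impI)
   fix \<epsilon> :: real assume ep: "\<epsilon> > 0"
   obtain N where N: "!!m n. m \<ge> N ==> norm (\<Sum>k\<in>{m..<n}. (c k)\<^sup>2) < \<epsilon>\<^sup>2"
    using c ep unfolding summable_Cauchy by (metis zero_less_power)
   have "sqrt (ip (?u m - ?u n) (?u m - ?u n)) < \<epsilon>" if "m \<ge> N" "n \<ge> N" for m n
   proof -
    have "ip (?u m - ?u n) (?u m - ?u n) < \<epsilon>\<^sup>2"
    proof (cases "n \<le> m")
     case True then show ?thesis using diff[OF True] N[OF that(2), of m] by simp
    next
     case False then show ?thesis using diff[of m n] symm[of m n] N[OF that(1), of n] by simp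
    qed
    then show ?thesis using ep by (metis abs_of_pos real_sqrt_abs real_sqrt_less_mono)
   qed
   then show "\<exists>N. \<forall>m\<ge>N. \<forall>n\<ge>N. sqrt (ip (?u m - ?u n) (?u m - ?u n)) < \<epsilon>" by blast
  qed
 qed (simp add: psum_mem)
 then obtain l where l: "l \<in> E" and lim: "(%n. nm (?u n - l)) \<longlonglongrightarrow> 0" unfolding nm_def by blast
 have lc: "ip l (e k) = c k" for k
 proof -
  have "(%n. ip (?u n) (e k) - ip l (e k)) \<longlonglongrightarrow> 0"
  proof (rule tendsto_0_le[OF lim, where K = 1])
   show "\<forall>\<^sub>F n in sequentially. norm (ip (?u n) (e k) - ip l (e k)) \<le> norm (nm (?u n - l)) * 1"
   proof (intro always_eventually allI)
    fix n
    have "\<bar>ip (?u n - l) (e k)\<bar> \<le> nm (?u n - l) * nm (e k)" using mem psum_mem l eE by (intro cauchy_schwarz) auto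
    then show "norm (ip (?u n) (e k) - ip l (e k)) \<le> norm (nm (?u n - l)) * 1"
     using diff1[OF psum_mem l eE] by (simp add: nm_def on)
   qed
  qed
  moreover have "\<forall>\<^sub>F n in sequentially. ip (?u n) (e k) - ip l (e k) = c k - ip l (e k)"
   unfolding eventually_sequentially by (intro exI[of _ "Suc k"]) (auto simp: psum_ip)
  ultimately have "(%n. c k - ip l (e k)) \<longlonglongrightarrow> 0" by (rule Lim_transform_eventually)
  then show ?thesis by (simp add: LIMSEQ_const_iff)
 qed
 have "(%n. (\<Sum>k<n. (c k)\<^sup>2)) \<longlonglongrightarrow> ip l l"
 proof -
  have "(%n. nm (?u n - l) * nm l) \<longlonglongrightarrow> 0 * nm l" by (intro tendsto_intros lim)
  then have *: "(%n. nm (?u n - l) * nm l) \<longlonglongrightarrow> 0" by simp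
  have "(%n. ip (?u n) l - ip l l) \<longlonglongrightarrow> 0"
  proof (rule tendsto_0_le[OF *, where K = 1])
   show "\<forall>\<^sub>F n in sequentially. norm (ip (?u n) l - ip l l) \<le> norm (nm (?u n - l) * nm l) * 1"
   proof (intro always_eventually allI)
    fix n
    have "\<bar>ip (?u n - l) l\<bar> \<le> nm (?u n - l) * nm l" using mem psum_mem l by (intro cauchy_schwarz) auto
    then show "norm (ip (?u n) l - ip l l) \<le> norm (nm (?u n - l) * nm l) * 1"
     using diff1[OF psum_mem l l] by simp
   qed
  qed
  then have "(%n. ip (?u n) l) \<longlonglongrightarrow> ip l l" by (simp add: LIM_zero_iff)
  moreover have "ip (?u n) l = (\<Sum>k<n. (c k)\<^sup>2)" for n
   using psum_ip2[of "{..<n}" l c] l lc by (simp add: power2_eq_square)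
  ultimately show ?thesis by simp
 qed
 then have "ip l l = (\<Sum>n. (c n)\<^sup>2)" using sums_unique[of "%n. (c n)\<^sup>2" "ip l l"] by (simp add: sums_def)
 then show ?thesis using l lc by blast
qed

lemma coords_eq: "x \<in> E ==> y \<in> E ==> (\<forall>n. ip x (e n) = ip y (e n)) ==> x = y"
 using total[of "x - y"] mem eE by (simp add: diff1)

text \<open>The element that Riesz-Fischer attaches to the coefficients of \<open>x\<close> has the
  asserted norm, and it equals \<open>x\<close> by totality.\<close>

lemma parseval: "x \<in> E ==> ip x x = (\<Sum>n. (ip x (e n))\<^sup>2)"
proof -
 assume x: "x \<in> E"
 obtain y where y: "y \<in> E" "\<forall>n. ip y (e n) = ip x (e n)" "ip y y = (\<Sum>n. (ip x (e n))\<^sup>2)"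
  using riesz_fischer[OF bessel[OF x]] by blast
 have "y = x" by (rule coords_eq[OF y(1) x]) (use y in simp)
 then show ?thesis using y by simp
qed

end

text \<open>Elements with the same coordinates with respect to two bases are matched; both spaces
  carry exactly the square-summable sequences.\<close>

theorem hilbert_isometry:
 assumes "hilbert_sub E ip" "hilbert_sub E' ip'"
 shows "\<exists>f. bij_betw f E E' \<and> (\<forall>x\<in>E. \<forall>y\<in>E. f (x + y) = f x + f y) \<and> (\<forall>c. \<forall>x\<in>E. f (c *\<^sub>R x) = c *\<^sub>R f x) \<and>
   (\<forall>x\<in>E. ip' (f x) (f x) = ip x x)"
proof -
 obtain e where e: "hilbert_basis E ip e"
  using hilbert_sub.ex_basis[OF assms(1)] assms(1) unfolding hilbert_basis_def hilbert_basis_axioms_def by blast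
 obtain e' where e': "hilbert_basis E' ip' e'"
  using hilbert_sub.ex_basis[OF assms(2)] assms(2) unfolding hilbert_basis_def hilbert_basis_axioms_def by blast
 interpret A: hilbert_basis E ip e by (rule e)
 interpret B: hilbert_basis E' ip' e' by (rule e')
 have "\<forall>x\<in>E. \<exists>y\<in>E'. \<forall>n. ip' y (e' n) = ip x (e n)"
  using B.riesz_fischer[OF A.bessel] by blast
 then obtain f where f: "!!x. x \<in> E ==> f x \<in> E'" "!!x n. x \<in> E ==> ip' (f x) (e' n) = ip x (e n)" by metis
 have "\<forall>y\<in>E'. \<exists>x\<in>E. \<forall>n. ip x (e n) = ip' y (e' n)"
  using A.riesz_fischer[OF B.bessel] by blast
 then obtain g where g: "!!y. y \<in> E' ==> g y \<in> E" "!!y n. y \<in> E' ==> ip (g y) (e n) = ip' y (e' n)" by metis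
 have "bij_betw f E E'"
 proof (rule bij_betw_byWitness[where f' = g])
  show "\<forall>x\<in>E. g (f x) = x" using f g by (auto intro: A.coords_eq)
  show "\<forall>y\<in>E'. f (g y) = y" using f g by (auto intro: B.coords_eq)
 qed (use f g in auto)
 moreover have "f (x + y) = f x + f y" if "x \<in> E" "y \<in> E" for x y
  using that f A.mem B.mem by (intro B.coords_eq) (auto simp: A.add B.add A.eE B.eE)
 moreover have "f (c *\<^sub>R x) = c *\<^sub>R f x" if "x \<in> E" for c x
  using that f A.mem B.mem by (intro B.coords_eq) (auto simp: A.scale B.scale A.eE B.eE)
 moreover have "ip' (f x) (f x) = ip x x" if "x \<in> E" for x
  using that f by (simp add: A.parseval B.parseval)
 ultimately show ?thesis by blast
qed

section \<open>Square-integrable classes and their primitives\<close>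

abbreviation TT :: real where "TT \<equiv> 2 * pi"

lemma ltwo_quot: "Quotient3 ltwo_rel abs_ltwo rep_ltwo"
 by (rule Quotient3_ltwo)

lemma abs_rep: "abs_ltwo (rep_ltwo u) = u"
 using Quotient3_abs_rep[OF ltwo_quot] .

lemma sq_rep: "square_int (rep_ltwo u)"
 using Quotient3_rep_reflp[OF ltwo_quot, of u] by (simp add: ltwo_rel_def)

lemma abs_eq_iff: "square_int f ==> square_int g ==> abs_ltwo f = abs_ltwo g \<longleftrightarrow> (AE x in leb_int. f x = g x)"
 using Quotient3_rel[OF ltwo_quot, of f g] by (auto simp: ltwo_rel_def)

lemma rep_abs: "square_int f ==> AE x in leb_int. rep_ltwo (abs_ltwo f) x = f x"
 using abs_eq_iff[OF sq_rep, of f "abs_ltwo f"] abs_rep by simp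

lemma abs_add: "square_int f ==> square_int g ==> abs_ltwo f + abs_ltwo g = abs_ltwo (%x. f x + g x)"
 by (rule plus_ltwo.abs_eq) (auto simp: ltwo_rel_def eq_onp_def)

lemma abs_scale: "square_int f ==> c *\<^sub>R abs_ltwo f = abs_ltwo (%x. c * f x)"
 by (rule scaleR_ltwo.abs_eq) (auto simp: ltwo_rel_def eq_onp_def)

lemma abs_inner: "square_int f ==> square_int g ==> abs_ltwo f \<bullet> abs_ltwo g = integral\<^sup>L leb_int (%x. f x * g x)"
 by (rule inner_ltwo.abs_eq) (auto simp: ltwo_rel_def eq_onp_def)

lemma rep_add: "AE x in leb_int. rep_ltwo (u + v) x = rep_ltwo u x + rep_ltwo v x"
 using rep_abs[OF square_int_add[OF sq_rep sq_rep], of u v] abs_add[OF sq_rep sq_rep, of u v] by (simp add: abs_rep)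

lemma rep_scale: "AE x in leb_int. rep_ltwo (c *\<^sub>R u) x = c * rep_ltwo u x"
 using rep_abs[OF square_int_scale[OF sq_rep], of c u] abs_scale[OF sq_rep, of c u] by (simp add: abs_rep)

lemma fin_leb: "finite_measure leb_int"
 by (intro finite_measureI) (simp add: emeasure_restrict_space)

lemma sq_const: "square_int (%x. c)"
 using fin_leb by (simp add: square_int_def finite_measure.integrable_const)

lemma sq_integrable: "square_int f ==> integrable leb_int f"
 using square_int_mult[OF _ sq_const[of 1]] by simp

lemma sq_abs: "square_int f ==> square_int (%x. \<bar>f x\<bar>)"
 by (auto simp: square_int_def)

lemma AE_negligible:
 assumes "AE x in leb_int. P x"
 shows "negligible {x \<in> {0..TT}. \<not> P x}"
proof -
 obtain N where N: "{x \<in> space leb_int. \<not> P x} \<subseteq> N" "emeasure leb_int N = 0" "N \<in> sets leb_int"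
  using AE_E[OF assms] by blast
 have "N \<subseteq> {0..TT}" "N \<in> sets lebesgue"
  using N(3) sets.sets_into_space[OF N(3)] by (auto simp: sets_restrict_space_iff)
 then have "emeasure lebesgue N = 0" using N(2) by (simp add: emeasure_restrict_space)
 then have "negligible N" using \<open>N \<in> sets lebesgue\<close> by (simp add: negligible_iff_null_sets null_sets_def)
 then show ?thesis by (rule negligible_subset) (use N(1) in auto)
qed

lemma negligible_AE: "negligible N ==> AE x in leb_int. x \<notin> N"
proof -
 assume "negligible N"
 then have "AE x in lebesgue. x \<notin> N" by (simp add: negligible_iff_null_sets AE_not_in)
 then show ?thesis by (simp add: AE_restrict_space_iff) (erule eventually_mono, simp)
qed

lemma lint: "integrable leb_int f ==> integral\<^sup>L leb_int f = integral {0..TT} f" for f :: "real => real"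
 by (rule lebesgue_integral_eq_integral) auto

lemma int_on: "integrable leb_int f ==> t \<le> TT ==> f integrable_on {0..t}" for f :: "real => real"
 by (rule integrable_on_subinterval[OF integrable_on_lebesgue_on[of "{0..TT}"]]) auto

lemma sq_int_on: "square_int f ==> t \<le> TT ==> f integrable_on {0..t}"
 using int_on sq_integrable by blast

lemma integral_AE:
 assumes "AE x in leb_int. f x = g x" "t \<le> TT"
 shows "integral {0..t} f = integral {0..t} (g :: real => real)"
 by (rule integral_spike[OF AE_negligible[OF assms(1)]]) (use assms(2) in auto)

text \<open>Continuous functions on the interval are represented by bounded continuous functions on
  the line that are extended constantly beyond the end points; this gives them a type with a
  complete norm. \<open>cl\<close> is the retraction used for the extension.\<close>

definition cl :: "real => real" where "cl t = max 0 (min TT t)"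

lemma cl_range [simp]: "0 \<le> cl t" "cl t \<le> TT" "cl t \<in> {0..TT}"
 by (auto simp: cl_def)

lemma cl_id: "t \<in> {0..TT} ==> cl t = t" by (auto simp: cl_def)

lemma cl_cl [simp]: "cl (cl t) = cl t" by (simp add: cl_def)

lemma cont_cl: "continuous_on UNIV cl" unfolding cl_def by (intro continuous_intros)

type_synonym cfun = "real \<Rightarrow>\<^sub>C real"

definition mk :: "(real => real) => cfun" where "mk f = Bcontfun (%t. f (cl t))"

lemma mk_apply: "continuous_on {0..TT} f ==> apply_bcontfun (mk f) t = f (cl t)"
proof -
 assume f: "continuous_on {0..TT} f"
 then have "bounded (f ` {0..TT})" by (intro compact_imp_bounded compact_continuous_image) auto
 then obtain b where b: "!!x. x \<in> {0..TT} ==> norm (f x) \<le> b" unfolding bounded_iff by blast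
 have "continuous_on UNIV (%t. f (cl t))"
  by (rule continuous_on_compose2[OF f cont_cl]) auto
 then have "(%t. f (cl t)) \<in> bcontfun" by (rule bcontfun_normI[where b = b]) (use b in auto)
 then show ?thesis unfolding mk_def by (simp add: Bcontfun_inverse)
qed

definition I :: "ltwo => cfun" where "I q = mk (%t. integral {0..t} (rep_ltwo q))"

lemma I_apply: "I q t = integral {0..cl t} (rep_ltwo q)"
 unfolding I_def by (subst mk_apply) (auto intro!: indefinite_integral_continuous_1 sq_int_on sq_rep)

lemma I_abs: "square_int f ==> I (abs_ltwo f) t = integral {0..cl t} f"
 unfolding I_apply by (rule integral_AE[OF rep_abs]) auto

lemma I_zero: "I q t = 0" if "t \<le> 0" using that by (simp add: I_apply cl_def)

lemma norm_abs_square: "square_int f ==> (norm (abs_ltwo f))\<^sup>2 = integral\<^sup>L leb_int (%x. (f x)\<^sup>2)"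
 unfolding power2_norm_eq_inner by (subst abs_inner) (simp_all add: power2_eq_square)

lemma norm_abs_le:
 assumes "square_int f" "square_int g" "AE x in leb_int. \<bar>f x\<bar> \<le> \<bar>g x\<bar>"
 shows "norm (abs_ltwo f) \<le> norm (abs_ltwo g)"
proof (rule power2_le_imp_le)
 have "AE x in leb_int. (f x)\<^sup>2 \<le> (g x)\<^sup>2" using assms(3) by (simp add: abs_le_square_iff)
 then show "(norm (abs_ltwo f))\<^sup>2 \<le> (norm (abs_ltwo g))\<^sup>2"
  unfolding norm_abs_square[OF assms(1)] norm_abs_square[OF assms(2)]
  using assms(1,2) by (intro integral_mono_AE) (auto simp: square_int_def)
qed simp

lemma norm_const: "norm (abs_ltwo (%x. c)) = sqrt TT * \<bar>c\<bar>"
proof -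
 have "measure leb_int (space leb_int) = TT" by (simp add: measure_restrict_space)
 then have "(norm (abs_ltwo (%x. c)))\<^sup>2 = TT * c\<^sup>2" using norm_abs_square[OF sq_const, of c] by simp
 then have "sqrt ((norm (abs_ltwo (%x. c)))\<^sup>2) = sqrt (TT * c\<^sup>2)" by (rule arg_cong)
 then show ?thesis by (simp add: real_sqrt_mult)
qed

lemma L1_le: "integral {0..TT} (%x. \<bar>rep_ltwo q x\<bar>) \<le> sqrt TT * norm q"
proof -
 have s: "square_int (%x. \<bar>rep_ltwo q x\<bar>)" by (rule sq_abs[OF sq_rep])
 have n: "norm (abs_ltwo (%x. \<bar>rep_ltwo q x\<bar>)) \<le> norm q"
  using norm_abs_le[OF s sq_rep, of q] by (simp add: abs_rep)
 have "integral {0..TT} (%x. \<bar>rep_ltwo q x\<bar>) = abs_ltwo (%x. \<bar>rep_ltwo q x\<bar>) \<bullet> abs_ltwo (%x. 1)"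
  using abs_inner[OF s sq_const[of 1]] lint[OF sq_integrable[OF s]] by simp
 also have "\<dots> \<le> norm (abs_ltwo (%x. \<bar>rep_ltwo q x\<bar>)) * norm (abs_ltwo (%x. 1))" by (rule norm_cauchy_schwarz)
 also have "\<dots> \<le> norm q * sqrt TT" using n by (intro mult_mono) (auto simp: norm_const)
 finally show ?thesis by (simp add: mult.commute)
qed

lemma I_bound: "\<bar>I q t\<bar> \<le> sqrt TT * norm q"
proof -
 have "\<bar>I q t\<bar> \<le> integral {0..cl t} (%x. \<bar>rep_ltwo q x\<bar>)"
  unfolding I_apply using integral_norm_bound_integral[of "rep_ltwo q" "{0..cl t}" "%x. \<bar>rep_ltwo q x\<bar>"]
   sq_int_on[OF sq_rep, of "cl t" q] sq_int_on[OF sq_abs[OF sq_rep], of "cl t" q] by simp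
 also have "\<dots> \<le> integral {0..TT} (%x. \<bar>rep_ltwo q x\<bar>)"
  by (rule integral_subset_le[OF _ sq_int_on[OF sq_abs[OF sq_rep]] sq_int_on[OF sq_abs[OF sq_rep]]]) auto
 finally show ?thesis using L1_le by (rule order_trans)
qed

lemma bounded_linear_I: "bounded_linear I"
proof (rule bounded_linear_intro[where K = "sqrt TT"])
 show "I (u + v) = I u + I v" for u v
 proof (rule bcontfun_eqI)
  fix t have "I (u + v) t = integral {0..cl t} (%x. rep_ltwo u x + rep_ltwo v x)"
   unfolding I_apply by (rule integral_AE[OF rep_add]) simp
  also have "\<dots> = (I u + I v) t"
   by (simp add: I_apply integral_add sq_int_on[OF sq_rep])
  finally show "I (u + v) t = (I u + I v) t" .
 qed
 show "I (c *\<^sub>R u) = c *\<^sub>R I u" for c u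
 proof (rule bcontfun_eqI)
  fix t have "I (c *\<^sub>R u) t = integral {0..cl t} (%x. c * rep_ltwo u x)"
   unfolding I_apply by (rule integral_AE[OF rep_scale]) simp
  then show "I (c *\<^sub>R u) t = (c *\<^sub>R I u) t"
   by (simp add: I_apply)
 qed
 show "norm (I u) \<le> norm u * sqrt TT" for u
  by (rule norm_bound) (use I_bound in \<open>auto simp: mult.commute\<close>)
qed

lemma cfun_meas: "continuous_on {0..TT} f ==> f \<in> borel_measurable leb_int" for f :: "real => real"
 by (rule continuous_imp_measurable_on_sets_lebesgue) auto

lemma sq_mult_bounded:
 assumes f: "square_int f" and g: "g \<in> borel_measurable leb_int" "!!x. x \<in> {0..TT} ==> \<bar>g x\<bar> \<le> b"
 shows "square_int (%x. f x * g x)" and "norm (abs_ltwo (%x. f x * g x)) \<le> norm (abs_ltwo f) * b"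
proof -
 have b: "0 \<le> b" using g(2)[of 0] by simp
 have le: "(f x * g x)\<^sup>2 \<le> (b * f x)\<^sup>2" if "x \<in> {0..TT}" for x
 proof -
  have "\<bar>g x\<bar> * \<bar>f x\<bar> \<le> b * \<bar>f x\<bar>" by (rule mult_right_mono[OF g(2)[OF that]]) simp
  then have "\<bar>f x * g x\<bar> \<le> \<bar>b * f x\<bar>" using b by (simp add: abs_mult mult.commute)
  then show ?thesis by (simp add: abs_le_square_iff)
 qed
 have bf: "square_int (%x. b * f x)" by (rule square_int_scale[OF f])
 have "integrable leb_int (%x. (f x * g x)\<^sup>2)"
 proof (rule Bochner_Integration.integrable_bound)
  show "integrable leb_int (%x. (b * f x)\<^sup>2)" using bf by (simp add: square_int_def)
  show "AE x in leb_int. norm ((f x * g x)\<^sup>2) \<le> norm ((b * f x)\<^sup>2)" using le by (intro AE_I2) simp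
 qed (use f g in \<open>auto simp: square_int_def\<close>)
 then show s: "square_int (%x. f x * g x)" using f g by (auto simp: square_int_def)
 have "norm (abs_ltwo (%x. f x * g x)) \<le> norm (abs_ltwo (%x. b * f x))"
  using le by (intro norm_abs_le[OF s bf] AE_I2) (simp add: abs_le_square_iff)
 also have "\<dots> = norm (abs_ltwo f) * b" using abs_scale[OF f, of b] b by (metis norm_scaleR abs_of_nonneg mult.commute)
 finally show "norm (abs_ltwo (%x. f x * g x)) \<le> norm (abs_ltwo f) * b" .
qed

lemma sq_cont: "continuous_on {0..TT} f ==> square_int f"
proof -
 assume f: "continuous_on {0..TT} f"
 then have "bounded (f ` {0..TT})" by (intro compact_imp_bounded compact_continuous_image) auto
 then obtain b where "\<forall>y\<in>f ` {0..TT}. norm y \<le> b" unfolding bounded_iff by blast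
 then have b: "!!x. x \<in> {0..TT} ==> \<bar>f x\<bar> \<le> b" by simp
 show ?thesis using sq_mult_bounded(1)[OF sq_const[of 1] cfun_meas[OF f] b] by simp
qed

lemma sq_cfun: "square_int (apply_bcontfun f)"
 by (rule sq_cont) simp

definition emb :: "cfun => ltwo" where "emb f = abs_ltwo (apply_bcontfun f)"

definition mulL :: "ltwo => cfun => ltwo" where "mulL q f = abs_ltwo (%x. rep_ltwo q x * f x)"

lemma mulL_sq: "square_int (%x. rep_ltwo q x * apply_bcontfun f x)"
 and mulL_norm: "norm (mulL q f) \<le> norm q * norm f"
 using sq_mult_bounded[OF sq_rep cfun_meas, of "apply_bcontfun f" "norm f" q] norm_bounded[of f]
 unfolding mulL_def abs_rep by simp_all

lemma mulL_abs: "square_int g ==> mulL (abs_ltwo g) f = abs_ltwo (%x. g x * f x)"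
proof -
 assume g: "square_int g"
 have "square_int (%x. g x * f x)"
  using sq_mult_bounded(1)[OF g cfun_meas, of "apply_bcontfun f" "norm f"] norm_bounded[of f] by simp
 then show ?thesis unfolding mulL_def using rep_abs[OF g] by (subst abs_eq_iff[OF mulL_sq]) (auto elim: AE_mp)
qed

lemma bounded_bilinear_mulL: "bounded_bilinear mulL"
proof (rule bounded_bilinear.intro)
 show "mulL (u + v) f = mulL u f + mulL v f" for u v f
  using mulL_abs[OF square_int_add[OF sq_rep[of u] sq_rep[of v]], of f] abs_add[OF sq_rep sq_rep, of u v]
   abs_add[OF mulL_sq mulL_sq, of u f v f] by (simp add: abs_rep mulL_def algebra_simps)
 show "mulL (c *\<^sub>R u) f = c *\<^sub>R mulL u f" for c u f
  using mulL_abs[OF square_int_scale[OF sq_rep[of u]], of c f] abs_scale[OF sq_rep, of c u]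
   abs_scale[OF mulL_sq, of c u f] by (simp add: abs_rep mulL_def algebra_simps)
 show "mulL u (f + g) = mulL u f + mulL u g" for u f g
  using abs_add[OF mulL_sq mulL_sq, of u f u g] by (simp add: mulL_def algebra_simps)
 show "mulL u (c *\<^sub>R f) = c *\<^sub>R mulL u f" for c u f
  using abs_scale[OF mulL_sq, of c u f] by (simp add: mulL_def algebra_simps)
 show "\<exists>K. \<forall>a b. norm (mulL a b) \<le> norm a * norm b * K"
  using mulL_norm by (intro exI[of _ 1]) simp
qed

lemma emb_mulL: "emb f = mulL (abs_ltwo (%x. 1)) f"
 using mulL_abs[OF sq_const[of 1], of f] by (simp add: emb_def)

lemma bounded_linear_emb: "bounded_linear emb"
 using bounded_bilinear.bounded_linear_right[OF bounded_bilinear_mulL, of "abs_ltwo (%x. 1)"]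
 by (simp add: emb_mulL[abs_def])

lemma I_mulL: "I (mulL q f) t = integral {0..cl t} (%x. rep_ltwo q x * f x)"
 unfolding mulL_def by (rule I_abs[OF mulL_sq])

lemma I_emb: "I (emb f) t = integral {0..cl t} f"
 unfolding emb_def by (rule I_abs[OF sq_cfun])

definition ymul :: "cfun => cfun => cfun" where "ymul f g = Bcontfun (%t. f t * g t)"

lemma ymul_apply [simp]: "ymul f g t = f t * g t"
proof -
 have "(%t. f t * g t) \<in> bcontfun"
 proof (rule bcontfun_normI[where b = "norm f * norm g"])
  show "norm (f x * g x) \<le> norm f * norm g" for x
   unfolding norm_mult by (intro mult_mono norm_bounded) auto
 qed (intro continuous_intros continuous_on_apply_bcontfun)
 then show ?thesis by (simp add: ymul_def Bcontfun_inverse)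
qed

lemma bounded_bilinear_ymul: "bounded_bilinear ymul"
proof (rule bounded_bilinear.intro)
 show "\<exists>K. \<forall>a b. norm (ymul a b) \<le> norm a * norm b * K"
 proof (intro exI[of _ 1] allI norm_bound)
  fix a b :: cfun and x
  have "norm (a x * b x) \<le> norm a * norm b" unfolding norm_mult by (intro mult_mono norm_bounded) auto
  then show "norm (ymul a b x) \<le> norm a * norm b * 1" by simp
 qed
qed (auto intro!: bcontfun_eqI simp: algebra_simps)

lemma mulL_mulL: "mulL (mulL q f) g = mulL q (ymul f g)"
proof -
 have "mulL (mulL q f) g = abs_ltwo (%x. rep_ltwo q x * f x * g x)"
  unfolding mulL_def[of q f] by (rule mulL_abs[OF mulL_sq])
 then show ?thesis by (simp add: mulL_def mult.assoc)
qed

lemma mulL_emb: "mulL (emb f) g = emb (ymul f g)"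
 by (simp add: emb_mulL mulL_mulL)

text \<open>Lebesgue differentiation: almost everywhere the function is the limit of its averages
  over small intervals to the right, and these averages are differences of values of the
  primitive.\<close>

lemma I_inj: "I u = 0 ==> u = 0"
proof -
 assume 0: "I u = 0"
 let ?r = "rep_ltwo u"
 \<comment> \<open>Extension by 0 makes the function integrable over every box; the step h is chosen
   below so that the box stays in the interval.\<close>
 define f where "f x = (if x \<in> {0..TT} then ?r x else 0)" for x
 have fu: "(f has_integral integral {0..TT} ?r) UNIV"
  unfolding f_def has_integral_restrict_UNIV by (intro integrable_integral sq_int_on sq_rep order_refl)
 have fi: "f integrable_on cbox a b" for a b
  by (rule integrable_on_subcbox[where S = UNIV]) (use fu in auto)
 have I0: "integral {0..t} ?r = 0" if "t \<in> {0..TT}" for t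
  using 0 I_apply[of u t] cl_id[OF that] by simp
 have F0: "integral {x..y} f = 0" if "0 \<le> x" "x \<le> y" "y \<le> TT" for x y
 proof -
  have "integral {x..y} f = integral {x..y} ?r"
   by (rule integral_cong) (use that in \<open>auto simp: f_def\<close>)
  moreover have "integral {0..x} ?r + integral {x..y} ?r = integral {0..y} ?r"
   by (rule Henstock_Kurzweil_Integration.integral_combine) (use that sq_int_on[OF sq_rep] in auto)
  ultimately show ?thesis using I0[of x] I0[of y] that by simp
 qed
 obtain N where N: "negligible N" "!!x e. x \<notin> N ==> 0 < e ==>
   \<exists>d>0. \<forall>h. 0 < h \<and> h < d --> norm (integral (cbox x (x + h *\<^sub>R One)) f /\<^sub>R h ^ DIM(real) - f x) < e"
  using integrable_ccontinuous_explicit[OF fi] by metis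
 have f0: "f x = 0" if xN: "x \<notin> N" "0 \<le> x" "x < TT" for x
 proof (rule ccontr)
  assume "f x \<noteq> 0"
  then obtain d where d: "d > 0" "!!h. 0 < h ==> h < d ==> norm (integral (cbox x (x + h *\<^sub>R One)) f /\<^sub>R h ^ DIM(real) - f x) < norm (f x)"
   using N(2)[OF xN(1), of "norm (f x)"] by auto
  define h where "h = min (d/2) (TT - x)"
  have h: "0 < h" "h < d" "x + h \<le> TT" using d xN by (auto simp: h_def min_def)
  have "integral (cbox x (x + h *\<^sub>R One)) f = 0" using F0[of x "x + h"] h xN by simp
  then show False using d(2)[OF h(1,2)] by simp
 qed
 have "negligible (insert TT N)" using N(1) by simp
 then have "AE x in leb_int. x \<notin> insert TT N" by (rule negligible_AE)
 moreover have "AE x in leb_int. x \<in> {0..TT}" by (rule AE_I2) simp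
 ultimately have "AE x in leb_int. ?r x = 0"
 proof eventually_elim
  case (elim x)
  then have "f x = 0" by (intro f0) auto
  then show ?case using elim by (simp add: f_def)
 qed
 then have "abs_ltwo ?r = abs_ltwo (%x. 0)" using abs_eq_iff[OF sq_rep square_int_zero] by blast
 then show "u = 0" unfolding abs_rep zero_ltwo_def .
qed

text \<open>Continuous functions that differ at a point differ on a nondegenerate interval, which is
  not negligible.\<close>

lemma emb_inj:
 assumes "emb f = emb g" "t \<in> {0..TT}"
 shows "f t = g t"
proof -
 have "AE x in leb_int. f x = g x" using assms(1) abs_eq_iff[OF sq_cfun sq_cfun] by (simp add: emb_def)
 then have neg: "negligible {x \<in> {0..TT}. f x \<noteq> g x}" by (rule AE_negligible)
 show ?thesis
 proof (rule ccontr)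
  assume ne: "f t \<noteq> g t"
  let ?U = "{x. f x \<noteq> g x}"
  have "open ?U" by (rule open_Collect_neq) (auto intro: continuous_on_apply_bcontfun)
  then obtain e where e: "e > 0" "ball t e \<subseteq> ?U" using ne by (auto simp: open_contains_ball)
  define a b where "a = max 0 (t - e/2)" and "b = min TT (t + e/2)"
  have ab: "a < b" using e assms(2) pi_gt_zero by (auto simp: a_def b_def)
  have sub: "{a..b} \<subseteq> {x \<in> {0..TT}. f x \<noteq> g x}"
  proof
   fix x assume "x \<in> {a..b}"
   then have "x \<in> {0..TT}" "x \<le> t + e/2" "t - e/2 \<le> x" by (auto simp: a_def b_def)
   then have x: "x \<in> {0..TT}" "\<bar>x - t\<bar> \<le> e/2" unfolding abs_le_iff by (blast, linarith)
   have "dist t x < e" using x(2) e(1) unfolding dist_real_def by linarith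
   then have "x \<in> ball t e" by simp
   then show "x \<in> {x \<in> {0..TT}. f x \<noteq> g x}" using e x by auto
  qed
  have "negligible {a..b}" by (rule negligible_subset[OF neg sub])
  then show False using ab negligible_interval(1)[of a b] by simp
 qed
qed

text \<open>By Fubini on the square.\<close>

lemma integral_parts:
 assumes u: "square_int u" and v: "square_int v" and t: "0 \<le> t" "t \<le> TT"
 shows "integral {0..t} u * integral {0..t} v =
  integral {0..t} (%s. u s * integral {0..s} v) + integral {0..t} (%s. v s * integral {0..s} u)"
proof -
 let ?M = "lebesgue_on {0..t}"
 interpret finite_measure ?M using t by (intro finite_measureI) (simp add: emeasure_restrict_space)
 interpret P: pair_sigma_finite ?M ?M ..
 have restr: "integrable ?M f" if "integrable leb_int f" for f :: "real => real"
 proof -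
  have iff: "integrable (lebesgue_on {0..c}) f \<longleftrightarrow> integrable lebesgue (%x. indicat_real {0..c} x *\<^sub>R f x)" for c
   by (rule integrable_restrict_space) auto
  have "integrable lebesgue (%x. indicat_real {0..TT} x *\<^sub>R f x)" using that unfolding iff .
  then have "integrable lebesgue (%x. indicat_real {0..t} x *\<^sub>R (indicat_real {0..TT} x *\<^sub>R f x))"
   by (rule integrable_mult_indicator[rotated]) simp
  also have "(%x. indicat_real {0..t} x *\<^sub>R (indicat_real {0..TT} x *\<^sub>R f x)) = (%x. indicat_real {0..t} x *\<^sub>R f x)"
   using t by (auto simp: indicator_def)
  finally show ?thesis unfolding iff .
 qed
 have iu [simp]: "integrable ?M u" and iv [simp]: "integrable ?M v"
  using restr sq_integrable[OF u] sq_integrable[OF v] by auto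
 note [measurable] = borel_measurable_integrable[OF iu] borel_measurable_integrable[OF iv]
 have id [measurable]: "(%x. x) \<in> borel_measurable ?M"
  by (rule continuous_imp_measurable_on_sets_lebesgue) auto
 have eqI: "integral\<^sup>L ?M f = integral {0..t} f" if "integrable ?M f" for f :: "real => real"
  using that by (rule lebesgue_integral_eq_integral) auto
 have inner_int: "(\<integral>s. f s * indicator {..r} s \<partial>?M) = integral {0..r} f"
  if f: "integrable ?M f" and r: "r \<in> {0..t}" for f :: "real => real" and r
 proof -
  have i: "integrable ?M (%s. f s * indicator {..r} s)"
  proof (rule Bochner_Integration.integrable_bound[OF f])
   have [measurable]: "f \<in> borel_measurable ?M" using f by (rule borel_measurable_integrable)
   show "(%s. f s * indicator {..r} s) \<in> borel_measurable ?M" unfolding indicator_def by simp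
  qed (auto simp: indicator_def)
  have "(\<integral>s. f s * indicator {..r} s \<partial>?M) = integral {0..t} (%s. f s * indicator {..r} s)"
   by (rule eqI[OF i])
  also have "\<dots> = integral {0..t} (%s. if s \<in> {0..r} then f s else 0)"
   by (rule integral_cong) (auto simp: indicator_def)
  also have "\<dots> = integral {0..r} f"
  proof -
   have "{0..r} \<inter> {0..t} = {0..r}" using r by auto
   then show ?thesis by (simp only: integral_restrict_Int)
  qed
  finally show ?thesis .
 qed
 have key: "integrable (?M \<Otimes>\<^sub>M ?M) (%(r, s). u r * v s)"
 proof (rule P.Fubini_integrable)
  show "integrable ?M (%x. \<integral>y. norm (case (x, y) of (r, s) => u r * v s) \<partial>?M)"
   by (simp add: abs_mult)
 qed (auto simp: split_beta')
 have key2: "integrable (?M \<Otimes>\<^sub>M ?M) (%(r, s). u r * v s * indicator {(r, s). s \<le> r} (r, s))" (is "integrable _ ?A")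
  by (rule Bochner_Integration.integrable_bound[OF key]) (auto simp: split_beta' indicator_def)
 have key3: "integrable (?M \<Otimes>\<^sub>M ?M) (%(r, s). u r * v s * indicator {(r, s). r \<le> s} (r, s))" (is "integrable _ ?B")
  by (rule Bochner_Integration.integrable_bound[OF key]) (auto simp: split_beta' indicator_def)
 have A: "(\<integral>r. (\<integral>s. ?A (r, s) \<partial>?M) \<partial>?M) = integral {0..t} (%s. u s * integral {0..s} v)"
 proof -
  have e: "(\<integral>s. ?A (r, s) \<partial>?M) = u r * integral {0..r} v" if "r \<in> {0..t}" for r
  proof -
   have "(\<integral>s. ?A (r, s) \<partial>?M) = (\<integral>s. u r * (v s * indicator {..r} s) \<partial>?M)"
    by (rule Bochner_Integration.integral_cong) (auto simp: indicator_def)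
   then show ?thesis using inner_int[OF iv that] by simp
  qed
  have i: "integrable ?M (%r. \<integral>s. ?A (r, s) \<partial>?M)" using P.integrable_fst[OF key2] by simp
  show ?thesis unfolding eqI[OF i] by (rule integral_cong) (rule e)
 qed
 have B: "(\<integral>s. (\<integral>r. ?B (r, s) \<partial>?M) \<partial>?M) = integral {0..t} (%s. v s * integral {0..s} u)"
 proof -
  have e: "(\<integral>r. ?B (r, s) \<partial>?M) = v s * integral {0..s} u" if "s \<in> {0..t}" for s
  proof -
   have "(\<integral>r. ?B (r, s) \<partial>?M) = (\<integral>r. v s * (u r * indicator {..s} r) \<partial>?M)"
    by (rule Bochner_Integration.integral_cong) (auto simp: indicator_def)
   then show ?thesis using inner_int[OF iu that] by simp
  qed
  have i: "integrable ?M (%s. \<integral>r. ?B (r, s) \<partial>?M)" using P.integrable_snd[OF key3] by simp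
  show ?thesis unfolding eqI[OF i] by (rule integral_cong) (rule e)
 qed
 have null: "AE s in ?M. s \<noteq> r" for r
 proof -
  have "AE s in lebesgue. s \<notin> {r}"
   using negligible_sing[of r] by (intro AE_not_in) (simp add: negligible_iff_null_sets)
  then show ?thesis by (simp add: AE_restrict_space_iff) (erule eventually_mono, simp)
 qed
 have "integral {0..t} u * integral {0..t} v = (\<integral>r. (\<integral>s. u r * v s \<partial>?M) \<partial>?M)"
  by (simp add: eqI)
 also have "\<dots> = (\<integral>r. (\<integral>s. ?A (r, s) \<partial>?M) + (\<integral>s. ?B (r, s) \<partial>?M) \<partial>?M)"
 proof (rule Bochner_Integration.integral_cong_AE)
  have "AE r in ?M. integrable ?M (%s. ?A (r, s)) \<and> integrable ?M (%s. ?B (r, s))"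
   using P.AE_integrable_fst[OF key2] P.AE_integrable_fst[OF key3] by eventually_elim simp
  then show "AE r in ?M. (\<integral>s. u r * v s \<partial>?M) = (\<integral>s. ?A (r, s) \<partial>?M) + (\<integral>s. ?B (r, s) \<partial>?M)"
  proof eventually_elim
   case (elim r)
   then have "(\<integral>s. ?A (r, s) \<partial>?M) + (\<integral>s. ?B (r, s) \<partial>?M) = (\<integral>s. ?A (r, s) + ?B (r, s) \<partial>?M)"
    by (intro Bochner_Integration.integral_add[symmetric]) auto
   also have "\<dots> = (\<integral>s. u r * v s \<partial>?M)"
   proof (rule Bochner_Integration.integral_cong_AE)
    show "AE s in ?M. ?A (r, s) + ?B (r, s) = u r * v s"
     using null[of r] by eventually_elim (auto simp: indicator_def)
   qed (use elim in auto)
   finally show ?case by simp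
  qed
  show "(%r. (\<integral>s. ?A (r, s) \<partial>?M) + (\<integral>s. ?B (r, s) \<partial>?M)) \<in> borel_measurable ?M"
   using P.integrable_fst[OF key2] P.integrable_fst[OF key3] by simp
 qed simp
 also have "\<dots> = (\<integral>r. (\<integral>s. ?A (r, s) \<partial>?M) \<partial>?M) + (\<integral>r. (\<integral>s. ?B (r, s) \<partial>?M) \<partial>?M)"
  using P.integrable_fst[OF key2] P.integrable_fst[OF key3] by (intro Bochner_Integration.integral_add) auto
 also have "(\<integral>r. (\<integral>s. ?B (r, s) \<partial>?M) \<partial>?M) = (\<integral>s. (\<integral>r. ?B (r, s) \<partial>?M) \<partial>?M)"
  by (rule P.Fubini_integral[symmetric, of "%r s. ?B (r, s)"]) (use key3 in \<open>simp add: split_beta'\<close>)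
 finally show ?thesis unfolding A B .
qed

lemma cl_sub: "s \<le> cl t ==> s \<le> TT"
 by (rule order_trans[OF _ cl_range(2)])

lemma cl_id': "s \<in> {0..cl t} ==> cl s = s"
 by (rule cl_id) (auto intro: cl_sub)

lemma I_parts: "ymul (I u) (I v) = I (mulL u (I v) + mulL v (I u))"
proof (rule bcontfun_eqI)
 fix t
 interpret I: bounded_linear I by (rule bounded_linear_I)
 have e: "integral {0..cl t} (%x. rep_ltwo u x * I v x) = integral {0..cl t} (%x. rep_ltwo u x * integral {0..x} (rep_ltwo v))" for u v
  by (rule integral_cong) (drule cl_id', simp add: I_apply)
 show "ymul (I u) (I v) t = I (mulL u (I v) + mulL v (I u)) t"
 proof -
  have "I (mulL u (I v) + mulL v (I u)) t = integral {0..cl t} (%x. rep_ltwo u x * I v x) + integral {0..cl t} (%x. rep_ltwo v x * I u x)"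
   by (simp add: I.add I_mulL)
  also have "\<dots> = integral {0..cl t} (rep_ltwo u) * integral {0..cl t} (rep_ltwo v)"
   unfolding e by (rule integral_parts[OF sq_rep sq_rep, symmetric]) simp_all
  finally show ?thesis by (simp add: I_apply)
 qed
qed

abbreviation K :: "real => cfun" where "K c \<equiv> const_bcontfun c"

lemma K_apply [simp]: "K c t = c" by (simp add: const_bcontfun.rep_eq)

lemma ymul_K [simp]: "ymul (K c) f = c *\<^sub>R f" "ymul f (K c) = c *\<^sub>R f"
 by (auto intro!: bcontfun_eqI)

lemma mulL_K [simp]: "mulL u (K c) = c *\<^sub>R u"
proof -
 have "mulL u (K c) = abs_ltwo (%x. c * rep_ltwo u x)" by (simp add: mulL_def mult.commute)
 then show ?thesis using abs_scale[OF sq_rep, of c u] by (simp add: abs_rep)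
qed

lemma K_add: "K (a + b) = K a + K b" and K_scale: "K (a * b) = a *\<^sub>R K b"
 by (auto intro!: bcontfun_eqI)

text \<open>The product rule for absolutely continuous functions with square-integrable derivatives,
  in integrated form. It replaces pointwise differentiation wherever a factor has a derivative only
  in L2.\<close>

lemma AC_parts: "ymul (K a + I u) (K b + I v) = K (a * b) + I (mulL u (K b + I v) + mulL v (K a + I u))"
proof -
 interpret I: bounded_linear I by (rule bounded_linear_I)
 interpret m: bounded_bilinear ymul by (rule bounded_bilinear_ymul)
 interpret l: bounded_bilinear mulL by (rule bounded_bilinear_mulL)
 show ?thesis
  by (simp add: m.add_left m.add_right l.add_right I.add I.scaleR I_parts) (rule bcontfun_eqI, simp add: algebra_simps)
qed

lemma cfun_FTC:
 assumes f: "!!t. t \<in> {0..TT} ==> (f has_vector_derivative g t) (at t within {0..TT})" and g: "continuous_on {0..TT} g"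
 shows "mk f = K (f 0) + I (emb (mk g))"
proof (rule bcontfun_eqI)
 fix t
 have cf: "continuous_on {0..TT} f"
  using f by (meson continuous_on_eq_continuous_within has_vector_derivative_continuous)
 have "(g has_integral (f (cl t) - f 0)) {0..cl t}"
  by (rule fundamental_theorem_of_calculus)
    (auto intro!: has_vector_derivative_within_subset[OF f] intro: cl_sub)
 then have "integral {0..cl t} g = f (cl t) - f 0" by (rule integral_unique)
 moreover have "integral {0..cl t} (mk g) = integral {0..cl t} g"
  by (rule integral_cong) (drule cl_id', simp add: mk_apply[OF g])
 ultimately show "mk f t = (K (f 0) + I (emb (mk g))) t"
  by (simp add: mk_apply[OF cf] I_emb)
qed

text \<open>On an interval of finite length an L2 Cauchy sequence is an L1 Cauchy sequence, so a
  subsequence converges almost everywhere. Fatou's lemma then bounds the L2 distance of the terms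
  from that limit.\<close>

lemma ltwo_complete:
 fixes u :: "nat => ltwo"
 assumes "Cauchy u"
 shows "convergent u"
proof -
 let ?f = "%n. rep_ltwo (u n)"
 have diff: "AE x in leb_int. rep_ltwo (a - b) x = rep_ltwo a x - rep_ltwo b x" for a b
  using rep_add[of a "- b"] rep_scale[of "-1" b] by (auto elim!: AE_mp)
 have fm [measurable]: "rep_ltwo w \<in> borel_measurable leb_int" for w using sq_rep[of w] by (simp add: square_int_def)
 have n2: "(norm (a - b))\<^sup>2 = (\<integral>x. (rep_ltwo a x - rep_ltwo b x)\<^sup>2 \<partial>leb_int)" for a b
 proof -
  have "(norm (a - b))\<^sup>2 = (\<integral>x. (rep_ltwo (a - b) x)\<^sup>2 \<partial>leb_int)"
   using norm_abs_square[OF sq_rep, of "a - b"] by (simp add: abs_rep)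
  also have "\<dots> = (\<integral>x. (rep_ltwo a x - rep_ltwo b x)\<^sup>2 \<partial>leb_int)"
   by (rule integral_cong_AE) (measurable, rule eventually_mono[OF diff[of a b]], simp)
  finally show ?thesis .
 qed
 have n1: "(\<integral>x. norm (rep_ltwo a x - rep_ltwo b x) \<partial>leb_int) \<le> sqrt TT * norm (a - b)" for a b
 proof -
  have s: "square_int (%x. \<bar>rep_ltwo (a - b) x\<bar>)" by (rule sq_abs[OF sq_rep])
  have "(\<integral>x. norm (rep_ltwo a x - rep_ltwo b x) \<partial>leb_int) = (\<integral>x. \<bar>rep_ltwo (a - b) x\<bar> \<partial>leb_int)"
   by (rule integral_cong_AE) (measurable, rule eventually_mono[OF diff[of a b]], simp)
  also have "\<dots> = integral {0..TT} (%x. \<bar>rep_ltwo (a - b) x\<bar>)" by (rule lint[OF sq_integrable[OF s]])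
  finally show ?thesis using L1_le by simp
 qed
 have T0: "0 < sqrt TT" by simp
 have c1: "\<exists>N. \<forall>i\<ge>N. \<forall>j\<ge>N. (\<integral>x. norm (?f i x - ?f j x) \<partial>leb_int) < e" if "e > 0" for e
 proof -
  obtain N where N: "!!i j. i \<ge> N ==> j \<ge> N ==> dist (u i) (u j) < e / sqrt TT"
   using assms \<open>e > 0\<close> T0 unfolding Cauchy_def by (metis divide_pos_pos)
  show ?thesis
  proof (intro exI[of _ N] allI impI)
   fix i j assume "i \<ge> N" "j \<ge> N"
   then have "sqrt TT * norm (u i - u j) < sqrt TT * (e / sqrt TT)"
    using N[of i j] T0 by (intro mult_strict_left_mono) (auto simp: dist_norm)
   then show "(\<integral>x. norm (?f i x - ?f j x) \<partial>leb_int) < e" using n1[of "u i" "u j"] T0 by simp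
  qed
 qed
 obtain r where r: "strict_mono r" "AE x in leb_int. Cauchy (%i. ?f (r i) x)"
  using cauchy_L1_AE_cauchy_subseq[OF sq_integrable[OF sq_rep] c1] by blast
 define g where "g x = lim (%i. ?f (r i) x)" for x
 have gm [measurable]: "g \<in> borel_measurable leb_int"
  unfolding g_def by (intro borel_measurable_lim_metric fm)
 have lim: "AE x in leb_int. (%i. ?f (r i) x) \<longlonglongrightarrow> g x"
  using r(2) by eventually_elim (simp add: g_def Cauchy_convergent_iff convergent_LIMSEQ_iff)
 \<comment> \<open>The index m is fixed and only the subsequence runs, so the Cauchy bound survives
   in the limit.\<close>
 have fatou: "(\<integral>\<^sup>+x. ennreal ((g x - ?f m x)\<^sup>2) \<partial>leb_int) \<le> ennreal (e\<^sup>2)"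
  if e: "e > 0" and N: "!!i. i \<ge> N ==> norm (u i - u m) \<le> e" for e m N
 proof -
  have "(\<integral>\<^sup>+x. ennreal ((g x - ?f m x)\<^sup>2) \<partial>leb_int) = (\<integral>\<^sup>+x. liminf (%i. ennreal ((?f (r i) x - ?f m x)\<^sup>2)) \<partial>leb_int)"
  proof (rule nn_integral_cong_AE)
   show "AE x in leb_int. ennreal ((g x - ?f m x)\<^sup>2) = liminf (%i. ennreal ((?f (r i) x - ?f m x)\<^sup>2))"
    using lim
   proof eventually_elim
    case (elim x)
    then have "(%i. ennreal ((?f (r i) x - ?f m x)\<^sup>2)) \<longlonglongrightarrow> ennreal ((g x - ?f m x)\<^sup>2)"
     by (intro tendsto_intros)
    then show ?case by (rule lim_imp_Liminf[OF trivial_limit_sequentially, symmetric])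
   qed
  qed
  also have "\<dots> \<le> liminf (%i. \<integral>\<^sup>+x. ennreal ((?f (r i) x - ?f m x)\<^sup>2) \<partial>leb_int)"
   by (rule nn_integral_liminf) simp
  also have "\<dots> \<le> ennreal (e\<^sup>2)"
  proof (rule order_trans[OF Liminf_le_Limsup Limsup_bounded])
   show "\<forall>\<^sub>F i in sequentially. (\<integral>\<^sup>+x. ennreal ((?f (r i) x - ?f m x)\<^sup>2) \<partial>leb_int) \<le> ennreal (e\<^sup>2)"
    unfolding eventually_sequentially
   proof (intro exI[of _ N] allI impI)
    fix i assume "i \<ge> N"
    then have "r i \<ge> N" using seq_suble[OF r(1), of i] by simp
    then have "(norm (u (r i) - u m))\<^sup>2 \<le> e\<^sup>2" using N by (intro power_mono) auto
    moreover have "square_int (%x. ?f (r i) x + (-1) * ?f m x)"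
     by (intro square_int_add square_int_scale sq_rep)
    then have "integrable leb_int (%x. (?f (r i) x - ?f m x)\<^sup>2)" by (simp add: square_int_def)
    ultimately show "(\<integral>\<^sup>+x. ennreal ((?f (r i) x - ?f m x)\<^sup>2) \<partial>leb_int) \<le> ennreal (e\<^sup>2)"
     using n2[of "u (r i)" "u m"] by (subst nn_integral_eq_integral) auto
   qed
  qed simp
  finally show ?thesis .
 qed
 have cau: "\<exists>N. \<forall>m\<ge>N. \<forall>i\<ge>N. norm (u i - u m) \<le> e" if "e > 0" for e
  using assms that unfolding Cauchy_def dist_norm by (meson less_imp_le)
 have sqd: "square_int (%x. g x - ?f m x)" if "e > 0" "!!i. i \<ge> N ==> norm (u i - u m) \<le> e" for e m N
 proof -
  have "(\<integral>\<^sup>+x. ennreal ((g x - ?f m x)\<^sup>2) \<partial>leb_int) < \<infinity>"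
   unfolding infinity_ennreal_def using fatou[OF that] ennreal_less_top by (rule le_less_trans)
  then have "integrable leb_int (%x. (g x - ?f m x)\<^sup>2)" by (intro integrableI_nonneg) auto
  then show ?thesis by (simp add: square_int_def)
 qed
 obtain N1 where N1: "\<forall>m\<ge>N1. \<forall>i\<ge>N1. norm (u i - u m) \<le> 1" using cau[of 1] by auto
 have "square_int (%x. (g x - ?f N1 x) + ?f N1 x)"
  by (intro square_int_add sq_rep sqd[of 1 N1]) (use N1 in auto)
 then have g: "square_int g" by simp
 have "u \<longlonglongrightarrow> abs_ltwo g"
 proof (rule LIMSEQ_I)
  fix e :: real assume "e > 0"
  then obtain N where N: "\<forall>m\<ge>N. \<forall>i\<ge>N. norm (u i - u m) \<le> e / 2" using cau[of "e/2"] by auto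
  show "\<exists>no. \<forall>n\<ge>no. norm (u n - abs_ltwo g) < e"
  proof (intro exI[of _ N] allI impI)
   fix n assume n: "n \<ge> N"
   have e2: "e / 2 > 0" using \<open>e > 0\<close> by simp
   have sd: "square_int (%x. g x - ?f n x)" by (rule sqd[OF e2, of N]) (use N n in auto)
   have "abs_ltwo g - u n = abs_ltwo g + (-1) *\<^sub>R abs_ltwo (?f n)" by (simp add: abs_rep)
   also have "\<dots> = abs_ltwo (%x. g x - ?f n x)"
    using abs_scale[OF sq_rep, of "-1" "u n"] abs_add[OF g square_int_scale[OF sq_rep], of "-1" "u n"] by simp
   finally have "(norm (abs_ltwo g - u n))\<^sup>2 = (\<integral>x. (g x - ?f n x)\<^sup>2 \<partial>leb_int)" by (simp add: norm_abs_square[OF sd])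
   moreover have "ennreal (\<integral>x. (g x - ?f n x)\<^sup>2 \<partial>leb_int) \<le> ennreal ((e/2)\<^sup>2)"
   proof -
    have i: "integrable leb_int (%x. (g x - ?f n x)\<^sup>2)" using sd by (simp add: square_int_def)
    have "ennreal (\<integral>x. (g x - ?f n x)\<^sup>2 \<partial>leb_int) = (\<integral>\<^sup>+x. ennreal ((g x - ?f n x)\<^sup>2) \<partial>leb_int)"
     by (rule nn_integral_eq_integral[OF i, symmetric]) simp
    also have "\<dots> \<le> ennreal ((e/2)\<^sup>2)" by (rule fatou[OF e2, of N n]) (use N n in auto)
    finally show ?thesis .
   qed
   ultimately have "(norm (abs_ltwo g - u n))\<^sup>2 \<le> (e/2)\<^sup>2" by simp
   then have "norm (abs_ltwo g - u n) \<le> e/2" by (rule power2_le_imp_le) (use e2 in simp)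
   then show "norm (u n - abs_ltwo g) < e" using \<open>e > 0\<close> by (simp add: norm_minus_commute)
  qed
 qed
 then show ?thesis by (rule convergentI)
qed

declare sobolev.simps(2) [simp del]

section \<open>Smooth maps between normed types; exponential and inverse of continuous
  functions\<close>

definition tsp :: "'a::real_normed_vector nsp" where "tsp = (UNIV, norm)"

lemma tsp_simps [simp]: "fst tsp = UNIV" "snd tsp = norm"
 by (simp_all add: tsp_def)

lemma nspace_tsp [simp]: "nspace (tsp :: 'a::real_normed_vector nsp)"
 by (auto simp: nspace_def norm_triangle_ineq)

lemma nopen_tsp: "open U ==> nopen tsp (U :: 'a::real_normed_vector set)"
 unfolding nopen_def
proof (intro conjI ballI)
 fix x assume "open U" "x \<in> U"
 then obtain e where "e > 0" "ball x e \<subseteq> U" by (meson openE)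
 then show "\<exists>d>0. \<forall>h\<in>fst tsp. snd tsp h < d --> x + h \<in> U"
  by (intro exI[of _ e]) (auto simp: dist_norm)
qed simp

lemma nlinear_bl: "bounded_linear f ==> nlinear tsp tsp f"
 unfolding nlinear_def using bounded_linear.bounded[of f]
 by (auto simp: linear_simps mult.commute)

lemma nbilinear_bb: "bounded_bilinear b ==> nbilinear tsp tsp tsp b"
 unfolding nbilinear_def using bounded_bilinear.bounded[of b]
 by (auto simp: bounded_bilinear.add_left bounded_bilinear.add_right bounded_bilinear.scaleR_left bounded_bilinear.scaleR_right mult.commute mult.left_commute)

lemma smooth_bl: "nspace X ==> bounded_linear L ==> smooth X tsp U f ==> smooth X tsp U (%x. L (f x))"
 by (rule smooth_compose[OF _ nspace_tsp nspace_tsp smooth_linear[OF nspace_tsp nspace_tsp nlinear_bl]]) auto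

lemma smooth_bb: "nspace X ==> bounded_bilinear b ==> smooth X tsp U f ==> smooth X tsp U g ==> smooth X tsp U (%x. b (f x) (g x))"
 by (rule smooth_bilinear[OF _ nspace_tsp nspace_tsp nspace_tsp nbilinear_bb])

lemma smooth_id: "nspace X ==> U \<subseteq> fst X ==> smooth X X U (%x. x)"
 by (rule smooth_linear) (auto simp: nlinear_def intro: exI[of _ 1])

lemma smooth_tconst: "nspace X ==> smooth X tsp U (%x. c)"
 by (rule smooth_const) auto

lemma smooth_scale:
 assumes X: "nspace X" and Y: "nspace Y" and f: "smooth X Y U f"
 shows "smooth X Y U (%x. c *\<^sub>R f x)"
proof (rule smooth_compose[OF X Y Y smooth_linear[OF Y Y _ order_refl] f])
 show "nlinear Y Y (%y. c *\<^sub>R y)" unfolding nlinear_def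
  using nspace_mem(4)[OF Y] nspaceD(5)[OF Y] by (auto simp: algebra_simps intro!: exI[of _ "\<bar>c\<bar>"])
 show "f ` U \<subseteq> fst Y" using smooth_mem[OF f] by auto
qed

lemma smooth_diff:
 assumes X: "nspace X" and Y: "nspace Y" and f: "smooth X Y U f" and g: "smooth X Y U g"
 shows "smooth X Y U (%x. f x - g x)"
 using smooth_add[OF X Y f smooth_scale[OF X Y g, of "-1"]] by simp

lemma has_mderiv_typed:
 assumes "!!x. x \<in> U ==> (f has_derivative f' x) (at x)"
 shows "has_mderiv tsp tsp U 0 (%x vs. f x) (%x vs. f' x (hd vs))"
 unfolding has_mderiv_def
proof (intro ballI allI impI)
 fix x and e :: real assume "x \<in> U" "e > 0"
 then obtain d where d: "d > 0" "!!y. norm (y - x) < d ==> norm (f y - f x - f' x (y - x)) \<le> e * norm (y - x)"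
  using assms[of x] unfolding has_derivative_at_alt by metis
 show "\<exists>d>0. \<forall>h\<in>fst tsp. snd tsp h < d \<and> x + h \<in> U --> (\<forall>vs. args tsp 0 vs -->
   snd tsp (f (x + h) - f x - f' x (hd (h # vs))) \<le> e * snd tsp h * pn tsp vs)"
  using d(1) d(2)[of "x + _"] by (intro exI[of _ d]) auto
qed

lemma has_derivative_quadratic:
 fixes f :: "'a::real_normed_vector => 'b::real_normed_vector"
 assumes "bounded_linear f'" "d > 0" "!!h. norm h < d ==> norm (f (x + h) - f x - f' h) \<le> C * norm h * norm h"
 shows "(f has_derivative f') (at x)"
 unfolding has_derivative_at_alt
proof (intro conjI allI impI assms(1))
 fix e :: real assume e: "e > 0"
 let ?C = "\<bar>C\<bar> + 1"
 show "\<exists>d>0. \<forall>y. norm (y - x) < d --> norm (f y - f x - f' (y - x)) \<le> e * norm (y - x)"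
 proof (intro exI[of _ "min d (e / ?C)"] conjI allI impI)
  fix y assume y: "norm (y - x) < min d (e / ?C)"
  have "norm (f y - f x - f' (y - x)) \<le> C * norm (y - x) * norm (y - x)"
   using assms(3)[of "y - x"] y by simp
  also have "\<dots> \<le> (?C * (e / ?C)) * norm (y - x)"
   using y by (intro mult_right_mono mult_mono) auto
  finally show "norm (f y - f x - f' (y - x)) \<le> e * norm (y - x)" by simp
 qed (use assms(2) e in auto)
qed

theorem smooth_bootstrap_typed:
 fixes s :: "'a::real_normed_vector => 'b::real_normed_vector" and \<gamma> :: "'a => 'c::real_normed_vector"
 assumes V: "open V"
  and g: "smooth (tsp \<otimes>\<^sub>n tsp) tsp (V \<times> UNIV) (%z. g (fst z) (snd z))"
  and \<gamma>: "!!n. cdiff tsp tsp U n 0 (%x vs. s x) ==> cdiff tsp tsp U n 0 (%x vs. \<gamma> x)" "\<gamma> ` U \<subseteq> V"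
  and lin: "!!p h c. p \<in> V ==> g p (c *\<^sub>R h) = c *\<^sub>R g p h"
  and s: "!!x. x \<in> U ==> (s has_derivative g (\<gamma> x)) (at x)"
 shows "smooth tsp tsp U s"
 by (rule smooth_bootstrap[OF nspace_tsp nspace_tsp nspace_tsp nopen_tsp[OF V] _ _ \<gamma> _ has_mderiv_typed[OF s]])
   (use g lin in auto)

lemma smooth_pfst: "nspace X ==> nspace Y ==> smooth (X \<otimes>\<^sub>n Y) X (fst X \<times> fst Y) fst"
 by (rule smooth_linear[OF nspace_nprod _ nlinear_fst]) auto

lemma smooth_psnd: "nspace X ==> nspace Y ==> smooth (X \<otimes>\<^sub>n Y) Y (fst X \<times> fst Y) snd"
 by (rule smooth_linear[OF nspace_nprod _ nlinear_snd]) auto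

lemma smooth_tfst: "smooth (tsp \<otimes>\<^sub>n tsp) tsp U fst" and smooth_tsnd: "smooth (tsp \<otimes>\<^sub>n tsp) tsp U snd"
 using smooth_subset[OF smooth_pfst[OF nspace_tsp nspace_tsp], of U] smooth_subset[OF smooth_psnd[OF nspace_tsp nspace_tsp], of U] by auto

lemma nspace_tt [simp]: "nspace (tsp \<otimes>\<^sub>n tsp)" by (rule nspace_nprod) auto

definition yexp :: "cfun => cfun" where "yexp f = Bcontfun (%t. exp (f t))"

lemma abs_apply_le: "\<bar>apply_bcontfun f t\<bar> \<le> norm f"
 using norm_bounded[of f t] by simp

lemma yexp_apply [simp]: "yexp f t = exp (f t)"
proof -
 have "(%t. exp (f t)) \<in> bcontfun"
 proof (rule bcontfun_normI[where b = "exp (norm f)"])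
  show "norm (exp (f x)) \<le> exp (norm f)" for x using abs_apply_le[of f x] by simp
 qed (intro continuous_intros continuous_on_apply_bcontfun)
 then show ?thesis by (simp add: yexp_def Bcontfun_inverse)
qed

lemma exp_quadratic: "\<bar>x\<bar> \<le> 1 ==> \<bar>exp x - 1 - x\<bar> \<le> x * x" for x :: real
proof -
 assume x: "\<bar>x\<bar> \<le> 1"
 have "exp x \<le> 1 + x + x * x"
 proof (cases "x \<ge> 0")
  case True then show ?thesis using exp_bound[of x] x by (simp add: power2_eq_square)
 next
  case False
  have "x * x * x \<le> 0" using False by (simp add: mult_le_0_iff)
  \<comment> \<open>The product equals 1 - x^3, which is at least 1 for negative x; next, 1 - x is
    replaced by the larger exp (- x).\<close>
  then have "1 \<le> (1 - x) * (1 + x + x * x)" by (simp add: algebra_simps)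
  also have "\<dots> \<le> exp (- x) * (1 + x + x * x)"
   using exp_ge_add_one_self[of "-x"] sum_power2_ge_zero[of "x + 1/2" 0] by (intro mult_right_mono) (auto simp: power2_eq_square algebra_simps)
  finally have "exp x * 1 \<le> exp x * (exp (- x) * (1 + x + x * x))" by (intro mult_left_mono) auto
  also have "\<dots> = 1 + x + x * x" by (simp add: exp_minus mult.assoc[symmetric])
  finally show ?thesis by simp
 qed
 moreover have "0 \<le> x * x" by simp
 ultimately show ?thesis using exp_ge_add_one_self[of x] unfolding abs_le_iff by linarith
qed

lemma inverse_second_order:
 fixes a s :: real
 assumes "a > 0" "s > 0"
 shows "inverse s - inverse a + inverse a * inverse a * (s - a) = inverse a * inverse a * inverse s * ((s - a) * (s - a))"
 using assms by (simp add: field_simps)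

lemma yexp_deriv: "(yexp has_derivative ymul (yexp f)) (at f)"
proof (rule has_derivative_quadratic[where d = 1 and C = "norm (yexp f)"])
 show "bounded_linear (ymul (yexp f))"
  by (rule bounded_bilinear.bounded_linear_right[OF bounded_bilinear_ymul])
 fix h :: cfun assume h: "norm h < 1"
 show "norm (yexp (f + h) - yexp f - ymul (yexp f) h) \<le> norm (yexp f) * norm h * norm h"
 proof (rule norm_bound)
  fix t
  have ht: "\<bar>h t\<bar> \<le> norm h" by (rule abs_apply_le)
  have "norm ((yexp (f + h) - yexp f - ymul (yexp f) h) t) = \<bar>exp (f t) * (exp (h t) - 1 - h t)\<bar>"
   by (simp add: exp_add algebra_simps)
  also have "\<dots> = \<bar>exp (f t)\<bar> * \<bar>exp (h t) - 1 - h t\<bar>" by (rule abs_mult)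
  also have "\<dots> \<le> norm (yexp f) * (\<bar>h t\<bar> * \<bar>h t\<bar>)"
  proof (rule mult_mono)
   show "\<bar>exp (f t)\<bar> \<le> norm (yexp f)" using abs_apply_le[of "yexp f" t] by simp
   show "\<bar>exp (h t) - 1 - h t\<bar> \<le> \<bar>h t\<bar> * \<bar>h t\<bar>" using exp_quadratic[of "h t"] ht h by (simp add: abs_mult_self_eq)
  qed auto
  also have "\<dots> \<le> norm (yexp f) * (norm h * norm h)"
   using ht by (intro mult_left_mono mult_mono) auto
  finally show "norm ((yexp (f + h) - yexp f - ymul (yexp f) h) t) \<le> norm (yexp f) * norm h * norm h" by (simp add: mult.assoc)
 qed
qed simp

text \<open>The derivative of the exponential is multiplication by the exponential itself, which is
  exactly the situation of the bootstrap.\<close>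

lemma smooth_yexp: "smooth tsp tsp UNIV yexp"
proof (rule smooth_bootstrap_typed[where V = UNIV and \<gamma> = yexp and g = ymul])
 show "smooth (tsp \<otimes>\<^sub>n tsp) tsp (UNIV \<times> UNIV) (%z. ymul (fst z) (snd z))"
  by (rule smooth_bb[OF nspace_tt bounded_bilinear_ymul smooth_tfst smooth_tsnd])
 show "ymul p (c *\<^sub>R h) = c *\<^sub>R ymul p h" for p h c
  by (rule bounded_bilinear.scaleR_right[OF bounded_bilinear_ymul])
qed (auto simp: yexp_deriv)

text \<open>A uniform positive lower bound instead of pointwise positivity makes the set open and
  the inverse bounded on the whole line.\<close>

definition ypos :: "cfun set" where "ypos = {f. \<exists>c>0. \<forall>t. c \<le> apply_bcontfun f t}"

definition yinv :: "cfun => cfun" where "yinv f = Bcontfun (%t. inverse (f t))"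

lemma open_ypos: "open ypos"
 unfolding open_dist
proof
 fix f assume "f \<in> ypos"
 then obtain c where c: "c > 0" "!!t. c \<le> f t" by (auto simp: ypos_def)
 have "g \<in> ypos" if "dist g f < c / 2" for g
 proof -
  have "c / 2 \<le> g t" for t
   using abs_apply_le[of "g - f" t] that c(2)[of t] by (simp add: dist_norm)
  then show ?thesis using c by (auto simp: ypos_def intro!: exI[of _ "c/2"])
 qed
 then show "\<exists>e>0. \<forall>y. dist y f < e --> y \<in> ypos" using c(1) by (intro exI[of _ "c/2"]) auto
qed

lemma yinv_apply: "f \<in> ypos ==> yinv f t = inverse (f t)"
proof -
 assume "f \<in> ypos"
 then obtain c where c: "c > 0" "!!t. c \<le> f t" by (auto simp: ypos_def)
 then have n0: "f t \<noteq> 0" for t by (metis not_le)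
 have "(%t. inverse (f t)) \<in> bcontfun"
 proof (rule bcontfun_normI[where b = "inverse c"])
  show "continuous_on UNIV (%t. inverse (f t))" using n0 by (intro continuous_intros continuous_on_apply_bcontfun) auto
  fix x
  have "\<bar>f x\<bar> = f x" using c(1) c(2)[of x] by simp
  then show "norm (inverse (f x)) \<le> inverse c" using c(1) c(2)[of x] by (simp add: le_imp_inverse_le)
 qed
 then show ?thesis by (simp add: yinv_def Bcontfun_inverse)
qed

lemma yinv_deriv: "f \<in> ypos ==> (yinv has_derivative (%h. - ymul (ymul (yinv f) (yinv f)) h)) (at f)"
proof -
 assume f: "f \<in> ypos"
 then obtain c where c: "c > 0" "!!t. c \<le> f t" by (auto simp: ypos_def)
 show ?thesis
 proof (rule has_derivative_quadratic[where d = "c / 2" and C = "2 * inverse c * inverse c * inverse c"])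
  show "bounded_linear (%h. - ymul (ymul (yinv f) (yinv f)) h)"
   by (intro bounded_linear_minus bounded_bilinear.bounded_linear_right[OF bounded_bilinear_ymul])
  fix h :: cfun assume h: "norm h < c / 2"
  have lo: "c / 2 \<le> f t + h t" for t using abs_apply_le[of h t] h c(2)[of t] by linarith
  then have fh: "f + h \<in> ypos" using c by (auto simp: ypos_def intro!: exI[of _ "c/2"])
  show "norm (yinv (f + h) - yinv f - - ymul (ymul (yinv f) (yinv f)) h) \<le> 2 * inverse c * inverse c * inverse c * norm h * norm h"
  proof (rule norm_bound)
   fix t
   have p: "f t > 0" "f t + h t > 0" using c(1) c(2)[of t] lo[of t] by linarith+
   have "(yinv (f + h) - yinv f - - ymul (ymul (yinv f) (yinv f)) h) t = inverse (f t + h t) - inverse (f t) + inverse (f t) * inverse (f t) * h t"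
    using yinv_apply[OF f] yinv_apply[OF fh] by simp
   also have "\<dots> = inverse (f t) * inverse (f t) * inverse (f t + h t) * (h t * h t)"
    using inverse_second_order[OF p] by simp
   finally have "norm ((yinv (f + h) - yinv f - - ymul (ymul (yinv f) (yinv f)) h) t) = inverse (f t) * inverse (f t) * inverse (f t + h t) * (\<bar>h t\<bar> * \<bar>h t\<bar>)"
    using p by (simp add: abs_mult)
   also have "\<dots> \<le> inverse c * inverse c * inverse (c / 2) * (norm h * norm h)"
    using p c lo[of t] abs_apply_le[of h t] by (intro mult_mono le_imp_inverse_le) auto
   also have "inverse (c / 2) = 2 * inverse c" by (simp add: inverse_eq_divide)
   also have "inverse c * inverse c * (2 * inverse c) * (norm h * norm h) = 2 * inverse c * inverse c * inverse c * norm h * norm h"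
    by (simp only: mult_ac)
   finally show "norm ((yinv (f + h) - yinv f - - ymul (ymul (yinv f) (yinv f)) h) t) \<le> 2 * inverse c * inverse c * inverse c * norm h * norm h" .
  qed
 qed (use c in auto)
qed

lemma smooth_yinv: "smooth tsp tsp ypos yinv"
proof (rule smooth_bootstrap_typed[where V = UNIV and \<gamma> = yinv and g = "%p h. - ymul (ymul p p) h"])
 have "smooth (tsp \<otimes>\<^sub>n tsp) tsp (UNIV \<times> UNIV) (%z. (-1) *\<^sub>R ymul (ymul (fst z) (fst z)) (snd z))"
  by (intro smooth_scale smooth_bb[OF nspace_tt bounded_bilinear_ymul] smooth_tfst smooth_tsnd nspace_tt nspace_tsp)
 then show "smooth (tsp \<otimes>\<^sub>n tsp) tsp (UNIV \<times> UNIV) (%z. - ymul (ymul (fst z) (fst z)) (snd z))" by simp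
 show "- ymul (ymul p p) (c *\<^sub>R h) = c *\<^sub>R - ymul (ymul p p) h" for p h c
  by (simp add: bounded_bilinear.scaleR_right[OF bounded_bilinear_ymul])
qed (auto simp: yinv_deriv)

section \<open>Sobolev spaces\<close>

abbreviation ac :: "real => ltwo => ltwo" where "ac c v \<equiv> emb (K c + I v)"

lemma I_cl: "I v (cl t) = I v t" by (simp add: I_apply)

text \<open>A normal form that removes the choice of representatives: having the weak derivative
  \<open>v\<close> means being the class of a constant plus the primitive of
  \<open>v\<close>.\<close>

lemma has_weak_deriv_iff: "has_weak_deriv u v \<longleftrightarrow> (\<exists>c. u = ac c v)"
proof
 assume "has_weak_deriv u v"
 then obtain f g where f: "square_int f" "u = abs_ltwo f" and g: "square_int g" "v = abs_ltwo g"
  and fg: "!!t. t \<in> {0..TT} ==> (g has_integral (f t - f 0)) {0..t}" unfolding has_weak_deriv_def by blast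
 have ft: "f t = (K (f 0) + I v) t" if "t \<in> {0..TT}" for t
  using integral_unique[OF fg[OF that]] cl_id[OF that] by (simp add: g(2) I_abs[OF g(1)])
 have "AE t in leb_int. f t = (K (f 0) + I v) t" by (rule AE_I2, rule ft) simp
 then have "u = ac (f 0) v" unfolding f(2) emb_def using abs_eq_iff[OF f(1) sq_cfun] by blast
 then show "\<exists>c. u = ac c v" ..
next
 assume "\<exists>c. u = ac c v"
 then obtain c where u: "u = ac c v" ..
 show "has_weak_deriv u v" unfolding has_weak_deriv_def
 proof (intro exI conjI ballI)
  show "square_int (apply_bcontfun (K c + I v))" by (rule sq_cfun)
  show "square_int (rep_ltwo v)" by (rule sq_rep)
  show "u = abs_ltwo (apply_bcontfun (K c + I v))" using u by (simp add: emb_def)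
  show "v = abs_ltwo (rep_ltwo v)" by (simp add: abs_rep)
  fix t assume t: "t \<in> {0..TT}"
  have "(rep_ltwo v has_integral integral {0..t} (rep_ltwo v)) {0..t}"
   by (rule integrable_integral[OF sq_int_on[OF sq_rep]]) (use t in auto)
  then show "(rep_ltwo v has_integral ((K c + I v) t - (K c + I v) 0)) {0..t}"
   using cl_id[OF t] cl_id[of 0] by (simp add: I_apply)
 qed
qed

text \<open>The constant is the value at 0, and then injectivity of \<open>I\<close> gives the rest.
  So weak derivatives are unique and the description in \<open>weak_deriv\<close> denotes
  them.\<close>

lemma ac_eqD: "ac c v = ac d w ==> c = d \<and> v = w"
proof -
 assume eq: "ac c v = ac d w"
 interpret I: bounded_linear I by (rule bounded_linear_I)
 have e: "c + I v t = d + I w t" for t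
  using emb_inj[OF eq, of "cl t"] by (simp add: I_cl)
 have cd: "c = d" using e[of 0] by (simp add: I_zero)
 have "I (v - w) = 0" using e cd by (intro bcontfun_eqI) (simp add: I.diff)
 then show ?thesis using cd I_inj by fastforce
qed

lemma weak_deriv_ac [simp]: "weak_deriv (ac c v) = v"
 unfolding weak_deriv_def has_weak_deriv_iff
proof (rule the_equality)
 show "v' = v" if "\<exists>d. ac c v = ac d v'" for v' using that ac_eqD by blast
qed blast

lemma sobolev_Suc_iff: "u \<in> sobolev (Suc p) \<longleftrightarrow> (\<exists>c. \<exists>v\<in>sobolev p. u = ac c v)"
 by (auto simp: has_weak_deriv_iff sobolev.simps(2))

text \<open>\<open>cont_rep\<close> is an arbitrary choice, but by \<open>emb_inj\<close> continuous
  representatives agree at every point of the interval, including the ends.\<close>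

lemma cont_rep_emb: "t \<in> {0..TT} ==> cont_rep (emb f) t = f t"
proof -
 assume t: "t \<in> {0..TT}"
 let ?P = "%g. continuous_on {0..TT} g \<and> square_int g \<and> emb f = abs_ltwo g"
 have "?P (cont_rep (emb f))" unfolding cont_rep_def
  by (rule someI[of ?P "apply_bcontfun f"]) (auto simp: sq_cfun emb_def)
 then have c: "continuous_on {0..TT} (cont_rep (emb f))" "square_int (cont_rep (emb f))" "emb f = abs_ltwo (cont_rep (emb f))" by auto
 have "AE t in leb_int. mk (cont_rep (emb f)) t = cont_rep (emb f) t"
  by (rule AE_I2) (simp add: mk_apply[OF c(1)] cl_id)
 then have "emb (mk (cont_rep (emb f))) = abs_ltwo (cont_rep (emb f))"
  unfolding emb_def[of "mk _"] using abs_eq_iff[OF sq_cfun c(2)] by blast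
 then have "emb (mk (cont_rep (emb f))) = emb f" using c(3) by simp
 from emb_inj[OF this t] show ?thesis by (simp add: mk_apply[OF c(1)] cl_id[OF t])
qed

definition cr :: "ltwo => cfun" where "cr u = mk (cont_rep u)"

lemma cr_ac [simp]: "cr (ac c v) = K c + I v"
proof (rule bcontfun_eqI)
 fix t
 have "continuous_on {0..TT} (apply_bcontfun (K c + I v))" by (rule continuous_on_apply_bcontfun)
 then have "continuous_on {0..TT} (cont_rep (ac c v))"
  by (rule continuous_on_eq) (simp add: cont_rep_emb)
 then show "cr (ac c v) t = (K c + I v) t"
  unfolding cr_def by (simp add: mk_apply cont_rep_emb I_cl)
qed

definition S :: "nat => ltwo nsp" where "S p = (sobolev p, sobolev_norm p)"

lemma S_simps [simp]: "fst (S p) = sobolev p" "snd (S p) = sobolev_norm p" by (simp_all add: S_def)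

lemma sobolev_norm_0 [simp]: "sobolev_norm 0 u = norm u" by (simp add: sobolev_norm_def)

lemma sobolev_norm_nonneg: "0 \<le> sobolev_norm p u" by (simp add: sobolev_norm_def sum_nonneg)

lemma sobolev_norm_Suc: "sobolev_norm (Suc p) u = sqrt ((norm u)\<^sup>2 + (sobolev_norm p (weak_deriv u))\<^sup>2)"
proof -
 have "(\<Sum>j\<le>Suc p. (norm ((weak_deriv ^^ j) u))\<^sup>2) = (norm u)\<^sup>2 + (\<Sum>j\<le>p. (norm ((weak_deriv ^^ j) (weak_deriv u)))\<^sup>2)"
  unfolding sum.atMost_Suc_shift by (simp add: funpow_swap1)
 then show ?thesis by (simp add: sobolev_norm_def sum_nonneg)
qed

lemma ac_lin: "a *\<^sub>R ac c v + b *\<^sub>R ac d w = ac (a * c + b * d) (a *\<^sub>R v + b *\<^sub>R w)"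
proof -
 interpret I: bounded_linear I by (rule bounded_linear_I)
 interpret e: bounded_linear emb by (rule bounded_linear_emb)
 show ?thesis by (simp add: e.add[symmetric] e.scaleR[symmetric] I.add I.scaleR K_add K_scale algebra_simps)
qed

lemma subspace_sobolev: "subspace (sobolev p)"
proof (induction p)
 case (Suc p)
 show ?case
 proof (rule subspaceI)
  have "(0::ltwo) = ac 0 0" using ac_lin[of 0 0 0 0 0 0] by simp
  then show "0 \<in> sobolev (Suc p)" unfolding sobolev_Suc_iff using subspace_0[OF Suc] by blast
  show "x + y \<in> sobolev (Suc p)" if xy: "x \<in> sobolev (Suc p)" "y \<in> sobolev (Suc p)" for x y
  proof -
   obtain c v d w where "x = ac c v" "y = ac d w" "v \<in> sobolev p" "w \<in> sobolev p"
    using xy unfolding sobolev_Suc_iff by blast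
   then have "x + y = ac (c + d) (v + w)" "v + w \<in> sobolev p"
    using ac_lin[of 1 c v 1 d w] subspace_add[OF Suc, of v w] by simp_all
   then show ?thesis unfolding sobolev_Suc_iff by blast
  qed
  show "r *\<^sub>R x \<in> sobolev (Suc p)" if x: "x \<in> sobolev (Suc p)" for r x
  proof -
   obtain c v where "x = ac c v" "v \<in> sobolev p" using x unfolding sobolev_Suc_iff by blast
   then have "r *\<^sub>R x = ac (r * c) (r *\<^sub>R v)" "r *\<^sub>R v \<in> sobolev p"
    using ac_lin[of r c v 0 0 0] subspace_scale[OF Suc, of v r] by simp_all
   then show ?thesis unfolding sobolev_Suc_iff by blast
  qed
 qed
qed simp

lemma weak_deriv_lin:
 assumes "x \<in> sobolev (Suc p)" "y \<in> sobolev (Suc q)"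
 shows "weak_deriv (a *\<^sub>R x + b *\<^sub>R y) = a *\<^sub>R weak_deriv x + b *\<^sub>R weak_deriv y"
proof -
 obtain c v d w where "x = ac c v" "y = ac d w" using assms unfolding sobolev_Suc_iff by blast
 then show ?thesis by (simp only: ac_lin weak_deriv_ac)
qed

lemma weak_deriv_mem: "x \<in> sobolev (Suc p) ==> weak_deriv x \<in> sobolev p"
 unfolding sobolev_Suc_iff by auto

lemma nspace_S [simp]: "nspace (S p)"
proof (induction p)
 case 0 then show ?case by (auto simp: nspace_def norm_triangle_ineq)
next
 case (Suc p)
 show ?case unfolding nspace_def S_simps
 proof (intro conjI ballI allI subspace_sobolev sobolev_norm_nonneg impI)
  fix x assume x: "x \<in> sobolev (Suc p)"
  show "x = 0" if "sobolev_norm (Suc p) x = 0"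
   using that by (simp add: sobolev_norm_Suc sum_power2_eq_zero_iff)
  show "sobolev_norm (Suc p) (c *\<^sub>R x) = \<bar>c\<bar> * sobolev_norm (Suc p) x" for c
  proof -
   have "weak_deriv (c *\<^sub>R x) = c *\<^sub>R weak_deriv x" using weak_deriv_lin[OF x x, of c 0] by simp
   then have "sobolev_norm (Suc p) (c *\<^sub>R x) = sqrt (c\<^sup>2 * ((norm x)\<^sup>2 + (sobolev_norm p (weak_deriv x))\<^sup>2))"
    using nspaceD(5)[OF Suc, of "weak_deriv x" c] weak_deriv_mem[OF x]
    by (simp add: sobolev_norm_Suc power_mult_distrib algebra_simps)
   then show ?thesis by (simp add: sobolev_norm_Suc real_sqrt_mult)
  qed
  fix y assume y: "y \<in> sobolev (Suc p)"
  have d: "weak_deriv (x + y) = weak_deriv x + weak_deriv y" using weak_deriv_lin[OF x y, of 1 1] by simp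
  have "sobolev_norm (Suc p) (x + y) \<le> sqrt ((norm x + norm y)\<^sup>2 + (sobolev_norm p (weak_deriv x) + sobolev_norm p (weak_deriv y))\<^sup>2)"
   unfolding sobolev_norm_Suc d
   using nspaceD(4)[OF Suc, of "weak_deriv x" "weak_deriv y"] weak_deriv_mem[OF x] weak_deriv_mem[OF y]
   by (intro real_sqrt_le_mono add_mono power_mono norm_triangle_ineq) (auto simp: sobolev_norm_nonneg)
  also have "\<dots> \<le> sobolev_norm (Suc p) x + sobolev_norm (Suc p) y"
   unfolding sobolev_norm_Suc by (rule real_sqrt_sum_squares_triangle_ineq)
  finally show "sobolev_norm (Suc p) (x + y) \<le> sobolev_norm (Suc p) x + sobolev_norm (Suc p) y" .
 qed
qed

lemma sobolev_Suc_subset: "sobolev (Suc p) \<subseteq> sobolev p"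
proof (induction p)
 case (Suc p)
 show ?case
 proof
  fix u assume "u \<in> sobolev (Suc (Suc p))"
  then obtain c v where "u = ac c v" "v \<in> sobolev (Suc p)" unfolding sobolev_Suc_iff[of u "Suc p"] by blast
  then show "u \<in> sobolev (Suc p)" using Suc unfolding sobolev_Suc_iff[of u p] by blast
 qed
qed simp

lemma sobolev_norm_mono: "sobolev_norm p u \<le> sobolev_norm (Suc p) u"
 unfolding sobolev_norm_def by (intro real_sqrt_le_mono sum_mono2) auto

lemma nlinear_incl: "nlinear (S (Suc p)) (S p) (%u. u)"
 unfolding nlinear_def using sobolev_Suc_subset sobolev_norm_mono by (auto intro!: exI[of _ 1])

lemma norm_le_sobolev_norm: "norm u \<le> sobolev_norm p u"
proof (induction p)
 case (Suc p) then show ?case using sobolev_norm_mono[of p u] by simp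
qed simp

lemma nlinear_L2: "nlinear (S p) tsp (%u. u)"
 unfolding nlinear_def using norm_le_sobolev_norm by (auto intro!: exI[of _ 1])

lemma weak_deriv_norm: "sobolev_norm p (weak_deriv u) \<le> sobolev_norm (Suc p) u"
 unfolding sobolev_norm_Suc by (rule real_le_rsqrt) simp

lemma nlinear_weak_deriv: "nlinear (S (Suc p)) (S p) weak_deriv"
 unfolding nlinear_def using weak_deriv_norm weak_deriv_mem weak_deriv_lin
 by (auto intro!: exI[of _ 1])

lemma sobolev_norm_Suc_le: "sobolev_norm (Suc p) u \<le> norm u + sobolev_norm p (weak_deriv u)"
 unfolding sobolev_norm_Suc by (rule sqrt_sum_squares_le_sum) (auto simp: sobolev_norm_nonneg)

definition Il :: "ltwo => ltwo" where "Il v = emb (I v)"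

lemma bounded_linear_Il: "bounded_linear Il"
 unfolding Il_def[abs_def] by (rule bounded_linear_compose[OF bounded_linear_emb bounded_linear_I])

lemma Il_ac: "Il v = ac 0 v" by (simp add: Il_def)

lemma nlinear_Il: "nlinear (S p) (S (Suc p)) Il"
proof -
 interpret L: bounded_linear Il by (rule bounded_linear_Il)
 obtain C where C: "!!v. norm (Il v) \<le> norm v * C" using L.bounded by blast
 have "sobolev_norm (Suc p) (Il v) \<le> (\<bar>C\<bar> + 1) * sobolev_norm p v" for v
 proof -
  have "sobolev_norm (Suc p) (Il v) \<le> norm (Il v) + sobolev_norm p v"
   using sobolev_norm_Suc_le[of p "ac 0 v"] unfolding Il_ac weak_deriv_ac .
  also have "norm (Il v) \<le> norm v * C" by (rule C)
  also have "\<dots> \<le> sobolev_norm p v * \<bar>C\<bar>" by (rule order_trans[OF mult_left_mono[OF abs_ge_self norm_ge_zero] mult_right_mono[OF norm_le_sobolev_norm abs_ge_zero]])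
  finally show ?thesis by (simp add: algebra_simps)
 qed
 moreover have "Il v \<in> sobolev (Suc p)" if "v \<in> sobolev p" for v unfolding sobolev_Suc_iff Il_ac using that by blast
 ultimately show ?thesis unfolding nlinear_def by (auto simp: L.add L.scaleR)
qed

lemma nlinear_K: "nlinear tsp (S p) (%c. emb (K c))"
proof -
 interpret e: bounded_linear emb by (rule bounded_linear_emb)
 interpret I: bounded_linear I by (rule bounded_linear_I)
 have K: "emb (K c) = ac c 0" for c by (simp add: I.zero)
 have eq: "emb (K c) = c *\<^sub>R emb (K 1)" for c using K_scale[of c 1] by (simp add: e.scaleR)
 have m: "emb (K c) \<in> sobolev p" for c
 proof (cases p)
  case (Suc q) then show ?thesis using K subspace_0[OF subspace_sobolev] sobolev_Suc_iff by blast
 qed simp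
 have "emb (K (a *\<^sub>R x + b *\<^sub>R y)) = a *\<^sub>R emb (K x) + b *\<^sub>R emb (K y)" for a b x y
  unfolding eq[of "a *\<^sub>R x + b *\<^sub>R y"] eq[of x] eq[of y] by (simp add: algebra_simps)
 moreover have "sobolev_norm p (emb (K c)) \<le> sobolev_norm p (emb (K 1)) * norm c" for c
  unfolding eq[of c] using nspaceD(5)[OF nspace_S[of p], of "emb (K 1)" c] m by simp
 ultimately show ?thesis unfolding nlinear_def using m by auto
qed

text \<open>The Sobolev embedding into continuous functions. The constant in \<open>ac c v\<close>
  is estimated in L2, as the difference of the element and the primitive of its derivative; the
  primitive is bounded pointwise by \<open>I_bound\<close>.\<close>

lemma nlinear_cr: "nlinear (S (Suc p)) tsp cr"
proof -
 interpret I: bounded_linear I by (rule bounded_linear_I)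
 obtain C where C: "!!v. norm (Il v) \<le> norm v * C" using bounded_linear.bounded[OF bounded_linear_Il] by blast
 have lin: "cr (a *\<^sub>R x + b *\<^sub>R y) = a *\<^sub>R cr x + b *\<^sub>R cr y" if xy: "x \<in> sobolev (Suc p)" "y \<in> sobolev (Suc p)" for a b x y
 proof -
  obtain c v d w where e: "x = ac c v" "y = ac d w" using xy unfolding sobolev_Suc_iff by blast
  show ?thesis unfolding e ac_lin cr_ac by (simp add: I.add I.scaleR K_add K_scale algebra_simps)
 qed
 have "norm (cr x) \<le> (inverse (sqrt TT) * (1 + \<bar>C\<bar>) + sqrt TT) * sobolev_norm (Suc p) x" if x: "x \<in> sobolev (Suc p)" for x
 proof -
  obtain c v where e: "x = ac c v" using x unfolding sobolev_Suc_iff by blast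
  have nv: "norm v \<le> sobolev_norm (Suc p) x"
   using weak_deriv_norm[of p x] norm_le_sobolev_norm[of v p] e by simp
  have nx: "norm x \<le> sobolev_norm (Suc p) x" by (rule norm_le_sobolev_norm)
  have "emb (K c) = x - Il v" unfolding e Il_def by (simp add: linear_simps[OF bounded_linear_emb])
  then have "norm (emb (K c)) \<le> norm x + norm (Il v)" using norm_triangle_ineq4 by metis
  also have "\<dots> \<le> norm x + norm v * \<bar>C\<bar>" using order_trans[OF C[of v] mult_left_mono[OF abs_ge_self norm_ge_zero]] by (rule add_left_mono)
  also have "\<dots> \<le> (1 + \<bar>C\<bar>) * sobolev_norm (Suc p) x"
   using nx mult_right_mono[OF nv, of "\<bar>C\<bar>"] by (simp add: algebra_simps)
  finally have "sqrt TT * \<bar>c\<bar> \<le> (1 + \<bar>C\<bar>) * sobolev_norm (Suc p) x"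
   using norm_const[of c] by (simp add: emb_def const_bcontfun.rep_eq)
  then have "inverse (sqrt TT) * (sqrt TT * \<bar>c\<bar>) \<le> inverse (sqrt TT) * ((1 + \<bar>C\<bar>) * sobolev_norm (Suc p) x)"
   by (intro mult_left_mono) auto
  then have c: "\<bar>c\<bar> \<le> inverse (sqrt TT) * (1 + \<bar>C\<bar>) * sobolev_norm (Suc p) x"
   by (simp add: mult.assoc[symmetric])
  have "norm (cr x) \<le> norm (K c) + norm (I v)" unfolding e cr_ac by (rule norm_triangle_ineq)
  also have "norm (K c) \<le> \<bar>c\<bar>" by (rule norm_bound) simp
  also have "norm (I v) \<le> sqrt TT * norm v" by (rule norm_bound) (use I_bound in simp)
  also have "\<dots> \<le> sqrt TT * sobolev_norm (Suc p) x" using nv by (intro mult_left_mono) auto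
  finally show ?thesis using c by (simp add: algebra_simps)
 qed
 then show ?thesis unfolding nlinear_def using lin by (auto)
qed

text \<open>An asymmetric product: the first factor may be any L2 class, while the second one enters
  through its continuous representative, which has its intended meaning from the first Sobolev space
  on.\<close>

definition pm :: "ltwo => ltwo => ltwo" where "pm u v = mulL u (cr v)"

lemma pm_ac: "pm (ac a u) (ac b v) = ac (a * b) (pm u (ac b v) + pm v (ac a u))"
 unfolding pm_def cr_ac mulL_emb AC_parts ..

lemma emb_cr: "u \<in> sobolev (Suc p) ==> emb (cr u) = u"
 unfolding sobolev_Suc_iff by auto

text \<open>H^j is a module over H^(j+1). Asking one order more of the second factor includes the
  case j = 0 and fits the induction: in u' v + v' u both products again consist of a factor of some
  order and a factor of one order more.\<close>

lemma nbilinear_pm: "nbilinear (S j) (S (Suc j)) (S j) pm"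
proof -
 interpret l: bounded_bilinear mulL by (rule bounded_bilinear_mulL)
 have bnd: "\<exists>C\<ge>0. \<forall>u\<in>sobolev j. \<forall>v\<in>sobolev (Suc j). pm u v \<in> sobolev j \<and> sobolev_norm j (pm u v) \<le> C * sobolev_norm j u * sobolev_norm (Suc j) v"
 proof (induction j)
  case 0
  obtain D where D: "!!v. v \<in> sobolev (Suc 0) ==> norm (cr v) \<le> D * sobolev_norm (Suc 0) v"
   using nlinear_cr[of 0] unfolding nlinear_def S_simps tsp_simps by blast
  have "norm (pm u v) \<le> \<bar>D\<bar> * norm u * sobolev_norm (Suc 0) v" if "v \<in> sobolev (Suc 0)" for u v
  proof -
   have "norm (pm u v) \<le> norm u * norm (cr v)" unfolding pm_def by (rule mulL_norm)
   also have "\<dots> \<le> norm u * (\<bar>D\<bar> * sobolev_norm (Suc 0) v)"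
    by (rule mult_left_mono[OF order_trans[OF D[OF that] mult_right_mono[OF abs_ge_self sobolev_norm_nonneg]] norm_ge_zero])
   finally show ?thesis by (simp add: algebra_simps)
  qed
  then show ?case by (intro exI[of _ "\<bar>D\<bar>"]) auto
 next
  case (Suc j)
  then obtain C where C: "C \<ge> 0" "!!u v. u \<in> sobolev j ==> v \<in> sobolev (Suc j) ==> pm u v \<in> sobolev j \<and> sobolev_norm j (pm u v) \<le> C * sobolev_norm j u * sobolev_norm (Suc j) v" by blast
  obtain D where D: "!!v. v \<in> sobolev (Suc j) ==> norm (cr v) \<le> D * sobolev_norm (Suc j) v"
   using nlinear_cr[of j] unfolding nlinear_def S_simps tsp_simps by blast
  show ?case
  proof (intro exI[of _ "\<bar>D\<bar> + 2 * C"] conjI ballI)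
   show "0 \<le> \<bar>D\<bar> + 2 * C" using C by simp
   fix u v assume uv: "u \<in> sobolev (Suc j)" "v \<in> sobolev (Suc (Suc j))"
   obtain a u' where u: "u = ac a u'" "u' \<in> sobolev j" using uv unfolding sobolev_Suc_iff by blast
   obtain b v' where v: "v = ac b v'" "v' \<in> sobolev (Suc j)" using uv(2) unfolding sobolev_Suc_iff[of _ "Suc j"] by blast
   have v1: "v \<in> sobolev (Suc j)" "v' \<in> sobolev j" using uv v sobolev_Suc_subset by blast+
   have eq: "pm u v = ac (a * b) (pm u' v + pm v' u)" unfolding u v by (rule pm_ac)
   have m: "pm u' v \<in> sobolev j" "pm v' u \<in> sobolev j" using C(2)[OF u(2) v1(1)] C(2)[OF v1(2) uv(1)] by auto
   then have m2: "pm u' v + pm v' u \<in> sobolev j" by (rule subspace_add[OF subspace_sobolev])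
   then show "pm u v \<in> sobolev (Suc j)" unfolding eq sobolev_Suc_iff by blast
   let ?U = "sobolev_norm (Suc j) u" and ?V = "sobolev_norm (Suc (Suc j)) v"
   have n: "norm u \<le> ?U" "sobolev_norm j u' \<le> ?U" "sobolev_norm (Suc j) v \<le> ?V" "sobolev_norm j v' \<le> ?V" "0 \<le> ?U" "0 \<le> ?V"
    using norm_le_sobolev_norm[of u "Suc j"] weak_deriv_norm[of j u] sobolev_norm_mono[of "Suc j" v]
     weak_deriv_norm[of "Suc j" v] sobolev_norm_mono[of j v'] u v by (auto simp: sobolev_norm_nonneg)
   have "norm (pm u v) \<le> norm u * norm (cr v)" unfolding pm_def by (rule mulL_norm)
   also have "\<dots> \<le> ?U * (\<bar>D\<bar> * ?V)"
   proof (rule mult_mono[OF n(1)])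
    have "norm (cr v) \<le> D * sobolev_norm (Suc j) v" by (rule D[OF v1(1)])
    also have "\<dots> \<le> \<bar>D\<bar> * ?V" using n by (intro mult_mono) (auto simp: sobolev_norm_nonneg)
    finally show "norm (cr v) \<le> \<bar>D\<bar> * ?V" .
   qed (use n in auto)
   finally have 1: "norm (pm u v) \<le> \<bar>D\<bar> * (?U * ?V)" by (simp add: algebra_simps)
   have 2: "sobolev_norm j (pm u' v) \<le> C * (?U * ?V)"
   proof -
    have "sobolev_norm j (pm u' v) \<le> C * (sobolev_norm j u' * sobolev_norm (Suc j) v)" using C(2)[OF u(2) v1(1)] by (simp add: mult.assoc)
    also have "\<dots> \<le> C * (?U * ?V)" using n C(1) by (intro mult_left_mono mult_mono) (auto simp: sobolev_norm_nonneg)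
    finally show ?thesis .
   qed
   have 3: "sobolev_norm j (pm v' u) \<le> C * (?U * ?V)"
   proof -
    have "sobolev_norm j (pm v' u) \<le> C * (sobolev_norm j v' * ?U)" using C(2)[OF v1(2) uv(1)] by (simp add: mult.assoc)
    also have "\<dots> \<le> C * (?V * ?U)" using n C(1) by (intro mult_left_mono mult_right_mono) auto
    finally show ?thesis by (simp add: mult.commute)
   qed
   have "sobolev_norm (Suc j) (pm u v) \<le> norm (pm u v) + sobolev_norm j (pm u' v + pm v' u)"
    using sobolev_norm_Suc_le[of j "pm u v"] eq by simp
   also have "sobolev_norm j (pm u' v + pm v' u) \<le> sobolev_norm j (pm u' v) + sobolev_norm j (pm v' u)"
    using nspaceD(4)[OF nspace_S[of j]] m by simp
   finally show "sobolev_norm (Suc j) (pm u v) \<le> (\<bar>D\<bar> + 2 * C) * ?U * ?V" using 1 2 3 by (simp add: algebra_simps)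
  qed
 qed
 have crl: "cr (r *\<^sub>R x + s *\<^sub>R y) = r *\<^sub>R cr x + s *\<^sub>R cr y" if "x \<in> sobolev (Suc j)" "y \<in> sobolev (Suc j)" for r s x y
  using nlinear_cr[of j] that unfolding nlinear_def S_simps by blast
 show ?thesis unfolding nbilinear_def S_simps
 proof (intro conjI ballI allI)
  fix x y y' r s assume "y \<in> sobolev (Suc j)" "y' \<in> sobolev (Suc j)"
  then show "pm x (r *\<^sub>R y + s *\<^sub>R y') = r *\<^sub>R pm x y + s *\<^sub>R pm x y'"
   unfolding pm_def by (simp only: crl l.add_right l.scaleR_right)
 next
  fix x x' y r s
  show "pm (r *\<^sub>R x + s *\<^sub>R x') y = r *\<^sub>R pm x y + s *\<^sub>R pm x' y"
   unfolding pm_def by (simp only: l.add_left l.scaleR_left)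
 qed (use bnd in blast)+
qed

section \<open>The Volterra equation and the fundamental solutions\<close>

instance bcontfun :: (metric_space, banach) banach ..

lemma bounded_bilinear_compose_linear:
 assumes L: "bounded_linear L" and b: "bounded_bilinear b"
 shows "bounded_bilinear (%x y. L (b x y))"
proof -
 interpret L: bounded_linear L by (rule L)
 interpret b: bounded_bilinear b by (rule b)
 obtain C where C: "C \<ge> 0" "!!x. norm (L x) \<le> norm x * C" using L.nonneg_bounded by blast
 obtain D where D: "!!x y. norm (b x y) \<le> norm x * norm y * D" using b.bounded by blast
 show ?thesis
 proof (rule bounded_bilinear.intro)
  show "\<exists>K. \<forall>x y. norm (L (b x y)) \<le> norm x * norm y * K"
  proof (intro exI[of _ "D * C"] allI)
   fix x y
   have "norm (L (b x y)) \<le> norm (b x y) * C" by (rule C)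
   also have "\<dots> \<le> norm x * norm y * D * C" by (rule mult_right_mono[OF D C(1)])
   finally show "norm (L (b x y)) \<le> norm x * norm y * (D * C)" by (simp add: mult.assoc)
  qed
 qed (simp_all add: b.add_left b.add_right b.scaleR_left b.scaleR_right L.add L.scaleR)
qed

text \<open>The equation v'' = q v with given initial values is v = f + \<open>Bop q v\<close>,
  where f is the affine function with these values.\<close>

definition Bop :: "ltwo => cfun => cfun" where "Bop q f = I (emb (I (mulL q f)))"

lemma bounded_bilinear_Bop: "bounded_bilinear Bop"
 unfolding Bop_def[abs_def]
 by (rule bounded_bilinear_compose_linear[OF bounded_linear_I bounded_bilinear_compose_linear[OF bounded_linear_emb
   bounded_bilinear_compose_linear[OF bounded_linear_I bounded_bilinear_mulL]]])

definition Bb :: "ltwo => cfun \<Rightarrow>\<^sub>L cfun" where "Bb q = Blinfun (Bop q)"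

lemma Bb_apply [simp]: "blinfun_apply (Bb q) f = Bop q f"
 unfolding Bb_def by (simp add: bounded_linear_Blinfun_apply bounded_bilinear.bounded_linear_right[OF bounded_bilinear_Bop])

lemma bounded_linear_Bb: "bounded_linear Bb"
proof -
 interpret B: bounded_bilinear Bop by (rule bounded_bilinear_Bop)
 obtain C where C: "C \<ge> 0" "!!q f. norm (Bop q f) \<le> norm q * norm f * C" using B.nonneg_bounded by blast
 show ?thesis
 proof (rule bounded_linear_intro[where K = C])
  show "norm (Bb q) \<le> norm q * C" for q
   by (rule norm_blinfun_bound) (use C in \<open>auto simp: algebra_simps\<close>)
 qed (auto intro!: blinfun_eqI simp: B.add_left B.scaleR_left blinfun.bilinear_simps)
qed

primrec Bp :: "ltwo => nat => cfun \<Rightarrow>\<^sub>L cfun" where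
 "Bp q 0 = id_blinfun"
| "Bp q (Suc n) = Bb q o\<^sub>L Bp q n"

lemma Bp_comm: "Bp q n o\<^sub>L Bb q = Bb q o\<^sub>L Bp q n"
proof (induction n)
 case (Suc n)
 have "blinfun_apply (Bp q n) (Bop q f) = Bop q (blinfun_apply (Bp q n) f)" for f
  using arg_cong[OF Suc, of "%T. blinfun_apply T f"] by simp
 then show ?case by (auto intro!: blinfun_eqI)
qed (auto intro!: blinfun_eqI)

lemma mulL_I_bound:
 fixes f :: cfun
 assumes f: "!!s. s \<in> {0..t} ==> \<bar>f s\<bar> \<le> M" and t: "t \<in> {0..TT}"
 shows "\<bar>I (mulL q f) t\<bar> \<le> sqrt TT * norm q * M"
proof -
 have M: "0 \<le> M" using f[of 0] t by auto
 have i: "(%x. \<bar>rep_ltwo q x\<bar>) integrable_on {0..t}" using t by (intro sq_int_on[OF sq_abs[OF sq_rep]]) auto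
 have "\<bar>I (mulL q f) t\<bar> = norm (integral {0..t} (%x. rep_ltwo q x * f x))" using cl_id[OF t] by (simp add: I_mulL)
 also have "\<dots> \<le> integral {0..t} (%x. \<bar>rep_ltwo q x\<bar> * M)"
 proof (rule integral_norm_bound_integral)
  show "(%x. rep_ltwo q x * f x) integrable_on {0..t}" using t by (intro sq_int_on[OF mulL_sq]) auto
  show "(%x. \<bar>rep_ltwo q x\<bar> * M) integrable_on {0..t}" using i by (rule integrable_on_mult_left)
  show "norm (rep_ltwo q x * f x) \<le> \<bar>rep_ltwo q x\<bar> * M" if "x \<in> {0..t}" for x
   using f[OF that] by (simp add: abs_mult mult_left_mono)
 qed
 also have "\<dots> = integral {0..t} (%x. \<bar>rep_ltwo q x\<bar>) * M" by simp
 also have "\<dots> \<le> (sqrt TT * norm q) * M"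
 proof (rule mult_right_mono[OF _ M])
  have "integral {0..t} (%x. \<bar>rep_ltwo q x\<bar>) \<le> integral {0..TT} (%x. \<bar>rep_ltwo q x\<bar>)"
   using t by (intro integral_subset_le i sq_int_on[OF sq_abs[OF sq_rep]]) auto
  then show "integral {0..t} (%x. \<bar>rep_ltwo q x\<bar>) \<le> sqrt TT * norm q" using L1_le[of q] by simp
 qed
 finally show ?thesis .
qed

lemma Bop_cl: "Bop q f (cl t) = Bop q f t"
 by (simp add: Bop_def I_cl)

text \<open>Each application integrates twice. The inner integral is estimated by the L1 norm of the
  potential and contributes a constant; the outer one alone produces t^n / n!.\<close>

lemma Bp_bound:
 assumes t: "t \<in> {0..TT}"
 shows "\<bar>blinfun_apply (Bp q n) f t\<bar> \<le> norm f * ((sqrt TT * norm q) ^ n * t ^ n / fact n)"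
 using t
proof (induction n arbitrary: t)
 case 0 then show ?case using abs_apply_le[of f t] by simp
next
 case (Suc n)
 let ?\<kappa> = "sqrt TT * norm q" let ?g = "blinfun_apply (Bp q n) f"
 let ?c = "norm f * (?\<kappa> ^ n / fact n)"
 have k: "0 \<le> ?\<kappa>" by simp
 have c: "0 \<le> ?c" using k by simp
 have 1: "\<bar>I (mulL q ?g) s\<bar> \<le> ?\<kappa> * ?c * s ^ n" if s: "s \<in> {0..TT}" for s
 proof -
  have "\<bar>I (mulL q ?g) s\<bar> \<le> ?\<kappa> * (?c * s ^ n)"
  proof (rule mulL_I_bound[OF _ s])
   fix r assume r: "r \<in> {0..s}"
   have "\<bar>?g r\<bar> \<le> ?c * r ^ n" using Suc.IH[of r] r s by simp
   also have "\<dots> \<le> ?c * s ^ n" using r c by (intro mult_left_mono power_mono) auto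
   finally show "\<bar>?g r\<bar> \<le> ?c * s ^ n" .
  qed
  then show ?thesis by (simp add: mult.assoc)
 qed
 have pw: "((%s. ?\<kappa> * ?c * s ^ n) has_integral ?\<kappa> * ?c * (t ^ Suc n / real (Suc n))) {0..t}"
 proof -
  have "((%s. s ^ n) has_integral (t ^ Suc n / real (Suc n) - 0 ^ Suc n / real (Suc n))) {0..t}"
  proof (rule fundamental_theorem_of_calculus)
   fix x assume "x \<in> {0..t}"
   have "((%x. x ^ Suc n / real (Suc n)) has_real_derivative x ^ n) (at x within {0..t})"
    by (auto intro!: derivative_eq_intros simp del: power_Suc)
   then show "((%x. x ^ Suc n / real (Suc n)) has_vector_derivative x ^ n) (at x within {0..t})"
    by (simp add: has_real_derivative_iff_has_vector_derivative)
  qed (use Suc.prems in auto)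
  moreover have "t ^ Suc n / real (Suc n) - 0 ^ Suc n / real (Suc n) = t ^ Suc n / real (Suc n)" by simp
  ultimately have "((%s. s ^ n) has_integral (t ^ Suc n / real (Suc n))) {0..t}" by (simp only:)
  from has_integral_mult_right[OF this, of "?\<kappa> * ?c"] show ?thesis .
 qed
 have "\<bar>blinfun_apply (Bp q (Suc n)) f t\<bar> = norm (integral {0..t} (I (mulL q ?g)))"
  using cl_id[OF Suc.prems] by (simp add: Bop_def I_emb)
 also have "\<dots> \<le> integral {0..t} (%s. ?\<kappa> * ?c * s ^ n)"
 proof (rule integral_norm_bound_integral)
  show "apply_bcontfun (I (mulL q ?g)) integrable_on {0..t}"
   by (rule integrable_continuous_interval) (rule continuous_on_apply_bcontfun)
  show "(%s. ?\<kappa> * ?c * s ^ n) integrable_on {0..t}" using pw by blast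
  show "norm (I (mulL q ?g) s) \<le> ?\<kappa> * ?c * s ^ n" if "s \<in> {0..t}" for s
   using 1[of s] that Suc.prems by auto
 qed
 also have "\<dots> = ?\<kappa> * ?c * (t ^ Suc n / real (Suc n))" using pw by (rule integral_unique)
 also have "\<dots> = norm f * (?\<kappa> ^ Suc n * t ^ Suc n / fact (Suc n))" by (simp add: field_simps)
 finally show ?case .
qed

lemma Bp_cl: "blinfun_apply (Bp q (Suc n)) f (cl t) = blinfun_apply (Bp q (Suc n)) f t"
 by (simp add: Bop_cl)

lemma Bp_norm: "norm (Bp q n) \<le> (sqrt TT * norm q * TT) ^ n / fact n"
proof (rule norm_blinfun_bound)
 fix f :: cfun
 show "norm (blinfun_apply (Bp q n) f) \<le> (sqrt TT * norm q * TT) ^ n / fact n * norm f"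
 proof (cases n)
  case (Suc m)
  show ?thesis
  proof (rule norm_bound)
   fix t
   have "\<bar>blinfun_apply (Bp q n) f (cl t)\<bar> \<le> norm f * ((sqrt TT * norm q) ^ n * cl t ^ n / fact n)"
    by (rule Bp_bound) simp
   also have "\<dots> \<le> norm f * ((sqrt TT * norm q) ^ n * TT ^ n / fact n)"
    by (intro mult_left_mono divide_right_mono power_mono) auto
   also have "\<dots> = (sqrt TT * norm q * TT) ^ n / fact n * norm f" by (simp add: power_mult_distrib)
   finally show "norm (blinfun_apply (Bp q n) f t) \<le> (sqrt TT * norm q * TT) ^ n / fact n * norm f"
    using Bp_cl[of q m f t] Suc by (simp del: Bp.simps)
  qed
 qed simp
qed simp

text \<open>The resolvent of the Volterra operator, as a Neumann series.\<close>

definition R :: "ltwo => cfun \<Rightarrow>\<^sub>L cfun" where "R q = (\<Sum>n. Bp q n)"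

lemma exp_sums: "(%n. x ^ n / fact n) sums exp (x::real)"
 using exp_converges[of x] by (simp add: field_simps)

lemma R_summable: "summable (Bp q)" and R_norm: "norm (R q) \<le> exp (sqrt TT * norm q * TT)"
proof -
 let ?x = "sqrt TT * norm q * TT"
 have s: "summable (%n. norm (Bp q n))"
  by (rule summable_comparison_test[OF _ sums_summable[OF exp_sums[of ?x]]]) (use Bp_norm in auto)
 then show "summable (Bp q)" by (rule summable_norm_cancel)
 have "norm (R q) \<le> (\<Sum>n. norm (Bp q n))" unfolding R_def by (rule summable_norm[OF s])
 also have "\<dots> \<le> (\<Sum>n. ?x ^ n / fact n)" by (rule suminf_le[OF Bp_norm s sums_summable[OF exp_sums]])
 also have "\<dots> = exp ?x" using sums_unique[OF exp_sums] by simp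
 finally show "norm (R q) \<le> exp ?x" .
qed

lemma R_left: "R q = id_blinfun + (Bb q o\<^sub>L R q)"
proof -
 have bl: "bounded_linear (%x. Bb q o\<^sub>L x)" by (rule bounded_bilinear.bounded_linear_right[OF bounded_bilinear_blinfun_compose])
 have "(\<Sum>n. Bp q (Suc n)) = Bb q o\<^sub>L R q"
  unfolding R_def using bounded_linear.suminf[OF bl R_summable] by simp
 then have "Bb q o\<^sub>L R q = R q - id_blinfun" unfolding R_def using suminf_split_head[OF R_summable, of q] by simp
 then show ?thesis by (simp add: algebra_simps)
qed

lemma R_right: "R q = id_blinfun + (R q o\<^sub>L Bb q)"
proof -
 have bl: "bounded_linear (%x. x o\<^sub>L Bb q)" by (rule bounded_bilinear.bounded_linear_left[OF bounded_bilinear_blinfun_compose])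
 have "(\<Sum>n. Bp q (Suc n)) = R q o\<^sub>L Bb q"
  unfolding R_def using bounded_linear.suminf[OF bl R_summable] by (simp add: Bp_comm)
 then have "R q o\<^sub>L Bb q = R q - id_blinfun" unfolding R_def using suminf_split_head[OF R_summable, of q] by simp
 then show ?thesis by (simp add: algebra_simps)
qed

lemma R_solves: "R q f = f + Bop q (R q f)"
proof -
 have "blinfun_apply (R q) f = blinfun_apply (id_blinfun + (Bb q o\<^sub>L R q)) f" by (rule arg_cong[OF R_left])
 also have "\<dots> = f + Bop q (R q f)" by (simp add: blinfun.add_left)
 finally show ?thesis .
qed

lemma R_unique: "g = f + Bop q g ==> g = R q f"
proof -
 assume g: "g = f + Bop q g"
 have "blinfun_apply (R q) g = blinfun_apply (id_blinfun + (R q o\<^sub>L Bb q)) g" by (rule arg_cong[OF R_right])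
 also have "\<dots> = g + R q (Bop q g)" by (simp add: blinfun.add_left)
 finally have 1: "R q g = g + R q (Bop q g)" .
 have "R q g = R q (f + Bop q g)" by (rule arg_cong[OF g])
 also have "\<dots> = R q f + R q (Bop q g)" by (rule blinfun.add_right)
 finally have "g + R q (Bop q g) = R q f + R q (Bop q g)" unfolding 1 .
 then show ?thesis by (rule add_right_imp_eq)
qed

text \<open>The second resolvent identity, read off from uniqueness of the solution. Applied twice
  it leaves a remainder quadratic in h, which proves \<open>R_deriv\<close>.\<close>

lemma R_resolvent: "R (q + h) - R q = R (q + h) o\<^sub>L Bb h o\<^sub>L R q"
proof (rule blinfun_eqI)
 fix f
 interpret B: bounded_bilinear Bop by (rule bounded_bilinear_Bop)
 let ?g = "R q f"
 have "?g = (f - Bop h ?g) + Bop (q + h) ?g"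
  using R_solves[of q f] by (simp add: B.add_left)
 then have "?g = R (q + h) (f - Bop h ?g)" by (rule R_unique)
 also have "\<dots> = R (q + h) f - R (q + h) (Bop h ?g)" by (rule blinfun.diff_right)
 finally have "R (q + h) f - ?g = R (q + h) (Bop h ?g)"
  using eq_diff_eq[of ?g "R (q + h) f" "R (q + h) (Bop h ?g)"] diff_eq_eq[of "R (q + h) f" ?g "R (q + h) (Bop h ?g)"] by (metis add.commute)
 then show "blinfun_apply (R (q + h) - R q) f = blinfun_apply (R (q + h) o\<^sub>L Bb h o\<^sub>L R q) f"
  by (simp add: blinfun.bilinear_simps)
qed

lemma R_deriv: "(R has_derivative (%h. R q o\<^sub>L Bb h o\<^sub>L R q)) (at q)"
proof -
 interpret b: bounded_linear Bb by (rule bounded_linear_Bb)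
 obtain D where D: "D \<ge> 0" "!!h. norm (Bb h) \<le> norm h * D" using b.nonneg_bounded by blast
 define C where "C = exp (sqrt TT * (norm q + 1) * TT)"
 have RC: "norm (R (q + h)) \<le> C" if "norm h < 1" for h :: ltwo
 proof -
  have "norm (q + h) \<le> norm q + 1" using norm_triangle_ineq[of q h] that by simp
  then have "exp (sqrt TT * norm (q + h) * TT) \<le> C" unfolding C_def by (simp add: mult_left_mono)
  then show ?thesis using R_norm[of "q + h"] by simp
 qed
 have C0: "0 \<le> C" by (simp add: C_def)
 have R0: "norm (R q) \<le> C" using RC[of 0] by simp
 show ?thesis
 proof (rule has_derivative_quadratic[where d = 1 and C = "C * D * C * D * C"])
  show "bounded_linear (%h. R q o\<^sub>L Bb h o\<^sub>L R q)"
   by (rule bounded_linear_compose[OF bounded_bilinear.bounded_linear_left[OF bounded_bilinear_blinfun_compose]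
     bounded_linear_compose[OF bounded_bilinear.bounded_linear_right[OF bounded_bilinear_blinfun_compose] bounded_linear_Bb]])
  fix h :: ltwo assume h: "norm h < 1"
  have cmp: "norm (a o\<^sub>L b) \<le> norm a * norm b" for a b :: "cfun \<Rightarrow>\<^sub>L cfun" by (rule norm_blinfun_compose)
  have "R (q + h) - R q - (R q o\<^sub>L Bb h o\<^sub>L R q) = (R (q + h) o\<^sub>L Bb h o\<^sub>L R q) - (R q o\<^sub>L Bb h o\<^sub>L R q)"
   by (simp only: R_resolvent)
  also have "\<dots> = (R (q + h) - R q) o\<^sub>L Bb h o\<^sub>L R q"
   by (auto intro!: blinfun_eqI simp: blinfun.bilinear_simps)
  also have "\<dots> = R (q + h) o\<^sub>L Bb h o\<^sub>L R q o\<^sub>L Bb h o\<^sub>L R q" by (simp only: R_resolvent)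
  finally have "norm (R (q + h) - R q - (R q o\<^sub>L Bb h o\<^sub>L R q)) \<le> norm (R (q + h)) * norm (Bb h) * norm (R q) * norm (Bb h) * norm (R q)"
   by (smt (verit) cmp mult_right_mono norm_ge_zero order_trans)
  also have "\<dots> \<le> C * (norm h * D) * C * (norm h * D) * C"
   using RC[OF h] R0 D C0 by (intro mult_mono) auto
  finally show "norm (R (q + h) - R q - (R q o\<^sub>L Bb h o\<^sub>L R q)) \<le> C * D * C * D * C * norm h * norm h" by (simp add: algebra_simps)
 qed simp
qed

text \<open>The derivative of \<open>R\<close> is a polynomial expression in \<open>R\<close>, so
  the bootstrap applies; through it the solutions depend smoothly on the potential.\<close>

lemma smooth_R: "smooth tsp tsp UNIV R"
proof (rule smooth_bootstrap_typed[where V = UNIV and \<gamma> = R and g = "%p h. p o\<^sub>L Bb h o\<^sub>L p"])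
 show "smooth (tsp \<otimes>\<^sub>n tsp) tsp (UNIV \<times> UNIV) (%z. fst z o\<^sub>L Bb (snd z) o\<^sub>L fst z)"
  by (intro smooth_bb[OF nspace_tt bounded_bilinear_blinfun_compose] smooth_bl[OF nspace_tt bounded_linear_Bb] smooth_tfst smooth_tsnd)
 show "p o\<^sub>L Bb (c *\<^sub>R h) o\<^sub>L p = c *\<^sub>R (p o\<^sub>L Bb h o\<^sub>L p)" for p h c
  by (auto intro!: blinfun_eqI simp: linear_simps[OF bounded_linear_Bb] blinfun.bilinear_simps bounded_bilinear.scaleR_left[OF bounded_bilinear_Bop])
qed (auto simp: R_deriv)

definition yid :: cfun where "yid = mk (%t. t)"

lemma yid_apply: "yid t = cl t" unfolding yid_def by (rule mk_apply) auto

lemma yid_eq: "yid = I (emb (K 1))"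
 by (rule bcontfun_eqI) (simp add: yid_apply I_emb)

text \<open>\<open>v1\<close> and \<open>v2\<close> are the solutions with initial values (1, 0) and
  (0, 1). Their derivatives \<open>z1\<close> and \<open>z2\<close> are defined by integrals, so
  that they are continuous functions for every square-integrable potential.\<close>

definition v1 :: "ltwo => cfun" where "v1 q = R q (K 1)"
definition v2 :: "ltwo => cfun" where "v2 q = R q yid"
definition z1 :: "ltwo => cfun" where "z1 q = I (mulL q (v1 q))"
definition z2 :: "ltwo => cfun" where "z2 q = K 1 + I (mulL q (v2 q))"

lemma v_eqs: "v1 q = K 1 + I (emb (z1 q))" "v2 q = I (emb (z2 q))"
proof -
 show "v1 q = K 1 + I (emb (z1 q))" using R_solves[of q "K 1"] by (simp add: v1_def z1_def Bop_def)
 have "v2 q = yid + I (emb (I (mulL q (v2 q))))" using R_solves[of q yid] by (simp add: v2_def Bop_def)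
 also have "\<dots> = I (emb (z2 q))" unfolding z2_def yid_eq by (simp add: linear_simps[OF bounded_linear_emb] linear_simps[OF bounded_linear_I])
 finally show "v2 q = I (emb (z2 q))" .
qed

lemma v_unique:
 assumes "f = K a + b *\<^sub>R yid + I (emb (I (mulL q f)))"
 shows "f = a *\<^sub>R v1 q + b *\<^sub>R v2 q"
proof -
 have "f = R q (K a + b *\<^sub>R yid)" by (rule R_unique) (use assms in \<open>simp add: Bop_def\<close>)
 also have "K a = a *\<^sub>R K 1" using K_scale[of a 1] by simp
 finally show ?thesis by (simp add: v1_def v2_def blinfun.bilinear_simps)
qed

text \<open>By the product rule v1 z2 and v2 z1 have the same derivative z1 z2 + q v1 v2, and their
  initial values differ by 1.\<close>

lemma wronskian: "v1 q t * z2 q t - v2 q t * z1 q t = 1"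
proof -
 interpret l: bounded_bilinear mulL by (rule bounded_bilinear_mulL)
 have "ymul (v1 q) (z2 q) = ymul (K 1 + I (emb (z1 q))) (K 1 + I (mulL q (v2 q)))" using v_eqs by (simp add: z2_def)
 also have "\<dots> = K 1 + I (mulL (emb (z1 q)) (z2 q) + mulL (mulL q (v2 q)) (v1 q))"
  unfolding AC_parts by (simp add: z2_def[symmetric] v_eqs(1)[symmetric])
 finally have 1: "ymul (v1 q) (z2 q) = K 1 + I (emb (ymul (z1 q) (z2 q)) + mulL q (ymul (v2 q) (v1 q)))" by (simp add: mulL_emb mulL_mulL)
 have "ymul (v2 q) (z1 q) = ymul (K 0 + I (emb (z2 q))) (K 0 + I (mulL q (v1 q)))" using v_eqs by (simp add: z1_def)
 also have "\<dots> = K 0 + I (mulL (emb (z2 q)) (z1 q) + mulL (mulL q (v1 q)) (v2 q))"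
  unfolding AC_parts using v_eqs(2) by (simp add: z1_def)
 finally have 2: "ymul (v2 q) (z1 q) = I (emb (ymul (z2 q) (z1 q)) + mulL q (ymul (v1 q) (v2 q)))" by (simp add: mulL_emb mulL_mulL)
 have comm: "ymul f g = ymul g f" for f g by (auto intro!: bcontfun_eqI)
 have "ymul (v1 q) (z2 q) - ymul (v2 q) (z1 q) = K 1" unfolding 1 2 by (simp add: comm)
 then have "(ymul (v1 q) (z2 q) - ymul (v2 q) (z1 q)) t = K 1 t" by simp
 then show ?thesis by simp
qed

lemma v_cl: "v1 q (cl t) = v1 q t" "v2 q (cl t) = v2 q t" "z1 q (cl t) = z1 q t" "z2 q (cl t) = z2 q t"
proof -
 show "v1 q (cl t) = v1 q t" unfolding v_eqs(1)[of q] by (simp add: I_cl)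
 show "v2 q (cl t) = v2 q t" unfolding v_eqs(2)[of q] by (simp add: I_cl)
 show "z1 q (cl t) = z1 q t" unfolding z1_def by (simp add: I_cl)
 show "z2 q (cl t) = z2 q t" unfolding z2_def by (simp add: I_cl)
qed

definition rho :: "ltwo => cfun" where "rho q = ymul (v1 q) (v1 q) + ymul (v2 q) (v2 q)"

lemma rho_apply: "rho q t = v1 q t * v1 q t + v2 q t * v2 q t" by (simp add: rho_def)

lemma rho_pos: "rho q t > 0"
proof -
 have "v1 q t \<noteq> 0 \<or> v2 q t \<noteq> 0" using wronskian[of q t] by auto
 then show ?thesis unfolding rho_apply by (simp add: sum_squares_gt_zero_iff)
qed

lemma rho_cl: "rho q (cl t) = rho q t" by (simp add: rho_apply v_cl)

lemma rho_ypos: "rho q \<in> ypos"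
proof -
 have "\<exists>x\<in>{0..TT}. \<forall>y\<in>{0..TT}. rho q x \<le> rho q y"
  by (rule continuous_attains_inf) auto
 then obtain x where x: "!!y. y \<in> {0..TT} ==> rho q x \<le> rho q y" by blast
 have "rho q x \<le> rho q t" for t using x[of "cl t"] by (simp add: rho_cl)
 then show ?thesis using rho_pos[of q x] by (auto simp: ypos_def)
qed

lemma I_emb_deriv:
 fixes f :: cfun
 assumes t: "t \<in> {0..TT}"
 shows "(apply_bcontfun (I (emb f)) has_real_derivative f t) (at t within {0..TT})"
proof -
 have "((%u. integral {0..u} f) has_vector_derivative f t) (at t within {0..TT})"
  by (rule integral_has_vector_derivative) (use t in auto)
 then have "((%u. integral {0..u} f) has_real_derivative f t) (at t within {0..TT})"
  by (simp add: has_real_derivative_iff_has_vector_derivative)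
 then show ?thesis
  by (rule has_field_derivative_transform_within[where d = 1]) (use t in \<open>auto simp: I_emb cl_id\<close>)
qed

lemma FTC_real:
 fixes g :: cfun
 assumes "!!t. t \<in> {0..TT} ==> (f has_real_derivative g t) (at t within {0..TT})"
 shows "mk f = K (f 0) + I (emb g)"
proof -
 have "mk f = K (f 0) + I (emb (mk g))"
  by (rule cfun_FTC) (use assms in \<open>auto simp: has_real_derivative_iff_has_vector_derivative intro: continuous_on_apply_bcontfun\<close>)
 moreover have "emb (mk g) = emb g"
 proof -
  have "AE t in leb_int. mk g t = g t"
   by (rule AE_I2) (simp add: mk_apply[OF continuous_on_apply_bcontfun] cl_id)
  then show ?thesis unfolding emb_def using abs_eq_iff[OF sq_cfun sq_cfun] by blast
 qed
 ultimately show ?thesis by simp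
qed

lemma cfun_FTC_eq:
 fixes f g :: cfun
 assumes "!!t. f (cl t) = f t" "!!t. t \<in> {0..TT} ==> (apply_bcontfun f has_real_derivative g t) (at t within {0..TT})"
 shows "f = K (f 0) + I (emb g)"
proof -
 have "mk f = f" by (rule bcontfun_eqI) (simp add: mk_apply[OF continuous_on_apply_bcontfun] assms(1))
 then show ?thesis using FTC_real[OF assms(2)] by simp
qed

section \<open>The transform and its inverse\<close>

text \<open>\<open>E\<close> is the angular velocity, \<open>Th\<close> the angle, and W' is
  \<open>I x\<close>. \<open>W\<close> and W' vanish at 0 because the first row starts at (1, 0)
  with derivative (0, 1): radius 1 and no radial velocity. \<open>kx\<close> is the part of the
  potential that is continuous for every \<open>x\<close> in L2.\<close>

definition W :: "ltwo => cfun" where "W x = I (emb (I x))"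
definition E :: "ltwo => cfun" where "E x = yexp (W x)"
definition Th :: "ltwo => cfun" where "Th x = I (emb (E x))"
definition kx :: "ltwo => cfun" where "kx x = (1/4) *\<^sub>R ymul (I x) (I x) - yexp (2 *\<^sub>R W x)"
definition F :: "ltwo => ltwo" where "F x = (-1/2) *\<^sub>R x + emb (kx x)"

definition V1 :: "ltwo => cfun" where "V1 x = mk (%t. exp (- W x t / 2) * cos (Th x t))"
definition V2 :: "ltwo => cfun" where "V2 x = mk (%t. exp (- W x t / 2) * sin (Th x t))"
definition Z1 :: "ltwo => cfun" where "Z1 x = (-1/2) *\<^sub>R ymul (I x) (V1 x) - ymul (E x) (V2 x)"
definition Z2 :: "ltwo => cfun" where "Z2 x = (-1/2) *\<^sub>R ymul (I x) (V2 x) + ymul (E x) (V1 x)"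

lemma E_apply: "E x t = exp (W x t)" by (simp add: E_def)

lemma W_cl: "W x (cl t) = W x t" and Th_cl: "Th x (cl t) = Th x t" by (simp_all add: W_def Th_def I_cl)

lemma V_apply: "V1 x t = exp (- W x t / 2) * cos (Th x t)" "V2 x t = exp (- W x t / 2) * sin (Th x t)"
proof -
 have 1: "continuous_on {0..TT} (%t. exp (- W x t / 2) * cos (Th x t))" "continuous_on {0..TT} (%t. exp (- W x t / 2) * sin (Th x t))"
  by (intro continuous_intros continuous_on_apply_bcontfun; simp)+
 show "V1 x t = exp (- W x t / 2) * cos (Th x t)" "V2 x t = exp (- W x t / 2) * sin (Th x t)"
  unfolding V1_def V2_def mk_apply[OF 1(1)] mk_apply[OF 1(2)] W_cl Th_cl by (rule refl)+
qed

lemma W_deriv: "t \<in> {0..TT} ==> (apply_bcontfun (W x) has_real_derivative I x t) (at t within {0..TT})"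
 unfolding W_def by (rule I_emb_deriv)

lemma Th_deriv: "t \<in> {0..TT} ==> (apply_bcontfun (Th x) has_real_derivative exp (W x t)) (at t within {0..TT})"
 using I_emb_deriv[of t "E x"] by (simp add: Th_def E_apply)

lemma init0: "W x 0 = 0" "Th x 0 = 0" by (simp_all add: W_def Th_def I_zero)

lemma V1_eq: "V1 x = K 1 + I (emb (Z1 x))"
proof -
 have "V1 x = K (V1 x 0) + I (emb (Z1 x))"
 proof (rule cfun_FTC_eq)
  show "V1 x (cl t) = V1 x t" for t by (simp add: V_apply W_cl Th_cl)
  fix t assume t: "t \<in> {0..TT}"
  show "(apply_bcontfun (V1 x) has_real_derivative Z1 x t) (at t within {0..TT})"
   unfolding V_apply[abs_def] Z1_def
   by (auto intro!: derivative_eq_intros W_deriv[OF t] Th_deriv[OF t] simp: V_apply E_apply)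
 qed
 then show ?thesis by (simp add: V_apply init0)
qed

lemma V2_eq: "V2 x = I (emb (Z2 x))"
proof -
 have "V2 x = K (V2 x 0) + I (emb (Z2 x))"
 proof (rule cfun_FTC_eq)
  show "V2 x (cl t) = V2 x t" for t by (simp add: V_apply W_cl Th_cl)
  fix t assume t: "t \<in> {0..TT}"
  show "(apply_bcontfun (V2 x) has_real_derivative Z2 x t) (at t within {0..TT})"
   unfolding V_apply[abs_def] Z2_def
   by (auto intro!: derivative_eq_intros W_deriv[OF t] Th_deriv[OF t] simp: V_apply E_apply)
 qed
 then show ?thesis by (simp add: V_apply init0)
qed

lemma E_eq: "E x = K 1 + I (emb (ymul (I x) (E x)))"
proof -
 have "E x = K (E x 0) + I (emb (ymul (I x) (E x)))"
 proof (rule cfun_FTC_eq)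
  show "E x (cl t) = E x t" for t by (simp add: E_apply W_cl)
  fix t assume t: "t \<in> {0..TT}"
  show "(apply_bcontfun (E x) has_real_derivative ymul (I x) (E x) t) (at t within {0..TT})"
   unfolding E_apply[abs_def]
   by (auto intro!: derivative_eq_intros W_deriv[OF t] simp: E_apply)
 qed
 then show ?thesis by (simp add: E_apply init0)
qed

lemma F_mulL: "mulL (F x) f = (-1/2) *\<^sub>R mulL x f + emb (ymul (kx x) f)"
proof -
 interpret l: bounded_bilinear mulL by (rule bounded_bilinear_mulL)
 show ?thesis unfolding F_def by (simp only: l.add_left l.scaleR_left mulL_emb)
qed

lemma AC0: "ymul (I u) (K b + I v) = I (mulL u (K b + I v) + mulL v (I u))"
 using AC_parts[of 0 u b v] by simp

lemma AC00: "ymul (K a + I u) (I v) = I (mulL u (I v) + mulL v (K a + I u))"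
 using AC_parts[of a u 0 v] by simp

lemma exp_double: "exp (2 * a) = exp a * exp (a::real)"
 by (simp add: exp_add[symmetric])

text \<open>The second half of the differential equation. \<open>I x\<close> is only absolutely
  continuous, so the products in \<open>Z1\<close> are differentiated by the integrated product
  rule; the continuous contributions combine to \<open>kx\<close> and leave \<open>x\<close> with
  the factor -1/2.\<close>

lemma Z1_eq: "Z1 x = I (mulL (F x) (V1 x))"
proof -
 interpret I: bounded_linear I by (rule bounded_linear_I)
 interpret e: bounded_linear emb by (rule bounded_linear_emb)
 have 1: "ymul (I x) (V1 x) = I (mulL x (V1 x) + mulL (emb (Z1 x)) (I x))"
  using AC0[of x 1 "emb (Z1 x)"] by (simp only: V1_eq[symmetric])
 have 2: "ymul (E x) (V2 x) = I (mulL (emb (ymul (I x) (E x))) (V2 x) + mulL (emb (Z2 x)) (E x))"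
  using AC00[of 1 "emb (ymul (I x) (E x))" "emb (Z2 x)"] by (simp only: E_eq[symmetric] V2_eq[symmetric])
 have "Z1 x = (-1/2) *\<^sub>R ymul (I x) (V1 x) - ymul (E x) (V2 x)" by (rule Z1_def)
 also have "\<dots> = I ((-1/2) *\<^sub>R mulL x (V1 x) + emb ((-1/2) *\<^sub>R ymul (Z1 x) (I x) - ymul (ymul (I x) (E x)) (V2 x) - ymul (Z2 x) (E x)))"
  unfolding 1 2 by (simp add: mulL_emb I.add I.diff I.neg I.scaleR e.add e.diff e.neg e.scaleR algebra_simps)
 also have "(-1/2) *\<^sub>R ymul (Z1 x) (I x) - ymul (ymul (I x) (E x)) (V2 x) - ymul (Z2 x) (E x) = ymul (kx x) (V1 x)"
  by (rule bcontfun_eqI) (simp add: Z1_def Z2_def kx_def E_apply exp_double algebra_simps)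
 finally show ?thesis by (simp only: F_mulL)
qed

lemma Z2_eq: "Z2 x = K 1 + I (mulL (F x) (V2 x))"
proof -
 interpret I: bounded_linear I by (rule bounded_linear_I)
 interpret e: bounded_linear emb by (rule bounded_linear_emb)
 have 1: "ymul (I x) (V2 x) = I (mulL x (V2 x) + mulL (emb (Z2 x)) (I x))"
  using AC0[of x 0 "emb (Z2 x)"] by (simp add: V2_eq[symmetric])
 have 2: "ymul (E x) (V1 x) = K 1 + I (mulL (emb (ymul (I x) (E x))) (V1 x) + mulL (emb (Z1 x)) (E x))"
  using AC_parts[of 1 "emb (ymul (I x) (E x))" 1 "emb (Z1 x)"] by (simp only: E_eq[symmetric] V1_eq[symmetric] mult_1)
 have "Z2 x = (-1/2) *\<^sub>R ymul (I x) (V2 x) + ymul (E x) (V1 x)" by (rule Z2_def)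
 also have "\<dots> = K 1 + I ((-1/2) *\<^sub>R mulL x (V2 x) + emb ((-1/2) *\<^sub>R ymul (Z2 x) (I x) + ymul (ymul (I x) (E x)) (V1 x) + ymul (Z1 x) (E x)))"
  unfolding 1 2 by (simp add: mulL_emb I.add I.diff I.neg I.scaleR e.add e.diff e.neg e.scaleR algebra_simps)
 also have "(-1/2) *\<^sub>R ymul (Z2 x) (I x) + ymul (ymul (I x) (E x)) (V1 x) + ymul (Z1 x) (E x) = ymul (kx x) (V2 x)"
  by (rule bcontfun_eqI) (simp add: Z1_def Z2_def kx_def E_apply exp_double algebra_simps)
 finally show ?thesis by (simp only: F_mulL)
qed

text \<open>The Kepler transform: the solutions of the equation with potential \<open>F x\<close> in polar coordinates.\<close>

lemma kepler: "v1 (F x) = V1 x" "v2 (F x) = V2 x" "z1 (F x) = Z1 x" "z2 (F x) = Z2 x"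
proof -
 interpret I: bounded_linear I by (rule bounded_linear_I)
 interpret e: bounded_linear emb by (rule bounded_linear_emb)
 have "V1 x = K 1 + 0 *\<^sub>R yid + I (emb (I (mulL (F x) (V1 x))))" using V1_eq[of x] unfolding Z1_eq by simp
 from v_unique[OF this] show 1: "v1 (F x) = V1 x" by simp
 have "V2 x = K 0 + 1 *\<^sub>R yid + I (emb (I (mulL (F x) (V2 x))))" using V2_eq[of x] unfolding Z2_eq yid_eq by (simp add: e.add I.add)
 from v_unique[OF this] show 2: "v2 (F x) = V2 x" by simp
 show "z1 (F x) = Z1 x" "z2 (F x) = Z2 x" unfolding z1_def z2_def 1 2 by (simp_all only: Z1_eq Z2_eq)
qed

text \<open>In terms of the radius r of the first row, \<open>rr\<close> is 1/r^2, \<open>nn\<close>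
  is r r' and \<open>mm\<close> is r'/r. Thus \<open>kq\<close> is \<open>kx\<close> expressed by
  the solution instead of by x, and \<open>X\<close> solves F x = q for x after this
  replacement.\<close>

definition rr :: "ltwo => cfun" where "rr q = yinv (rho q)"
definition nn :: "ltwo => cfun" where "nn q = ymul (v1 q) (z1 q) + ymul (v2 q) (z2 q)"
definition mm :: "ltwo => cfun" where "mm q = ymul (nn q) (rr q)"
definition kq :: "ltwo => cfun" where "kq q = ymul (mm q) (mm q) - ymul (rr q) (rr q)"
definition X :: "ltwo => ltwo" where "X q = (-2) *\<^sub>R q + 2 *\<^sub>R emb (kq q)"

lemma rr_apply: "rr q t = inverse (rho q t)" unfolding rr_def by (rule yinv_apply[OF rho_ypos])

lemma rho_F: "rho (F x) t = exp (- W x t)"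
proof -
 have "rho (F x) t = exp (- W x t / 2) * exp (- W x t / 2) * ((cos (Th x t))\<^sup>2 + (sin (Th x t))\<^sup>2)"
  by (simp only: rho_apply kepler V_apply power2_eq_square distrib_left mult_ac)
 then show ?thesis by (simp add: exp_add[symmetric])
qed

lemma nn_F: "nn (F x) t = - (I x t / 2) * rho (F x) t"
 by (simp add: nn_def rho_apply kepler Z1_def Z2_def algebra_simps)

lemma kq_F: "kq (F x) = kx x"
proof (rule bcontfun_eqI)
 fix t
 have p: "rho (F x) t \<noteq> 0" using rho_pos[of "F x" t] by simp
 have m: "mm (F x) t = - (I x t / 2)" using p by (simp add: mm_def nn_F rr_apply)
 have r: "rr (F x) t = exp (W x t)" by (simp add: rr_apply rho_F exp_minus)
 show "kq (F x) t = kx x t" by (simp add: kq_def kx_def m r exp_double)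
qed

lemma X_F: "X (F x) = x"
 by (simp add: X_def kq_F) (simp add: F_def algebra_simps)

lemma v_deriv:
 assumes "t \<in> {0..TT}"
 shows "(apply_bcontfun (v1 q) has_real_derivative z1 q t) (at t within {0..TT})"
  "(apply_bcontfun (v2 q) has_real_derivative z2 q t) (at t within {0..TT})"
proof -
 have e: "apply_bcontfun (v1 q) = (%t. 1 + I (emb (z1 q)) t)" "apply_bcontfun (v2 q) = apply_bcontfun (I (emb (z2 q)))"
  using arg_cong[OF v_eqs(1), of apply_bcontfun q] v_eqs(2)[of q] by (auto simp: fun_eq_iff)
 show "(apply_bcontfun (v1 q) has_real_derivative z1 q t) (at t within {0..TT})"
  unfolding e by (auto intro!: derivative_eq_intros I_emb_deriv[OF assms])
 show "(apply_bcontfun (v2 q) has_real_derivative z2 q t) (at t within {0..TT})"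
  unfolding e by (rule I_emb_deriv[OF assms])
qed

lemma rho_deriv:
 assumes "t \<in> {0..TT}"
 shows "(apply_bcontfun (rho q) has_real_derivative 2 * nn q t) (at t within {0..TT})"
 unfolding rho_apply[abs_def] by (auto intro!: derivative_eq_intros v_deriv[OF assms] simp: nn_def)

lemma init_v: "v1 q 0 = 1" "v2 q 0 = 0" "rho q 0 = 1" "rr q 0 = 1" "z1 q 0 = 0" "z2 q 0 = 1"
proof -
 show 1: "v1 q 0 = 1" "v2 q 0 = 0" by (simp_all add: v_eqs[of q] I_zero)
 show "z1 q 0 = 0" "z2 q 0 = 1" by (simp_all add: z1_def z2_def I_zero)
 show "rho q 0 = 1" "rr q 0 = 1" using 1 by (simp_all add: rr_apply rho_apply)
qed

lemma rr_deriv: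
 assumes "t \<in> {0..TT}"
 shows "(apply_bcontfun (rr q) has_real_derivative ((-2) *\<^sub>R ymul (nn q) (ymul (rr q) (rr q))) t) (at t within {0..TT})"
 unfolding rr_apply[abs_def] using rho_pos[of q t]
 by (auto intro!: derivative_eq_intros rho_deriv[OF assms] simp: rr_apply)

lemma rr_cl: "rr q (cl t) = rr q t" by (simp add: rr_apply rho_cl)

lemma rr_eq: "rr q = K 1 + I (emb ((-2) *\<^sub>R ymul (nn q) (ymul (rr q) (rr q))))"
 using cfun_FTC_eq[OF rr_cl rr_deriv, of q] unfolding init_v .

lemma nn_eq: "nn q = I (emb (ymul (z1 q) (z1 q) + ymul (z2 q) (z2 q)) + mulL q (rho q))"
proof -
 interpret I: bounded_linear I by (rule bounded_linear_I)
 interpret e: bounded_linear emb by (rule bounded_linear_emb)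
 interpret l: bounded_bilinear mulL by (rule bounded_bilinear_mulL)
 have 1: "ymul (v1 q) (z1 q) = I (mulL (emb (z1 q)) (z1 q) + mulL (mulL q (v1 q)) (v1 q))"
  using AC00[of 1 "emb (z1 q)" "mulL q (v1 q)"] by (simp only: v_eqs(1)[symmetric] z1_def[symmetric])
 have 2: "ymul (v2 q) (z2 q) = I (mulL (emb (z2 q)) (z2 q) + mulL (mulL q (v2 q)) (v2 q))"
  using AC0[of "emb (z2 q)" 1 "mulL q (v2 q)"] by (simp only: v_eqs(2)[symmetric] z2_def[symmetric])
 show ?thesis unfolding nn_def 1 2 rho_def
  by (simp add: mulL_emb mulL_mulL I.add e.add l.add_right)
qed

lemma wr_identity: "(a * d - b * c :: real) = 1 ==> (c * c + d * d) * (a * a + b * b) = (a * c + b * d) * (a * c + b * d) + 1"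
proof -
 assume w: "a * d - b * c = 1"
 have "(c * c + d * d) * (a * a + b * b) = (a * c + b * d) * (a * c + b * d) + (a * d - b * c) * (a * d - b * c)" by algebra
 then show ?thesis using w by simp
qed

text \<open>The claim is that X q is the derivative of -2 r'/r. Differentiating \<open>mm\<close> as
  the product of \<open>nn\<close> and \<open>rr\<close> produces the squared speed of the row,
  which Lagrange's identity with Wronskian 1 (\<open>wr_identity\<close>) expresses by
  \<open>nn\<close> and \<open>rho\<close>. What remains is q + 1/r^4 - (r'/r)^2.\<close>

lemma I_X: "I (X q) = (-2) *\<^sub>R mm q"
proof -
 interpret I: bounded_linear I by (rule bounded_linear_I)
 interpret e: bounded_linear emb by (rule bounded_linear_emb)
 interpret l: bounded_bilinear mulL by (rule bounded_bilinear_mulL)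
 let ?z = "ymul (z1 q) (z1 q) + ymul (z2 q) (z2 q)"
 let ?d = "(-2) *\<^sub>R ymul (nn q) (ymul (rr q) (rr q))"
 have rk: "ymul (rho q) (rr q) = K 1"
  using rho_pos[of q] by (intro bcontfun_eqI) (simp add: rr_apply less_imp_neq[symmetric])
 \<comment> \<open>Since \<open>rho\<close> times \<open>rr\<close> is 1, the potential comes out
   without a factor; everything else is continuous.\<close>
 have gen: "mulL (emb z + mulL q (rho q)) (rr q) + mulL (emb d) (nn q) = q + emb (ymul z (rr q) + ymul d (nn q))" for z d
  by (simp only: l.add_left mulL_emb mulL_mulL rk mulL_K e.add scaleR_one add_ac)
 have "mm q = I (mulL (emb ?z + mulL q (rho q)) (rr q) + mulL (emb ?d) (nn q))"
  using AC0[of "emb ?z + mulL q (rho q)" 1 "emb ?d"] by (simp only: mm_def nn_eq[symmetric] rr_eq[symmetric])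
 also have "\<dots> = I (q + emb (ymul ?z (rr q) + ymul ?d (nn q)))"
  by (simp only: gen)
 also have "ymul ?z (rr q) + ymul ?d (nn q) = ymul (rr q) (rr q) - ymul (mm q) (mm q)"
 proof (rule bcontfun_eqI)
  fix t
  have p: "rho q t \<noteq> 0" using rho_pos[of q t] by simp
  have id: "(z1 q t * z1 q t + z2 q t * z2 q t) * rho q t = nn q t * nn q t + 1"
   using wr_identity[OF wronskian[of q t]] by (simp add: rho_apply nn_def)
  have "z1 q t * z1 q t + z2 q t * z2 q t = (nn q t * nn q t + 1) * rr q t"
   using id p by (simp add: rr_apply field_simps)
  then have key: "(z1 q t * z1 q t + z2 q t * z2 q t) * rr q t = (nn q t * nn q t + 1) * rr q t * rr q t" by simp
  show "(ymul ?z (rr q) + ymul ?d (nn q)) t = (ymul (rr q) (rr q) - ymul (mm q) (mm q)) t"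
   by (simp add: mm_def key) (simp add: algebra_simps)
 qed
 finally have "(-2) *\<^sub>R mm q = I ((-2) *\<^sub>R (q + emb (ymul (rr q) (rr q) - ymul (mm q) (mm q))))"
  by (simp only: I.scaleR)
 also have "(-2) *\<^sub>R (q + emb (ymul (rr q) (rr q) - ymul (mm q) (mm q))) = X q"
  unfolding X_def kq_def by (simp add: e.diff algebra_simps)
 finally show ?thesis by simp
qed

text \<open>The logarithms of both sides vanish at 0 and have the derivative -2
  \<open>mm\<close>.\<close>

lemma E_X: "E (X q) = rr q"
proof (rule bcontfun_eqI)
 fix t
 have rp: "rr q t > 0" for t using rho_pos[of q t] by (simp add: rr_apply)
 have "mk (%t. ln (rr q t)) = K (ln (rr q 0)) + I (emb ((-2) *\<^sub>R mm q))"
 proof (rule FTC_real)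
  fix t assume t: "t \<in> {0..TT}"
  show "((%t. ln (rr q t)) has_real_derivative ((-2) *\<^sub>R mm q) t) (at t within {0..TT})"
   using rp[of t] by (auto intro!: derivative_eq_intros rr_deriv[OF t] simp: mm_def)
 qed
 then have "W (X q) = mk (%t. ln (rr q t))" by (simp add: W_def I_X init_v)
 moreover have "continuous_on {0..TT} (%t. ln (rr q t))"
  using rp by (intro continuous_intros continuous_on_apply_bcontfun) (auto simp: less_imp_neq[symmetric])
 ultimately have "W (X q) t = ln (rr q t)" by (simp add: mk_apply rr_cl)
 then show "E (X q) t = rr q t" using rp by (simp add: E_apply)
qed

lemma kx_X: "kx (X q) = kq q"
proof (rule bcontfun_eqI)
 fix t
 have "exp (W (X q) t) = rr q t" using E_X[of q] E_apply[of "X q" t] by simp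
 then show "kx (X q) t = kq q t" by (simp add: kx_def kq_def I_X exp_double)
qed

lemma F_X: "F (X q) = q"
 unfolding F_def kx_X by (simp add: X_def algebra_simps)

section \<open>The fundamental solution as a matrix\<close>

definition mat22 :: "real => real => real => real => real^2^2" where
 "mat22 a b c d = vector [vector [a, b], vector [c, d]]"

lemma mat22_nth [simp]: "mat22 a b c d $ 1 $ 1 = a" "mat22 a b c d $ 1 $ 2 = b" "mat22 a b c d $ 2 $ 1 = c" "mat22 a b c d $ 2 $ 2 = d"
 by (simp_all add: mat22_def)

lemma mat_eqI: "A $ 1 $ 1 = B $ 1 $ 1 ==> A $ 1 $ 2 = B $ 1 $ 2 ==> A $ 2 $ 1 = B $ 2 $ 1 ==> A $ 2 $ 2 = B $ 2 $ 2 ==> A = (B :: real^2^2)"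
 by (simp add: vec_eq_iff forall_2)

lemma mat22_eta: "mat22 (A $ 1 $ 1) (A $ 1 $ 2) (A $ 2 $ 1) (A $ 2 $ 2) = A"
 by (rule mat_eqI) simp_all

lemma mat22_mult: "mat22 a b c d ** mat22 a' b' c' d' = mat22 (a*a'+b*c') (a*b'+b*d') (c*a'+d*c') (c*b'+d*d')"
 by (rule mat_eqI) (simp_all add: matrix_matrix_mult_def sum_2)

lemma has_integral_mat: "(f has_integral A) D \<longleftrightarrow> (\<forall>i j. ((%s. f s $ i $ j) has_integral A $ i $ j) D)" for f :: "real => real^2^2"
 unfolding has_integral_componentwise_iff[of f]
 by (simp add: Basis_vec_def inner_axis cart_eq_inner_axis[symmetric])

definition Phi :: "ltwo => real => real^2^2" where
 "Phi q t = mat22 (v1 q t) (v2 q t) (z1 q t) (z2 q t)"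

text \<open>\<open>fundamental_solution\<close> is an arbitrary choice, so it must be identified by
  uniqueness: in each column the second entry can be eliminated, and the first then satisfies the
  scalar Volterra equation of \<open>v_unique\<close>.\<close>

lemma fundamental_solution_eq:
 assumes t: "t \<in> {0..TT}"
 shows "fundamental_solution q t = Phi q t"
proof -
 let ?A = "%s. (vector [vector [0, 1], vector [rep_ltwo q s, 0]] :: real^2^2)"
 let ?P = "%\<Phi>. continuous_on {0..TT} \<Phi> \<and> (\<forall>t\<in>{0..TT}. ((%s. ?A s ** \<Phi> s) has_integral (\<Phi> t - mat 1)) {0..t})"
 have A: "?A s ** B = mat22 (B $ 2 $ 1) (B $ 2 $ 2) (rep_ltwo q s * B $ 1 $ 1) (rep_ltwo q s * B $ 1 $ 2)" for s B
  using mat22_mult[of 0 1 "rep_ltwo q s" 0 "B $ 1 $ 1" "B $ 1 $ 2" "B $ 2 $ 1" "B $ 2 $ 2"] by (simp add: mat22_eta) (simp add: mat22_def)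
 have m1: "mat 1 = mat22 1 0 0 1" by (rule mat_eqI) (simp_all add: mat_def)
 have i1: "(apply_bcontfun f has_integral I (emb f) t) {0..t}" if "t \<in> {0..TT}" for f t
  using cl_id[OF that] by (simp add: I_emb integrable_integral integrable_continuous_interval)
 have i2: "((%s. rep_ltwo q s * apply_bcontfun f s) has_integral I (mulL q f) t) {0..t}" if "t \<in> {0..TT}" for f t
  using cl_id[OF that] sq_int_on[OF mulL_sq, of t q f] that by (simp add: I_mulL integrable_integral)
 have "?P (Phi q)"
 proof (intro conjI ballI)
  have "continuous_on {0..TT} (%t. \<chi> i j. mat22 (v1 q t) (v2 q t) (z1 q t) (z2 q t) $ i $ j)"
  proof (intro continuous_on_vec_lambda)
   fix i j :: 2
   show "continuous_on {0..TT} (%t. mat22 (v1 q t) (v2 q t) (z1 q t) (z2 q t) $ i $ j)"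
    using exhaust_2[of i] exhaust_2[of j] by auto
  qed
  then show "continuous_on {0..TT} (Phi q)" by (simp add: Phi_def[abs_def])
  fix t assume t: "t \<in> {0..TT}"
  show "((%s. ?A s ** Phi q s) has_integral (Phi q t - mat 1)) {0..t}"
  proof -
   have "v1 q t = 1 + I (emb (z1 q)) t" "v2 q t = I (emb (z2 q)) t" "z1 q t = I (mulL q (v1 q)) t" "z2 q t = 1 + I (mulL q (v2 q)) t"
    using arg_cong[OF v_eqs(1), of "%f. f t" q] arg_cong[OF v_eqs(2), of "%f. f t" q]
     arg_cong[OF z1_def, of "%f. f t" q] arg_cong[OF z2_def, of "%f. f t" q] by simp_all
   then have "(apply_bcontfun (z1 q) has_integral v1 q t - 1) {0..t}" "(apply_bcontfun (z2 q) has_integral v2 q t) {0..t}"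
    "((%s. rep_ltwo q s * v1 q s) has_integral z1 q t) {0..t}" "((%s. rep_ltwo q s * v2 q s) has_integral z2 q t - 1) {0..t}"
    using i1[OF t, of "z1 q"] i1[OF t, of "z2 q"] i2[OF t, of "v1 q"] i2[OF t, of "v2 q"] by simp_all
   then show ?thesis unfolding has_integral_mat A m1 forall_2 Phi_def by simp
  qed
 qed
 then have P: "?P (fundamental_solution q)"
  unfolding fundamental_solution_def by (rule someI[of ?P])
 let ?\<Phi> = "fundamental_solution q"
 have c: "continuous_on {0..TT} (%t. ?\<Phi> t $ i $ j)" for i j
  by (intro continuous_on_component) (use P in blast)
 \<comment> \<open>The chosen function is constrained on the interval only, so its entries are first
   replaced by their constant extensions.\<close>
 define f where "f i j = mk (%t. ?\<Phi> t $ i $ j)" for i j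
 have fa: "f i j t = ?\<Phi> (cl t) $ i $ j" for i j t unfolding f_def by (rule mk_apply[OF c])
 have hi: "((%s. (?A s ** ?\<Phi> s) $ i $ j) has_integral (?\<Phi> t - mat 1) $ i $ j) {0..t}" if "t \<in> {0..TT}" for t i j
  using P that unfolding has_integral_mat by blast
 have f1: "f 1 j = K (mat 1 $ 1 $ j) + I (emb (f 2 j))" for j
 proof (rule bcontfun_eqI)
  fix t
  have "I (emb (f 2 j)) t = integral {0..cl t} (%s. (?A s ** ?\<Phi> s) $ 1 $ j)"
   unfolding I_emb by (rule integral_cong, drule cl_id', cases "j = 1") (use exhaust_2[of j] in \<open>auto simp: fa A\<close>)
  also have "\<dots> = (?\<Phi> (cl t) - mat 1) $ 1 $ j" by (rule integral_unique[OF hi]) simp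
  finally show "f 1 j t = (K (mat 1 $ 1 $ j) + I (emb (f 2 j))) t" by (simp add: fa)
 qed
 have f2: "f 2 j = K (mat 1 $ 2 $ j) + I (mulL q (f 1 j))" for j
 proof (rule bcontfun_eqI)
  fix t
  have "I (mulL q (f 1 j)) t = integral {0..cl t} (%s. (?A s ** ?\<Phi> s) $ 2 $ j)"
   unfolding I_mulL by (rule integral_cong, drule cl_id', cases "j = 1") (use exhaust_2[of j] in \<open>auto simp: fa A\<close>)
  also have "\<dots> = (?\<Phi> (cl t) - mat 1) $ 2 $ j" by (rule integral_unique[OF hi]) simp
  finally show "f 2 j t = (K (mat 1 $ 2 $ j) + I (mulL q (f 1 j))) t" by (simp add: fa)
 qed
 interpret I: bounded_linear I by (rule bounded_linear_I)
 interpret e: bounded_linear emb by (rule bounded_linear_emb)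
 interpret l: bounded_bilinear mulL by (rule bounded_bilinear_mulL)
 have Kc: "K c = c *\<^sub>R K 1" for c using K_scale[of c 1] by simp
 have g1: "f 1 j = (mat 1 $ 1 $ j) *\<^sub>R v1 q + (mat 1 $ 2 $ j) *\<^sub>R v2 q" for j
 proof (rule v_unique)
  have "f 1 j = K (mat 1 $ 1 $ j) + I (emb (K (mat 1 $ 2 $ j) + I (mulL q (f 1 j))))" using f1[of j] f2[of j] by simp
  also have "\<dots> = K (mat 1 $ 1 $ j) + (mat 1 $ 2 $ j) *\<^sub>R yid + I (emb (I (mulL q (f 1 j))))"
   unfolding yid_eq by (subst Kc[of "mat 1 $ 2 $ j"]) (simp add: e.add I.add e.scaleR I.scaleR add.assoc)
  finally show "f 1 j = K (mat 1 $ 1 $ j) + (mat 1 $ 2 $ j) *\<^sub>R yid + I (emb (I (mulL q (f 1 j))))" .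
 qed
 have g2: "f 2 j = (mat 1 $ 1 $ j) *\<^sub>R z1 q + (mat 1 $ 2 $ j) *\<^sub>R z2 q" for j
  unfolding f2[of j] g1[of j] z1_def z2_def
  by (subst Kc) (simp add: l.add_right l.scaleR_right I.add I.scaleR algebra_simps)
 have "?\<Phi> t $ i $ j = f i j t" for i j using fa[of i j t] cl_id[OF t] by simp
 then show ?thesis unfolding Phi_def by (intro mat_eqI) (simp_all add: g1 g2 mat_def)
qed

section \<open>Lifting curves through a covering\<close>

text \<open>Over an evenly covered set each of the two lifts stays locally in one sheet, and they
  agree there exactly when the sheets coincide. So the set of agreement is open and closed.\<close>

lemma covering_lift_unique:
 assumes cov: "covering_space c p S0" and T: "connected T" and a: "a \<in> T" "g1 a = g2 a"
  and g1: "continuous_on T g1" "!!x. x \<in> T ==> g1 x \<in> c" and g2: "continuous_on T g2" "!!x. x \<in> T ==> g2 x \<in> c"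
  and eq: "!!x. x \<in> T ==> p (g1 x) = p (g2 x)" and x: "x \<in> T"
 shows "g1 x = g2 x"
proof -
 have nb: "\<exists>N. openin (top_of_set T) N \<and> x \<in> N \<and> (\<forall>y\<in>N. (g1 y = g2 y) = (g1 x = g2 x))" if x: "x \<in> T" for x
 proof -
  have "p (g1 x) \<in> S0" using cov g1(2)[OF x] by (auto simp: covering_space_def)
  then obtain V v where V: "p (g1 x) \<in> V" "\<Union>v = c \<inter> p -` V" "\<forall>u\<in>v. openin (top_of_set c) u" "pairwise disjnt v"
    "\<forall>u\<in>v. \<exists>q. homeomorphism u V p q"
   using cov unfolding covering_space_def by metis
  have "g1 x \<in> \<Union>v" "g2 x \<in> \<Union>v" using V(1,2) g1(2)[OF x] g2(2)[OF x] eq[OF x] by auto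
  then obtain u1 u2 where u: "u1 \<in> v" "u2 \<in> v" "g1 x \<in> u1" "g2 x \<in> u2" by blast
  let ?N = "(T \<inter> g1 -` u1) \<inter> (T \<inter> g2 -` u2)"
  have "openin (top_of_set T) (T \<inter> g1 -` u1)" "openin (top_of_set T) (T \<inter> g2 -` u2)"
   using V(3) u g1 g2 by (auto intro!: continuous_openin_preimage[of _ _ c])
  then have o: "openin (top_of_set T) ?N" by (rule openin_Int)
  have inj: "inj_on p u" if "u \<in> v" for u
   using V(5) that by (metis homeomorphism_def inj_on_inverseI)
  have "(g1 y = g2 y) = (u1 = u2)" if y: "y \<in> ?N" for y
  proof (cases "u1 = u2")
   case True
   then show ?thesis using inj[OF u(1)] y eq[of y] by (auto simp: inj_on_def)
  next
   case False
   then have "disjnt u1 u2" using V(4) u by (auto simp: pairwise_def)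
   then show ?thesis using False y by (auto simp: disjnt_def)
  qed
  moreover have "x \<in> ?N" using x u by auto
  ultimately show ?thesis using o by blast
 qed
 let ?A = "{x \<in> T. g1 x = g2 x}"
 have "openin (top_of_set T) ?A"
 proof (subst openin_subopen, intro ballI)
  fix y assume "y \<in> ?A"
  then have y: "y \<in> T" "g1 y = g2 y" by auto
  obtain N where N: "openin (top_of_set T) N" "y \<in> N" "\<forall>z\<in>N. (g1 z = g2 z) = (g1 y = g2 y)" using nb[OF y(1)] by blast
  moreover have "N \<subseteq> ?A" using N(3) y(2) openin_imp_subset[OF N(1)] by blast
  ultimately show "\<exists>N. openin (top_of_set T) N \<and> y \<in> N \<and> N \<subseteq> ?A" by blast
 qed
 moreover have "openin (top_of_set T) (T - ?A)"
 proof (subst openin_subopen, intro ballI)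
  fix y assume "y \<in> T - ?A"
  then have y: "y \<in> T" "g1 y \<noteq> g2 y" by auto
  obtain N where N: "openin (top_of_set T) N" "y \<in> N" "\<forall>z\<in>N. (g1 z = g2 z) = (g1 y = g2 y)" using nb[OF y(1)] by blast
  moreover have "N \<subseteq> T - ?A" using N(3) y(2) openin_imp_subset[OF N(1)] by blast
  ultimately show "\<exists>N. openin (top_of_set T) N \<and> y \<in> N \<and> N \<subseteq> T - ?A" by blast
 qed
 then have "closedin (top_of_set T) ?A" by (simp add: closedin_def Collect_restrict)
 ultimately have "?A = {} \<or> ?A = T" using T unfolding connected_clopen by blast
 then show ?thesis using a x by blast
qed

text \<open>The length \<open>\<epsilon>\<close> depends on s alone: any lift that reaches beyond s
  - \<open>\<epsilon>\<close> is continued past s by the inverse of the projection on the sheet of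
  its end point. The lift need not reach s itself, which is what an argument with a supremum
  requires.\<close>

lemma covering_lift_step:
 assumes cov: "covering_space c p S0" and f: "continuous_on {0..} f" "!!t. t \<ge> 0 ==> f t \<in> S0" and s: "(s::real) \<ge> 0"
 shows "\<exists>\<epsilon>>0. \<forall>r g. r \<ge> 0 --> s - \<epsilon> < r --> r \<le> s --> continuous_on {0..r} g --> (\<forall>t\<in>{0..r}. g t \<in> c \<and> p (g t) = f t) -->
   (\<exists>g'. continuous_on {0..s + \<epsilon>} g' \<and> g' 0 = g 0 \<and> (\<forall>t\<in>{0..s + \<epsilon>}. g' t \<in> c \<and> p (g' t) = f t))"
proof -
 obtain V v where V: "f s \<in> V" "openin (top_of_set S0) V" "\<Union>v = c \<inter> p -` V" "\<forall>u\<in>v. openin (top_of_set c) u"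
   "\<forall>u\<in>v. \<exists>q. homeomorphism u V p q"
  using cov f(2)[OF s] unfolding covering_space_def by metis
 have "openin (top_of_set {0..}) ({0..} \<inter> f -` V)"
  using f V(2) by (intro continuous_openin_preimage[of _ _ S0]) auto
 moreover have "s \<in> {0..} \<inter> f -` V" using s V(1) by auto
 ultimately obtain d where "d > 0" "\<forall>t\<in>{0..}. dist t s < d --> t \<in> {0..} \<inter> f -` V"
  unfolding openin_euclidean_subtopology_iff by blast
 then have d: "d > 0" "!!t. t \<ge> 0 ==> dist t s < d ==> f t \<in> V" by auto
 define \<epsilon> where "\<epsilon> = d / 2"
 have fV: "f t \<in> V" if "0 \<le> t" "s - \<epsilon> < t" "t \<le> s + \<epsilon>" for t
  using d that by (auto simp: \<epsilon>_def dist_real_def)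
 show ?thesis
 proof (intro exI[of _ \<epsilon>] conjI allI impI)
  show "\<epsilon> > 0" using d by (simp add: \<epsilon>_def)
  fix r g assume r: "r \<ge> 0" "s - \<epsilon> < r" "r \<le> s" and g: "continuous_on {0..r} g" "\<forall>t\<in>{0..r}. g t \<in> c \<and> p (g t) = f t"
  have "p (g r) \<in> V" using g(2) r fV[of r] d by (auto simp: \<epsilon>_def)
  then obtain u where u: "u \<in> v" "g r \<in> u" using V(3) g(2) r by (metis IntI UnionE atLeastAtMost_iff order_refl vimageI2)
  obtain q where q: "homeomorphism u V p q" using V(5) u by blast
  have uc: "u \<subseteq> c" using V(3) u by blast
  have img: "f ` {r..s + \<epsilon>} \<subseteq> V"
  proof (rule image_subsetI)
   fix t assume "t \<in> {r..s + \<epsilon>}"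
   then show "f t \<in> V" using fV[of t] r by simp
  qed
  have sub: "{r..s + \<epsilon>} \<subseteq> {0..}" using r by auto
  define g' where "g' t = (if t \<le> r then g t else q (f t))" for t
  have "continuous_on ({0..r} \<union> {r..s + \<epsilon>}) g'"
   unfolding g'_def
  proof (rule continuous_on_cases)
   show "continuous_on {r..s + \<epsilon>} (%t. q (f t))"
    by (rule continuous_on_compose2[OF homeomorphism_cont2[OF q] continuous_on_subset[OF f(1) sub] img])
   show "\<forall>x. x \<in> {0..r} \<and> \<not> x \<le> r \<or> x \<in> {r..s + \<epsilon>} \<and> x \<le> r --> g x = q (f x)"
   proof (intro allI impI)
    fix x assume "x \<in> {0..r} \<and> \<not> x \<le> r \<or> x \<in> {r..s + \<epsilon>} \<and> x \<le> r"
    then have x: "x = r" by auto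
    have "r \<in> {0..r}" using r by simp
    then have "f r = p (g r)" using g(2) by simp
    then show "g x = q (f x)" unfolding x using homeomorphism_apply1[OF q u(2)] by simp
   qed
  qed (use g in auto)
  moreover have "{0..r} \<union> {r..s + \<epsilon>} = {0..s + \<epsilon>}" using r d by (auto simp: \<epsilon>_def)
  moreover have "g' t \<in> c \<and> p (g' t) = f t" if "t \<in> {0..s + \<epsilon>}" for t
  proof (cases "t \<le> r")
   case False
   then have "f t \<in> V" using fV[of t] that r by auto
   then show ?thesis using False homeomorphism_apply2[OF q] homeomorphism_image2[OF q] uc by (auto simp: g'_def)
  qed (use g that in \<open>auto simp: g'_def\<close>)
  ultimately show "\<exists>g'. continuous_on {0..s + \<epsilon>} g' \<and> g' 0 = g 0 \<and> (\<forall>t\<in>{0..s + \<epsilon>}. g' t \<in> c \<and> p (g' t) = f t)"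
   using r by (intro exI[of _ g']) (auto simp: g'_def)
 qed
qed

text \<open>If the lengths of liftable intervals were bounded, the previous step would push a lift
  beyond their supremum. Lifts of different lengths agree by uniqueness and are glued along the
  diagonal \<open>G t t\<close>.\<close>

lemma covering_lift_halfline:
 assumes cov: "covering_space c p S0" and f: "continuous_on {0..} f" "!!t. t \<ge> 0 ==> f t \<in> S0" and a: "a \<in> c" "p a = f (0::real)"
 shows "\<exists>g. continuous_on {0..} g \<and> g 0 = a \<and> (\<forall>t\<ge>0. g t \<in> c \<and> p (g t) = f t)"
proof -
 define P where "P r g \<longleftrightarrow> continuous_on {0..r} g \<and> g 0 = a \<and> (\<forall>t\<in>{0..r}. g t \<in> c \<and> p (g t) = f t)" for r g
 define A where "A = {r. r \<ge> 0 \<and> (\<exists>g. P r g)}"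
 have A0: "0 \<in> A" unfolding A_def P_def using a by (auto intro!: exI[of _ "%_. a"])
 have down: "r' \<in> A" if h: "r \<in> A" "0 \<le> r'" "r' \<le> r" for r r'
 proof -
  obtain g where g: "P r g" using h(1) by (auto simp: A_def)
  have "continuous_on {0..r'} g" by (rule continuous_on_subset[of "{0..r}"]) (use g h in \<open>auto simp: P_def\<close>)
  then have "P r' g" using g h(3) unfolding P_def by auto
  then show ?thesis using h(2) by (auto simp: A_def)
 qed
 have all: "r \<in> A" if r: "r \<ge> 0" for r
 proof (rule ccontr)
  assume "r \<notin> A"
  then have ub: "x \<le> r" if "x \<in> A" for x using down[OF that r] by force
  then have bdd: "bdd_above A" by (rule bdd_aboveI)
  define s where "s = Sup A"
  have s0: "s \<ge> 0" unfolding s_def by (rule cSup_upper[OF A0 bdd])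
  obtain \<epsilon> where e: "\<epsilon> > 0" "!!r g. r \<ge> 0 ==> s - \<epsilon> < r ==> r \<le> s ==> continuous_on {0..r} g ==> (\<forall>t\<in>{0..r}. g t \<in> c \<and> p (g t) = f t) ==>
   (\<exists>g'. continuous_on {0..s + \<epsilon>} g' \<and> g' 0 = g 0 \<and> (\<forall>t\<in>{0..s + \<epsilon>}. g' t \<in> c \<and> p (g' t) = f t))"
   using covering_lift_step[OF cov f s0] by metis
  have "s - \<epsilon> < Sup A" using e by (simp add: s_def)
  then obtain r1 where r1: "r1 \<in> A" "s - \<epsilon> < r1" using less_cSupD[of A "s - \<epsilon>"] A0 by blast
  have "r1 \<le> s" unfolding s_def by (rule cSup_upper[OF r1(1) bdd])
  moreover obtain g where "P r1 g" "r1 \<ge> 0" using r1 by (auto simp: A_def)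
  ultimately have "\<exists>g'. P (s + \<epsilon>) g'" using e(2)[of r1 g] r1 unfolding P_def by metis
  then have "s + \<epsilon> \<in> A" using s0 e by (auto simp: A_def)
  then have "s + \<epsilon> \<le> s" unfolding s_def by (rule cSup_upper[OF _ bdd])
  then show False using e by simp
 qed
 then have "\<forall>r. \<exists>g. r \<ge> 0 --> P r g" by (auto simp: A_def)
 then obtain G where G: "!!r. r \<ge> 0 ==> P r (G r)" by metis
 have uniq: "G r t = G r' t" if "0 \<le> t" "t \<le> r" "r \<le> r'" for r r' t
 proof (rule covering_lift_unique[OF cov, of "{0..r}" 0 "G r" "G r'"])
  show "continuous_on {0..r} (G r')" using G[of r'] that unfolding P_def by (auto intro: continuous_on_subset)
 qed (use G[of r] G[of r'] that in \<open>auto simp: P_def\<close>)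
 define g where "g t = G t t" for t
 have gG: "g t = G r t" if "0 \<le> t" "t \<le> r" for t r unfolding g_def using uniq[of t t r] that by simp
 have "continuous_on {0..} g"
  unfolding continuous_on_eq_continuous_within
 proof
  fix t :: real assume t: "t \<in> {0..}"
  have "continuous_on {0..t + 1} (G (t + 1))" using G[of "t + 1"] t by (auto simp: P_def)
  then have "continuous_on {0..t + 1} g" by (rule continuous_on_eq) (use gG in auto)
  then have "continuous (at t within {0..t + 1}) g" using t by (auto simp: continuous_on_eq_continuous_within)
  moreover have "at t within {0..t + 1} = at t within {0..}"
   by (rule at_within_nhd[of _ "{..<t + 1}"]) auto
  ultimately show "continuous (at t within {0..}) g" by simp
 qed
 moreover have "g t \<in> c \<and> p (g t) = f t" if "t \<ge> 0" for t using G[of t] that by (auto simp: P_def g_def)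
 moreover have "g 0 = a" using G[of 0] by (simp add: P_def g_def)
 ultimately show ?thesis by blast
qed

lemma covering_lift_line:
 assumes cov: "covering_space c p S0" and f: "continuous_on UNIV f" "!!t. f t \<in> S0" and a: "a \<in> c" "p a = f (0::real)"
 shows "\<exists>g. continuous_on UNIV g \<and> g 0 = a \<and> (\<forall>t. g t \<in> c \<and> p (g t) = f t)"
proof -
 obtain g1 where g1: "continuous_on {0..} g1" "g1 0 = a" "!!t. t \<ge> 0 ==> g1 t \<in> c \<and> p (g1 t) = f t"
  using covering_lift_halfline[OF cov continuous_on_subset[OF f(1)] f(2) a] by auto
 have f': "continuous_on {0..} (%t. f (- t))"
  by (rule continuous_on_compose2[OF f(1)]) (auto intro: continuous_intros)
 obtain g2 where g2: "continuous_on {0..} g2" "g2 0 = a" "!!t. t \<ge> 0 ==> g2 t \<in> c \<and> p (g2 t) = f (- t)"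
  using covering_lift_halfline[OF cov f' f(2), of a] a by auto
 let ?g = "%t. if t \<ge> 0 then g1 t else g2 (- t)"
 have "continuous_on ({0..} \<union> {..0}) ?g"
 proof (rule continuous_on_cases)
  show "continuous_on {..0} (%t. g2 (- t))"
   by (rule continuous_on_compose2[OF g2(1)]) (auto intro: continuous_intros)
 qed (use g1 g2 in auto)
 moreover have "{0..} \<union> {..0} = (UNIV :: real set)" by auto
 moreover have "?g t \<in> c \<and> p (?g t) = f t" for t using g1(3)[of t] g2(3)[of "- t"] by auto
 ultimately show ?thesis using g1(2) by (intro exI[of _ ?g]) auto
qed

section \<open>Polar angle and the two Iwasawa decompositions\<close>

text \<open>A plane curve with Wronskian 1 sweeps equal areas in equal times, so its continuous
  angle is the integral of 1/r^2. In particular the angle is positive for positive t, which is the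
  fact behind \<open>G0_eq\<close>.\<close>

lemma polar_angle:
 fixes a b a' b' :: "real => real"
 assumes T: "T \<ge> 0" and a: "!!t. (a has_real_derivative a' t) (at t)" and b: "!!t. (b has_real_derivative b' t) (at t)"
  and w: "!!t. a t * b' t - a' t * b t = 1" and ini: "a 0 > 0" "b 0 = 0" and t: "t \<in> {0..T}"
 defines "\<psi> \<equiv> %t. integral {0..t} (%s. 1 / ((a s)\<^sup>2 + (b s)\<^sup>2))"
 shows "a t = sqrt ((a t)\<^sup>2 + (b t)\<^sup>2) * cos (\<psi> t)" "b t = sqrt ((a t)\<^sup>2 + (b t)\<^sup>2) * sin (\<psi> t)" "continuous_on {0..T} \<psi>"
  "0 < t ==> 0 < \<psi> t" "(a t)\<^sup>2 + (b t)\<^sup>2 > 0"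
proof -
 let ?N = "%t. (a t)\<^sup>2 + (b t)\<^sup>2"
 have Np: "?N s > 0" for s
 proof -
  have "a s \<noteq> 0 \<or> b s \<noteq> 0" using w[of s] by auto
  then show ?thesis by (simp add: sum_power2_gt_zero_iff)
 qed
 then show "?N t > 0" .
 have ca: "continuous_on UNIV a" "continuous_on UNIV b"
  using DERIV_isCont[OF a] DERIV_isCont[OF b] by (auto simp: continuous_on_eq_continuous_at)
 have cN: "continuous_on D (%s. 1 / ?N s)" for D
 proof -
  have N0: "\<forall>s\<in>D. ?N s \<noteq> 0" using Np by (metis less_irrefl)
  show ?thesis by (intro continuous_intros continuous_on_subset[OF ca(1)] continuous_on_subset[OF ca(2)] N0 subset_UNIV)
 qed
 have d\<psi>: "(\<psi> has_real_derivative 1 / ?N s) (at s within {0..T})" if "s \<in> {0..T}" for s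
  unfolding \<psi>_def by (rule integral_has_real_derivative[OF cN that])
 show c\<psi>: "continuous_on {0..T} \<psi>" by (rule DERIV_continuous_on, rule d\<psi>)
 have \<psi>0: "\<psi> 0 = 0" by (simp add: \<psi>_def)
 define k n where "k s = (a s * a' s + b s * b' s) / ?N s" and "n s = 1 / ?N s" for s
 have a'e: "a' s = k s * a s - b s * n s" and b'e: "b' s = k s * b s + a s * n s" for s
 proof -
  have n: "?N s \<noteq> 0" by (rule less_imp_neq[OF Np, symmetric])
  have kn: "k s * ?N s = a s * a' s + b s * b' s" "n s * ?N s = 1" unfolding k_def n_def using n by simp_all
  have "a' s * ?N s = (a s * a' s + b s * b' s) * a s - b s * (a s * b' s - a' s * b s)" by (simp add: power2_eq_square algebra_simps)
  also have "\<dots> = (k s * ?N s) * a s - b s * (n s * ?N s)" unfolding kn w ..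
  also have "\<dots> = (k s * a s - b s * n s) * ?N s" by (simp only: left_diff_distrib mult_ac)
  finally show "a' s = k s * a s - b s * n s" using mult_right_cancel[OF n] by blast
  have "b' s * ?N s = (a s * a' s + b s * b' s) * b s + a s * (a s * b' s - a' s * b s)" by (simp add: power2_eq_square algebra_simps)
  also have "\<dots> = (k s * ?N s) * b s + a s * (n s * ?N s)" unfolding kn w ..
  also have "\<dots> = (k s * b s + a s * n s) * ?N s" by (simp only: distrib_right mult_ac)
  finally show "b' s = k s * b s + a s * n s" using mult_right_cancel[OF n] by blast
 qed
 have da: "(a has_real_derivative a' s) (at s within D)" "(b has_real_derivative b' s) (at s within D)" for s D
  by (rule has_field_derivative_at_within[OF a], rule has_field_derivative_at_within[OF b])
 define r where "r s = sqrt (?N s)" for s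
 have rp: "r s > 0" "r s * r s = ?N s" for s using Np[of s] by (auto simp: r_def)
 have dr: "(r has_real_derivative k s * r s) (at s within {0..T})" for s
 proof -
  have "(r has_real_derivative (2 * a s * a' s + 2 * b s * b' s) * (inverse (r s) / 2)) (at s within {0..T})"
   unfolding r_def[abs_def] using Np[of s] by (auto intro!: derivative_eq_intros da)
  moreover have "(2 * a s * a' s + 2 * b s * b' s) * (inverse (r s) / 2) = k s * r s"
   unfolding k_def rp(2)[symmetric] using rp(1)[of s] by (simp add: field_simps)
  ultimately show ?thesis by simp
 qed
 \<comment> \<open>The coordinates of the curve in the frame turned by \<open>\<psi>\<close>. Both
   satisfy f' = k f, as does r, so their quotients by r keep the initial values 1 and 0.\<close>
 define Xf Yf where "Xf s = a s * cos (\<psi> s) + b s * sin (\<psi> s)" and "Yf s = b s * cos (\<psi> s) - a s * sin (\<psi> s)" for s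
 have dX: "(Xf has_real_derivative k s * Xf s) (at s within {0..T})" if s: "s \<in> {0..T}" for s
 proof -
  have "(Xf has_real_derivative (a' s * cos (\<psi> s) - a s * (sin (\<psi> s) * n s) + (b' s * sin (\<psi> s) + b s * (cos (\<psi> s) * n s)))) (at s within {0..T})"
   unfolding Xf_def[abs_def] using d\<psi>[OF s] unfolding n_def[symmetric] by (auto intro!: derivative_eq_intros da)
  then show ?thesis unfolding a'e[of s] b'e[of s] Xf_def by (simp add: algebra_simps)
 qed
 have dY: "(Yf has_real_derivative k s * Yf s) (at s within {0..T})" if s: "s \<in> {0..T}" for s
 proof -
  have "(Yf has_real_derivative (b' s * cos (\<psi> s) - b s * (sin (\<psi> s) * n s) - (a' s * sin (\<psi> s) + a s * (cos (\<psi> s) * n s)))) (at s within {0..T})"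
   unfolding Yf_def[abs_def] using d\<psi>[OF s] unfolding n_def[symmetric] by (auto intro!: derivative_eq_intros da)
  then show ?thesis unfolding a'e[of s] b'e[of s] Yf_def by (simp add: algebra_simps)
 qed
 have const: "f t / r t = f 0 / r 0" if ff: "!!s. s \<in> {0..T} ==> (f has_real_derivative k s * f s) (at s within {0..T})" for f
 proof -
  have "((%s. f s / r s) has_real_derivative 0) (at s within {0..T})" if s: "s \<in> {0..T}" for s
  proof -
   have "((%s. f s / r s) has_real_derivative (k s * f s * r s - f s * (k s * r s)) / (r s * r s)) (at s within {0..T})"
    using rp(1)[of s] by (intro DERIV_divide ff dr s) auto
   then show ?thesis by (simp add: mult_ac)
  qed
  then obtain c where "!!s. s \<in> {0..T} ==> f s / r s = c"
   using has_field_derivative_zero_constant[of "{0..T}" "%s. f s / r s"] by auto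
  then show ?thesis using t T by auto
 qed
 have r0: "r 0 = a 0" using ini by (simp add: r_def)
 have "Xf t / r t = 1" using const[OF dX] ini r0 by (simp add: Xf_def \<psi>0)
 then have Xt: "Xf t = r t" using rp(1)[of t] by (simp add: field_simps)
 have "Yf t / r t = 0" using const[OF dY] ini by (simp add: Yf_def \<psi>0)
 then have Yt: "Yf t = 0" using rp(1)[of t] by simp
 have cs: "cos (\<psi> t) * cos (\<psi> t) + sin (\<psi> t) * sin (\<psi> t) = 1" using sin_cos_squared_add3 by (simp add: add.commute)
 have "a t = a t * (cos (\<psi> t) * cos (\<psi> t) + sin (\<psi> t) * sin (\<psi> t))" using cs by simp
 also have "\<dots> = Xf t * cos (\<psi> t) - Yf t * sin (\<psi> t)" unfolding Xf_def Yf_def by (simp only: algebra_simps)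
 finally show "a t = sqrt (?N t) * cos (\<psi> t)" using Xt Yt by (simp add: r_def)
 have "b t = b t * (cos (\<psi> t) * cos (\<psi> t) + sin (\<psi> t) * sin (\<psi> t))" using cs by simp
 also have "\<dots> = Xf t * sin (\<psi> t) + Yf t * cos (\<psi> t)" unfolding Xf_def Yf_def by (simp only: algebra_simps)
 finally show "b t = sqrt (?N t) * sin (\<psi> t)" using Xt Yt by (simp add: r_def)
 show "0 < \<psi> t" if "0 < t"
 proof -
  have "\<psi> 0 < \<psi> t"
  proof (rule DERIV_pos_imp_increasing_open[OF that])
   fix x assume x: "0 < x" "x < t"
   then have "(\<psi> has_real_derivative 1 / ?N x) (at x)"
    using d\<psi>[of x] t at_within_Icc_at[of 0 x T] by simp
   then show "\<exists>y. (\<psi> has_real_derivative y) (at x) \<and> 0 < y" using Np[of x] by (intro exI[of _ "1 / ?N x"]) auto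
  next
   show "continuous_on {0..t} \<psi>"
    by (rule continuous_on_subset[OF c\<psi>]) (use t in auto)
  qed
  then show ?thesis by (simp add: \<psi>0)
 qed
qed

text \<open>The signs and halves are arranged so that the fundamental solution for
  \<open>F x\<close> has the coordinates \<open>Th\<close>, \<open>W\<close> and \<open>I\<close> of
  x (\<open>Mt_kepler\<close>). Each family is a curve through the identity and can thus be lifted
  by itself.\<close>

definition Rt :: "real => real^2^2" where "Rt \<theta> = mat22 (cos \<theta>) (sin \<theta>) (- sin \<theta>) (cos \<theta>)"
definition Dt :: "real => real^2^2" where "Dt \<beta> = mat22 (exp (- \<beta> / 2)) 0 0 (exp (\<beta> / 2))"
definition Lt :: "real => real^2^2" where "Lt \<alpha> = mat22 1 0 (- \<alpha> / 2) 1"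

text \<open>The opposite Iwasawa decomposition, in which the first row is in polar coordinates.\<close>

definition Mt :: "real \<times> real \<times> real => real^2^2" where
 "Mt = (%(\<theta>, \<beta>, \<alpha>). mat22 (exp (- \<beta> / 2) * cos \<theta>) (exp (- \<beta> / 2) * sin \<theta>)
   (- \<alpha> / 2 * (exp (- \<beta> / 2) * cos \<theta>) - exp (\<beta> / 2) * sin \<theta>) (- \<alpha> / 2 * (exp (- \<beta> / 2) * sin \<theta>) + exp (\<beta> / 2) * cos \<theta>))"

lemma Mt_eq: "Mt (\<theta>, \<beta>, \<alpha>) = Lt \<alpha> ** (Dt \<beta> ** Rt \<theta>)"
 by (simp add: Mt_def Lt_def Dt_def Rt_def mat22_mult)

lemma iwasawa_eq: "\<rho> > 0 ==> iwasawa (\<theta>, \<rho>, \<nu>) = Rt \<theta> ** (Dt (- ln \<rho>) ** Lt (- \<nu>))"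
proof -
 assume \<rho>: "\<rho> > 0"
 have s: "exp (ln \<rho> / 2) = sqrt \<rho>" using \<rho> by (simp flip: ln_sqrt)
 have "exp (- ln \<rho> / 2) = 1 / sqrt \<rho>" using s by (simp add: exp_minus inverse_eq_divide)
 then have "Dt (- ln \<rho>) = vector [vector [sqrt \<rho>, 0], vector [0, 1 / sqrt \<rho>]]" using s by (simp add: Dt_def mat22_def)
 then show ?thesis unfolding iwasawa_def Rt_def Lt_def by (simp add: mat22_def matrix_mul_assoc)
qed

lemma det_mat22: "det (mat22 a b c d) = a * d - b * c"
 by (simp add: det_2)

lemma det_R: "det (Rt \<theta>) = 1" "det (Dt \<beta>) = 1" "det (Lt \<alpha>) = 1"
 by (simp_all add: Rt_def Dt_def Lt_def det_mat22 exp_add[symmetric] sin_cos_squared_add3)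

lemma iwasawa_mat: "\<rho> > 0 ==> iwasawa (\<theta>, \<rho>, \<nu>) = mat22 (cos \<theta> * sqrt \<rho> + sin \<theta> / sqrt \<rho> * (\<nu> / 2)) (sin \<theta> / sqrt \<rho>)
  (- sin \<theta> * sqrt \<rho> + cos \<theta> / sqrt \<rho> * (\<nu> / 2)) (cos \<theta> / sqrt \<rho>)"
 unfolding iwasawa_def by (simp add: mat22_def[symmetric] mat22_mult)

text \<open>A lower triangular factor on the left only rescales the first row, so angle and length
  are read off there; the third coordinate is the component of the second row along the
  first.\<close>

lemma Mt_of_polar:
 assumes r: "r > 0" and d: "a * d - b * c = (1::real)" and a: "a = r * cos \<psi>" and b: "b = r * sin \<psi>"
 shows "mat22 a b c d = Mt (\<psi>, - 2 * ln r, - 2 * (a * c + b * d) / r\<^sup>2)"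
proof -
 have r2: "r\<^sup>2 = a * a + b * b" unfolding a b by (simp add: power2_eq_square algebra_simps) (metis distrib_left mult.commute mult_1_right sin_cos_squared_add3)
 have rn: "r \<noteq> 0" using r by simp
 have e: "exp (ln r) = r" "exp (- ln r) = 1 / r" using r by (simp_all add: exp_minus inverse_eq_divide)
 have cs: "sin \<psi> / r = b / r\<^sup>2" "cos \<psi> / r = a / r\<^sup>2" unfolding a b using rn by (simp_all add: power2_eq_square)
 have "(a * c + b * d) * a - b = c * r\<^sup>2" unfolding r2 using d by algebra
 then have c: "(a * c + b * d) / r\<^sup>2 * a - sin \<psi> / r = c" unfolding cs using rn by (simp add: field_simps)
 have "(a * c + b * d) * b + a = d * r\<^sup>2" unfolding r2 using d by algebra
 then have dd: "(a * c + b * d) / r\<^sup>2 * b + cos \<psi> / r = d" unfolding cs using rn by (simp add: field_simps)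
 have k: "- (- 2 * z / y) / 2 = z / y" for z y :: real by simp
 have e': "exp (- (- 2 * ln r) / 2) = r" "exp (- 2 * ln r / 2) = 1 / r" using e by simp_all
 have c': "(a * c + b * d) / r\<^sup>2 * a - 1 / r * sin \<psi> = c" "(a * c + b * d) / r\<^sup>2 * b + 1 / r * cos \<psi> = d" using c dd by simp_all
 show ?thesis unfolding Mt_def prod.case k e' a[symmetric] b[symmetric] c' ..
qed

text \<open>With the lower triangular factor on the right it is the second column whose direction is
  preserved; its angle is counted with the lower entry as cosine.\<close>

lemma iwasawa_of_polar:
 assumes r: "r > 0" and d: "a * d - b * c = (1::real)" and dc: "d = r * cos \<psi>" and b: "b = r * sin \<psi>"
 shows "mat22 a b c d = iwasawa (\<psi>, 1 / r\<^sup>2, 2 * (a * b + c * d) / r\<^sup>2)"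
proof -
 have r2: "r\<^sup>2 = d * d + b * b" unfolding dc b by (simp add: power2_eq_square algebra_simps) (metis distrib_left mult.commute mult_1_right sin_cos_squared_add3)
 have rn: "r \<noteq> 0" "1 / r\<^sup>2 > 0" using r by simp_all
 have s: "sqrt (1 / r\<^sup>2) = 1 / r" using r by (simp add: real_sqrt_divide)
 have cs: "sin \<psi> / r = b / r\<^sup>2" "cos \<psi> / r = d / r\<^sup>2" unfolding dc b using rn by (simp_all add: power2_eq_square)
 have "d + b * (a * b + c * d) = a * r\<^sup>2" unfolding r2 using d by algebra
 then have aa: "cos \<psi> / r + b * ((a * b + c * d) / r\<^sup>2) = a" unfolding cs using rn by (simp add: field_simps)
 have "- b + d * (a * b + c * d) = c * r\<^sup>2" unfolding r2 using d by algebra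
 then have cc: "- (sin \<psi> / r) + d * ((a * b + c * d) / r\<^sup>2) = c" unfolding cs using rn by (simp add: field_simps)
 have k: "2 * z / y / 2 = z / y" for z y :: real by simp
 have e: "sin \<psi> / (1 / r) = b" "cos \<psi> / (1 / r) = d" using b dc by simp_all
 have "cos \<psi> * (1 / r) + b * ((a * b + c * d) / r\<^sup>2) = a" "- sin \<psi> * (1 / r) + d * ((a * b + c * d) / r\<^sup>2) = c" using aa cc by simp_all
 then show ?thesis unfolding iwasawa_mat[OF rn(2)] s k e by (simp only:)
qed

lemma cont_mat22:
 assumes "continuous_on D a" "continuous_on D b" "continuous_on D c" "continuous_on D d"
 shows "continuous_on D (%x. mat22 (a x) (b x) (c x) (d x))"
proof -
 have "continuous_on D (%x. \<chi> i j. mat22 (a x) (b x) (c x) (d x) $ i $ j)"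
 proof (intro continuous_on_vec_lambda)
  fix i j :: 2
  show "continuous_on D (%x. mat22 (a x) (b x) (c x) (d x) $ i $ j)"
   using exhaust_2[of i] exhaust_2[of j] assms by auto
 qed
 then show ?thesis by simp
qed

lemma Mt_inj: "Mt (\<theta>, \<beta>, \<alpha>) = Mt (\<theta>', \<beta>', \<alpha>') ==> \<beta> = \<beta>' \<and> \<alpha> = \<alpha>' \<and> cos \<theta> = cos \<theta>' \<and> sin \<theta> = sin \<theta>'"
proof -
 assume eq: "Mt (\<theta>, \<beta>, \<alpha>) = Mt (\<theta>', \<beta>', \<alpha>')"
 let ?a = "exp (- \<beta> / 2)" let ?a' = "exp (- \<beta>' / 2)"
 have 1: "?a * cos \<theta> = ?a' * cos \<theta>'" "?a * sin \<theta> = ?a' * sin \<theta>'"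
  using arg_cong[OF eq, of "%A. A $ 1 $ 1"] arg_cong[OF eq, of "%A. A $ 1 $ 2"] by (simp_all add: Mt_def)
 have n: "(x * cos t) * (x * cos t) + (x * sin t) * (x * sin t) = x * x" for x t :: real
 proof -
  have "(x * cos t) * (x * cos t) + (x * sin t) * (x * sin t) = x * x * (cos t * cos t + sin t * sin t)" by algebra
  then show ?thesis by (simp only: sin_cos_squared_add3 mult_1_right)
 qed
 have "?a * ?a = ?a' * ?a'" using n[of ?a \<theta>] n[of ?a' \<theta>'] 1 by simp
 then have b: "\<beta> = \<beta>'" by (simp add: exp_add[symmetric])
 then have cs: "cos \<theta> = cos \<theta>'" "sin \<theta> = sin \<theta>'" using 1 by simp_all
 have 2: "- \<alpha> / 2 * (?a * cos \<theta>) = - \<alpha>' / 2 * (?a * cos \<theta>)" "- \<alpha> / 2 * (?a * sin \<theta>) = - \<alpha>' / 2 * (?a * sin \<theta>)"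
  using arg_cong[OF eq, of "%A. A $ 2 $ 1"] arg_cong[OF eq, of "%A. A $ 2 $ 2"] b cs by (simp_all add: Mt_def)
 have "cos \<theta> \<noteq> 0 \<or> sin \<theta> \<noteq> 0" using sin_cos_squared_add3[of \<theta>] by force
 then have "\<alpha> = \<alpha>'" using 2 by auto
 then show ?thesis using b cs by simp
qed

text \<open>The branch of the inverse of \<open>Mt\<close> around the angle
  \<open>\<theta>0\<close>: the first row is turned back by \<open>\<theta>0\<close>, and the
  arctangent is taken in the right half-plane, which is \<open>Wm\<close>. The formula makes sense
  on an open set of all matrices, as a smooth map out of the group must be given.\<close>

definition om :: "real => real^2^2 => real \<times> real \<times> real" where
 "om \<theta>0 A = (\<theta>0 + arctan ((A $ 1 $ 2 * cos \<theta>0 - A $ 1 $ 1 * sin \<theta>0) / (A $ 1 $ 1 * cos \<theta>0 + A $ 1 $ 2 * sin \<theta>0)),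
   - ln ((A $ 1 $ 1)\<^sup>2 + (A $ 1 $ 2)\<^sup>2), - 2 * (A $ 1 $ 1 * A $ 2 $ 1 + A $ 1 $ 2 * A $ 2 $ 2) / ((A $ 1 $ 1)\<^sup>2 + (A $ 1 $ 2)\<^sup>2))"

definition Wm :: "real => (real^2^2) set" where "Wm \<theta>0 = {A. A $ 1 $ 1 * cos \<theta>0 + A $ 1 $ 2 * sin \<theta>0 > 0}"

lemma open_Wm: "open (Wm \<theta>0)"
 unfolding Wm_def by (intro open_Collect_less continuous_intros continuous_on_component)

lemma Wm_pos: "A \<in> Wm \<theta>0 ==> (A $ 1 $ 1)\<^sup>2 + (A $ 1 $ 2)\<^sup>2 > 0"
 by (auto simp: Wm_def sum_power2_gt_zero_iff)

lemma cont_om: "continuous_on (Wm \<theta>0) (om \<theta>0)"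
proof -
 have "\<forall>A\<in>Wm \<theta>0. A $ 1 $ 1 * cos \<theta>0 + A $ 1 $ 2 * sin \<theta>0 \<noteq> 0" by (auto simp: Wm_def)
 moreover have "\<forall>A\<in>Wm \<theta>0. (A $ 1 $ 1)\<^sup>2 + (A $ 1 $ 2)\<^sup>2 \<noteq> 0" using Wm_pos by (metis less_irrefl)
 ultimately show ?thesis unfolding om_def[abs_def] by (intro continuous_intros continuous_on_component) auto
qed

lemma Mt_om: "A \<in> Wm \<theta>0 ==> det A = 1 ==> Mt (om \<theta>0 A) = A"
proof -
 assume A: "A \<in> Wm \<theta>0" and d: "det A = 1"
 let ?a = "A $ 1 $ 1" let ?b = "A $ 1 $ 2"
 define u v where "u = ?a * cos \<theta>0 + ?b * sin \<theta>0" and "v = ?b * cos \<theta>0 - ?a * sin \<theta>0"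
 define r where "r = sqrt (?a\<^sup>2 + ?b\<^sup>2)"
 have r: "r > 0" "r\<^sup>2 = ?a\<^sup>2 + ?b\<^sup>2" using Wm_pos[OF A] by (auto simp: r_def)
 have up: "u > 0" using A by (simp add: Wm_def u_def)
 have cs: "cos \<theta>0 * cos \<theta>0 + sin \<theta>0 * sin \<theta>0 = 1" using sin_cos_squared_add3[of \<theta>0] by simp
 have uv: "u\<^sup>2 + v\<^sup>2 = r\<^sup>2"
 proof -
  have "u\<^sup>2 + v\<^sup>2 = (?a\<^sup>2 + ?b\<^sup>2) * (cos \<theta>0 * cos \<theta>0 + sin \<theta>0 * sin \<theta>0)" unfolding u_def v_def by algebra
  then show ?thesis using cs r by simp
 qed
 have sq: "sqrt (1 + (v / u)\<^sup>2) = r / u"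
 proof -
  have "1 + (v / u)\<^sup>2 = (r / u)\<^sup>2" using up uv by (simp add: power_divide field_simps)
  then show ?thesis using up r by simp
 qed
 have co: "cos (arctan (v / u)) = u / r" "sin (arctan (v / u)) = v / r"
  using cos_arctan[of "v / u"] sin_arctan[of "v / u"] up r unfolding sq by simp_all
 define \<psi> where "\<psi> = \<theta>0 + arctan (v / u)"
 have "r * cos \<psi> = cos \<theta>0 * u - sin \<theta>0 * v" unfolding \<psi>_def cos_add co using r by (simp add: field_simps)
 also have "\<dots> = ?a * (cos \<theta>0 * cos \<theta>0 + sin \<theta>0 * sin \<theta>0)" unfolding u_def v_def by algebra
 finally have a: "?a = r * cos \<psi>" using cs by simp
 have "r * sin \<psi> = sin \<theta>0 * u + cos \<theta>0 * v" unfolding \<psi>_def sin_add co using r by (simp add: field_simps)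
 also have "\<dots> = ?b * (cos \<theta>0 * cos \<theta>0 + sin \<theta>0 * sin \<theta>0)" unfolding u_def v_def by algebra
 finally have b: "?b = r * sin \<psi>" using cs by simp
 have "mat22 ?a ?b (A $ 2 $ 1) (A $ 2 $ 2) = Mt (\<psi>, - 2 * ln r, - 2 * (?a * A $ 2 $ 1 + ?b * A $ 2 $ 2) / r\<^sup>2)"
  by (rule Mt_of_polar[OF r(1) _ a b]) (use d in \<open>simp add: det_2\<close>)
 also have "- 2 * ln r = - ln (?a\<^sup>2 + ?b\<^sup>2)" using Wm_pos[OF A] by (simp add: r_def ln_sqrt)
 finally show ?thesis unfolding mat22_eta om_def \<psi>_def u_def v_def r(2) by simp
qed

lemma om_Mt: "\<bar>\<theta> - \<theta>0\<bar> < pi / 2 ==> Mt (\<theta>, \<beta>, \<alpha>) \<in> Wm \<theta>0 \<and> om \<theta>0 (Mt (\<theta>, \<beta>, \<alpha>)) = (\<theta>, \<beta>, \<alpha>)"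
proof -
 assume th: "\<bar>\<theta> - \<theta>0\<bar> < pi / 2"
 let ?A = "Mt (\<theta>, \<beta>, \<alpha>)" let ?e = "exp (- \<beta> / 2)"
 have e0: "?e > 0" by simp
 have u: "?A $ 1 $ 1 * cos \<theta>0 + ?A $ 1 $ 2 * sin \<theta>0 = ?e * cos (\<theta> - \<theta>0)"
  by (simp add: Mt_def cos_diff algebra_simps)
 have v: "?A $ 1 $ 2 * cos \<theta>0 - ?A $ 1 $ 1 * sin \<theta>0 = ?e * sin (\<theta> - \<theta>0)"
  by (simp add: Mt_def sin_diff algebra_simps)
 have th': "- (pi / 2) < \<theta> - \<theta>0" "\<theta> - \<theta>0 < pi / 2" using th by linarith+
 have cp: "cos (\<theta> - \<theta>0) > 0" using th' by (rule cos_gt_zero_pi)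
 have W: "?A \<in> Wm \<theta>0" unfolding Wm_def mem_Collect_eq u using cp by simp
 have at: "arctan (?e * sin (\<theta> - \<theta>0) / (?e * cos (\<theta> - \<theta>0))) = \<theta> - \<theta>0"
  using arctan_tan[OF th'] by (simp add: tan_def)
 have "det ?A = 1" unfolding Mt_eq by (simp add: det_mul det_R)
 then have "Mt (om \<theta>0 ?A) = ?A" using Mt_om[OF W] by simp
 moreover have f: "fst (om \<theta>0 ?A) = \<theta>" unfolding om_def fst_conv u v at by simp
 ultimately have "snd (om \<theta>0 ?A) = (\<beta>, \<alpha>)" using Mt_inj by (metis prod.collapse)
 then show ?thesis using W f by (simp add: prod_eq_iff)
qed

lemma Mt_kepler: "Mt (Th x t, W x t, I x t) = Phi (F x) t"
proof -
 have h: "exp (W x t) * exp (- W x t / 2) = exp (W x t / 2)" by (simp add: exp_add[symmetric])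
 have "Z1 x t = - I x t / 2 * V1 x t - exp (W x t) * V2 x t" "Z2 x t = - I x t / 2 * V2 x t + exp (W x t) * V1 x t"
  by (simp_all add: Z1_def Z2_def E_apply)
 then show ?thesis unfolding Phi_def kepler Mt_def prod.case
  by (intro mat_eqI) (simp_all only: mat22_nth V_apply h[symmetric] mult.assoc)
qed

section \<open>Coordinates on the universal cover and the lifted monodromy\<close>

locale cover_SL2 =
 fixes G :: "('g::topological_space, 'm) monoid_scheme" and pr :: "'g => real^2^2"
 assumes uc: "universal_cover_SL2 G pr"
begin

lemma cov: "covering_space (carrier G) pr (carrier SL2)" and hom: "group_hom G SL2 pr" and sc: "simply_connected (carrier G)"
 using uc by (auto simp: universal_cover_SL2_def)

lemma SL2_mem: "A \<in> carrier SL2 \<longleftrightarrow> det A = 1" by (simp add: SL2_def)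

lemma pr_one: "pr \<one>\<^bsub>G\<^esub> = mat 1" using group_hom.hom_one[OF hom] by (simp add: SL2_def)

lemma pr_mult: "x \<in> carrier G ==> y \<in> carrier G ==> pr (x \<otimes>\<^bsub>G\<^esub> y) = pr x ** pr y"
 using group_hom.hom_mult[OF hom] by (simp add: SL2_def)

lemma grp: "group G" using hom by (simp add: group_hom_def)

lemma one_mem: "\<one>\<^bsub>G\<^esub> \<in> carrier G" using grp by (simp add: group.is_monoid)

lemma mult_mem: "x \<in> carrier G ==> y \<in> carrier G ==> x \<otimes>\<^bsub>G\<^esub> y \<in> carrier G"
 using grp by (simp add: group.is_monoid monoid.m_closed)

lemma lift_one_parameter:
 assumes "continuous_on UNIV f" "!!t. det (f t) = 1" "f (0::real) = mat 1"
 shows "\<exists>g. continuous_on UNIV g \<and> g 0 = \<one>\<^bsub>G\<^esub> \<and> (\<forall>t. g t \<in> carrier G \<and> pr (g t) = f t)"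
 using covering_lift_line[OF cov assms(1), of "\<one>\<^bsub>G\<^esub>"] assms pr_one one_mem by (simp add: SL2_mem)

lemma cont_mult:
 assumes "continuous_on D f" "continuous_on D g" "f ` D \<subseteq> carrier G" "g ` D \<subseteq> carrier G"
 shows "continuous_on D (%x. f x \<otimes>\<^bsub>G\<^esub> g x)"
proof -
 have m: "continuous_on (carrier G \<times> carrier G) (%(x, y). x \<otimes>\<^bsub>G\<^esub> y)" using uc by (simp add: universal_cover_SL2_def)
 have "continuous_on D (%x. (%(x, y). x \<otimes>\<^bsub>G\<^esub> y) (f x, g x))"
  by (rule continuous_on_compose2[OF m continuous_on_Pair[OF assms(1,2)]]) (use assms in auto)
 then show ?thesis by simp
qed

lemma ex_lifts: "\<exists>lr ld ll. (continuous_on UNIV lr \<and> lr 0 = \<one>\<^bsub>G\<^esub> \<and> (\<forall>t. lr t \<in> carrier G \<and> pr (lr t) = Rt t)) \<and>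
  (continuous_on UNIV ld \<and> ld 0 = \<one>\<^bsub>G\<^esub> \<and> (\<forall>t. ld t \<in> carrier G \<and> pr (ld t) = Dt t)) \<and>
  (continuous_on UNIV ll \<and> ll 0 = \<one>\<^bsub>G\<^esub> \<and> (\<forall>t. ll t \<in> carrier G \<and> pr (ll t) = Lt t))"
proof -
 have m1: "mat 1 = mat22 1 0 0 1" by (rule mat_eqI) (simp_all add: mat_def)
 have "continuous_on UNIV Rt" "continuous_on UNIV Dt" "continuous_on UNIV Lt"
  unfolding Rt_def[abs_def] Dt_def[abs_def] Lt_def[abs_def] by (intro cont_mat22 continuous_intros; simp)+
 then show ?thesis
  using lift_one_parameter[of Rt] lift_one_parameter[of Dt] lift_one_parameter[of Lt] det_R
  by (simp add: m1 Rt_def Dt_def Lt_def)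
qed

definition phi :: "real \<times> real \<times> real => 'g" where
 "phi = (SOME f. continuous_on UNIV f \<and> (\<forall>c. f c \<in> carrier G \<and> pr (f c) = Mt c) \<and> f (0, 0, 0) = \<one>\<^bsub>G\<^esub>)"

text \<open>The lift of \<open>Mt\<close> is a product, formed in \<open>G\<close>, of lifts of
  three curves. So only curves have to be lifted, not maps of three variables.\<close>

lemma phi: "continuous_on UNIV phi" "phi c \<in> carrier G" "pr (phi c) = Mt c" "phi (0, 0, 0) = \<one>\<^bsub>G\<^esub>"
proof -
 obtain lr ld ll where l: "continuous_on UNIV lr" "lr 0 = \<one>\<^bsub>G\<^esub>" "!!t. lr t \<in> carrier G" "!!t. pr (lr t) = Rt t"
   "continuous_on UNIV ld" "ld 0 = \<one>\<^bsub>G\<^esub>" "!!t. ld t \<in> carrier G" "!!t. pr (ld t) = Dt t"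
   "continuous_on UNIV ll" "ll 0 = \<one>\<^bsub>G\<^esub>" "!!t. ll t \<in> carrier G" "!!t. pr (ll t) = Lt t"
  using ex_lifts by blast
 let ?f = "%c. ll (snd (snd c)) \<otimes>\<^bsub>G\<^esub> (ld (fst (snd c)) \<otimes>\<^bsub>G\<^esub> lr (fst c))"
 have "continuous_on UNIV ?f"
  by (intro cont_mult continuous_on_compose2[OF l(1)] continuous_on_compose2[OF l(5)] continuous_on_compose2[OF l(9)] continuous_intros)
    (use l mult_mem in auto)
 moreover have "?f c \<in> carrier G \<and> pr (?f c) = Mt c" for c
  using l mult_mem by (cases c) (auto simp: pr_mult Mt_eq)
 moreover have "?f (0, 0, 0) = \<one>\<^bsub>G\<^esub>" using l grp one_mem by (simp add: group.is_monoid)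
 ultimately have "continuous_on UNIV phi \<and> (\<forall>c. phi c \<in> carrier G \<and> pr (phi c) = Mt c) \<and> phi (0, 0, 0) = \<one>\<^bsub>G\<^esub>"
  unfolding phi_def by (intro someI[of "%f. continuous_on UNIV f \<and> (\<forall>c. f c \<in> carrier G \<and> pr (f c) = Mt c) \<and> f (0, 0, 0) = \<one>\<^bsub>G\<^esub>" ?f]) blast
 then show "continuous_on UNIV phi" "phi c \<in> carrier G" "pr (phi c) = Mt c" "phi (0, 0, 0) = \<one>\<^bsub>G\<^esub>" by blast+
qed

abbreviation dom_L :: "(real \<times> real \<times> real) set" where "dom_L \<equiv> UNIV \<times> {0<..} \<times> UNIV"

text \<open>The same product in the other order is a witness for the choice in
  \<open>phi_L\<close>.\<close>

lemma phi_L: "continuous_on dom_L (phi_L G pr)" "x \<in> dom_L ==> phi_L G pr x \<in> carrier G" "x \<in> dom_L ==> pr (phi_L G pr x) = iwasawa x"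
 "phi_L G pr (0, 1, 0) = \<one>\<^bsub>G\<^esub>"
proof -
 obtain lr ld ll where l: "continuous_on UNIV lr" "lr 0 = \<one>\<^bsub>G\<^esub>" "!!t. lr t \<in> carrier G" "!!t. pr (lr t) = Rt t"
   "continuous_on UNIV ld" "ld 0 = \<one>\<^bsub>G\<^esub>" "!!t. ld t \<in> carrier G" "!!t. pr (ld t) = Dt t"
   "continuous_on UNIV ll" "ll 0 = \<one>\<^bsub>G\<^esub>" "!!t. ll t \<in> carrier G" "!!t. pr (ll t) = Lt t"
  using ex_lifts by blast
 let ?f = "%c. lr (fst c) \<otimes>\<^bsub>G\<^esub> (ld (- ln (fst (snd c))) \<otimes>\<^bsub>G\<^esub> ll (- snd (snd c)))"
 have "continuous_on dom_L ?f"
  by (intro cont_mult continuous_on_compose2[OF l(1)] continuous_on_compose2[OF l(5)] continuous_on_compose2[OF l(9)] continuous_intros)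
    (use l mult_mem in auto)
 moreover have "?f c \<in> carrier G \<and> (c \<in> dom_L --> pr (?f c) = iwasawa c)" for c
  using l mult_mem by (cases c) (auto simp: pr_mult iwasawa_eq)
 moreover have "?f (0, 1, 0) = \<one>\<^bsub>G\<^esub>" using l grp one_mem by (simp add: group.is_monoid)
 ultimately have "\<exists>\<phi>. continuous_on dom_L \<phi> \<and> \<phi> ` dom_L \<subseteq> carrier G \<and> \<phi> (0, 1, 0) = \<one>\<^bsub>G\<^esub> \<and> (\<forall>x\<in>dom_L. pr (\<phi> x) = iwasawa x)"
  by (intro exI[of _ ?f]) blast
 then have *: "continuous_on dom_L (phi_L G pr) \<and> phi_L G pr ` dom_L \<subseteq> carrier G \<and> phi_L G pr (0, 1, 0) = \<one>\<^bsub>G\<^esub> \<and> (\<forall>x\<in>dom_L. pr (phi_L G pr x) = iwasawa x)"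
  unfolding phi_L_def by (rule someI_ex)
 then show "continuous_on dom_L (phi_L G pr)" "x \<in> dom_L ==> phi_L G pr x \<in> carrier G" "x \<in> dom_L ==> pr (phi_L G pr x) = iwasawa x"
  "phi_L G pr (0, 1, 0) = \<one>\<^bsub>G\<^esub>" by blast+
qed

text \<open>The tool for comparing the two coordinate systems in \<open>G\<close>: equality of two
  curves of matrices and of their starting points upstairs suffices.\<close>

lemma same_lift:
 fixes T :: real
 assumes T: "T \<ge> 0" and c: "continuous_on {0..T} c" and d: "continuous_on {0..T} d" "!!t. t \<in> {0..T} ==> d t \<in> dom_L"
  and eq: "!!t. t \<in> {0..T} ==> Mt (c t) = iwasawa (d t)" and ini: "phi (c 0) = phi_L G pr (d 0)"
 shows "phi (c T) = phi_L G pr (d T)"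
proof (rule covering_lift_unique[OF cov, of "{0..T}" 0 "%t. phi (c t)" "%t. phi_L G pr (d t)"])
 show "continuous_on {0..T} (%t. phi (c t))" by (rule continuous_on_compose2[OF phi(1) c]) auto
 show "continuous_on {0..T} (%t. phi_L G pr (d t))" by (rule continuous_on_compose2[OF phi_L(1) d(1)]) (rule image_subsetI, rule d(2))
qed (use T ini phi phi_L d eq in auto)

lemma triangular_lift:
 "\<rho> > 0 ==> phi (0, - ln \<rho>, - \<nu> / \<rho>) = phi_L G pr (0, \<rho>, \<nu>)"
proof -
 assume \<rho>: "\<rho> > 0"
 \<comment> \<open>The segment from (1, 0) to (\<open>\<rho>\<close>, \<open>\<nu>\<close>) joins
   the identity to the given triangular element without leaving the domain, at angle 0 in both
   decompositions.\<close>
 define u where "u t = 1 + t * (\<rho> - 1)" for t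
 have u: "u t > 0" if "t \<in> {0..1}" for t
 proof -
  have "u t = (1 - t) + t * \<rho>" by (simp add: u_def algebra_simps)
  moreover have "0 < (1 - t) + t * \<rho>"
  proof (cases "t = 0")
   case False
   then have "0 < t * \<rho>" using that \<rho> by auto
   then show ?thesis using that by (auto intro: add_nonneg_pos)
  qed simp
  ultimately show ?thesis by simp
 qed
 have cu: "continuous_on {0..1} u" unfolding u_def[abs_def] by (intro continuous_intros)
 have "phi (0, - ln (u 1), - (1 * \<nu>) / u 1) = phi_L G pr (0, u 1, 1 * \<nu>)"
 proof (rule same_lift[of 1 "%t. (0, - ln (u t), - (t * \<nu>) / u t)" "%t. (0, u t, t * \<nu>)"])
  show "continuous_on {0..1} (%t. (0, - ln (u t), - (t * \<nu>) / u t))"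
   using u by (intro continuous_intros cu) force+
  show "continuous_on {0..1} (%t. (0, u t, t * \<nu>))" by (intro continuous_intros cu)
  fix t :: real assume t: "t \<in> {0..1}"
  have s: "sqrt (u t) > 0" "sqrt (u t) * sqrt (u t) = u t" using u[OF t] by auto
  have "iwasawa (0, u t, t * \<nu>) = mat22 (sqrt (u t)) 0 (1 / sqrt (u t) * (t * \<nu> / 2)) (1 / sqrt (u t))"
   using iwasawa_mat[OF u[OF t], of 0 "t * \<nu>"] by simp
  also have "\<dots> = Mt (0, - 2 * ln (sqrt (u t)), - 2 * (sqrt (u t) * (1 / sqrt (u t) * (t * \<nu> / 2)) + 0 * (1 / sqrt (u t))) / (sqrt (u t))\<^sup>2)"
   by (rule Mt_of_polar[OF s(1)]) (use s in simp_all)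
  also have "\<dots> = Mt (0, - ln (u t), - (t * \<nu>) / u t)" using s u[OF t] by (simp add: ln_sqrt)
  finally show "Mt (0, - ln (u t), - (t * \<nu>) / u t) = iwasawa (0, u t, t * \<nu>)" by simp
  show "(0, u t, t * \<nu>) \<in> dom_L" using u[OF t] by simp
 qed (use phi(4) phi_L(4) in \<open>auto simp: u_def\<close>)
 then show ?thesis by (simp add: u_def)
qed

lemma triangular_lift': "phi (0, \<beta>, \<alpha>) = phi_L G pr (0, exp (- \<beta>), - \<alpha> * exp (- \<beta>))"
 using triangular_lift[of "exp (- \<beta>)" "- \<alpha> * exp (- \<beta>)"] by simp

text \<open>Start at angle 0, where the decompositions are matched by
  \<open>triangular_lift\<close>, and increase one angle with the other two coordinates fixed. In
  the first direction the left angle runs and the first row moves with Wronskian 1; in the second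
  the row angle runs and the second column does. By \<open>polar_angle\<close> the other angle
  becomes positive.\<close>

lemma G0_eq: "G0 G pr = phi ` ({0<..} \<times> UNIV \<times> UNIV)"
proof (intro equalityI subsetI)
 fix g assume "g \<in> G0 G pr"
 then obtain \<theta> \<rho> \<nu> where g: "g = phi_L G pr (\<theta>, \<rho>, \<nu>)" and \<theta>: "\<theta> > 0" and \<rho>: "\<rho> > 0" by (auto simp: G0_def)
 define s where "s = sqrt \<rho>"
 have s: "s > 0" "s * s = \<rho>" "s\<^sup>2 = \<rho>" using \<rho> by (auto simp: s_def)
 define a where "a t = cos t * s + sin t / s * (\<nu> / 2)" for t
 define b where "b t = sin t / s" for t
 define c where "c t = - sin t * s + cos t / s * (\<nu> / 2)" for t
 define d where "d t = cos t / s" for t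
 have iw: "iwasawa (t, \<rho>, \<nu>) = mat22 (a t) (b t) (c t) (d t)" for t
  unfolding iwasawa_mat[OF \<rho>] a_def b_def c_def d_def s_def ..
 have w: "a t * d t - c t * b t = 1" for t
 proof -
  have "a t * d t - c t * b t = (cos t * cos t + sin t * sin t) * (s / s)" unfolding a_def b_def c_def d_def by (simp add: algebra_simps add_divide_distrib)
  then show ?thesis using s(1) sin_cos_squared_add3[of t] by simp
 qed
 have da: "(a has_real_derivative c t) (at t)" "(b has_real_derivative d t) (at t)" for t
  unfolding a_def[abs_def] b_def[abs_def] c_def d_def using s(1) by (auto intro!: derivative_eq_intros simp: field_simps)
 have ini: "a 0 > 0" "b 0 = 0" using s by (auto simp: a_def b_def)
 define \<psi> where "\<psi> t = integral {0..t} (%s. 1 / ((a s)\<^sup>2 + (b s)\<^sup>2))" for t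
 define r where "r t = sqrt ((a t)\<^sup>2 + (b t)\<^sup>2)" for t
 note P = polar_angle[OF less_imp_le[OF \<theta>] da w ini, folded \<psi>_def r_def]
 have r: "r t > 0" if "t \<in> {0..\<theta>}" for t using P(5)[OF that] by (simp add: r_def)
 have ct: "continuous_on {0..\<theta>} a" "continuous_on {0..\<theta>} b" "continuous_on {0..\<theta>} c" "continuous_on {0..\<theta>} d"
  unfolding a_def[abs_def] b_def[abs_def] c_def[abs_def] d_def[abs_def] using s(1) by (intro continuous_intros; simp)+
 have cr: "continuous_on {0..\<theta>} r" unfolding r_def[abs_def] by (intro continuous_intros ct)
 let ?C = "%t. (\<psi> t, - 2 * ln (r t), - 2 * (a t * c t + b t * d t) / (r t)\<^sup>2)"
 have "phi (?C \<theta>) = phi_L G pr (\<theta>, \<rho>, \<nu>)"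
 proof (rule same_lift[of \<theta> ?C "%t. (t, \<rho>, \<nu>)"])
  show "continuous_on {0..\<theta>} ?C"
   using P(3)[of 0] \<theta> r by (intro continuous_intros ct cr) force+
  show "Mt (?C t) = iwasawa (t, \<rho>, \<nu>)" if t: "t \<in> {0..\<theta>}" for t
   unfolding iw by (rule Mt_of_polar[OF r[OF t] _ P(1,2)[OF t], symmetric]) (use w[of t] in \<open>simp add: mult.commute\<close>)
  have "?C 0 = (0, - ln \<rho>, - \<nu> / \<rho>)"
  proof -
   have "r 0 = s" using s(1) by (simp add: r_def a_def b_def)
   moreover have "ln \<rho> = 2 * ln s" using s(1) by (simp add: s(2)[symmetric] ln_mult)
   ultimately show ?thesis using s by (simp add: \<psi>_def a_def b_def c_def d_def)
  qed
  then show "phi (?C 0) = phi_L G pr (0, \<rho>, \<nu>)" using triangular_lift[OF \<rho>] by simp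
 qed (use \<theta> \<rho> in \<open>auto intro!: continuous_intros\<close>)
 moreover have "\<psi> \<theta> > 0" using P(4)[of \<theta>] \<theta> by simp
 then have "phi (?C \<theta>) \<in> phi ` ({0<..} \<times> UNIV \<times> UNIV)" by (intro imageI) simp
 ultimately show "g \<in> phi ` ({0<..} \<times> UNIV \<times> UNIV)" unfolding g by simp
next
 fix g assume "g \<in> phi ` ({0<..} \<times> UNIV \<times> UNIV)"
 then obtain \<theta> \<beta> \<alpha> where g: "g = phi (\<theta>, \<beta>, \<alpha>)" and \<theta>: "\<theta> > 0" by auto
 define e f where "e = exp (- \<beta> / 2)" and "f = exp (\<beta> / 2)"
 have ef: "e > 0" "f > 0" "e * f = 1" by (simp_all add: e_def f_def exp_add[symmetric])
 define a where "a t = e * cos t" for t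
 define b where "b t = e * sin t" for t
 define c where "c t = - \<alpha> / 2 * (e * cos t) - f * sin t" for t
 define d where "d t = - \<alpha> / 2 * (e * sin t) + f * cos t" for t
 have M: "Mt (t, \<beta>, \<alpha>) = mat22 (a t) (b t) (c t) (d t)" for t
  unfolding Mt_def a_def b_def c_def d_def e_def f_def by simp
 have w: "d t * a t - c t * b t = 1" for t
 proof -
  have "d t * a t - c t * b t = (e * f) * (cos t * cos t + sin t * sin t)" unfolding a_def b_def c_def d_def by algebra
  then show ?thesis using ef sin_cos_squared_add3[of t] by simp
 qed
 have da: "(d has_real_derivative c t) (at t)" "(b has_real_derivative a t) (at t)" for t
  unfolding a_def b_def[abs_def] c_def d_def[abs_def] by (auto intro!: derivative_eq_intros)
 have ini: "d 0 > 0" "b 0 = 0" using ef by (auto simp: d_def b_def)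
 define \<psi> where "\<psi> t = integral {0..t} (%s. 1 / ((d s)\<^sup>2 + (b s)\<^sup>2))" for t
 define r where "r t = sqrt ((d t)\<^sup>2 + (b t)\<^sup>2)" for t
 note P = polar_angle[OF less_imp_le[OF \<theta>] da w ini, folded \<psi>_def r_def]
 have r: "r t > 0" if "t \<in> {0..\<theta>}" for t using P(5)[OF that] by (simp add: r_def)
 have ct: "continuous_on {0..\<theta>} a" "continuous_on {0..\<theta>} b" "continuous_on {0..\<theta>} c" "continuous_on {0..\<theta>} d"
  unfolding a_def[abs_def] b_def[abs_def] c_def[abs_def] d_def[abs_def] by (intro continuous_intros)+
 have cr: "continuous_on {0..\<theta>} r" unfolding r_def[abs_def] by (intro continuous_intros ct)
 let ?C = "%t. (\<psi> t, 1 / (r t)\<^sup>2, 2 * (a t * b t + c t * d t) / (r t)\<^sup>2)"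
 have "phi (\<theta>, \<beta>, \<alpha>) = phi_L G pr (?C \<theta>)"
 proof (rule same_lift[of \<theta> "%t. (t, \<beta>, \<alpha>)" ?C])
  show "continuous_on {0..\<theta>} ?C"
   using P(3)[of 0] \<theta> r by (intro continuous_intros ct cr) force+
  show "Mt (t, \<beta>, \<alpha>) = iwasawa (?C t)" if t: "t \<in> {0..\<theta>}" for t
   unfolding M by (rule iwasawa_of_polar[OF r[OF t] _ P(1,2)[OF t]]) (use w[of t] in \<open>simp add: mult.commute\<close>)
  show "?C t \<in> dom_L" if t: "t \<in> {0..\<theta>}" for t using r[OF t] by simp
  have f2: "exp (- \<beta>) = 1 / f\<^sup>2" "e = 1 / f" using ef by (simp_all add: f_def e_def power2_eq_square exp_add[symmetric] exp_minus inverse_eq_divide)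
  have "?C 0 = (0, exp (- \<beta>), - \<alpha> * exp (- \<beta>))"
   unfolding f2(1) using ef f2(2) by (simp add: r_def \<psi>_def a_def b_def c_def d_def)
  then show "phi (0, \<beta>, \<alpha>) = phi_L G pr (?C 0)" using triangular_lift' by simp
 qed (use \<theta> in \<open>auto intro!: continuous_intros\<close>)
 moreover have "\<psi> \<theta> > 0" using P(4)[of \<theta>] \<theta> by simp
 moreover have "r \<theta> > 0" using r[of \<theta>] \<theta> by simp
 ultimately show "g \<in> G0 G pr" unfolding g G0_def by auto
qed

text \<open>The first row of a loop in \<open>G\<close> is null-homotopic in the punctured plane, so it has a continuous logarithm.\<close>

lemma phi_inj: "phi c = phi c' ==> c = c'"
proof -
 assume eq: "phi c = phi c'"
 obtain \<theta> \<beta> \<alpha> \<theta>' \<beta>' \<alpha>' where c: "c = (\<theta>, \<beta>, \<alpha>)" "c' = (\<theta>', \<beta>', \<alpha>')" by (metis prod.exhaust)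
 have "Mt c = Mt c'" using eq phi(3) by metis
 then have b: "\<beta>' = \<beta>" "\<alpha>' = \<alpha>" "cos \<theta> = cos \<theta>'" "sin \<theta> = sin \<theta>'" using Mt_inj c by metis+
 define \<omega> where "\<omega> = \<theta>' - \<theta>"
 define p where "p t = phi (\<theta> + t * \<omega>, \<beta>, \<alpha>)" for t
 have cp: "continuous_on UNIV p" unfolding p_def[abs_def]
  by (rule continuous_on_compose2[OF phi(1)]) (intro continuous_intros, simp)
 have pp: "path p" "path_image p \<subseteq> carrier G" "pathfinish p = pathstart p"
  using continuous_on_subset[OF cp] phi(2) eq c b by (auto simp: path_def path_image_def pathstart_def pathfinish_def p_def \<omega>_def)
 have "path (%_. p 0) \<and> pathfinish (%_. p 0) = pathstart (%_. p 0) \<and> path_image (%_. p 0) \<subseteq> carrier G"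
  using phi(2) by (auto simp: path_def pathfinish_def pathstart_def path_image_def p_def)
 then have "homotopic_loops (carrier G) p (%_. p 0)"
  using sc pp unfolding simply_connected_def by blast
 then obtain h where h: "continuous_on ({0..1::real} \<times> {0..1::real}) h" "h ` ({0..1} \<times> {0..1}) \<subseteq> carrier G"
   "!!x. x \<in> {0..1} ==> h (0, x) = p x" "!!x. x \<in> {0..1} ==> h (1, x) = p 0"
   "!!t. t \<in> {0..1} ==> h (t, 1) = h (t, 0)"
  unfolding homotopic_loops pathstart_def pathfinish_def image_subset_iff_funcset comp_apply by blast
 let ?Q = "{0..1::real} \<times> {0..1::real}"
 define z where "z A = Complex (A $ 1 $ 1) (A $ 1 $ 2)" for A :: "real^2^2"
 have cz: "continuous_on D z" for D unfolding z_def[abs_def] Complex_eq by (intro continuous_intros continuous_on_component)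
 have z0: "z A \<noteq> 0" if "A \<in> carrier SL2" for A using that unfolding SL2_mem z_def by (auto simp: det_2 Complex_eq_0)
 have prc: "continuous_on (carrier G) pr" "pr ` carrier G = carrier SL2" using cov by (auto simp: covering_space_def)
 have "continuous_on ?Q (%x. z (pr (h x)))"
  by (rule continuous_on_compose2[OF cz[of UNIV] continuous_on_compose2[OF prc(1) h(1,2)]]) auto
 moreover have "contractible ?Q" by (intro convex_imp_contractible convex_Times) auto
 moreover have "z (pr (h x)) \<noteq> 0" if x: "x \<in> ?Q" for x
 proof (rule z0)
  have "h x \<in> carrier G" using h(2) x by (rule subsetD[OF _ imageI])
  then show "pr (h x) \<in> carrier SL2" unfolding prc(2)[symmetric] by (rule imageI)
 qed
 ultimately obtain g where g: "continuous_on ?Q g" "!!x. x \<in> ?Q ==> z (pr (h x)) = exp (g x)"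
  by (rule continuous_logarithm_on_contractible) (assumption | rule that)+
 have const: "f 1 = f 0" if f: "continuous_on {0..1} f" "!!t. t \<in> {0..1} ==> exp (f t) = 1" for f :: "real => complex"
 proof -
  have "continuous_on {0..1} (%t. Im (f t) / (2 * pi))" by (intro continuous_intros f(1)) simp
  moreover have "Im (f t) / (2 * pi) \<in> \<int>" and re: "Re (f t) = 0" if t: "t \<in> {0..1}" for t
  proof -
   obtain n :: int where n: "Re (f t) = 0" "Im (f t) = of_int (2 * n) * pi" using f(2)[OF t] unfolding exp_eq_1 by auto
   then have "Im (f t) / (2 * pi) = of_int n" by simp
   then show "Im (f t) / (2 * pi) \<in> \<int>" "Re (f t) = 0" using n by simp_all
  qed
  ultimately have "(%t. Im (f t) / (2 * pi)) constant_on {0..1}"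
  proof (intro continuous_discrete_range_constant)
   fix t assume Z: "!!t. t \<in> {0..1} ==> Im (f t) / (2 * pi) \<in> \<int>" and t: "t \<in> {0..1::real}"
   have "1 \<le> norm (Im (f s) / (2 * pi) - Im (f t) / (2 * pi))" if "s \<in> {0..1}" "Im (f s) / (2 * pi) \<noteq> Im (f t) / (2 * pi)" for s
    using Ints_nonzero_abs_ge1[OF Ints_diff[OF Z[OF that(1)] Z[OF t]]] that(2) by simp
   then show "\<exists>e>0. \<forall>s. s \<in> {0..1} \<and> Im (f s) / (2 * pi) \<noteq> Im (f t) / (2 * pi) --> e \<le> norm (Im (f s) / (2 * pi) - Im (f t) / (2 * pi))"
    by (intro exI[of _ 1]) simp
  qed (simp_all add: connected_Icc)
  then have "Im (f 1) / (2 * pi) = Im (f 0) / (2 * pi)" unfolding constant_on_def by (metis atLeastAtMost_iff order_refl zero_le_one)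
  then show ?thesis using re[of 0] re[of 1] by (simp add: complex_eq_iff)
 qed
 have s0: "continuous_on {0..1} (%t. g (t, k))" "continuous_on {0..1} (%t. g (k, t))" if "k \<in> {0..1}" for k
 proof -
  have "continuous_on {0..1} (%t. (t, k))" "continuous_on {0..1} (%t. (k, t))" by (intro continuous_intros)+
  moreover have "(%t. (t, k)) ` {0..1} \<subseteq> {0..1} \<times> {0..1}" "Pair k ` {0..1} \<subseteq> {0..1} \<times> {0..1}" using that by auto
  ultimately
  show "continuous_on {0..1} (%t. g (t, k))" "continuous_on {0..1} (%t. g (k, t))"
   using continuous_on_compose2[OF g(1)] by blast+
 qed
 \<comment> \<open>The increment of the logarithm over a closed curve lies in 2 pi i times the
   integers, so it is constant along the homotopy. It is 0 for the constant loop and i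
   \<open>\<omega>\<close> for \<open>p\<close>.\<close>
 have A: "g (1, 1) - g (1, 0) = g (0, 1) - g (0, 0)"
 proof (rule const[of "%t. g (t, 1) - g (t, 0)"])
  show "continuous_on {0..1} (%t. g (t, 1) - g (t, 0))" by (intro continuous_on_diff s0) simp_all
  fix t :: real assume t: "t \<in> {0..1}"
  have "exp (g (t, 1)) = exp (g (t, 0))" using g(2)[of "(t, 1)"] g(2)[of "(t, 0)"] h(5)[OF t] t by simp
  then show "exp (g (t, 1) - g (t, 0)) = 1" by (simp add: exp_diff)
 qed
 have B: "g (1, 1) - g (1, 0) = 0"
 proof -
  have e: "exp (g (1, t) - g (1, 0)) = 1" if t: "t \<in> {0..1}" for t
  proof -
   have "exp (g (1, t)) = exp (g (1, 0))" using g(2)[of "(1, t)"] g(2)[of "(1, 0)"] h(4)[OF t] h(4)[of 0] t by simp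
   then show ?thesis by (simp add: exp_diff)
  qed
  have "continuous_on {0..1} (%t. g (1, t) - g (1, 0))" by (intro continuous_on_diff s0 continuous_on_const) simp
  from const[OF this e] show ?thesis by simp
 qed
 have C: "g (0, 1) - g (0, 0) = \<i> * \<omega>"
 proof -
  have zp: "z (pr (p t)) = exp (complex_of_real (- \<beta> / 2) + \<i> * complex_of_real (\<theta> + t * \<omega>))" for t
   unfolding p_def phi(3) z_def Mt_def exp_add exp_of_real by (simp add: complex_eq_iff Re_exp Im_exp)
  have e: "exp (g (0, t) - g (0, 0) - \<i> * complex_of_real (t * \<omega>)) = 1" if t: "t \<in> {0..1}" for t
  proof -
   have "exp (g (0, t)) = exp (complex_of_real (- \<beta> / 2) + \<i> * complex_of_real (\<theta> + t * \<omega>))" "exp (g (0, 0)) = exp (complex_of_real (- \<beta> / 2) + \<i> * complex_of_real \<theta>)"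
    using g(2)[of "(0, t)"] g(2)[of "(0, 0)"] h(3)[OF t] h(3)[of 0] t zp[of t] zp[of 0] by simp_all
   then show ?thesis unfolding exp_diff by (simp add: exp_add[symmetric] exp_diff[symmetric] algebra_simps)
  qed
  have cc: "continuous_on {0..1} (%t. g (0, t) - g (0, 0) - \<i> * complex_of_real (t * \<omega>))"
   by (rule continuous_on_diff continuous_on_const s0 continuous_intros | simp)+
  from const[OF cc e] have "g (0, 1) - g (0, 0) - \<i> * complex_of_real (1 * \<omega>) = g (0, 0) - g (0, 0) - \<i> * complex_of_real (0 * \<omega>)" by simp
  then show ?thesis by simp
 qed
 have "\<omega> = 0" using A B C by simp
 then show "c = c'" using c b by (simp add: \<omega>_def)
qed

definition crd :: "'g => real \<times> real \<times> real" where "crd g = inv_into UNIV phi g"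

lemma crd_phi [simp]: "crd (phi c) = c"
 unfolding crd_def by (rule inv_into_f_f) (auto intro: injI phi_inj)

text \<open>Near g the coordinates on \<open>G\<close> are a function of the matrix alone, which is
  the shape that \<open>smooth_from_cover\<close> asks for. The neighbourhood is so small that the
  branch \<open>om\<close> stays close to the coordinates of g.\<close>

lemma local_coordinates:
 assumes g: "g \<in> G0 G pr"
 shows "\<exists>U. openin (top_of_set (G0 G pr)) U \<and> g \<in> U \<and> pr ` U \<subseteq> Wm (fst (crd g)) \<inter> {A. fst (om (fst (crd g)) A) > 0} \<and>
   (\<forall>g'\<in>U. crd g' = om (fst (crd g)) (pr g'))"
proof -
 obtain c0 where c0: "g = phi c0" "fst c0 > 0" using g unfolding G0_eq by auto
 let ?\<theta> = "fst c0" let ?H = "G0 G pr"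
 have HG: "?H \<subseteq> carrier G" unfolding G0_eq using phi(2) by auto
 have "g \<in> carrier G" using c0 phi(2) by simp
 then obtain u V q where u: "g \<in> u" "openin (top_of_set (carrier G)) u" "homeomorphism u V pr q"
  using covering_space_local_homeomorphism[OF cov] by metis
 obtain O1 where O1: "open O1" "u = carrier G \<inter> O1" using u(2) by (auto simp: openin_open)
 have "open (phi -` O1)" using phi(1) O1(1) by (intro open_vimage) auto
 moreover have "c0 \<in> phi -` O1" using u(1) O1 c0 by auto
 ultimately obtain e where e: "e > 0" "ball c0 e \<subseteq> phi -` O1" by (meson openE)
 define \<delta> where "\<delta> = min e (pi / 4)"
 have \<delta>: "\<delta> > 0" using e by (simp add: \<delta>_def)
 have omc: "om ?\<theta> (Mt c0) = c0" "Mt c0 \<in> Wm ?\<theta>" using om_Mt[of ?\<theta> ?\<theta> "fst (snd c0)" "snd (snd c0)"] by auto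
 have "open (Wm ?\<theta> \<inter> om ?\<theta> -` (ball c0 \<delta>))"
  using cont_om open_Wm by (intro continuous_open_preimage) auto
 then have oW: "openin (top_of_set UNIV) (Wm ?\<theta> \<inter> om ?\<theta> -` (ball c0 \<delta>))" by simp
 let ?U = "(?H \<inter> O1) \<inter> (?H \<inter> pr -` (Wm ?\<theta> \<inter> om ?\<theta> -` (ball c0 \<delta>)))"
 have prc: "continuous_on ?H pr" using cov HG by (auto simp: covering_space_def intro: continuous_on_subset)
 have "openin (top_of_set ?H) ?U"
  by (intro openin_Int openin_open_Int O1(1) continuous_openin_preimage[OF prc _ oW]) auto
 moreover have "g \<in> ?U" using g u(1) O1 omc \<delta> c0 by (auto simp: phi(3))
 moreover have main: "crd g' = om ?\<theta> (pr g')" if g': "g' \<in> ?U" for g'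
 proof -
  let ?c = "om ?\<theta> (pr g')"
  \<comment> \<open>Then \<open>phi ?c\<close> and \<open>g'\<close> lie in the same sheet and over
    the same matrix, hence coincide.\<close>
  have "?c \<in> ball c0 e" using g' by (auto simp: \<delta>_def)
  then have pu: "phi ?c \<in> u" using e(2) O1 phi(2) by auto
  have "det (pr g') = 1" using g' HG cov SL2_mem unfolding covering_space_def by blast
  then have "pr (phi ?c) = pr g'" using g' Mt_om by (simp add: phi(3))
  moreover have "g' \<in> u" using g' O1 HG by auto
  ultimately have "phi ?c = g'" using u(3) pu by (metis homeomorphism_apply1)
  then show ?thesis using crd_phi by metis
 qed
 moreover have "pr ` ?U \<subseteq> Wm ?\<theta> \<inter> {A. fst (om ?\<theta> A) > 0}"
 proof (rule image_subsetI)
  fix g' assume g': "g' \<in> ?U"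
  then obtain c where c: "g' = phi c" "fst c > 0" unfolding G0_eq by auto
  then show "pr g' \<in> Wm ?\<theta> \<inter> {A. fst (om ?\<theta> A) > 0}" using g' main[OF g'] by simp
 qed
 ultimately show ?thesis using c0 by (intro exI[of _ ?U]) simp
qed

text \<open>Any coordinate curve for the fundamental solution that starts at the origin yields a
  lift, and by uniqueness it is the one chosen in \<open>lifted_solution\<close>.\<close>

lemma monodromy_eq:
 assumes c: "continuous_on {0..TT} c" "c 0 = (0, 0, 0)" "!!t. t \<in> {0..TT} ==> Mt (c t) = fundamental_solution q t"
 shows "monodromy G pr q = phi (c TT)"
proof -
 let ?P = "%\<Phi>. continuous_on {0..TT} \<Phi> \<and> \<Phi> ` {0..TT} \<subseteq> carrier G \<and> \<Phi> 0 = \<one>\<^bsub>G\<^esub> \<and> (\<forall>t\<in>{0..TT}. pr (\<Phi> t) = fundamental_solution q t)"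
 have phim: "phi (c t) \<in> carrier G" "pr (phi (c t)) = Mt (c t)" for t by (rule phi)+
 have cc: "continuous_on {0..TT} (%t. phi (c t))" by (rule continuous_on_compose2[OF phi(1) c(1)]) auto
 have "?P (%t. phi (c t))"
  using cc c phi(4) by (intro conjI image_subsetI ballI) (simp_all add: phim del: split_paired_All)
 then have P: "?P (lifted_solution G pr q)" unfolding lifted_solution_def by (rule someI[of ?P])
 show ?thesis unfolding monodromy_def
  by (rule covering_lift_unique[OF cov, of "{0..TT}" 0 _ "%t. phi (c t)"]) (use P cc phim c phi(4) in auto)
qed

lemma monodromy_F: "monodromy G pr (F x) = phi (Th x TT, W x TT, I x TT)"
proof (rule monodromy_eq[of "%t. (Th x t, W x t, I x t)"])
 show "continuous_on {0..TT} (%t. (Th x t, W x t, I x t))" by (intro continuous_intros continuous_on_apply_bcontfun)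
 show "(Th x 0, W x 0, I x 0) = (0, 0, 0)" using init0 by (simp add: I_zero)
 fix t assume t: "t \<in> {0..TT}"
 show "Mt (Th x t, W x t, I x t) = fundamental_solution (F x) t" unfolding fundamental_solution_eq[OF t] by (rule Mt_kepler)
qed

end

section \<open>Smoothness of the coordinates and of the transform in every Sobolev norm\<close>

text \<open>Since order 0 of \<open>cdiff\<close> says nothing about continuity, it is extracted
  from the first derivative.\<close>

lemma smooth_imp_continuous_on:
 fixes f :: "'a::real_normed_vector => 'b::real_normed_vector"
 assumes f: "smooth tsp tsp U f"
 shows "continuous_on U f"
 unfolding continuous_on_iff
proof (intro ballI allI impI)
 fix x and e :: real assume x: "x \<in> U" and e: "e > 0"
 have "cdiff tsp tsp U (Suc 0) 0 (%x vs. f x)" using f unfolding smooth_def by blast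
 then obtain M' where M': "has_mderiv tsp tsp U 0 (%x vs. f x) M'" "cdiff tsp tsp U 0 (Suc 0) M'" by auto
 have "bml tsp tsp (Suc 0) (M' x)" using cdiff_bml[OF M'(2) x] .
 then obtain C where C: "!!vs. args (tsp :: 'a nsp) (Suc 0) vs ==> norm (M' x vs) \<le> C * pn tsp vs"
  using bmlD(3)[of tsp tsp "Suc 0" "M' x"] by auto
 obtain d where d: "d > 0" "!!h. norm h < d ==> x + h \<in> U ==> norm (f (x + h) - f x - M' x [h]) \<le> norm h"
  using M'(1) x unfolding has_mderiv_def by (auto dest!: bspec[of _ _ x] spec[of _ "1::real"])
 let ?C = "\<bar>C\<bar> + 1"
 show "\<exists>d>0. \<forall>x'\<in>U. dist x' x < d --> dist (f x') (f x) < e"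
 proof (intro exI[of _ "min d (e / ?C)"] conjI ballI impI)
  show "min d (e / ?C) > 0" using d e by simp
  fix x' assume x': "x' \<in> U" "dist x' x < min d (e / ?C)"
  define h where "h = x' - x"
  have h: "norm h < d" "norm h < e / ?C" "x + h \<in> U" using x' by (auto simp: h_def dist_norm)
  have "norm (f (x + h) - f x) \<le> norm (f (x + h) - f x - M' x [h]) + norm (M' x [h])"
   by (metis diff_add_cancel norm_triangle_ineq)
  also have "\<dots> \<le> norm h + C * norm h" using d(2)[OF h(1,3)] C[of "[h]"] by simp
  also have "\<dots> \<le> ?C * norm h" by (simp add: algebra_simps mult_right_mono)
  also have "\<dots> < e" using h(2) by (simp add: field_simps add_pos_nonneg)
  finally show "dist (f x') (f x) < e" by (simp add: h_def dist_norm)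
 qed
qed

lemma smooth_times: "nspace Z ==> smooth Z tsp U f ==> smooth Z tsp U g ==> smooth Z tsp U (%x. f x * g x :: real)"
 by (rule smooth_bb[OF _ bounded_bilinear_mult])

lemma smooth_comp:
 fixes g :: "'b::real_normed_vector => 'c::real_normed_vector"
 shows "nspace Z ==> smooth tsp tsp V g ==> smooth Z tsp U f ==> f ` U \<subseteq> V ==> smooth Z tsp U (%x. g (f x))"
 using smooth_compose[of Z tsp tsp V g U f] by (simp add: o_def)

text \<open>The bootstrap for real functions: \<open>f'\<close> only has to be as differentiable as
  f is already known to be.\<close>

lemma smooth_real:
 fixes f :: "real => real"
 assumes g: "!!n. cdiff tsp tsp U n 0 (%x vs. f x) ==> cdiff tsp tsp U n 0 (%x vs. f' x)"
  and f: "!!x. x \<in> U ==> (f has_real_derivative f' x) (at x)"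
 shows "smooth tsp tsp U f"
proof (rule smooth_bootstrap_typed[where V = UNIV and \<gamma> = f' and g = "%p h. p * h"])
 show "smooth (tsp \<otimes>\<^sub>n tsp) tsp (UNIV \<times> UNIV) (%z. fst z * snd z :: real)"
  by (rule smooth_times[OF nspace_tt smooth_tfst smooth_tsnd])
qed (use g f in \<open>auto simp: has_field_derivative_def\<close>)

lemma smooth_inverse: "smooth tsp tsp {0<..} (inverse :: real => real)"
proof (rule smooth_real[where f' = "%x. (- 1) *\<^sub>R (inverse x * inverse x)"])
 fix n assume c: "cdiff tsp tsp {0<..} n 0 (%x vs. inverse x :: real)"
 have "smooth tsp tsp UNIV (%y. (- 1) *\<^sub>R (y * y) :: real)"
  by (intro smooth_scale smooth_times smooth_id nspace_tsp) simp_all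
 then have "cdiff tsp tsp UNIV n 0 (%y vs. (- 1) *\<^sub>R (y * y) :: real)" unfolding smooth_def by blast
 then show "cdiff tsp tsp {0<..} n 0 (%x vs. (- 1) *\<^sub>R (inverse x * inverse x) :: real)"
  using cdiff_compose[OF nspace_tsp nspace_tsp nspace_tsp, of inverse "{0<..}" UNIV n "%y. (- 1) *\<^sub>R (y * y) :: real"] c by (simp add: o_def)
qed (auto intro!: derivative_eq_intros)

lemma smooth_ln: "smooth tsp tsp {0<..} (ln :: real => real)"
proof (rule smooth_real[where f' = inverse])
 show "cdiff tsp tsp {0<..} n 0 (%x vs. inverse x :: real)" for n using smooth_inverse unfolding smooth_def by blast
qed (auto intro!: derivative_eq_intros simp: inverse_eq_divide)

lemma smooth_arctan: "smooth tsp tsp UNIV (arctan :: real => real)"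
proof (rule smooth_real[where f' = "%x. inverse (1 + x * x)"])
 have "smooth tsp tsp UNIV (%x. 1 + x * x :: real)"
  by (intro smooth_add smooth_times smooth_id smooth_tconst nspace_tsp) simp_all
 then have "smooth tsp tsp UNIV (%x. inverse (1 + x * x) :: real)"
  by (rule smooth_comp[OF nspace_tsp smooth_inverse]) (auto simp: add_pos_nonneg)
 then show "cdiff tsp tsp UNIV n 0 (%x vs. inverse (1 + x * x) :: real)" for n unfolding smooth_def by blast
qed (auto intro!: derivative_eq_intros simp: power2_eq_square)

lemma smooth_divide:
 assumes Z: "nspace Z" and f: "smooth Z tsp U f" and g: "smooth Z tsp U g" and p: "!!x. x \<in> U ==> g x > 0"
 shows "smooth Z tsp U (%x. f x / g x :: real)"
 unfolding divide_inverse
 by (intro smooth_times smooth_comp[OF Z smooth_inverse] Z f g) (use p in auto)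

lemma bounded_linear_entry: "bounded_linear (%A :: real^2^2. A $ i $ j)"
 by (intro bounded_linear_intros bounded_linear_compose[OF bounded_linear_vec_nth bounded_linear_vec_nth])

lemma smooth_om:
 "smooth tsp tsp (Wm \<theta>0) (%A. fst (om \<theta>0 A))" "smooth tsp tsp (Wm \<theta>0) (%A. fst (snd (om \<theta>0 A)))" "smooth tsp tsp (Wm \<theta>0) (%A. snd (snd (om \<theta>0 A)))"
proof -
 have e: "smooth tsp tsp (Wm \<theta>0) (%A :: real^2^2. A $ i $ j)" for i j
  by (intro smooth_bl[OF nspace_tsp bounded_linear_entry] smooth_id) simp_all
 have c: "smooth tsp tsp (Wm \<theta>0) (%A :: real^2^2. c)" for c :: real by (rule smooth_tconst[OF nspace_tsp])
 note s = smooth_add[OF nspace_tsp nspace_tsp] smooth_diff[OF nspace_tsp nspace_tsp] smooth_times[OF nspace_tsp] e c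
 have "smooth tsp tsp (Wm \<theta>0) (%A. (A $ 1 $ 2 * cos \<theta>0 - A $ 1 $ 1 * sin \<theta>0) / (A $ 1 $ 1 * cos \<theta>0 + A $ 1 $ 2 * sin \<theta>0))"
  by (intro smooth_divide nspace_tsp s) (simp add: Wm_def)
 then show "smooth tsp tsp (Wm \<theta>0) (%A. fst (om \<theta>0 A))" unfolding om_def fst_conv
  by (intro s smooth_comp[OF nspace_tsp smooth_arctan]) auto
 have "smooth tsp tsp (Wm \<theta>0) (%A. 0 - ln ((A $ 1 $ 1)\<^sup>2 + (A $ 1 $ 2)\<^sup>2))"
  unfolding power2_eq_square
  by (intro s smooth_comp[OF nspace_tsp smooth_ln]) (use Wm_pos in \<open>auto simp: power2_eq_square\<close>)
 then show "smooth tsp tsp (Wm \<theta>0) (%A. fst (snd (om \<theta>0 A)))" unfolding om_def by simp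
 show "smooth tsp tsp (Wm \<theta>0) (%A. snd (snd (om \<theta>0 A)))" unfolding om_def snd_conv power2_eq_square
  by (intro smooth_divide nspace_tsp s) (use Wm_pos in \<open>auto simp: power2_eq_square\<close>)
qed

definition ev :: "cfun => real" where "ev f = f TT"

lemma bounded_linear_ev: "bounded_linear ev"
 unfolding ev_def[abs_def] by (rule bounded_linear_intro[where K = 1]) (auto simp: abs_apply_le)

definition lint :: "cfun => real" where "lint f = ev (I (emb f))"

lemma bounded_linear_lint: "bounded_linear lint"
 unfolding lint_def[abs_def] by (intro bounded_linear_compose[OF bounded_linear_ev] bounded_linear_compose[OF bounded_linear_I] bounded_linear_emb)

lemma bounded_linear_W: "bounded_linear W"
 unfolding W_def[abs_def] by (intro bounded_linear_compose[OF bounded_linear_I] bounded_linear_compose[OF bounded_linear_emb] bounded_linear_I)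

lemma lint_eq: "lint f = integral {0..TT} f"
 by (simp add: lint_def ev_def I_emb cl_def)

lemma lint_pos:
 assumes f: "!!t. 0 < t ==> t < TT ==> 0 < apply_bcontfun f t"
 shows "0 < lint f"
proof -
 have c: "continuous_on {0..TT} f" by (intro continuous_on_apply_bcontfun continuous_on_id)
 have b: "0 \<le> f t" if t: "t \<in> {0..TT}" for t
 proof (rule continuous_ge_on_closure[of "{0<..<TT}" f])
  show "continuous_on (closure {0<..<TT}) f" using c by simp
 qed (use f t less_imp_le in auto)
 have nn: "0 \<le> lint f" unfolding lint_eq by (rule integral_nonneg[OF integrable_continuous_real[OF c]]) (use b in auto)
 have "lint f \<noteq> 0"
 proof
  assume "lint f = 0"
  then have "(apply_bcontfun f has_integral 0) (cbox 0 TT)"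
   using integrable_integral[OF integrable_continuous_real[OF c]] by (simp add: lint_eq)
  then have "f pi = 0"
   using has_integral_0_cbox_imp_0[of 0 TT f pi] c b pi_gt_zero by (auto simp: box_real simp flip: not_less)
  then show False using f[of pi] by simp
 qed
 then show ?thesis using nn by simp
qed

lemma lint_mono: "(!!t. t \<in> {0..TT} ==> apply_bcontfun f t \<le> apply_bcontfun g t) ==> lint f \<le> lint g"
 unfolding lint_eq by (intro integral_le integrable_continuous_real continuous_on_apply_bcontfun continuous_on_id) auto

definition En :: "ltwo => ltwo" where "En x = emb (yexp (2 *\<^sub>R W x))"
definition Kx :: "ltwo => ltwo" where "Kx x = emb (kx x)"

lemma smooth_W: "nspace Z ==> smooth Z tsp U f ==> smooth Z tsp U (%x. W (f x))"
 by (rule smooth_bl[OF _ bounded_linear_W])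

text \<open>The exponential written as the integral of its own derivative. The right side is a
  constant plus a primitive of a product that contains \<open>En\<close> again, so it gains one
  derivative over what is known of \<open>En\<close>.\<close>

lemma En_ext: "En x = emb (K 1) + Il (2 *\<^sub>R pm (En x) (Il x))"
proof -
 let ?g = "2 *\<^sub>R ymul (I x) (yexp (2 *\<^sub>R W x))"
 have 1: "yexp (2 *\<^sub>R W x) = K (yexp (2 *\<^sub>R W x) 0) + I (emb ?g)"
 proof (rule cfun_FTC_eq)
  show "yexp (2 *\<^sub>R W x) (cl t) = yexp (2 *\<^sub>R W x) t" for t by (simp add: W_cl)
  fix t assume "t \<in> {0..TT}"
  show "(apply_bcontfun (yexp (2 *\<^sub>R W x)) has_real_derivative ?g t) (at t within {0..TT})"
   using W_deriv[OF \<open>t \<in> {0..TT}\<close>, of x] by (auto intro!: derivative_eq_intros simp: yexp_apply[abs_def] mult_ac)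
 qed
 have "yexp (2 *\<^sub>R W x) 0 = 1" using init0 by simp
 with 1 have 1: "yexp (2 *\<^sub>R W x) = K 1 + I (emb ?g)" by simp
 have "emb ?g = 2 *\<^sub>R pm (En x) (Il x)"
 proof -
  have "cr (Il x) = I x" using cr_ac[of 0 x] by (simp add: Il_def)
  then have "pm (En x) (Il x) = emb (ymul (yexp (2 *\<^sub>R W x)) (I x))" by (simp add: pm_def En_def mulL_emb)
  moreover have "ymul (yexp (2 *\<^sub>R W x)) (I x) = ymul (I x) (yexp (2 *\<^sub>R W x))" by (rule bcontfun_eqI) simp
  ultimately show ?thesis by (simp add: linear_simps[OF bounded_linear_emb])
 qed
 moreover have "En x = emb (K 1 + I (emb ?g))" unfolding En_def 1[symmetric] ..
 ultimately show ?thesis unfolding Il_def by (simp only: linear_simps(1)[OF bounded_linear_emb])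
qed

lemma Kx_eq: "Kx x = (1/4) *\<^sub>R pm (Il x) (Il x) - En x"
proof -
 have "cr (Il x) = I x" using cr_ac[of 0 x] by (simp add: Il_def)
 then show ?thesis by (simp add: Kx_def kx_def En_def pm_def Il_def mulL_emb linear_simps[OF bounded_linear_emb])
qed

lemma pm_Il: "pm (Il x) (Il x) = Il (2 *\<^sub>R pm x (Il x))"
 using pm_ac[of 0 x 0 x] by (simp add: Il_def scaleR_2)

lemma F_eq: "F x = (-1/2) *\<^sub>R x + Kx x" by (simp add: F_def Kx_def)

lemma smooth_lin:
 assumes "nspace Z" "nspace Y" "nspace V" "nlinear Y V L" "smooth Z Y U f"
 shows "smooth Z V U (%x. L (f x))"
 using smooth_compose[OF assms(1-3) smooth_linear[OF assms(2-4) subset_refl] assms(5)] smooth_mem[OF assms(5)] by (auto simp: o_def)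

text \<open>For x in H^p the primitive of x is in H^(p+1), so its product with \<open>En x\<close>
  in H^p stays in H^p, and the outer primitive in \<open>En_ext\<close> raises the order to p +
  1.\<close>

lemma smooth_En_Suc: "smooth (S p) (S p) (sobolev p) En ==> smooth (S p) (S (Suc p)) (sobolev p) En"
proof -
 assume E: "smooth (S p) (S p) (sobolev p) En"
 have x: "smooth (S p) (S p) (sobolev p) (%x. x)" by (rule smooth_id) simp_all
 have one: "emb (K 1) \<in> sobolev (Suc p)" using nlinear_K[of "Suc p"] unfolding nlinear_def S_simps tsp_simps by blast
 have "smooth (S p) (S (Suc p)) (sobolev p) (%x. emb (K 1) + Il (2 *\<^sub>R pm (En x) (Il x)))"
  by (intro smooth_add smooth_const smooth_lin[OF _ _ _ nlinear_Il] smooth_scale smooth_bilinear[OF _ _ _ _ nbilinear_pm] E x nspace_S)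
    (simp_all add: one)
 then show ?thesis using En_ext by (intro smooth_cong[of "S p" _ En]) simp_all
qed

lemma smooth_En: "smooth (S p) (S (Suc p)) (sobolev p) En"
proof (induction p)
 case 0
 have "smooth tsp tsp UNIV (%x. En x)" unfolding En_def
  by (intro smooth_bl[OF nspace_tsp bounded_linear_emb] smooth_comp[OF nspace_tsp smooth_yexp] smooth_scale smooth_W smooth_id nspace_tsp) simp_all
 moreover have "S 0 = tsp" by (simp add: S_def tsp_def sobolev_norm_0[abs_def])
 ultimately show ?case using smooth_En_Suc[of 0] by simp
next
 case (Suc p)
 have "smooth (S (Suc p)) (S (Suc p)) (sobolev (Suc p)) En"
  using smooth_compose[OF _ _ _ Suc.IH smooth_linear[OF _ _ nlinear_incl subset_refl]] sobolev_Suc_subset[of p] by (simp add: o_def)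
 then show ?case by (rule smooth_En_Suc)
qed

text \<open>The square of the primitive of x is itself a primitive, of 2 x times that primitive
  (\<open>pm_Il\<close>); so both parts of \<open>Kx\<close> map H^p to H^(p+1).\<close>

lemma smooth_Kx: "smooth (S p) (S (Suc p)) (sobolev p) Kx"
proof -
 have x: "smooth (S p) (S p) (sobolev p) (%x. x)" by (rule smooth_id) simp_all
 have "smooth (S p) (S (Suc p)) (sobolev p) (%x. (1/4) *\<^sub>R Il (2 *\<^sub>R pm x (Il x)) - En x)"
  by (intro smooth_diff smooth_scale smooth_lin[OF _ _ _ nlinear_Il] smooth_bilinear[OF _ _ _ _ nbilinear_pm] smooth_En x nspace_S)
 then show ?thesis using Kx_eq pm_Il by (intro smooth_cong[of "S p" _ Kx]) simp_all
qed

lemma smooth_incl: "smooth Z (S (Suc p)) U f ==> nspace Z ==> smooth Z (S p) U f"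
 using smooth_lin[OF _ _ _ nlinear_incl] by simp

lemma smooth_F: "smooth (S p) (S p) (sobolev p) F"
proof -
 have "smooth (S p) (S p) (sobolev p) (%x. (-1/2) *\<^sub>R x + Kx x)"
  by (intro smooth_add smooth_scale smooth_id smooth_incl[OF smooth_Kx] nspace_S) simp
 then show ?thesis using F_eq by (intro smooth_cong[of "S p" _ F]) simp_all
qed

lemma smooth_v: "smooth tsp tsp UNIV v1" "smooth tsp tsp UNIV v2" "smooth tsp tsp UNIV z1" "smooth tsp tsp UNIV z2"
proof -
 have R: "smooth tsp tsp UNIV (%q. R q f)" for f
  by (rule smooth_bl[OF nspace_tsp blinfun.bounded_linear_left smooth_R])
 then show v: "smooth tsp tsp UNIV v1" "smooth tsp tsp UNIV v2" unfolding v1_def[abs_def] v2_def[abs_def] by auto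
 have q: "smooth tsp tsp UNIV (%q. q :: ltwo)" by (rule smooth_id) simp_all
 show "smooth tsp tsp UNIV z1" "smooth tsp tsp UNIV z2" unfolding z1_def[abs_def] z2_def[abs_def]
  by (intro smooth_add smooth_tconst smooth_bl[OF nspace_tsp bounded_linear_I] smooth_bb[OF nspace_tsp bounded_bilinear_mulL] v q nspace_tsp)+
qed

lemma smooth_X_tsp: "smooth tsp tsp UNIV X"
proof -
 note y = smooth_bb[OF nspace_tsp bounded_bilinear_ymul]
 have "smooth tsp tsp UNIV rho" "smooth tsp tsp UNIV nn" unfolding rho_def[abs_def] nn_def[abs_def]
  by (intro smooth_add y smooth_v nspace_tsp)+
 moreover from this have "smooth tsp tsp UNIV rr" unfolding rr_def[abs_def]
  by (intro smooth_comp[OF nspace_tsp smooth_yinv]) (use rho_ypos in auto)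
 ultimately have "smooth tsp tsp UNIV kq" unfolding kq_def[abs_def] mm_def
  by (intro smooth_diff y nspace_tsp)
 then show ?thesis unfolding X_def[abs_def]
  by (intro smooth_add smooth_scale smooth_id smooth_bl[OF nspace_tsp bounded_linear_emb] nspace_tsp) simp_all
qed

lemma X_eq: "X q = (-2) *\<^sub>R q + 2 *\<^sub>R Kx (X q)"
 unfolding Kx_def kx_X by (rule X_def)

text \<open>The correction \<open>Kx\<close> gains one derivative, which propagates regularity from \<open>p\<close> to \<open>Suc p\<close>.\<close>

lemma smooth_X: "smooth (S p) (S p) (sobolev p) X"
proof (induction p)
 case 0
 have "S 0 = tsp" by (simp add: S_def tsp_def sobolev_norm_0[abs_def])
 then show ?case using smooth_X_tsp by simp
next
 case (Suc p)
 have X: "smooth (S (Suc p)) (S p) (sobolev (Suc p)) X"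
  using smooth_compose[OF _ _ _ Suc.IH smooth_linear[OF _ _ nlinear_incl subset_refl]] sobolev_Suc_subset[of p] by (simp add: o_def)
 have KX: "smooth (S (Suc p)) (S (Suc p)) (sobolev (Suc p)) (%x. Kx (X x))"
  using smooth_compose[OF _ _ _ smooth_Kx X] smooth_mem[OF X] by (auto simp: o_def)
 have "smooth (S (Suc p)) (S (Suc p)) (sobolev (Suc p)) (%q. (-2) *\<^sub>R q + 2 *\<^sub>R Kx (X q))"
  by (intro smooth_add smooth_scale smooth_id KX nspace_S) simp
 then show ?case using X_eq by (intro smooth_cong[of "S (Suc p)" _ X]) simp_all
qed

lemma smooth_Phi: "smooth tsp tsp UNIV (%q. Phi q TT)"
proof -
 have ax: "mat22 a b c d = a *\<^sub>R mat22 1 0 0 0 + b *\<^sub>R mat22 0 1 0 0 + c *\<^sub>R mat22 0 0 1 0 + d *\<^sub>R mat22 0 0 0 1" for a b c d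
  by (rule mat_eqI) simp_all
 have e: "smooth tsp tsp UNIV (%q. f q TT *\<^sub>R A)" if f: "smooth tsp tsp UNIV f" for f :: "ltwo => cfun" and A :: "real^2^2"
  using smooth_bl[OF nspace_tsp bounded_linear_compose[OF bounded_linear_scaleR_left bounded_linear_ev] f] by (simp add: ev_def)
 have "smooth tsp tsp UNIV (%q. v1 q TT *\<^sub>R mat22 1 0 0 0 + v2 q TT *\<^sub>R mat22 0 1 0 0 + z1 q TT *\<^sub>R mat22 0 0 1 0 + z2 q TT *\<^sub>R mat22 0 0 0 1)"
  by (intro smooth_add e smooth_v nspace_tsp)
 then show ?thesis by (rule smooth_cong[OF nspace_tsp, rotated]) (unfold Phi_def, rule ax)
qed

section \<open>Solving for the total angle\<close>

locale angle_bump =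
 fixes b :: cfun
 assumes b_pos: "!!t. 0 < t ==> t < TT ==> 0 < b t"
begin

text \<open>The total angle after adding to x the multiple s of an element whose second primitive is
  \<open>b\<close>.\<close>

definition Gs :: "real => ltwo => real" where "Gs s x = lint (yexp (W x + s *\<^sub>R b))"

lemma Gs_strict: "s < s' ==> Gs s x < Gs s' x"
proof -
 assume s: "s < s'"
 have "0 < lint (yexp (W x + s' *\<^sub>R b) - yexp (W x + s *\<^sub>R b))"
  by (rule lint_pos) (use s b_pos in \<open>simp add: mult_strict_right_mono\<close>)
 then show ?thesis by (simp add: Gs_def linear_simps[OF bounded_linear_lint])
qed

lemma Gs_inj: "Gs s x = Gs s' x ==> s = s'"
 by (metis Gs_strict less_irrefl linorder_neqE_linordered_idom)

lemma Gs_less_iff: "Gs s x < Gs s' x \<longleftrightarrow> s < s'"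
 by (metis Gs_strict less_asym linorder_neqE_linordered_idom)

lemma smooth_Gs: "smooth tsp tsp UNIV (%z. Gs (fst z) (snd z))"
 unfolding Gs_def
 by (intro smooth_bl[OF nspace_tsp bounded_linear_lint] smooth_comp[OF nspace_tsp smooth_yexp] smooth_add smooth_W smooth_bb[OF nspace_tsp bounded_bilinear_scaleR]
   smooth_tconst smooth_bl[OF nspace_tsp bounded_linear_fst] smooth_bl[OF nspace_tsp bounded_linear_snd] smooth_id nspace_tsp) simp_all

lemma Gs_cont: "continuous_on UNIV (%x. Gs s x)" "continuous_on UNIV (%s. Gs s x)"
proof -
 have c: "continuous_on UNIV (%z. Gs (fst z) (snd z))" by (rule smooth_imp_continuous_on[OF smooth_Gs])
 show "continuous_on UNIV (%x. Gs s x)" "continuous_on UNIV (%s. Gs s x)"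
  using continuous_on_compose2[OF c, of UNIV "%x. (s, x)"] continuous_on_compose2[OF c, of UNIV "%s. (s, x)"]
  by (simp_all add: continuous_on_Pair continuous_on_const continuous_on_id)
qed


lemma Gs_nonneg: "0 < Gs s x" unfolding Gs_def by (rule lint_pos) simp

text \<open>The inequality y \<le> exp y bounds the total angle from below by a linear function of s
  with positive slope.\<close>

lemma Gs_large: "\<exists>s. M < Gs s x"
proof -
 define L where "L = lint (ymul b (yexp (W x)))"
 have L: "L > 0" unfolding L_def by (rule lint_pos) (use b_pos in simp)
 define s where "s = (\<bar>M\<bar> + 1) / L"
 have s0: "s > 0" using L by (simp add: s_def)
 have "s * L \<le> Gs s x"
 proof -
  have "lint (s *\<^sub>R ymul b (yexp (W x))) \<le> lint (yexp (W x + s *\<^sub>R b))"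
  proof (rule lint_mono)
   fix t
   have "s * b t \<le> exp (s * b t)" using exp_ge_add_one_self[of "s * b t"] by linarith
   then have "s * b t * exp (W x t) \<le> exp (s * b t) * exp (W x t)" by (rule mult_right_mono) simp
   then show "(s *\<^sub>R ymul b (yexp (W x))) t \<le> (yexp (W x + s *\<^sub>R b)) t" by (simp add: exp_add mult_ac)
  qed
  then show ?thesis by (simp add: Gs_def L_def linear_simps[OF bounded_linear_lint])
 qed
 moreover have "s * L = \<bar>M\<bar> + 1" using L by (simp add: s_def)
 ultimately show ?thesis by (intro exI[of _ s]) linarith
qed

text \<open>Dominated convergence along s = -n, with exp (W x) as majorant. The integrand tends to 0
  on the open interval only, since \<open>b\<close> may vanish at the ends.\<close>

lemma Gs_small: "M > 0 ==> \<exists>s. Gs s x < M"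
proof -
 assume M: "M > 0"
 let ?f = "%n t. indicator {0<..<TT} t * exp (W x t - real n * b t)"
 have c: "continuous_on D (apply_bcontfun f)" for D and f :: cfun by (intro continuous_on_apply_bcontfun continuous_on_id)
 have "(%n. \<integral>t. ?f n t \<partial>lborel) \<longlonglongrightarrow> (\<integral>t. 0 \<partial>(lborel :: real measure))"
 proof (rule integral_dominated_convergence[where w = "%t. indicator {0..TT} t * exp (W x t)"])
  have cc: "continuous_on {0..TT} (%t. exp (W x t))" by (intro continuous_intros c)
  show "integrable lborel (%t. indicator {0..TT} t * exp (W x t))"
   using borel_integrable_atLeastAtMost'[OF cc] by (simp add: set_integrable_def)
  have m: "apply_bcontfun f \<in> borel_measurable lborel" for f :: cfun
   using borel_measurable_continuous_onI[OF c] by simp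
  show "?f n \<in> borel_measurable lborel" for n using m[of "W x"] m[of b] by measurable
  show "AE t in lborel. (%n. ?f n t) \<longlonglongrightarrow> 0"
  proof (intro AE_I2)
   fix t
   show "(%n. ?f n t) \<longlonglongrightarrow> 0"
   proof (cases "0 < t \<and> t < TT")
    case True
    then have b: "b t > 0" by (intro b_pos) auto
    have "(%n. exp (W x t) * (exp (- b t)) ^ n) \<longlonglongrightarrow> exp (W x t) * 0"
     by (intro tendsto_intros LIMSEQ_power_zero) (use b in simp)
    moreover have "exp (W x t - real n * b t) = exp (W x t) * (exp (- b t)) ^ n" for n
     by (simp add: exp_diff exp_of_nat_mult[symmetric] exp_minus field_simps)
    ultimately show ?thesis using True by simp
   qed auto
  qed
  show "AE t in lborel. norm (?f n t) \<le> indicator {0..TT} t * exp (W x t)" for n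
  proof (intro AE_I2)
   fix t show "norm (?f n t) \<le> indicator {0..TT} t * exp (W x t)"
   proof (cases "0 < t \<and> t < TT")
    case True
    then have "0 \<le> real n * b t" using b_pos[of t] by simp
    then show ?thesis using True by simp
   qed simp
  qed
 qed auto
 then have "eventually (%n. (\<integral>t. ?f n t \<partial>lborel) < M) sequentially" using M by (auto intro: order_tendstoD)
 then obtain n where n: "(\<integral>t. ?f n t \<partial>lborel) < M" by (auto simp: eventually_sequentially)
 have "Gs (- real n) x = integral {0<..<TT} (%t. exp (W x t - real n * b t))"
 proof -
  have "apply_bcontfun (yexp (W x + (- real n) *\<^sub>R b)) = (%t. exp (W x t - real n * b t))" by (rule ext) simp
  then show ?thesis unfolding Gs_def lint_eq by (simp only: integral_open_interval_real)
 qed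
 also have "\<dots> = (\<integral>t. ?f n t \<partial>lborel)"
 proof -
  have "continuous_on {0..TT} (%t. exp (W x t - real n * b t))" by (intro continuous_intros c)
  from borel_integrable_atLeastAtMost'[OF this] have "set_integrable lborel {0<..<TT} (%t. exp (W x t - real n * b t))"
   by (rule set_integrable_subset) auto
  from set_borel_integral_eq_integral(2)[OF this] show ?thesis by (simp add: set_lebesgue_integral_def)
 qed
 finally have "Gs (- real n) x < M" using n by simp
 then show ?thesis by blast
qed

lemma ex_sigma: "\<theta> > 0 ==> \<exists>s. Gs s x = \<theta>"
proof -
 assume t: "\<theta> > 0"
 obtain s where s: "Gs s x < \<theta>" using Gs_small[OF t] by blast
 obtain s' where s': "\<theta> < Gs s' x" using Gs_large by blast
 have "s \<le> s'" using s s' Gs_strict[of s' s x] by (cases "s \<le> s'") auto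
 then show ?thesis using IVT'[of "%s. Gs s x" s \<theta> s'] s s' continuous_on_subset[OF Gs_cont(2)] by auto
qed

definition sigma :: "real \<times> ltwo => real" where "sigma z = (THE s. Gs s (snd z) = fst z)"

lemma sigma: "\<theta> > 0 ==> Gs (sigma (\<theta>, x)) x = \<theta>"
proof -
 assume "\<theta> > 0"
 then obtain s where s: "Gs s x = \<theta>" using ex_sigma by blast
 then have "sigma (\<theta>, x) = s" unfolding sigma_def fst_conv snd_conv using Gs_inj by (intro the_equality) auto
 then show ?thesis using s by simp
qed

lemma sigma_Gs: "sigma (Gs s x, x) = s"
 using sigma[OF Gs_nonneg] Gs_inj by blast

abbreviation dom_sigma :: "(real \<times> ltwo) set" where "dom_sigma \<equiv> {0<..} \<times> UNIV"

text \<open>Strict monotonicity takes the place of an implicit function theorem: being within e of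
  the value s of \<open>sigma\<close> at z follows from Gs (s - e) < \<theta> < Gs (s + e), which is
  an open condition on the point.\<close>

lemma sigma_cont: "z \<in> dom_sigma ==> isCont sigma z"
 unfolding isCont_def tendsto_iff dist_real_def
proof (intro allI impI)
 fix e :: real assume z: "z \<in> dom_sigma" and e: "e > 0"
 obtain \<theta> x where zx: "z = (\<theta>, x)" "\<theta> > 0" using z by auto
 let ?s = "sigma z"
 let ?U = "{w. fst w > 0} \<inter> {w. Gs (?s - e) (snd w) < fst w} \<inter> {w. fst w < Gs (?s + e) (snd w)}"
 have "open ?U"
  by (intro open_Int open_Collect_less continuous_intros continuous_on_compose2[OF Gs_cont(1)]) auto
 moreover have "z \<in> ?U" using sigma[OF zx(2), of x] Gs_strict[of "?s - e" ?s x] Gs_strict[of ?s "?s + e" x] e zx by auto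
 ultimately have "eventually (%w. w \<in> ?U) (nhds z)" by (rule eventually_nhds_in_open)
 then have "eventually (%w. \<bar>sigma w - ?s\<bar> < e) (nhds z)"
 proof (rule eventually_mono)
  fix w assume w: "w \<in> ?U"
  then have g: "Gs (sigma w) (snd w) = fst w" using sigma[of "fst w" "snd w"] by simp
  have "Gs (?s - e) (snd w) < Gs (sigma w) (snd w)" "Gs (sigma w) (snd w) < Gs (?s + e) (snd w)" unfolding g using w by auto
  then have "?s - e < sigma w" "sigma w < ?s + e" by (simp_all only: Gs_less_iff)
  then show "\<bar>sigma w - ?s\<bar> < e" by auto
 qed
 then show "eventually (%w. \<bar>sigma w - ?s\<bar> < e) (at z)" by (simp add: eventually_nhds_conv_at)
qed

definition gam :: "real \<times> ltwo => cfun" where "gam z = yexp (W (snd z) + sigma z *\<^sub>R b)"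

abbreviation Vg :: "cfun set" where "Vg \<equiv> {f. 0 < lint (ymul f b)}"

text \<open>The formula found by differentiating the equation that the integral of exp (W x +
  \<sigma> b) is \<theta>; f stands for the integrand, and \<open>Vg\<close> is the set where the
  denominator is positive.\<close>

definition gd :: "cfun => real \<times> ltwo => real" where "gd f h = (fst h - lint (ymul f (W (snd h)))) / lint (ymul f b)"

lemma gam_Vg: "gam z \<in> Vg"
 unfolding gam_def mem_Collect_eq by (rule lint_pos) (use b_pos in simp)

text \<open>The map (\<theta>, x) to (\<sigma>, x) inverts (s, x) to (\<open>Gs s x\<close>, x). The
  derivative of the latter is triangular with explicit inverse, and continuity of the inverse map is
  already known.\<close>

lemma sigma_deriv: "z \<in> dom_sigma ==> (sigma has_derivative gd (gam z)) (at z)"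
proof -
 assume z: "z \<in> dom_sigma"
 let ?H = "%w :: real \<times> ltwo. (Gs (fst w) (snd w), snd w)" and ?g = "%z. (sigma z, snd z)"
 let ?f = "gam z"
 let ?H' = "%h :: real \<times> ltwo. (lint (ymul ?f (W (snd h) + fst h *\<^sub>R b)), snd h)" and ?g' = "%h. (gd ?f h, snd h)"
 have Lp: "0 < lint (ymul ?f b)" using gam_Vg by simp
 have "bounded_linear (%h. fst h - lint (ymul ?f (W (snd h))))"
  by (intro bounded_linear_sub bounded_linear_fst bounded_linear_compose[OF bounded_linear_lint]
    bounded_linear_compose[OF bounded_bilinear.bounded_linear_right[OF bounded_bilinear_ymul]] bounded_linear_compose[OF bounded_linear_W] bounded_linear_snd)
 from bounded_linear_compose[OF bounded_linear_divide this]
 have bg: "bounded_linear (gd ?f)" unfolding gd_def[abs_def] .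
 define Lin where "Lin w = W (snd w) + fst w *\<^sub>R b" for w :: "real \<times> ltwo"
 have bL: "bounded_linear Lin" unfolding Lin_def[abs_def]
  by (intro bounded_linear_add bounded_linear_compose[OF bounded_linear_W] bounded_linear_snd
    bounded_linear_compose[OF bounded_linear_scaleR_left] bounded_linear_fst)
 have fL: "?f = yexp (Lin (?g z))" by (simp add: gam_def Lin_def)
 have "((%w. lint (yexp (Lin w))) has_derivative (%h. lint (ymul ?f (Lin h)))) (at (?g z))"
  unfolding fL
  by (intro bounded_linear.has_derivative[OF bounded_linear_lint] has_derivative_compose[OF bounded_linear_imp_has_derivative[OF bL] yexp_deriv])
 then have "((%w. Gs (fst w) (snd w)) has_derivative (%h. lint (ymul ?f (Lin h)))) (at (?g z))" unfolding Gs_def Lin_def .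
 from has_derivative_Pair[OF this has_derivative_snd[OF has_derivative_ident]]
 have H: "(?H has_derivative ?H') (at (?g z))" unfolding Lin_def .
 have inv: "?g' \<circ> ?H' = id"
 proof
  fix h :: "real \<times> ltwo"
  have "lint (ymul ?f (W (snd h) + fst h *\<^sub>R b)) = lint (ymul ?f (W (snd h))) + fst h * lint (ymul ?f b)"
   by (simp add: linear_simps[OF bounded_linear_lint] bounded_bilinear.add_right[OF bounded_bilinear_ymul] bounded_bilinear.scaleR_right[OF bounded_bilinear_ymul])
  then show "(?g' \<circ> ?H') h = id h" using Lp by (simp add: gd_def)
 qed
 have "(?g has_derivative ?g') (at z)"
 proof (rule has_derivative_inverse_basic[where f = ?H and f' = ?H' and g = ?g and g' = ?g' and y = z and T = dom_sigma])
  show "bounded_linear ?g'" by (intro bounded_linear_Pair bg bounded_linear_snd)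
  show "continuous (at z) ?g" using sigma_cont[OF z] by (intro continuous_intros) auto
  show "open dom_sigma" by (intro open_Times) auto
  show "?H (?g w) = w" if "w \<in> dom_sigma" for w using that sigma[of "fst w" "snd w"] by auto
 qed (fact z H inv)+
 from has_derivative_fst[OF this] show ?thesis by simp
qed

text \<open>The derivative depends on the point only through \<open>gam\<close>, which is built from
  \<open>sigma\<close> by smooth operations and is thus differentiable to the same order; this
  closes the bootstrap.\<close>

lemma smooth_sigma: "smooth tsp tsp dom_sigma sigma"
proof (rule smooth_bootstrap_typed[where V = Vg and \<gamma> = gam and g = gd])
 have bb: "bounded_linear (%f. lint (ymul f b))"
  by (intro bounded_linear_compose[OF bounded_linear_lint] bounded_bilinear.bounded_linear_left[OF bounded_bilinear_ymul])
 show "open Vg" by (intro open_Collect_less continuous_intros linear_continuous_on[OF bb])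
 show "smooth (tsp \<otimes>\<^sub>n tsp) tsp (Vg \<times> UNIV) (%z. gd (fst z) (snd z))" unfolding gd_def
  by (intro smooth_divide smooth_diff smooth_bl[OF nspace_tt bounded_linear_fst] smooth_bl[OF nspace_tt bounded_linear_snd]
   smooth_bl[OF nspace_tt bounded_linear_lint] smooth_bl[OF nspace_tt bounded_linear_W] smooth_bb[OF nspace_tt bounded_bilinear_ymul] smooth_tfst smooth_tsnd
   smooth_tconst nspace_tt nspace_tsp) auto
 show "gd p (c *\<^sub>R h) = c *\<^sub>R gd p h" for p h c
  by (simp add: gd_def linear_simps[OF bounded_linear_lint] linear_simps[OF bounded_linear_W] bounded_bilinear.scaleR_right[OF bounded_bilinear_ymul]
    right_diff_distrib[symmetric])
 show "gam ` dom_sigma \<subseteq> Vg" using gam_Vg by blast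
 fix n assume s: "cdiff tsp tsp dom_sigma n 0 (%x vs. sigma x)"
 have id: "cdiff tsp tsp dom_sigma n 0 (%x vs. x)" for n using smooth_id[of tsp dom_sigma] unfolding smooth_def by simp
 have P: "cdiff tsp (tsp \<otimes>\<^sub>n tsp) dom_sigma n 0 (%x vs. (sigma x, x))"
  by (rule cdiff_pair[OF nspace_tsp nspace_tsp nspace_tsp s id])
 have "smooth (tsp \<otimes>\<^sub>n tsp) tsp UNIV (%w. yexp (W (snd (snd w)) + fst w *\<^sub>R b))"
 proof (rule smooth_comp[OF nspace_tt smooth_yexp])
  show "smooth (tsp \<otimes>\<^sub>n tsp) tsp UNIV (%w. W (snd (snd w)) + fst w *\<^sub>R b)"
   by (rule smooth_add[OF nspace_tt nspace_tsp smooth_bl[OF nspace_tt bounded_linear_W smooth_bl[OF nspace_tt bounded_linear_snd smooth_tsnd]]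
    smooth_bb[OF nspace_tt bounded_bilinear_scaleR smooth_tfst smooth_tconst[OF nspace_tt]]])
 qed simp
 then have "cdiff (tsp \<otimes>\<^sub>n tsp) tsp UNIV n 0 (%w vs. yexp (W (snd (snd w)) + fst w *\<^sub>R b))" unfolding smooth_def by blast
 from cdiff_compose[OF nspace_tsp nspace_tt nspace_tsp subset_UNIV this P]
 show "cdiff tsp tsp dom_sigma n 0 (%x vs. gam x)" unfolding gam_def o_def fst_conv snd_conv .
qed (rule sigma_deriv)

end

section \<open>Polynomials and jets at the end points\<close>

definition pe :: "real poly => ltwo" where "pe q = emb (mk (poly q))"

lemma mk_poly: "mk (poly q) t = poly q (cl t)"
 by (rule mk_apply) (intro continuous_intros)

lemma cl_TT [simp]: "cl TT = TT" "cl 0 = 0" by (simp_all add: cl_def)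

lemma pe_mk: "mk (poly q) = K (poly q 0) + I (pe (pderiv q))"
 unfolding pe_def
proof (rule FTC_real)
 fix t :: real assume t: "t \<in> {0..TT}"
 show "(poly q has_real_derivative mk (poly (pderiv q)) t) (at t within {0..TT})"
  unfolding mk_poly using t by (simp add: cl_def poly_DERIV has_field_derivative_at_within)
qed

lemma pe_eq: "pe q = ac (poly q 0) (pe (pderiv q))"
 unfolding pe_def[of q] pe_mk[of q] ..

lemma pe_sobolev: "pe q \<in> sobolev p"
proof (induction p arbitrary: q)
 case (Suc p)
 show ?case unfolding sobolev_Suc_iff using pe_eq[of q] Suc.IH by blast
qed simp

lemma I_pe: "I (pe (pderiv q)) t = poly q (cl t) - poly q 0"
 using arg_cong[OF pe_mk[of q], of "%f. f t"] by (simp add: mk_poly)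

lemma weak_deriv_pe: "weak_deriv (pe q) = pe (pderiv q)"
 by (subst pe_eq) (rule weak_deriv_ac)

lemma weak_deriv_funpow_pe: "(weak_deriv ^^ j) (pe q) = pe ((pderiv ^^ j) q)"
 by (induction j) (simp_all add: weak_deriv_pe)

lemma W_pe: "poly (pderiv q) 0 = 0 ==> W (pe (pderiv (pderiv q))) t = poly q (cl t) - poly q 0"
proof -
 assume 0: "poly (pderiv q) 0 = 0"
 have "I (pe (pderiv (pderiv q))) = mk (poly (pderiv q))" by (rule bcontfun_eqI) (simp add: I_pe mk_poly 0)
 then have "W (pe (pderiv (pderiv q))) = I (pe (pderiv q))" by (simp add: W_def pe_def)
 then show ?thesis by (simp add: I_pe)
qed

lemma cr_emb: "cr (emb f) t = f (cl t)"
proof -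
 have "continuous_on {0..TT} (cont_rep (emb f)) \<longleftrightarrow> continuous_on {0..TT} f"
  by (rule continuous_on_cong) (simp_all add: cont_rep_emb)
 then have "continuous_on {0..TT} (cont_rep (emb f))" by (simp add: continuous_on_apply_bcontfun continuous_on_id)
 then show ?thesis by (simp add: cr_def mk_apply cont_rep_emb)
qed

text \<open>The jump of the j-th derivative where the interval is closed up to a circle. The
  periodic space is the common kernel of these functionals for j < p
  (\<open>circle_iff\<close>).\<close>

definition J :: "nat => ltwo => real" where
 "J j u = cr ((weak_deriv ^^ j) u) TT - cr ((weak_deriv ^^ j) u) 0"

lemma J_pe: "J j (pe q) = poly ((pderiv ^^ j) q) TT - poly ((pderiv ^^ j) q) 0"
 unfolding J_def weak_deriv_funpow_pe by (simp add: pe_def cr_emb mk_poly)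

lemma nlinear_compose: "nspace M ==> nspace N ==> nspace L ==> nlinear M N f ==> nlinear N L g ==> nlinear M L (%x. g (f x))"
proof -
 assume M: "nspace M" and N: "nspace N" and f: "nlinear M N f" and g: "nlinear N L g"
 obtain C where C0: "\<forall>x\<in>fst M. snd N (f x) \<le> C * snd M x" using f unfolding nlinear_def by auto
 obtain D where D0: "\<forall>y\<in>fst N. snd L (g y) \<le> D * snd N y" using g unfolding nlinear_def by auto
 note C = bspec[OF C0] and D = bspec[OF D0]
 have "snd L (g (f x)) \<le> (\<bar>D\<bar> * C) * snd M x" if x: "x \<in> fst M" for x
 proof -
  have fx: "f x \<in> fst N" using f x unfolding nlinear_def by blast
  have "snd L (g (f x)) \<le> D * snd N (f x)" by (rule D[OF fx])
  also have "\<dots> \<le> \<bar>D\<bar> * snd N (f x)" using N fx by (intro mult_right_mono) (auto simp: nspace_def)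
  also have "\<dots> \<le> \<bar>D\<bar> * (C * snd M x)" by (intro mult_left_mono C x) simp
  finally show ?thesis by (simp add: mult.assoc)
 qed
 then have "\<exists>C. \<forall>x\<in>fst M. snd L (g (f x)) \<le> C * snd M x" by blast
 moreover have "g (f (a *\<^sub>R x + b *\<^sub>R y)) = a *\<^sub>R g (f x) + b *\<^sub>R g (f y)" if "x \<in> fst M" "y \<in> fst M" for a b x y
  using that f g unfolding nlinear_def by simp
 moreover have "g (f x) \<in> fst L" if "x \<in> fst M" for x using that f g unfolding nlinear_def by blast
 ultimately show ?thesis unfolding nlinear_def by blast
qed

lemma nlinear_funpow: "nlinear (S (j + m)) (S m) (weak_deriv ^^ j)"
proof (induction j)
 case 0
 show ?case by (auto simp: nlinear_def intro!: exI[of _ 1])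
next
 case (Suc j)
 show ?case using nlinear_compose[OF _ _ _ nlinear_weak_deriv Suc.IH] by (simp add: funpow_Suc_right o_def del: funpow.simps)
qed

lemma nlinear_J: "j < p ==> nlinear (S p) tsp (J j)"
proof -
 assume "j < p"
 then obtain m where p: "p = j + Suc m" using less_imp_Suc_add by auto
 have e0: "bounded_linear (%f :: cfun. f 0)" by (rule bounded_linear_intro[where K = 1]) (auto simp: abs_apply_le)
 have e1: "nlinear tsp tsp (%f. ev f - f 0)" by (intro nlinear_bl bounded_linear_sub bounded_linear_ev e0)
 have "nlinear (S (j + Suc m)) tsp (%x. ev (cr ((weak_deriv ^^ j) x)) - cr ((weak_deriv ^^ j) x) 0)"
  by (rule nlinear_compose[OF _ _ _ nlinear_compose[OF _ _ _ nlinear_funpow nlinear_cr] e1]) simp_all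
 then show ?thesis unfolding J_def[abs_def] p ev_def .
qed

lemma J_lin: "j < p ==> x \<in> sobolev p ==> y \<in> sobolev p ==> J j (a *\<^sub>R x + b *\<^sub>R y) = a * J j x + b * J j y"
 using nlinear_J[of j p] unfolding nlinear_def by simp

lemma J_scale: "j < p ==> x \<in> sobolev p ==> J j (a *\<^sub>R x) = a * J j x"
 using J_lin[of j p x x a 0] by simp

lemma J_add: "j < p ==> x \<in> sobolev p ==> y \<in> sobolev p ==> J j (x + y) = J j x + J j y"
 using J_lin[of j p x y 1 1] by simp

lemma J_diff: "j < p ==> x \<in> sobolev p ==> y \<in> sobolev p ==> J j (x - y) = J j x - J j y"
 using J_lin[of j p x y 1 "-1"] by simp

lemma J_sum:
 assumes j: "j < p" and A: "finite A" and f: "!!i. i \<in> A ==> f i \<in> sobolev p"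
 shows "J j (\<Sum>i\<in>A. a i *\<^sub>R f i) = (\<Sum>i\<in>A. a i * J j (f i))"
 using A f
proof (induction A rule: finite_induct)
 case empty
 show ?case using J_scale[OF j, of 0 0] subspace_0[OF subspace_sobolev] by simp
next
 case (insert i A)
 have "(\<Sum>i\<in>A. a i *\<^sub>R f i) \<in> sobolev p" using insert by (intro subspace_sum subspace_scale subspace_sobolev) auto
 then show ?case using insert J_lin[OF j, of "f i" "\<Sum>i\<in>A. a i *\<^sub>R f i" "a i" 1] by simp
qed

lemma sobolev_antimono: "m \<le> n ==> sobolev n \<subseteq> sobolev m"
 using sobolev_Suc_subset by (rule lift_Suc_antimono_le)

text \<open>\<open>Zs m\<close>: the derivatives of order less than \<open>m\<close> vanish at both end points.\<close>

primrec Zs :: "nat => ltwo set" where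
 "Zs 0 = UNIV"
| "Zs (Suc m) = {u. \<exists>v\<in>Zs m. u = Il v \<and> I v TT = 0}"

lemma Zs_SucI: "v \<in> Zs m ==> I v TT = 0 ==> Il v \<in> Zs (Suc m)" by auto

lemma Zs_Suc_subset: "Zs (Suc m) \<subseteq> Zs m"
proof (induction m)
 case (Suc m)
 show ?case
 proof
  fix u assume "u \<in> Zs (Suc (Suc m))"
  then obtain v where v: "v \<in> Zs (Suc m)" "u = Il v" "I v TT = 0" using Zs.simps(2)[of "Suc m"] by blast
  then show "u \<in> Zs (Suc m)" using Suc.IH Zs_SucI by blast
 qed
qed simp

lemma Zs_antimono: "m \<le> n ==> Zs n \<subseteq> Zs m"
 using Zs_Suc_subset by (rule lift_Suc_antimono_le)

lemma Il_lin: "Il (a *\<^sub>R x + b *\<^sub>R y) = a *\<^sub>R Il x + b *\<^sub>R Il y" "Il 0 = 0" "Il (x + y) = Il x + Il y" "Il (c *\<^sub>R x) = c *\<^sub>R Il x"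
 by (simp_all add: linear_simps[OF bounded_linear_Il])

lemma I_lin: "I (a *\<^sub>R x) t = a * I x t" "I (x + y) t = I x t + I y t" "I (x - y) t = I x t - I y t" "I 0 t = 0"
 by (simp_all add: linear_simps[OF bounded_linear_I])

lemma W_lin: "W (a *\<^sub>R x) t = a * W x t" "W (x + y) t = W x t + W y t" "W (x - y) t = W x t - W y t" "W 0 t = 0"
 by (simp_all add: linear_simps[OF bounded_linear_W])

lemma subspace_Zs: "subspace (Zs m)"
proof (induction m)
 case (Suc m)
 note c = subspace_0[OF Suc] subspace_add[OF Suc] subspace_scale[OF Suc]
 show ?case
 proof (rule subspaceI)
  show "0 \<in> Zs (Suc m)" using Zs_SucI[OF c(1)] by (simp add: Il_lin I_lin)
  fix x assume "x \<in> Zs (Suc m)"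
  then obtain v where v: "v \<in> Zs m" "x = Il v" "I v TT = 0" by auto
  show "a *\<^sub>R x \<in> Zs (Suc m)" for a using Zs_SucI[OF c(3)[OF v(1), of a]] v by (simp add: Il_lin I_lin)
  fix y assume "y \<in> Zs (Suc m)"
  then obtain w where w: "w \<in> Zs m" "y = Il w" "I w TT = 0" by auto
  show "x + y \<in> Zs (Suc m)" using Zs_SucI[OF c(2)[OF v(1) w(1)]] v w by (simp add: Il_lin I_lin)
 qed
qed simp

lemma Il_eq: "Il v = ac 0 v" by (simp add: Il_def)

lemma Zs_J: "u \<in> Zs m ==> j < m ==> J j u = 0"
proof (induction j arbitrary: m u)
 case 0
 then obtain k where "m = Suc k" by (cases m) auto
 then obtain v where "u = Il v" "I v TT = 0" using 0 by auto
 then show ?case by (simp add: J_def Il_def cr_emb I_zero)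
next
 case (Suc j)
 then obtain k where k: "m = Suc k" by (cases m) auto
 then obtain v where v: "v \<in> Zs k" "u = Il v" using Suc.prems by auto
 have "weak_deriv (Il v) = v" using weak_deriv_ac[of 0 v] by (simp add: Il_def)
 then have "J (Suc j) u = J j v" unfolding J_def v(2) funpow_Suc_right o_def by simp
 then show ?case using Suc.IH[OF v(1)] Suc.prems k by simp
qed

lemma pm_comm: "u \<in> sobolev (Suc m) ==> v \<in> sobolev (Suc n) ==> pm u v = pm v u"
proof -
 assume u: "u \<in> sobolev (Suc m)" and v: "v \<in> sobolev (Suc n)"
 have e: "pm a b = emb (ymul (cr a) (cr b))" if a: "a \<in> sobolev (Suc k)" for a b k
  using mulL_emb[of "cr a" "cr b"] unfolding pm_def emb_cr[OF a] .
 have "ymul (cr u) (cr v) = ymul (cr v) (cr u)" by (rule bcontfun_eqI) simp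
 then show ?thesis unfolding e[OF u] e[OF v] by simp
qed

lemma Il_sobolev: "v \<in> sobolev m ==> Il v \<in> sobolev (Suc m)"
 unfolding Il_eq sobolev_Suc_iff by blast

lemma Zs_pm: "u \<in> Zs m ==> v \<in> sobolev (Suc m) ==> pm u v \<in> Zs m"
proof (induction m arbitrary: u v)
 case (Suc m)
 obtain u' where u: "u' \<in> Zs m" "u = Il u'" "I u' TT = 0" using Suc.prems(1) by auto
 obtain b v' where v: "v' \<in> sobolev (Suc m)" "v = ac b v'" using Suc.prems(2) unfolding sobolev_Suc_iff[of v "Suc m"] by blast
 let ?s = "pm u' v + pm v' u"
 have uv: "pm u v = Il ?s" unfolding u(2) v(2) Il_eq pm_ac by simp
 have "pm u' v \<in> Zs m" using Suc.IH[OF u(1)] Suc.prems(2) sobolev_Suc_subset by blast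
 moreover have "pm v' u = pm u v'" by (rule pm_comm[OF v(1)]) (unfold u(2), rule Il_sobolev[of _ 0], simp)
 moreover have "pm u v' \<in> Zs m" using Suc.IH[OF _ v(1)] Suc.prems(1) Zs_Suc_subset by blast
 ultimately have s: "?s \<in> Zs m" using subspace_add[OF subspace_Zs] by metis
 have "emb (I ?s) = emb (ymul (I u') (cr v))" using uv unfolding Il_def u(2) pm_def mulL_emb by simp
 from emb_inj[OF this, of TT] have "I ?s TT = 0" using u(3) by simp
 then show ?case unfolding uv using Zs_SucI[OF s] by simp
qed simp

lemma cr_En: "cr (En x) = yexp (2 *\<^sub>R W x)"
 unfolding En_def by (rule bcontfun_eqI) (simp add: cr_emb W_cl)

lemma En_sobolev: "x \<in> sobolev p ==> En x \<in> sobolev (Suc p)"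
 using smooth_mem[OF smooth_En] by simp

lemma Kx_sobolev: "x \<in> sobolev p ==> Kx x \<in> sobolev p"
 using smooth_mem[OF smooth_incl[OF smooth_Kx]] by simp

text \<open>The correction \<open>Kx\<close> gains one order of vanishing of the jets of a difference.\<close>

lemma Kx_ideal:
 assumes x: "x \<in> sobolev p" and w: "w \<in> sobolev p" "w \<in> Zs m" "m < p" "I w TT = 0" "W w TT = 0"
 shows "Kx (x + w) - Kx x \<in> Zs (Suc m)"
proof -
 have sub: "sobolev (Suc p) \<subseteq> sobolev (Suc (Suc m))" using w(3) by (intro sobolev_antimono) simp
 have Iw: "Il w \<in> Zs (Suc m)" by (rule Zs_SucI[OF w(2,4)])
 have crI: "cr (Il v) = I v" for v using cr_ac[of 0 v] by (simp add: Il_def)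
 have "2 *\<^sub>R x + w \<in> sobolev p" using x w subspace_add[OF subspace_sobolev] subspace_scale[OF subspace_sobolev] by blast
 then have 1: "pm (Il w) (Il (2 *\<^sub>R x + w)) \<in> Zs (Suc m)" using Il_sobolev sub by (intro Zs_pm[OF Iw]) blast
 have pI: "pm (Il u) (Il v) = emb (ymul (I u) (I v))" for u v unfolding pm_def crI by (simp add: Il_def mulL_emb)
 \<comment> \<open>Both parts of \<open>Kx\<close> change by a product with a factor whose jets
   vanish: here I w, and below exp (2 W w) - 1, which is the primitive of \<open>?g\<close>.\<close>
 have "ymul (I (x + w)) (I (x + w)) = ymul (I x) (I x) + ymul (I w) (I (2 *\<^sub>R x + w))"
  by (rule bcontfun_eqI) (simp add: I_lin algebra_simps)
 then have e1: "pm (Il (x + w)) (Il (x + w)) = pm (Il x) (Il x) + pm (Il w) (Il (2 *\<^sub>R x + w))"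
  unfolding pI by (simp add: linear_simps[OF bounded_linear_emb])
 let ?g = "2 *\<^sub>R pm (En w) (Il w)"
 have "pm (En w) (Il w) = pm (Il w) (En w)" by (rule pm_comm[OF En_sobolev[OF w(1)] Il_sobolev[OF w(1)]])
 moreover have "pm (Il w) (En w) \<in> Zs (Suc m)" using En_sobolev[OF w(1)] sub by (intro Zs_pm[OF Iw]) blast
 ultimately have g: "?g \<in> Zs (Suc m)" using subspace_scale[OF subspace_Zs] by metis
 have "emb (K 1 + I ?g) = emb (yexp (2 *\<^sub>R W w))" using En_ext[of w] unfolding En_def[of w] Il_def
  by (simp add: linear_simps(1)[OF bounded_linear_emb])
 from emb_inj[OF this, of TT] have "I ?g TT = 0" using w(5) by simp
 from Zs_SucI[OF g this] have "Il ?g \<in> Zs (Suc m)" using Zs_Suc_subset by blast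
 then have 2: "pm (Il ?g) (En x) \<in> Zs (Suc m)" using En_sobolev[OF x] sub by (intro Zs_pm) auto
 have "En w = emb (K 1) + Il ?g" by (rule En_ext)
 then have "Il ?g = En w - emb (K 1)" by (metis add_diff_cancel_left')
 also have "\<dots> = emb (yexp (2 *\<^sub>R W w) - K 1)" unfolding En_def by (simp add: linear_simps[OF bounded_linear_emb])
 finally have "Il ?g = emb (yexp (2 *\<^sub>R W w) - K 1)" .
 then have "pm (Il ?g) (En x) = emb (ymul (yexp (2 *\<^sub>R W w) - K 1) (yexp (2 *\<^sub>R W x)))"
  unfolding pm_def cr_En by (simp only: mulL_emb)
 also have "ymul (yexp (2 *\<^sub>R W w) - K 1) (yexp (2 *\<^sub>R W x)) = yexp (2 *\<^sub>R W (x + w)) - yexp (2 *\<^sub>R W x)"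
  by (rule bcontfun_eqI) (simp add: W_lin algebra_simps exp_add)
 finally have e2: "En (x + w) - En x = pm (Il ?g) (En x)" unfolding En_def by (simp add: linear_simps[OF bounded_linear_emb])
 have "Kx (x + w) - Kx x = (1/4) *\<^sub>R pm (Il w) (Il (2 *\<^sub>R x + w)) - (En (x + w) - En x)"
  unfolding Kx_eq e1 by (simp add: scaleR_add_right)
 then show ?thesis unfolding e2 using 1 2 subspace_diff[OF subspace_Zs] subspace_scale[OF subspace_Zs] by metis
qed

definition bq :: "real poly" where "bq = [:0, TT, -1:]"

lemma bq: "poly bq t = t * (TT - t)" "bq = [:- TT, 1:] * [:0, -1:]" "bq = [:- 0, 1:] * [:TT, -1:]"
 by (simp_all add: bq_def algebra_simps)

lemma pderiv_power: "\<exists>r'. pderiv (a ^ Suc m * r) = a ^ m * r'" for a :: "real poly"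
proof -
 have "pderiv (a ^ Suc m * r) = a ^ m * (a * pderiv r + smult (of_nat (Suc m)) (pderiv a) * r)"
  unfolding pderiv_mult pderiv_power_Suc by (simp add: algebra_simps)
 then show ?thesis by blast
qed

lemma Zs_pe: "pe (bq ^ m * r) \<in> Zs m"
proof (induction m arbitrary: r)
 case (Suc m)
 obtain r' where r': "pderiv (bq ^ Suc m * r) = bq ^ m * r'" using pderiv_power by blast
 let ?q = "bq ^ Suc m * r"
 have z: "poly ?q 0 = 0" "poly ?q TT = 0" by (simp_all add: bq(1))
 have "I (pe (pderiv ?q)) TT = 0" unfolding I_pe cl_TT z by simp
 moreover have "pe ?q = Il (pe (pderiv ?q))" using pe_eq[of ?q] unfolding Il_eq z .
 ultimately show ?case using Zs_SucI[OF Suc.IH[of r', folded r']] by simp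
qed simp

text \<open>Each derivative removes one linear factor, up to terms that still contain it; this gives
  the Taylor coefficient at a root without binomial sums.\<close>

lemma pderiv_root:
 "poly ((pderiv ^^ n) ([:- a, 1:] ^ n * r)) a = fact n * poly r a"
 "n < m ==> poly ((pderiv ^^ n) ([:- a, 1:] ^ m * r)) a = (0::real)"
proof (induction n arbitrary: m r)
 case 0
 { case 1 show ?case by simp next case 2 then show ?case by simp }
next
 case (Suc n)
 have d: "pderiv ([:- a, 1:] ^ Suc k * r) = [:- a, 1:] ^ k * (smult (of_nat (Suc k)) r + [:- a, 1:] * pderiv r)" for k and r :: "real poly"
 proof -
  have "pderiv [:- a, 1:] = 1" by (simp add: pderiv_pCons)
  then show ?thesis unfolding pderiv_mult pderiv_power_Suc by (simp add: algebra_simps)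
 qed
 { case 1
  show ?case unfolding funpow_Suc_right o_def d Suc.IH(1) by (simp add: algebra_simps)
 next
  case 2
  then obtain k where k: "m = Suc k" "n < k" by (cases m) auto
  show ?case unfolding k(1) funpow_Suc_right o_def d using Suc.IH(2)[OF k(2)] by simp }
qed

text \<open>The element is the second derivative of (t (2 pi - t))^(j+2) t. The exponent leaves j
  orders of vanishing after two derivatives, and its first and second primitives vanish at the end.
  The additional factor t makes the derivative of order j + 2 vanish at 0 but not at 2 pi, so that
  there is a jump.\<close>

lemma ex_jump: "\<exists>e. e \<in> Zs j \<and> (\<forall>p. e \<in> sobolev p) \<and> J j e = 1 \<and> I e TT = 0 \<and> W e TT = 0"
proof -
 let ?q = "bq ^ Suc (Suc j) * [:0, 1:]"
 obtain r where r: "pderiv ?q = bq ^ Suc j * r" using pderiv_power by blast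
 obtain r' where r': "pderiv (pderiv ?q) = bq ^ j * r'" unfolding r using pderiv_power by blast
 let ?e = "pe (pderiv (pderiv ?q))"
 have z: "poly ?q 0 = 0" "poly ?q TT = 0" "poly (pderiv ?q) 0 = 0" "poly (pderiv ?q) TT = 0" unfolding r by (simp_all add: bq(1))
 have Z: "?e \<in> Zs j" unfolding r' by (rule Zs_pe)
 have i: "I ?e TT = 0" "W ?e TT = 0" by (simp_all only: I_pe W_pe[OF z(3)] cl_TT z diff_self)
 have "(pderiv ^^ j) (pderiv (pderiv ?q)) = (pderiv ^^ Suc (Suc j)) ?q" by (simp only: funpow_Suc_right o_def)
 moreover have "poly ((pderiv ^^ Suc (Suc j)) ?q) TT = fact (Suc (Suc j)) * poly ([:0, -1:] ^ Suc (Suc j) * [:0, 1:]) TT"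
  unfolding bq(2) power_mult_distrib mult.assoc by (rule pderiv_root(1))
 moreover have "poly ((pderiv ^^ Suc (Suc j)) ?q) 0 = 0"
 proof -
  have "?q = [:- 0, 1:] ^ Suc (Suc (Suc j)) * [:TT, -1:] ^ Suc (Suc j)"
   unfolding bq(3) power_mult_distrib by (simp add: mult_ac)
  then show ?thesis using pderiv_root(2)[of "Suc (Suc j)" "Suc (Suc (Suc j))" 0 "[:TT, -1:] ^ Suc (Suc j)"] by simp
 qed
 ultimately have Jn: "J j ?e \<noteq> 0" unfolding J_pe by simp
 let ?c = "1 / J j ?e"
 have "J j (?c *\<^sub>R ?e) = 1" using J_scale[of j "Suc j" ?e ?c] pe_sobolev Jn by simp
 moreover have "?c *\<^sub>R ?e \<in> Zs j" by (rule subspace_scale[OF subspace_Zs Z])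
 moreover have "\<forall>p. ?c *\<^sub>R ?e \<in> sobolev p" using subspace_scale[OF subspace_sobolev pe_sobolev] by blast
 ultimately show ?thesis using i by (intro exI[of _ "?c *\<^sub>R ?e"]) (simp add: I_lin W_lin)
qed

abbreviation dual_at :: "nat => (nat => ltwo) => nat => bool" where
 "dual_at p d j \<equiv> d j \<in> Zs j \<and> d j \<in> sobolev p \<and> I (d j) TT = 0 \<and> W (d j) TT = 0 \<and> (\<forall>i<p. J i (d j) = (if i = j then 1 else 0))"

lemma I_sum0: "finite A ==> (!!i. i \<in> A ==> I (f i) TT = 0 \<and> W (f i) TT = 0) ==> I (\<Sum>i\<in>A. a i *\<^sub>R f i) TT = 0 \<and> W (\<Sum>i\<in>A. a i *\<^sub>R f i) TT = 0"
 by (induction A rule: finite_induct) (simp_all add: I_lin W_lin)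

text \<open>The elements of \<open>ex_jump\<close> have no jumps below their index, jump 1 at it and
  unknown jumps above. This triangular system is solved from the highest index downwards, by
  subtracting dual elements already found.\<close>

lemma ex_dual: "\<exists>d. \<forall>j<p. dual_at p d j"
proof -
 have "\<exists>d. \<forall>j<p. p - k \<le> j --> dual_at p d j" if "k \<le> p" for k
  using that
 proof (induction k)
  case (Suc k)
  then obtain d where d: "!!j. j < p ==> p - k \<le> j ==> dual_at p d j" by auto
  define l where "l = p - Suc k"
  have l: "l < p" "p - k = Suc l" using Suc.prems by (auto simp: l_def)
  obtain e where e: "e \<in> Zs l" "e \<in> sobolev p" "J l e = 1" "I e TT = 0" "W e TT = 0" using ex_jump[of l] by blast
  define A where "A = {Suc l..<p}"
  have A: "finite A" "i \<in> A ==> dual_at p d i" for i using d l(2) by (auto simp: A_def)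
  let ?s = "\<Sum>i\<in>A. J i e *\<^sub>R d i"
  have sS: "?s \<in> sobolev p" using A by (intro subspace_sum subspace_scale subspace_sobolev) auto
  have sZ: "?s \<in> Zs l"
  proof (intro subspace_sum subspace_scale subspace_Zs)
   fix i assume i: "i \<in> A"
   then have "d i \<in> Zs i" "l \<le> i" using A(2)[OF i] by (auto simp: A_def)
   then show "d i \<in> Zs l" using Zs_antimono by blast
  qed
  have sI: "I ?s TT = 0 \<and> W ?s TT = 0" using A by (intro I_sum0) auto
  have J: "J i (e - ?s) = (if i = l then 1 else 0)" if i: "i < p" for i
  proof -
   have "J i ?s = (\<Sum>j\<in>A. J j e * J i (d j))" using A by (intro J_sum[OF i]) auto
   also have "\<dots> = (\<Sum>j\<in>A. if j = i then J i e else 0)" using A(2) i by (intro sum.cong) auto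
   also have "\<dots> = (if i \<in> A then J i e else 0)" using A(1) by (simp add: sum.delta)
   finally have Js: "J i ?s = (if i \<in> A then J i e else 0)" .
   have Jd: "J i (e - ?s) = J i e - J i ?s" by (rule J_diff[OF i e(2) sS])
   consider "i < l" | "i = l" | "i \<in> A" using i by (force simp: A_def)
   then show ?thesis
   proof cases
    case 1 then show ?thesis using Zs_J[OF e(1)] Jd Js by (simp add: A_def)
   next
    case 2 then show ?thesis using e(3) Jd Js by (simp add: A_def)
   next
    case 3 then show ?thesis using Jd Js by (auto simp: A_def)
   qed
  qed
  have dual_l: "dual_at p (d(l := e - ?s)) l"
   using J subspace_diff[OF subspace_Zs e(1) sZ] subspace_diff[OF subspace_sobolev e(2) sS] sI e(4,5) by (simp add: I_lin W_lin)
  have dual_ge: "dual_at p (d(l := e - ?s)) j" if "j < p" "Suc l \<le> j" for j using d[of j] l(2) that by simp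
  have "\<forall>j<p. l \<le> j --> dual_at p (d(l := e - ?s)) j"
  proof (intro allI impI)
   fix j assume "j < p" "l \<le> j"
   then consider "j = l" | "j < p" "Suc l \<le> j" by linarith
   then show "dual_at p (d(l := e - ?s)) j"
   proof cases
    case 1 show ?thesis unfolding \<open>j = l\<close> by (rule dual_l)
   next
    case 2 then show ?thesis by (rule dual_ge)
   qed
  qed
  then show ?case unfolding l_def by blast
 qed simp
 from this[of p] show ?thesis by simp
qed

section \<open>The periodic case\<close>

lemma J_circle: "u \<in> sobolev p ==> j < p ==> J j u = cont_rep ((weak_deriv ^^ j) u) TT - cont_rep ((weak_deriv ^^ j) u) 0"
proof -
 assume u: "u \<in> sobolev p" and j: "j < p"
 then obtain m where p: "p = j + Suc m" using less_imp_Suc_add by auto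
 have "(weak_deriv ^^ j) u \<in> sobolev (Suc m)" using nlinear_funpow[of j "Suc m"] u unfolding nlinear_def p by simp
 then obtain c v where "(weak_deriv ^^ j) u = ac c v" unfolding sobolev_Suc_iff by blast
 then show ?thesis unfolding J_def by (simp add: cont_rep_emb del: cr_ac add: cr_emb)
qed

lemma circle_iff: "u \<in> sobolev_circle p \<longleftrightarrow> u \<in> sobolev p \<and> (\<forall>j<p. J j u = 0)"
 unfolding sobolev_circle_def using J_circle[of u p] by auto

definition SC :: "nat => ltwo nsp" where "SC p = (sobolev_circle p, sobolev_norm p)"

lemma SC_simps [simp]: "fst (SC p) = sobolev_circle p" "snd (SC p) = sobolev_norm p" by (simp_all add: SC_def)

lemma subspace_circle: "subspace (sobolev_circle p)"
 using subspace_0[OF subspace_sobolev] subspace_add[OF subspace_sobolev] subspace_scale[OF subspace_sobolev] J_scale[of _ p 0 0]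
 by (intro subspaceI) (auto simp: circle_iff J_add J_scale)

lemma nspace_sub: "nspace M ==> subspace V ==> V \<subseteq> fst M ==> nspace (V, snd M)"
 unfolding nspace_def fst_conv snd_conv by (simp add: subset_iff)

lemma nspace_SC [simp]: "nspace (SC p)"
proof -
 have "sobolev_circle p \<subseteq> fst (S p)" using circle_iff by auto
 from nspace_sub[OF nspace_S subspace_circle this] show ?thesis by (simp add: SC_def)
qed

locale jump_dual =
 fixes p :: nat and d :: "nat => ltwo"
 assumes d: "j < p ==> dual_at p d j"
begin

definition dsum :: "(nat => real) => ltwo" where "dsum a = (\<Sum>j<p. a j *\<^sub>R d j)"

lemma dsum_sobolev: "dsum a \<in> sobolev p"
 unfolding dsum_def using d by (intro subspace_sum subspace_scale subspace_sobolev) auto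

lemma J_dsum: "i < p ==> J i (dsum a) = a i"
proof -
 assume i: "i < p"
 have "J i (dsum a) = (\<Sum>j<p. a j * J i (d j))" unfolding dsum_def using d by (intro J_sum[OF i]) auto
 also have "\<dots> = (\<Sum>j<p. if j = i then a i else 0)" using d i by (intro sum.cong) auto
 finally show ?thesis using i by (simp add: sum.delta)
qed

text \<open>Perturbations with m vanishing jets that leave the end values of \<open>I\<close> and
  \<open>W\<close> unchanged; these are the hypotheses of \<open>Kx_ideal\<close>.\<close>

definition Dz :: "nat => ltwo set" where "Dz m = {u. u \<in> Zs m \<and> u \<in> sobolev p \<and> I u TT = 0 \<and> W u TT = 0}"

lemma dsum_Dz: "(!!j. j < p ==> j < m ==> a j = 0) ==> dsum a \<in> Dz m"
proof -
 assume a: "!!j. j < p ==> j < m ==> a j = 0"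
 have "dsum a \<in> Zs m" unfolding dsum_def
 proof (rule subspace_sum[OF subspace_Zs])
  fix j assume j: "j \<in> {..<p}"
  show "a j *\<^sub>R d j \<in> Zs m"
  proof (cases "j < m")
   case True then show ?thesis using a j subspace_0[OF subspace_Zs] by simp
  next
   case False
   then have "d j \<in> Zs m" using d[of j] j Zs_antimono[of m j] by auto
   then show ?thesis by (rule subspace_scale[OF subspace_Zs])
  qed
 qed
 moreover have "I (dsum a) TT = 0 \<and> W (dsum a) TT = 0" unfolding dsum_def using d by (intro I_sum0) auto
 ultimately show ?thesis using dsum_sobolev by (simp add: Dz_def)
qed

definition Pd :: "ltwo => ltwo" where "Pd u = u - dsum (%j. J j u)"

text \<open>As F x = - x / 2 + Kx x, the jumps of F x vanish exactly when those of x are twice those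
  of Kx x. With the periodic part y of x prescribed this is the fixed-point equation x =
  \<open>B y x\<close>.\<close>

definition B :: "ltwo => ltwo => ltwo" where "B y x = y + 2 *\<^sub>R dsum (%j. J j (Kx x))"

lemma B_sobolev: "y \<in> sobolev p ==> B y x \<in> sobolev p"
 unfolding B_def by (intro subspace_add subspace_scale subspace_sobolev dsum_sobolev)

lemma B_diff: "B y x' - B y x = dsum (%j. 2 * (J j (Kx x') - J j (Kx x)))"
 by (simp add: B_def dsum_def sum_subtractf scaleR_left_diff_distrib scaleR_right_diff_distrib right_diff_distrib scaleR_sum_right)

text \<open>The case j = m is included thanks to the order gained in \<open>Kx_ideal\<close>;
  without it the iteration would not progress.\<close>

lemma Kx_coeff:
 assumes x: "x \<in> sobolev p" "x' - x \<in> Dz m" and j: "j < p" "j \<le> m"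
 shows "J j (Kx x') = J j (Kx x)"
proof -
 have w: "x' - x \<in> sobolev p" "x' - x \<in> Zs j" "I (x' - x) TT = 0" "W (x' - x) TT = 0"
  using x(2) Zs_antimono[OF j(2)] unfolding Dz_def by auto
 have x': "x' \<in> sobolev p" using subspace_add[OF subspace_sobolev x(1) w(1)] by simp
 have "Kx x' - Kx x \<in> Zs (Suc j)" using Kx_ideal[OF x(1) w(1,2) j(1) w(3,4)] by simp
 then have "J j (Kx x' - Kx x) = 0" by (rule Zs_J) simp
 then show ?thesis using J_diff[OF j(1) Kx_sobolev[OF x'] Kx_sobolev[OF x(1)]] by simp
qed

lemma B_gain: "x \<in> sobolev p ==> x' - x \<in> Dz m ==> B y x' - B y x \<in> Dz (Suc m)"
 unfolding B_diff by (intro dsum_Dz) (simp add: Kx_coeff less_Suc_eq_le)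

lemma B_eq: "x \<in> sobolev p ==> x' - x \<in> Dz p ==> B y x' = B y x"
proof -
 assume "x \<in> sobolev p" "x' - x \<in> Dz p"
 then have "J j (Kx x') = J j (Kx x)" if "j < p" for j using Kx_coeff that by simp
 then show ?thesis by (simp add: B_def dsum_def)
qed

definition it :: "nat => ltwo => ltwo" where "it k y = (B y ^^ k) y"

lemma it_Suc: "it 0 y = y" "it (Suc k) y = B y (it k y)" by (simp_all add: it_def)

lemma it_sobolev: "y \<in> sobolev p ==> it k y \<in> sobolev p"
 by (cases k) (simp_all add: it_Suc B_sobolev)

lemma it_diff: "y \<in> sobolev p ==> it (Suc k) y - it k y \<in> Dz k"
proof (induction k)
 case 0
 have "it (Suc 0) y - it 0 y = dsum (%j. 2 * J j (Kx y))" by (simp add: it_Suc B_def dsum_def scaleR_sum_right)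
 then show ?case by (simp add: dsum_Dz)
next
 case (Suc k)
 show ?case unfolding it_Suc(2)[of "Suc k"] it_Suc(2)[of k] using B_gain[OF it_sobolev Suc.IH] Suc.prems by (simp add: it_Suc)
qed

text \<open>The iterates of index p and p + 1 differ by an element of \<open>Dz p\<close>. Such an
  element has no effect on the p jumps of \<open>Kx\<close>, so the iterate of index p + 1 is fixed
  exactly.\<close>

definition X0 :: "ltwo => ltwo" where "X0 y = it (Suc p) y"

lemma X0_sobolev: "y \<in> sobolev p ==> X0 y \<in> sobolev p" unfolding X0_def by (rule it_sobolev)

lemma X0_fix: "y \<in> sobolev p ==> B y (X0 y) = X0 y"
proof -
 assume y: "y \<in> sobolev p"
 have "B y (it (Suc p) y) = B y (it p y)" by (rule B_eq[OF it_sobolev[OF y] it_diff[OF y]])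
 then show ?thesis by (simp add: X0_def it_Suc(2))
qed

text \<open>The same gain applied to two fixed points: they differ by an element of
  \<open>Dz m\<close> for every m, and for m = p this makes their images under \<open>B\<close>
  equal.\<close>

lemma fix_unique:
 assumes x: "x \<in> sobolev p" "B y x = x" and x': "x' \<in> sobolev p" "B y x' = x'"
 shows "x' = x"
proof -
 have "x' - x \<in> Dz m" for m
 proof (induction m)
  case 0
  have "x' - x = dsum (%j. 2 * (J j (Kx x') - J j (Kx x)))" using B_diff[of y x' x] x(2) x'(2) by simp
  then show ?case by (simp add: dsum_Dz)
 next
  case (Suc m)
  then show ?case using B_gain[OF x(1) Suc, of y] x(2) x'(2) by simp
 qed
 then show ?thesis using B_eq[OF x(1), of x' y] x(2) x'(2) by simp
qed

lemma X0_eq: "y \<in> sobolev p ==> X0 y = y + 2 *\<^sub>R dsum (%j. J j (Kx (X0 y)))"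
 using X0_fix[of y] by (simp add: B_def)

lemma X0_ends: "y \<in> sobolev p ==> I (X0 y) TT = I y TT" "y \<in> sobolev p ==> W (X0 y) TT = W y TT"
proof -
 assume y: "y \<in> sobolev p"
 let ?s = "dsum (%j. J j (Kx (X0 y)))"
 have s: "I ?s TT = 0" "W ?s TT = 0" using dsum_Dz[of 0] by (auto simp: Dz_def)
 have "I (X0 y) TT = I (y + 2 *\<^sub>R ?s) TT" "W (X0 y) TT = W (y + 2 *\<^sub>R ?s) TT" using X0_eq[OF y] by metis+
 then show "I (X0 y) TT = I y TT" "W (X0 y) TT = W y TT" using s by (simp_all add: I_lin W_lin)
qed

text \<open>Elements of \<open>Dz p\<close> do not influence the jumps of \<open>Kx\<close>. Hence
  the total angle can be adjusted along such an element without solving the boundary problem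
  again.\<close>

lemma X0_shift: "y \<in> sobolev p ==> c \<in> Dz p ==> X0 (y + s *\<^sub>R c) = X0 y + s *\<^sub>R c"
proof -
 assume y: "y \<in> sobolev p" and c: "c \<in> Dz p"
 have sc: "s *\<^sub>R c \<in> Dz p" using c unfolding Dz_def
  by (auto simp: I_lin W_lin intro: subspace_scale[OF subspace_Zs] subspace_scale[OF subspace_sobolev])
 then have scs: "s *\<^sub>R c \<in> sobolev p" by (simp add: Dz_def)
 have "B y (X0 y + s *\<^sub>R c) = B y (X0 y)" using B_eq[OF X0_sobolev[OF y]] sc by simp
 then have "B (y + s *\<^sub>R c) (X0 y + s *\<^sub>R c) = X0 y + s *\<^sub>R c" using X0_fix[OF y] by (simp add: B_def algebra_simps)
 moreover have "y + s *\<^sub>R c \<in> sobolev p" "X0 y + s *\<^sub>R c \<in> sobolev p"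
  using y scs X0_sobolev[OF y] by (auto intro: subspace_add[OF subspace_sobolev])
 ultimately show ?thesis using fix_unique[OF _ _ X0_sobolev X0_fix] by blast
qed

lemma Pd_circle: "u \<in> sobolev p ==> Pd u \<in> sobolev_circle p"
 unfolding Pd_def circle_iff using dsum_sobolev J_dsum by (auto simp: J_diff intro: subspace_diff[OF subspace_sobolev])

lemma Pd_id: "u \<in> sobolev_circle p ==> Pd u = u"
 by (simp add: Pd_def circle_iff dsum_def)

lemma Pd_X0: "y \<in> sobolev_circle p ==> Pd (X0 y) = y"
proof -
 assume y: "y \<in> sobolev_circle p"
 then have y': "y \<in> sobolev p" by (simp add: circle_iff)
 let ?a = "%j. J j (Kx (X0 y))"
 have "J j (X0 y) = 2 * ?a j" if j: "j < p" for j
 proof -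
  have "J j (X0 y) = J j (1 *\<^sub>R y + 2 *\<^sub>R dsum ?a)" using X0_eq[OF y'] by simp
  also have "\<dots> = 1 * J j y + 2 * J j (dsum ?a)" by (rule J_lin[OF j y' dsum_sobolev])
  finally show ?thesis using y j by (simp add: J_dsum circle_iff)
 qed
 then have "dsum (%j. J j (X0 y)) = 2 *\<^sub>R dsum ?a" by (simp add: dsum_def scaleR_sum_right)
 then show ?thesis using X0_eq[OF y'] unfolding Pd_def by (metis add_diff_cancel_right')
qed

lemma F_J: "x \<in> sobolev p ==> j < p ==> J j (F x) = (-1/2) * J j x + J j (Kx x)"
 using J_lin[of j p x "Kx x" "-1/2" 1] Kx_sobolev[of x p] by (simp add: F_eq)

lemma F_sobolev: "x \<in> sobolev p ==> F x \<in> sobolev p"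
 using smooth_mem[OF smooth_F] by simp

lemma F_X0: "y \<in> sobolev_circle p ==> F (X0 y) \<in> sobolev_circle p"
proof -
 assume y: "y \<in> sobolev_circle p"
 then have y': "y \<in> sobolev p" by (simp add: circle_iff)
 note x = X0_sobolev[OF y']
 have "J j (F (X0 y)) = 0" if j: "j < p" for j
 proof -
  have "J j (X0 y) = J j (1 *\<^sub>R y + 2 *\<^sub>R dsum (%j. J j (Kx (X0 y))))" using X0_eq[OF y'] by simp
  also have "\<dots> = 1 * J j y + 2 * J j (dsum (%j. J j (Kx (X0 y))))" by (rule J_lin[OF j y' dsum_sobolev])
  finally show ?thesis using F_J[OF x j] y j by (simp add: J_dsum circle_iff)
 qed
 then show ?thesis using F_sobolev[OF x] by (simp add: circle_iff)
qed

lemma X0_Pd: "q \<in> sobolev_circle p ==> X0 (Pd (X q)) = X q"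
proof -
 assume q: "q \<in> sobolev_circle p"
 then have q': "q \<in> sobolev p" by (simp add: circle_iff)
 have x: "X q \<in> sobolev p" using smooth_mem[OF smooth_X] q' by simp
 have P: "Pd (X q) \<in> sobolev p" using Pd_circle[OF x] by (simp add: circle_iff)
 have "J j (X q) = 2 * J j (Kx (X q))" if j: "j < p" for j
  using F_J[OF x j] q j unfolding F_X by (simp add: circle_iff)
 then have "dsum (%j. J j (X q)) = 2 *\<^sub>R dsum (%j. J j (Kx (X q)))" by (simp add: dsum_def scaleR_sum_right)
 then have "B (Pd (X q)) (X q) = X q" by (simp add: B_def Pd_def)
 then show ?thesis using fix_unique[OF x _ X0_sobolev[OF P] X0_fix[OF P]] by simp
qed

lemma nlinear_Pd: "nlinear (S p) (SC p) Pd"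
proof -
 have "\<forall>j. \<exists>C. j < p --> (\<forall>x\<in>sobolev p. \<bar>J j x\<bar> \<le> C * sobolev_norm p x)"
  using nlinear_J[of _ p] unfolding nlinear_def by auto
 then obtain C where C: "!!j x. j < p ==> x \<in> sobolev p ==> \<bar>J j x\<bar> \<le> C j * sobolev_norm p x" by metis
 let ?n = "sobolev_norm p"
 have b: "?n (Pd x) \<le> (1 + (\<Sum>j<p. C j * ?n (d j))) * ?n x" if x: "x \<in> sobolev p" for x
 proof -
  have "?n (Pd x) \<le> ?n x + ?n (dsum (%j. J j x))"
   unfolding Pd_def using nspace_diff[OF nspace_S[of p], of x "dsum (%j. J j x)"] x dsum_sobolev by simp
  also have "?n (dsum (%j. J j x)) \<le> (\<Sum>j<p. ?n (J j x *\<^sub>R d j))"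
   unfolding dsum_def using nspace_sum_le[OF nspace_S[of p], of "{..<p}" "%j. J j x *\<^sub>R d j"] d
   by (auto intro: subspace_scale[OF subspace_sobolev])
  also have "\<dots> \<le> (\<Sum>j<p. C j * ?n (d j) * ?n x)"
  proof (rule sum_mono)
   fix j assume j: "j \<in> {..<p}"
   have "?n (J j x *\<^sub>R d j) = \<bar>J j x\<bar> * ?n (d j)" using nspace_S[of p] d[of j] j by (simp add: nspace_def)
   also have "\<dots> \<le> (C j * ?n x) * ?n (d j)" using C[of j x] j x by (intro mult_right_mono sobolev_norm_nonneg) auto
   finally show "?n (J j x *\<^sub>R d j) \<le> C j * ?n (d j) * ?n x" by (simp add: mult_ac)
  qed
  finally show ?thesis by (simp add: distrib_right sum_distrib_right)
 qed
 have l: "Pd (a *\<^sub>R x + b *\<^sub>R y) = a *\<^sub>R Pd x + b *\<^sub>R Pd y" if "x \<in> sobolev p" "y \<in> sobolev p" for a b x y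
 proof -
  have "dsum (%j. J j (a *\<^sub>R x + b *\<^sub>R y)) = a *\<^sub>R dsum (%j. J j x) + b *\<^sub>R dsum (%j. J j y)"
   unfolding dsum_def using that by (simp add: J_lin scaleR_sum_right scaleR_add_left sum.distrib)
  then show ?thesis by (simp add: Pd_def algebra_simps)
 qed
 show ?thesis unfolding nlinear_def S_simps SC_simps using b l Pd_circle by blast
qed

text \<open>A fixed number of smooth iterations, so the fixed point depends smoothly on y without
  any contraction argument.\<close>

lemma smooth_X0: "smooth (SC p) (S p) (sobolev_circle p) X0"
proof -
 have id: "smooth (SC p) (S p) (sobolev_circle p) (%y. y)"
  by (rule smooth_linear) (auto simp: nlinear_def circle_iff intro!: exI[of _ 1])
 have "smooth (SC p) (S p) (sobolev_circle p) (it k)" for k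
 proof (induction k)
  case 0
  show ?case using id by (simp add: it_Suc[abs_def])
 next
  case (Suc k)
  have KX: "smooth (SC p) (S p) (sobolev_circle p) (%y. Kx (it k y))"
   using smooth_compose[OF _ _ _ smooth_incl[OF smooth_Kx] Suc.IH] smooth_mem[OF Suc.IH] by (auto simp: o_def)
  have dl: "nlinear tsp (S p) (%a. a *\<^sub>R d j)" if j: "j < p" for j
   using d[OF j] nspace_S[of p] subspace_scale[OF subspace_sobolev] subspace_add[OF subspace_sobolev]
   by (auto simp: nlinear_def scaleR_add_left nspace_def intro!: exI[of _ "sobolev_norm p (d j)"])
  have J: "smooth (SC p) (S p) (sobolev_circle p) (%y. J j (Kx (it k y)) *\<^sub>R d j)" if j: "j < p" for j
   by (rule smooth_lin[OF _ _ _ dl[OF j] smooth_lin[OF _ _ _ nlinear_J[OF j] KX]]) simp_all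
  have "smooth (SC p) (S p) (sobolev_circle p) (%y. \<Sum>j<m. J j (Kx (it k y)) *\<^sub>R d j)" if "m \<le> p" for m
   using that
  proof (induction m)
   case 0
   show ?case using smooth_const[of "SC p" "S p" 0] subspace_0[OF subspace_sobolev] by simp
  next
   case (Suc m)
   then show ?case using J[of m] by (auto intro!: smooth_add)
  qed
  from this[of p] have "smooth (SC p) (S p) (sobolev_circle p) (%y. y + 2 *\<^sub>R dsum (%j. J j (Kx (it k y))))"
   unfolding dsum_def by (intro smooth_add smooth_scale id) simp_all
  then show ?case by (simp add: it_Suc(2)[abs_def] B_def)
 qed
 then show ?thesis unfolding X0_def[abs_def] .
qed

end

section \<open>Hilbert space structure\<close>

definition ipS :: "nat => ltwo => ltwo => real" where
 "ipS p u v = (\<Sum>j\<le>p. (weak_deriv ^^ j) u \<bullet> (weak_deriv ^^ j) v)"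

lemma sqrt_ipS: "sqrt (ipS p u u) = sobolev_norm p u"
 by (simp add: ipS_def sobolev_norm_def power2_norm_eq_inner)

lemma ipS_self: "ipS p u u = (sobolev_norm p u)\<^sup>2"
 unfolding ipS_def sobolev_norm_def by (simp add: sum_nonneg power2_norm_eq_inner)

lemma ipS_comm: "ipS p u v = ipS p v u"
 by (simp add: ipS_def inner_commute)

lemma funpow_lin: "j \<le> p ==> x \<in> sobolev p ==> y \<in> sobolev p ==>
  (weak_deriv ^^ j) (a *\<^sub>R x + b *\<^sub>R y) = a *\<^sub>R (weak_deriv ^^ j) x + b *\<^sub>R (weak_deriv ^^ j) y"
 using nlinear_funpow[of j "p - j"] unfolding nlinear_def by simp

lemma ipS_lin: "x \<in> sobolev p ==> y \<in> sobolev p ==> ipS p (a *\<^sub>R x + b *\<^sub>R y) z = a * ipS p x z + b * ipS p y z"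
 unfolding ipS_def by (simp add: funpow_lin inner_add_left sum.distrib sum_distrib_left)

lemma norm_funpow_le: "j \<le> p ==> norm ((weak_deriv ^^ j) u) \<le> sobolev_norm p u"
 unfolding sobolev_norm_def
 by (intro real_le_rsqrt member_le_sum[where f = "%j. (norm ((weak_deriv ^^ j) u))\<^sup>2"]) auto

lemma nlinear_ipS: "nlinear (S p) tsp (%x. ipS p x z)"
proof -
 have "\<bar>ipS p x z\<bar> \<le> (\<Sum>j\<le>p. norm ((weak_deriv ^^ j) z)) * sobolev_norm p x" for x
 proof -
  have "\<bar>ipS p x z\<bar> \<le> (\<Sum>j\<le>p. \<bar>(weak_deriv ^^ j) x \<bullet> (weak_deriv ^^ j) z\<bar>)" unfolding ipS_def by (rule sum_abs)
  also have "\<dots> \<le> (\<Sum>j\<le>p. norm ((weak_deriv ^^ j) z) * sobolev_norm p x)"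
  proof (rule sum_mono)
   fix j assume j: "j \<in> {..p}"
   have "\<bar>(weak_deriv ^^ j) x \<bullet> (weak_deriv ^^ j) z\<bar> \<le> norm ((weak_deriv ^^ j) x) * norm ((weak_deriv ^^ j) z)"
    by (rule Cauchy_Schwarz_ineq2)
   also have "\<dots> \<le> sobolev_norm p x * norm ((weak_deriv ^^ j) z)" using j by (intro mult_right_mono norm_funpow_le) auto
   finally show "\<bar>(weak_deriv ^^ j) x \<bullet> (weak_deriv ^^ j) z\<bar> \<le> norm ((weak_deriv ^^ j) z) * sobolev_norm p x" by (simp add: mult.commute)
  qed
  finally show ?thesis by (simp add: sum_distrib_right)
 qed
 then show ?thesis unfolding nlinear_def using ipS_lin by auto
qed

lemma nlinear_I_end: "nlinear (S p) tsp (%x. I x TT)" and nlinear_W_end: "nlinear (S p) tsp (%x. W x TT)"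
proof -
 have "nlinear tsp tsp (%x. ev (I x))" "nlinear tsp tsp (%x. ev (W x))"
  by (intro nlinear_bl bounded_linear_compose[OF bounded_linear_ev] bounded_linear_I bounded_linear_W)+
 from this[THEN nlinear_compose[OF nspace_S nspace_tsp nspace_tsp nlinear_L2]]
 show "nlinear (S p) tsp (%x. I x TT)" "nlinear (S p) tsp (%x. W x TT)" unfolding ev_def .
qed

text \<open>The derivatives converge by induction, and the constants converge because evaluation at
  0 is bounded by the Sobolev embedding \<open>nlinear_cr\<close>.\<close>

lemma sobolev_complete:
 "(\<forall>n. u n \<in> sobolev p) ==> (\<forall>e>0. \<exists>N. \<forall>m\<ge>N. \<forall>n\<ge>N. sobolev_norm p (u m - u n) < e) ==>
  \<exists>l\<in>sobolev p. (%n. sobolev_norm p (u n - l)) \<longlonglongrightarrow> 0"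
proof (induction p arbitrary: u)
 case 0
 have "Cauchy u" using 0(2) unfolding Cauchy_def dist_norm by simp
 then obtain l where "u \<longlonglongrightarrow> l" using ltwo_complete convergent_def by blast
 then have "(%n. norm (u n - l)) \<longlonglongrightarrow> 0" using LIM_zero tendsto_norm_zero by blast
 then show ?case by (intro bexI[of _ l]) simp_all
next
 case (Suc p)
 have u: "u n \<in> sobolev (Suc p)" for n using Suc.prems(1) by blast
 then have "\<forall>n. \<exists>c v. v \<in> sobolev p \<and> u n = ac c v" unfolding sobolev_Suc_iff by blast
 then obtain c v where cv: "!!n. v n \<in> sobolev p" "!!n. u n = ac (c n) (v n)" by metis
 have d: "u m - u n = ac (c m - c n) (v m - v n)" for m n
  unfolding cv(2) by (simp add: linear_simps[OF bounded_linear_emb] linear_simps[OF bounded_linear_I] K_add[of "c m" "- c n", simplified] K_scale[of "-1" "c n", simplified] algebra_simps)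
 have wd: "weak_deriv (u m - u n) = v m - v n" for m n unfolding d by simp
 have "\<exists>l\<in>sobolev p. (%n. sobolev_norm p (v n - l)) \<longlonglongrightarrow> 0"
 proof (rule Suc.IH)
  show "\<forall>e>0. \<exists>N. \<forall>m\<ge>N. \<forall>n\<ge>N. sobolev_norm p (v m - v n) < e"
   using Suc.prems(2) weak_deriv_norm[of p "u _ - u _"] unfolding wd by (meson le_less_trans)
 qed (use cv in blast)
 then obtain w where w: "w \<in> sobolev p" "(%n. sobolev_norm p (v n - w)) \<longlonglongrightarrow> 0" by blast
 obtain C where C: "!!x. x \<in> sobolev (Suc p) ==> norm (cr x) \<le> C * sobolev_norm (Suc p) x"
  using nlinear_cr[of p] unfolding nlinear_def S_simps tsp_simps by blast
 have c: "\<bar>c m - c n\<bar> \<le> \<bar>C\<bar> * sobolev_norm (Suc p) (u m - u n)" for m n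
 proof -
  have "cr (u m - u n) 0 = c m - c n" unfolding d by (simp add: I_zero)
  then have "\<bar>c m - c n\<bar> \<le> norm (cr (u m - u n))" using abs_apply_le[of "cr (u m - u n)" 0] by simp
  also have "\<dots> \<le> C * sobolev_norm (Suc p) (u m - u n)" by (rule C[OF subspace_diff[OF subspace_sobolev u u]])
  also have "\<dots> \<le> \<bar>C\<bar> * sobolev_norm (Suc p) (u m - u n)" by (intro mult_right_mono sobolev_norm_nonneg) simp
  finally show ?thesis .
 qed
 have "Cauchy c" unfolding Cauchy_def dist_real_def
 proof (intro allI impI)
  fix e :: real assume e: "e > 0"
  have "e / (\<bar>C\<bar> + 1) > 0" using e by simp
  then obtain N where N: "!!m n. m \<ge> N ==> n \<ge> N ==> sobolev_norm (Suc p) (u m - u n) < e / (\<bar>C\<bar> + 1)" using Suc.prems(2) by blast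
  have "\<bar>c m - c n\<bar> < e" if "m \<ge> N" "n \<ge> N" for m n
  proof -
   have "\<bar>c m - c n\<bar> \<le> (\<bar>C\<bar> + 1) * sobolev_norm (Suc p) (u m - u n)"
    using c[of m n] sobolev_norm_nonneg[of "Suc p" "u m - u n"] by (simp add: distrib_right)
   also have "\<dots> < (\<bar>C\<bar> + 1) * (e / (\<bar>C\<bar> + 1))" using N[OF that] by (intro mult_strict_left_mono) auto
   finally show ?thesis by simp
  qed
  then show "\<exists>M. \<forall>m\<ge>M. \<forall>n\<ge>M. \<bar>c m - c n\<bar> < e" by blast
 qed
 then obtain c0 where c0: "c \<longlonglongrightarrow> c0" using Cauchy_convergent convergent_def by blast
 obtain D where D: "!!a. sobolev_norm (Suc p) (emb (K a)) \<le> D * \<bar>a\<bar>" using nlinear_K[of "Suc p"] unfolding nlinear_def by auto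
 obtain D' where D': "!!x. x \<in> sobolev p ==> sobolev_norm (Suc p) (Il x) \<le> D' * sobolev_norm p x"
  using nlinear_Il[of p] unfolding nlinear_def S_simps by blast
 have KS: "emb (K a) \<in> sobolev (Suc p)" for a using nlinear_K[of "Suc p"] unfolding nlinear_def S_simps by auto
 let ?l = "ac c0 w"
 have b: "sobolev_norm (Suc p) (u n - ?l) \<le> D * \<bar>c n - c0\<bar> + D' * sobolev_norm p (v n - w)" for n
 proof -
  have vw: "v n - w \<in> sobolev p" using cv w by (intro subspace_diff[OF subspace_sobolev])
  have "u n - ?l = emb (K (c n - c0)) + Il (v n - w)"
   unfolding cv(2) Il_def by (simp add: linear_simps[OF bounded_linear_emb] linear_simps[OF bounded_linear_I] K_add[of "c n" "- c0", simplified] K_scale[of "-1" c0, simplified] algebra_simps)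
  then have "sobolev_norm (Suc p) (u n - ?l) \<le> sobolev_norm (Suc p) (emb (K (c n - c0))) + sobolev_norm (Suc p) (Il (v n - w))"
   using nspaceD(2)[OF nspace_S[of "Suc p"]] nspace_S[of "Suc p"] KS Il_sobolev[OF vw] unfolding nspace_def S_simps by metis
  then show ?thesis using D[of "c n - c0"] D'[OF vw] by linarith
 qed
 have t: "(%n. D * \<bar>c n - c0\<bar> + D' * sobolev_norm p (v n - w)) \<longlonglongrightarrow> D * 0 + D' * 0"
  using c0 w(2) by (intro tendsto_intros) (auto intro: tendsto_rabs_zero LIM_zero)
 have "(%n. sobolev_norm (Suc p) (u n - ?l)) \<longlonglongrightarrow> 0"
  by (rule tendsto_sandwich[OF _ _ tendsto_const]) (use b t sobolev_norm_nonneg in auto)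
 moreover have "?l \<in> sobolev (Suc p)" using w(1) sobolev_Suc_iff by blast
 ultimately show ?case by blast
qed

text \<open>Outside the Sobolev space \<open>weak_deriv\<close> takes arbitrary values, so symmetry of the distance needs the junk values to be handled as well.\<close>

lemma ac_minus: "- ac c v = ac (- c) (- v)"
 using ac_lin[of "-1" c v 0 0 0] by simp

lemma sobolev_norm_minus: "sobolev_norm p (- u) = sobolev_norm p u"
proof (induction p arbitrary: u)
 case (Suc p)
 show ?case
 proof (cases "\<exists>v. has_weak_deriv u v")
  case True
  then obtain c v where "u = ac c v" unfolding has_weak_deriv_iff by blast
  then have "weak_deriv (- u) = - weak_deriv u" by (simp only: ac_minus weak_deriv_ac)
  then show ?thesis by (simp add: sobolev_norm_Suc Suc.IH)
 next
  case False
  have "\<not> has_weak_deriv (- u) v" for v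
  proof
   assume "has_weak_deriv (- u) v"
   then obtain c where "- u = ac c v" unfolding has_weak_deriv_iff by blast
   then have "u = ac (- c) (- v)" by (metis ac_minus minus_minus)
   then show False using False has_weak_deriv_iff by blast
  qed
  then have "weak_deriv (- u) = weak_deriv u" using False by (simp add: weak_deriv_def)
  then show ?thesis by (simp add: sobolev_norm_Suc)
 qed
qed simp

lemma sobolev_norm_commute: "sobolev_norm p (x - y) = sobolev_norm p (y - x)"
 using sobolev_norm_minus[of p "y - x"] by simp

text \<open>Kernels of bounded functionals are closed, hence complete. The finite set
  \<open>C\<close> supplies the rest of the space, so that the kernel is as infinite-dimensional as
  \<open>sobolev p\<close> is.\<close>

lemma hilbert_kernel:
 assumes Phi: "!!f. f \<in> \<Phi> ==> nlinear (S p) tsp (f :: ltwo => real)"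
  and C: "finite C" "sobolev p \<subseteq> span ({x \<in> sobolev p. \<forall>f\<in>\<Phi>. f x = 0} \<union> C)"
 shows "hilbert_sub {x \<in> sobolev p. \<forall>f\<in>\<Phi>. f x = 0} (ipS p)" (is "hilbert_sub ?V _")
proof
 have lin: "f (a *\<^sub>R x + b *\<^sub>R y) = a * f x + b * f y" if "f \<in> \<Phi>" "x \<in> sobolev p" "y \<in> sobolev p" for f x y a b
  using Phi[OF that(1)] that unfolding nlinear_def by simp
 have f0: "f 0 = 0" if "f \<in> \<Phi>" for f using lin[OF that, of 0 0 0 0] subspace_0[OF subspace_sobolev] by simp
 show "subspace ?V"
 proof (rule subspaceI)
  show "0 \<in> ?V" using f0 subspace_0[OF subspace_sobolev] by simp
  fix x assume x: "x \<in> ?V"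
  have "f (c *\<^sub>R x) = 0" if "f \<in> \<Phi>" for f c using lin[OF that, of x x c 0] x that by simp
  then show "c *\<^sub>R x \<in> ?V" for c using x subspace_scale[OF subspace_sobolev] by simp
  fix y assume y: "y \<in> ?V"
  have "f (x + y) = 0" if "f \<in> \<Phi>" for f
  proof -
   have "f x = 0" "f y = 0" using x y that by blast+
   then show ?thesis using lin[OF that, of x y 1 1] x y by simp
  qed
  then show "x + y \<in> ?V" using x y subspace_add[OF subspace_sobolev] by simp
 qed
 show "ipS p x y = ipS p y x" for x y by (rule ipS_comm)
 show "ipS p (x + y) z = ipS p x z + ipS p y z" if "x \<in> ?V" "y \<in> ?V" for x y z using ipS_lin[of x p y 1 1 z] that by simp
 show "ipS p (c *\<^sub>R x) z = c * ipS p x z" if "x \<in> ?V" for x z c using ipS_lin[of x p x c 0 z] that by simp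
 show "0 \<le> ipS p x x" for x unfolding ipS_self by simp
 show "x = 0" if "x \<in> ?V" "ipS p x x = 0" for x using that nspace_S[of p] unfolding ipS_self nspace_def by auto
 show "\<exists>l\<in>?V. (%n. sqrt (ipS p (u n - l) (u n - l))) \<longlonglongrightarrow> 0"
  if u: "\<forall>n. u n \<in> ?V" and c: "\<forall>e>0. \<exists>N. \<forall>m\<ge>N. \<forall>n\<ge>N. sqrt (ipS p (u m - u n) (u m - u n)) < e" for u
 proof -
  have us: "\<forall>n. u n \<in> sobolev p" using u by blast
  obtain l where l: "l \<in> sobolev p" "(%n. sobolev_norm p (u n - l)) \<longlonglongrightarrow> 0"
   using sobolev_complete[OF us c[unfolded sqrt_ipS]] by blast
  have "f l = 0" if f: "f \<in> \<Phi>" for f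
  proof -
   obtain B where "\<forall>x\<in>sobolev p. \<bar>f x\<bar> \<le> B * sobolev_norm p x" using Phi[OF f] unfolding nlinear_def by auto
   note B = bspec[OF this]
   have "\<bar>f l\<bar> \<le> B * sobolev_norm p (u n - l)" for n
   proof -
    have "f (u n - l) = f (u n) - f l" using lin[OF f, of "u n" l 1 "-1"] us l(1) by simp
    moreover have "f (u n) = 0" using u f by blast
    moreover have "u n - l \<in> sobolev p" using us l(1) by (intro subspace_diff[OF subspace_sobolev]) auto
    ultimately show ?thesis using B[of "u n - l"] by simp
   qed
   moreover have "(%n. B * sobolev_norm p (u n - l)) \<longlonglongrightarrow> B * 0" by (intro tendsto_intros l(2))
   ultimately have "\<bar>f l\<bar> \<le> B * 0" by (intro LIMSEQ_le_const) auto
   then show ?thesis by simp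
  qed
  then show ?thesis using l unfolding sqrt_ipS by blast
 qed
 show "\<exists>\<phi> :: nat => ltwo => real. (\<forall>n. (\<forall>x\<in>?V. \<forall>y\<in>?V. \<phi> n (x + y) = \<phi> n x + \<phi> n y) \<and>
    (\<forall>c. \<forall>x\<in>?V. \<phi> n (c *\<^sub>R x) = c * \<phi> n x) \<and> (\<exists>C. \<forall>x\<in>?V. \<bar>\<phi> n x\<bar> \<le> C * sqrt (ipS p x x))) \<and>
    (\<forall>x\<in>?V. (\<forall>n. \<phi> n x = 0) --> x = 0)"
 proof (intro exI[of _ "%n x. I x (from_nat_into \<rat> n)"] conjI allI ballI impI)
  fix n x
  show "\<exists>C. \<forall>x\<in>?V. \<bar>I x (from_nat_into \<rat> n)\<bar> \<le> C * sqrt (ipS p x x)"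
  proof (intro exI[of _ "sqrt TT"] ballI)
   fix x
   have "\<bar>I x (from_nat_into \<rat> n)\<bar> \<le> sqrt TT * norm x" by (rule I_bound)
   also have "\<dots> \<le> sqrt TT * sobolev_norm p x" by (intro mult_left_mono norm_le_sobolev_norm) simp
   finally show "\<bar>I x (from_nat_into \<rat> n)\<bar> \<le> sqrt TT * sqrt (ipS p x x)" unfolding sqrt_ipS .
  qed
  \<comment> \<open>The separating functionals are the values of the primitive at the rationals;
    \<open>I x\<close> is continuous and \<open>I\<close> is injective.\<close>
  show "x = 0" if z: "\<forall>n. I x (from_nat_into \<rat> n) = 0"
  proof -
   have "I x r = 0" if r: "r \<in> \<rat>" for r using z from_nat_into_surj[OF countable_rat r] by metis
   then have "I x t = 0" for t
    using continuous_constant_on_closure[of "\<rat>" "I x" 0 t] Rats_closure_real continuous_on_apply_bcontfun by auto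
   then have "I x = 0" by (intro bcontfun_eqI) simp
   then show ?thesis by (rule I_inj)
  qed
 qed (simp_all add: I_lin)
 show "span B \<noteq> ?V" if B: "finite B" "B \<subseteq> ?V" for B
 proof
  assume s: "span B = ?V"
  define n where "n = Suc (card (B \<union> C))"
  have "?V \<union> C \<subseteq> span (B \<union> C)" unfolding s[symmetric] by (auto intro: span_base span_mono[THEN subsetD])
  then have sp: "sobolev p \<subseteq> span (B \<union> C)" using C(2) span_minimal[OF _ subspace_span] by blast
  \<comment> \<open>More elements than the span of \<open>B\<close> and \<open>C\<close> has
    dimensions, independent because their jumps form an identity matrix. The order
    \<open>max n p\<close> puts them in \<open>sobolev p\<close> and makes n jumps
    available.\<close>
  obtain d where d: "!!j. j < max n p ==> dual_at (max n p) d j" using ex_dual by blast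
  have Jd: "i < n ==> j < n ==> J i (d j) = (if i = j then 1 else 0)" for i j using d[of j] by simp
  have inj: "inj_on d {..<n}" using Jd by (intro inj_onI) (metis lessThan_iff zero_neq_one)
  have ds: "d j \<in> sobolev n" "d j \<in> sobolev p" if "j < n" for j
   using d[of j] that sobolev_antimono[of n "max n p"] sobolev_antimono[of p "max n p"] by auto
  have "independent (d ` {..<n})"
  proof (rule independent_if_scalars_zero)
   fix f x assume f: "(\<Sum>x\<in>d ` {..<n}. f x *\<^sub>R x) = 0" and x: "x \<in> d ` {..<n}"
   obtain i where i: "x = d i" "i < n" using x by auto
   have "(\<Sum>j<n. f (d j) *\<^sub>R d j) = 0" using f sum.reindex[OF inj, of "%x. f x *\<^sub>R x"] by (simp add: o_def)
   moreover have "J i (\<Sum>j<n. f (d j) *\<^sub>R d j) = (\<Sum>j<n. f (d j) * J i (d j))" using ds(1) by (intro J_sum[OF i(2)]) auto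
   moreover have "(\<Sum>j<n. f (d j) * J i (d j)) = (\<Sum>j<n. if j = i then f (d i) else 0)" using Jd i(2) by (intro sum.cong) auto
   moreover have "J i 0 = 0" using J_scale[OF i(2), of 0 0] subspace_0[OF subspace_sobolev] by simp
   ultimately show "f x = 0" using i by simp
  qed simp
  moreover have "d ` {..<n} \<subseteq> span (B \<union> C)" using ds(2) sp by auto
  ultimately have "card (d ` {..<n}) \<le> card (B \<union> C)" using independent_span_bound[of "B \<union> C"] B C by blast
  then show False using card_image[OF inj] by (simp add: n_def)
 qed
qed

text \<open>Inner products with a countable dense set separate the points.\<close>

lemma hilbert_UNIV:
 assumes sep: "separable_space (euclidean :: 'h::{real_inner, complete_space} topology)"
  and inf: "\<not> (\<exists>B :: 'h set. finite B \<and> span B = UNIV)"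
 shows "hilbert_sub (UNIV :: 'h set) (\<bullet>)"
proof
 show "\<exists>l\<in>UNIV. (%n. sqrt ((u n - l) \<bullet> (u n - l))) \<longlonglongrightarrow> 0"
  if c: "\<forall>e>0. \<exists>N. \<forall>m\<ge>N. \<forall>n\<ge>N. sqrt ((u m - u n) \<bullet> (u m - u n)) < e" for u :: "nat => 'h"
 proof -
  have "Cauchy u" using c unfolding Cauchy_def dist_norm norm_eq_sqrt_inner .
  then obtain l where "u \<longlonglongrightarrow> l" using Cauchy_convergent convergent_def by blast
  then have "(%n. norm (u n - l)) \<longlonglongrightarrow> 0" using LIM_zero tendsto_norm_zero by blast
  then show ?thesis unfolding norm_eq_sqrt_inner by blast
 qed
 obtain D :: "'h set" where D: "countable D" "closure D = UNIV"
  using sep unfolding separable_space_def euclidean_closure_of by auto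
 have Dn: "D \<noteq> {}" using D(2) by auto
 show "\<exists>\<phi> :: nat => 'h => real. (\<forall>n. (\<forall>x\<in>UNIV. \<forall>y\<in>UNIV. \<phi> n (x + y) = \<phi> n x + \<phi> n y) \<and>
    (\<forall>c. \<forall>x\<in>UNIV. \<phi> n (c *\<^sub>R x) = c * \<phi> n x) \<and> (\<exists>C. \<forall>x\<in>UNIV. \<bar>\<phi> n x\<bar> \<le> C * sqrt (x \<bullet> x))) \<and>
    (\<forall>x\<in>UNIV. (\<forall>n. \<phi> n x = 0) --> x = 0)"
 proof (intro exI[of _ "%n x. x \<bullet> from_nat_into D n"] conjI allI ballI impI)
  fix n and x :: 'h
  show "\<exists>C. \<forall>x\<in>UNIV. \<bar>x \<bullet> from_nat_into D n\<bar> \<le> C * sqrt (x \<bullet> x)"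
   using Cauchy_Schwarz_ineq2 by (intro exI[of _ "norm (from_nat_into D n)"]) (auto simp: norm_eq_sqrt_inner[symmetric] mult.commute)
  show "x = 0" if z: "\<forall>n. x \<bullet> from_nat_into D n = 0"
  proof -
   have "x \<bullet> r = 0" if r: "r \<in> D" for r using z from_nat_into_surj[OF D(1) r] by metis
   moreover have "continuous_on (closure D) (%y. x \<bullet> y)" by (intro continuous_intros)
   ultimately have "x \<bullet> x = 0" using continuous_constant_on_closure[of D "%y. x \<bullet> y" 0 x] D(2) by simp
   then show ?thesis by simp
  qed
 qed (simp_all add: inner_add_left)
 show "x \<bullet> y = y \<bullet> x" for x y :: 'h by (rule inner_commute)
qed (use inf in \<open>auto simp: inner_add_left\<close>)

section \<open>Assembly\<close>

text \<open>All jets of order less than p vanish, so the same three elements serve the interval and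
  the circle. They come from the polynomial t (2 pi - t): \<open>c1\<close> from its power p,
  \<open>c2\<close> from the first derivative of its power p + 1, \<open>c3\<close> from the second
  derivative of its power p + 2, which is therefore the positive second primitive of
  \<open>c3\<close>. \<open>c1\<close> is finally corrected by \<open>c2\<close>.\<close>

lemma ex_directions:
 "\<exists>c1 c2 c3. (c1 \<in> Zs p \<and> c1 \<in> sobolev p \<and> I c1 TT = 1 \<and> W c1 TT = 0) \<and> (c2 \<in> Zs p \<and> c2 \<in> sobolev p \<and> I c2 TT = 0 \<and> W c2 TT = 1) \<and>
  (c3 \<in> Zs p \<and> c3 \<in> sobolev p \<and> I c3 TT = 0 \<and> W c3 TT = 0) \<and> (\<forall>t. 0 < t --> t < TT --> 0 < W c3 t)"
proof -
 have pos: "I (pe (bq ^ m)) TT > 0" for m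
 proof -
  have "I (pe (bq ^ m)) TT = lint (mk (poly (bq ^ m)))" by (simp add: lint_def ev_def pe_def)
  also have "\<dots> > 0" by (rule lint_pos) (simp add: mk_poly cl_def poly_power bq(1))
  finally show ?thesis .
 qed
 let ?b = "bq ^ Suc (Suc p)" let ?b1 = "bq ^ Suc p"
 obtain r where r: "pderiv (?b * 1) = bq ^ Suc p * r" using pderiv_power by blast
 obtain r' where r': "pderiv (bq ^ Suc p * r) = bq ^ p * r'" using pderiv_power by blast
 obtain r1 where r1: "pderiv (?b1 * 1) = bq ^ p * r1" using pderiv_power by blast
 have z: "poly (bq ^ Suc k * s) 0 = 0" "poly (bq ^ Suc k * s) TT = 0" for k s by (simp_all add: bq(1))
 define c3 where "c3 = pe (pderiv (pderiv ?b))"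
 have dz: "poly (pderiv ?b) 0 = 0" "poly (pderiv ?b) TT = 0" using r z by simp_all
 have bz: "poly (bq ^ Suc k) 0 = 0" "poly (bq ^ Suc k) TT = 0" for k using z[of k 1] by simp_all
 have c3: "c3 \<in> Zs p" "c3 \<in> sobolev p" unfolding c3_def using r r' Zs_pe pe_sobolev by simp_all
 have W3: "W c3 t = poly ?b (cl t)" for t unfolding c3_def W_pe[OF dz(1)] bz by simp
 have c3': "I c3 TT = 0" "W c3 TT = 0" unfolding W3 by (simp_all only: c3_def I_pe cl_TT dz bz diff_self)
 have c3p: "0 < W c3 t" if "0 < t" "t < TT" for t unfolding W3 using that by (simp add: cl_def poly_power bq(1))
 define u2 where "u2 = pe (pderiv ?b1)"
 have u2: "u2 \<in> Zs p" "u2 \<in> sobolev p" unfolding u2_def using r1 Zs_pe pe_sobolev by simp_all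
 have i2: "I u2 TT = 0" unfolding u2_def I_pe cl_TT bz by simp
 have "I u2 = mk (poly ?b1)" unfolding u2_def by (rule bcontfun_eqI) (simp only: I_pe bz mk_poly diff_zero)
 then have "W u2 TT = I (pe ?b1) TT" by (simp add: W_def pe_def)
 then have w2: "W u2 TT > 0" using pos by metis
 define c2 where "c2 = (1 / W u2 TT) *\<^sub>R u2"
 have c2: "c2 \<in> Zs p" "c2 \<in> sobolev p" "I c2 TT = 0" "W c2 TT = 1"
  unfolding c2_def using u2 i2 w2 by (auto simp: I_lin W_lin intro: subspace_scale[OF subspace_Zs] subspace_scale[OF subspace_sobolev])
 define u1 where "u1 = pe (bq ^ p)"
 have u1: "u1 \<in> Zs p" "u1 \<in> sobolev p" unfolding u1_def using Zs_pe[of p 1] pe_sobolev by simp_all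
 define v1 where "v1 = (1 / I u1 TT) *\<^sub>R u1"
 have i1: "I v1 TT = 1" using pos[of p] by (simp add: v1_def u1_def I_lin)
 have v1: "v1 \<in> Zs p" "v1 \<in> sobolev p" unfolding v1_def using u1 by (auto intro: subspace_scale[OF subspace_Zs] subspace_scale[OF subspace_sobolev])
 define c1 where "c1 = v1 - (W v1 TT) *\<^sub>R c2"
 have "c1 \<in> Zs p" "c1 \<in> sobolev p" "I c1 TT = 1" "W c1 TT = 0"
  unfolding c1_def using v1 c2 i1
  by (auto simp: I_lin W_lin intro!: subspace_diff[OF subspace_Zs] subspace_diff[OF subspace_sobolev] subspace_scale[OF subspace_Zs] subspace_scale[OF subspace_sobolev])
 then show ?thesis using c2 c3 c3' c3p by blast
qed

lemma nlinear_minus_proj: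
 assumes X: "nspace M" "nspace N" and f: "nlinear M N f" and g: "nlinear M tsp g" and c: "c \<in> fst N"
 shows "nlinear M N (%x. f x - g x *\<^sub>R c)"
proof -
 obtain A where A: "\<forall>x\<in>fst M. snd N (f x) \<le> A * snd M x" using f unfolding nlinear_def by auto
 obtain B where B: "\<forall>x\<in>fst M. \<bar>g x :: real\<bar> \<le> B * snd M x" using g unfolding nlinear_def by auto
 have fN: "f x \<in> fst N" if "x \<in> fst M" for x using f that unfolding nlinear_def by blast
 have "snd N (f x - g x *\<^sub>R c) \<le> (A + B * snd N c) * snd M x" if x: "x \<in> fst M" for x
 proof -
  have gc: "g x *\<^sub>R c \<in> fst N" using c X(2) unfolding nspace_def by (auto intro: subspace_scale)
  have "snd N (f x - g x *\<^sub>R c) \<le> snd N (f x) + snd N (g x *\<^sub>R c)" by (rule nspace_diff[OF X(2) fN[OF x] gc])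
  also have "snd N (g x *\<^sub>R c) = \<bar>g x\<bar> * snd N c" using X(2) c unfolding nspace_def by blast
  also have "\<bar>g x\<bar> * snd N c \<le> (B * snd M x) * snd N c" using B x X(2) c by (intro mult_right_mono) (auto simp: nspace_def)
  finally show ?thesis using bspec[OF A x] by (simp add: algebra_simps)
 qed
 moreover have "f x - g x *\<^sub>R c \<in> fst N" if "x \<in> fst M" for x
  using fN[OF that] c X(2) unfolding nspace_def by (auto intro: subspace_diff subspace_scale)
 moreover have "f (a *\<^sub>R x + b *\<^sub>R y) - g (a *\<^sub>R x + b *\<^sub>R y) *\<^sub>R c = a *\<^sub>R (f x - g x *\<^sub>R c) + b *\<^sub>R (f y - g y *\<^sub>R c)"
  if "x \<in> fst M" "y \<in> fst M" for a b x y using f g that unfolding nlinear_def by (simp add: algebra_simps)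
 ultimately show ?thesis unfolding nlinear_def by blast
qed

text \<open>One construction for both spaces. \<open>X0\<close> sends the linear parameter to the
  argument of the transform, so that the potential lands in \<open>Es\<close>, and \<open>Qp\<close>
  projects back onto \<open>Es\<close>; on the interval both are the identity.\<close>

locale target = cover_SL2 G pr for G :: "('g::topological_space, 'm) monoid_scheme" and pr +
 fixes p :: nat and Es :: "ltwo set" and X0 Qp :: "ltwo => ltwo" and c1 c2 c3 :: ltwo and kap :: "'h::real_inner => ltwo"
 assumes subE: "subspace Es" "Es \<subseteq> sobolev p"
  and X0s: "smooth (Es, sobolev_norm p) (S p) Es X0"
  and Qn: "nlinear (S p) (Es, sobolev_norm p) Qp"
  and Qid: "!!q. q \<in> Es ==> Qp q = q"
  and QX0: "!!y. y \<in> Es ==> Qp (X0 y) = y"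
  and X0Q: "!!q. q \<in> Es ==> X0 (Qp (X q)) = X q"
  and FX0: "!!y. y \<in> Es ==> F (X0 y) \<in> Es"
  and X0_shift: "!!y s. y \<in> Es ==> X0 (y + s *\<^sub>R c3) = X0 y + s *\<^sub>R c3"
  and X0_ends: "!!y. y \<in> Es ==> I (X0 y) TT = I y TT" "!!y. y \<in> Es ==> W (X0 y) TT = W y TT"
  and cE: "c1 \<in> Es" "c2 \<in> Es" "c3 \<in> Es"
  and c1: "I c1 TT = 1" "W c1 TT = 0" and c2: "I c2 TT = 0" "W c2 TT = 1" and c3: "I c3 TT = 0" "W c3 TT = 0"
  and bump: "!!t. 0 < t ==> t < TT ==> 0 < W c3 t"
  and kap: "bij_betw kap UNIV {x \<in> Es. I x TT = 0 \<and> W x TT = 0 \<and> ipS p x c3 = 0}"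
   "!!x y. kap (x + y) = kap x + kap y" "!!c x. kap (c *\<^sub>R x) = c *\<^sub>R kap x" "!!x. ipS p (kap x) (kap x) = x \<bullet> x"
begin

abbreviation NE :: "ltwo nsp" where "NE \<equiv> (Es, sobolev_norm p)"

lemma nspace_NE: "nspace NE"
 using nspace_sub[OF nspace_S subE(1), of p] subE(2) by simp

sublocale bump: angle_bump "W c3" by unfold_locales (rule bump)

abbreviation "sg \<equiv> bump.sigma"

definition base :: "real => real => 'h => ltwo" where "base \<beta> \<alpha> h = \<alpha> *\<^sub>R c1 + \<beta> *\<^sub>R c2 + kap h"

text \<open>The multiple of \<open>c3\<close> leaves \<open>I\<close> and \<open>W\<close> at the
  end alone and moves the total angle only. The angle is measured after \<open>X0\<close>, which
  commutes with adding \<open>c3\<close>, hence the second argument of \<open>sg\<close>.\<close>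

definition tgt :: "real \<times> real \<times> real => 'h => ltwo" where
 "tgt c h = base (fst (snd c)) (snd (snd c)) h + sg (fst c, X0 (base (fst (snd c)) (snd (snd c)) h)) *\<^sub>R c3"

text \<open>\<open>Qp\<close> does not change the value (\<open>psi_E\<close>). It is inserted
  because \<open>F\<close> is smooth as a map into \<open>sobolev p\<close>; composing with the
  projection makes the derivatives take values in \<open>Es\<close>.\<close>

definition psi :: "real \<times> real \<times> real => 'h => ltwo" where "psi c h = Qp (F (X0 (tgt c h)))"

definition endp :: "ltwo => real \<times> real \<times> real" where "endp x = (Th x TT, W x TT, I x TT)"

definition \<psi>3 :: "ltwo => real" where "\<psi>3 y = ipS p y c3 / ipS p c3 c3"

definition prj2 :: "ltwo => ltwo" where "prj2 y = y - I y TT *\<^sub>R c1 - W y TT *\<^sub>R c2"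

definition prj :: "ltwo => ltwo" where "prj y = prj2 y - \<psi>3 (prj2 y) *\<^sub>R c3"

definition hpt :: "ltwo => 'h" where "hpt y = inv_into UNIV kap (prj y)"

definition lam :: "ltwo => 'g \<times> 'h" where "lam q = (phi (endp (X q)), hpt (Qp (X q)))"

lemma kapE: "kap h \<in> Es" "I (kap h) TT = 0" "W (kap h) TT = 0" "ipS p (kap h) c3 = 0"
 using bij_betwE[OF kap(1)] by auto

lemma kap_norm: "sobolev_norm p (kap h) = norm h"
 using kap(4)[of h] sqrt_ipS[of p "kap h"] by (simp add: norm_eq_sqrt_inner)

lemma c3_pos: "ipS p c3 c3 > 0"
proof -
 have "c3 \<noteq> 0" using bump[of pi] by (auto simp: W_lin)
 then have "sobolev_norm p c3 \<noteq> 0" using nspace_NE cE(3) unfolding nspace_def by auto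
 then show ?thesis unfolding ipS_self by simp
qed

lemma Es_closed: "x \<in> Es ==> y \<in> Es ==> x + y \<in> Es" "x \<in> Es ==> y \<in> Es ==> x - y \<in> Es" "x \<in> Es ==> c *\<^sub>R x \<in> Es"
 using subE(1) by (auto intro: subspace_add subspace_diff subspace_scale)

lemma base_E: "base \<beta> \<alpha> h \<in> Es" "I (base \<beta> \<alpha> h) TT = \<alpha>" "W (base \<beta> \<alpha> h) TT = \<beta>"
 unfolding base_def using cE kapE c1 c2 by (auto simp: I_lin W_lin intro!: Es_closed)

lemma tgt_E: "tgt c h \<in> Es"
 unfolding tgt_def using cE base_E by (auto intro!: Es_closed)

lemma Th_Gs: "Th (x + s *\<^sub>R c3) TT = bump.Gs s x"
 by (simp add: Th_def E_def bump.Gs_def lint_def ev_def linear_simps[OF bounded_linear_W])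

lemma tgt_end: "fst c > 0 ==> endp (X0 (tgt c h)) = c"
proof -
 assume t: "fst c > 0"
 let ?b = "base (fst (snd c)) (snd (snd c)) h"
 have "X0 (tgt c h) = X0 ?b + sg (fst c, X0 ?b) *\<^sub>R c3" unfolding tgt_def by (rule X0_shift[OF base_E(1)])
 then have "Th (X0 (tgt c h)) TT = fst c" using bump.sigma[OF t] by (simp add: Th_Gs)
 moreover have "I (tgt c h) TT = snd (snd c)" "W (tgt c h) TT = fst (snd c)"
  unfolding tgt_def by (simp_all add: I_lin W_lin base_E c3)
 ultimately show ?thesis by (simp add: endp_def X0_ends[OF tgt_E])
qed

lemma psi_E: "psi c h = F (X0 (tgt c h))" "psi c h \<in> Es"
 unfolding psi_def using FX0[OF tgt_E] by (simp_all add: Qid)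

lemma prj_E:
 assumes y: "y \<in> Es"
 shows "prj y \<in> {x \<in> Es. I x TT = 0 \<and> W x TT = 0 \<and> ipS p x c3 = 0}"
proof -
 have 2: "prj2 y \<in> Es" "I (prj2 y) TT = 0" "W (prj2 y) TT = 0"
  unfolding prj2_def using y cE c1 c2 by (auto simp: I_lin W_lin intro!: Es_closed)
 have "ipS p (1 *\<^sub>R prj2 y + (- \<psi>3 (prj2 y)) *\<^sub>R c3) c3 = 1 * ipS p (prj2 y) c3 + (- \<psi>3 (prj2 y)) * ipS p c3 c3"
  using 2 subE(2) cE by (intro ipS_lin) auto
 then have "ipS p (prj y) c3 = 0" using c3_pos by (simp add: prj_def \<psi>3_def)
 then show ?thesis unfolding prj_def using 2 cE c3 by (auto simp: I_lin W_lin intro!: Es_closed)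
qed

lemma kap_hpt: "y \<in> Es ==> kap (hpt y) = prj y"
 unfolding hpt_def using prj_E[of y] kap(1) by (intro f_inv_into_f) (simp add: bij_betw_def)

lemma inj_kap: "kap h = kap h' ==> h = h'"
 using kap(1) by (auto simp: bij_betw_def inj_on_def)

lemma prj_tgt: "prj (tgt c h) = kap h"
proof -
 let ?s = "sg (fst c, X0 (base (fst (snd c)) (snd (snd c)) h))"
 have IW: "I (tgt c h) TT = snd (snd c)" "W (tgt c h) TT = fst (snd c)"
  unfolding tgt_def by (simp_all add: I_lin W_lin base_E c3)
 have 2: "prj2 (tgt c h) = 1 *\<^sub>R kap h + ?s *\<^sub>R c3" unfolding prj2_def IW by (simp add: tgt_def base_def)
 have "ipS p (1 *\<^sub>R kap h + ?s *\<^sub>R c3) c3 = 1 * ipS p (kap h) c3 + ?s * ipS p c3 c3"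
  using kapE subE(2) cE by (intro ipS_lin) auto
 then have "\<psi>3 (prj2 (tgt c h)) = ?s" unfolding 2 \<psi>3_def using c3_pos kapE(4) by simp
 then show ?thesis unfolding prj_def by (simp add: 2)
qed

lemma lam_psi: "fst c > 0 ==> lam (psi c h) = (phi c, h)"
proof -
 assume t: "fst c > 0"
 have "X (psi c h) = X0 (tgt c h)" unfolding psi_E(1) by (rule X_F)
 moreover have "hpt (tgt c h) = h" using inj_kap kap_hpt[OF tgt_E] prj_tgt by metis
 ultimately show ?thesis by (simp add: lam_def tgt_end[OF t] QX0[OF tgt_E])
qed

lemma Qp_E: "x \<in> sobolev p ==> Qp x \<in> Es"
 using Qn unfolding nlinear_def by simp

lemma X_sobolev: "x \<in> sobolev p ==> X x \<in> sobolev p"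
 using smooth_mem[OF smooth_X] by simp

lemma endp_pos: "fst (endp x) > 0"
 using lint_pos[of "E x"] by (simp add: endp_def Th_def lint_def ev_def E_def)

text \<open>The parameter of q splits into its prescribed end values, its Hilbert component and a
  multiple of \<open>c3\<close>. That multiple is the one \<open>sg\<close> finds, since the total
  angle determines it.\<close>

lemma psi_lam: "q \<in> Es ==> psi (endp (X q)) (hpt (Qp (X q))) = q"
proof -
 assume q: "q \<in> Es"
 let ?x = "X q" let ?y = "Qp (X q)"
 have x: "?x \<in> sobolev p" using q subE(2) X_sobolev by blast
 have y: "?y \<in> Es" by (rule Qp_E[OF x])
 have X0y: "X0 ?y = ?x" by (rule X0Q[OF q])
 have IW: "I ?y TT = I ?x TT" "W ?y TT = W ?x TT" using X0_ends[OF y] X0y by simp_all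
 let ?b = "base (W ?x TT) (I ?x TT) (hpt ?y)" let ?s = "\<psi>3 (prj2 ?y)"
 have yb: "?y = ?b + ?s *\<^sub>R c3" unfolding base_def kap_hpt[OF y] prj_def prj2_def IW by simp
 have "?x = X0 ?b + ?s *\<^sub>R c3" using X0_shift[OF base_E(1), of "W ?x TT" "I ?x TT" "hpt ?y" ?s] X0y yb by simp
 then have "Th ?x TT = bump.Gs ?s (X0 ?b)" using Th_Gs by metis
 then have "sg (Th ?x TT, X0 ?b) = ?s" by (simp add: bump.sigma_Gs)
 then have "tgt (endp ?x) (hpt ?y) = ?y" unfolding tgt_def endp_def using yb by simp
 then show ?thesis unfolding psi_E(1) by (simp add: X0y F_X)
qed

definition Psi :: "'g \<times> 'h => ltwo" where "Psi gh = psi (crd (fst gh)) (snd gh)"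

lemma G0_phi: "g \<in> G0 G pr \<longleftrightarrow> (\<exists>c. fst c > 0 \<and> g = phi c)"
 unfolding G0_eq by force

lemma endp_G0: "phi (endp x) \<in> G0 G pr"
 using endp_pos G0_phi by blast

lemma Psi_phi: "Psi (phi c, h) = psi c h" by (simp add: Psi_def)

lemma bij_Psi: "bij_betw Psi (G0 G pr \<times> UNIV) Es"
proof (rule bij_betw_byWitness[where f' = lam])
 show "\<forall>a\<in>G0 G pr \<times> UNIV. lam (Psi a) = a" using lam_psi by (auto simp: G0_phi Psi_phi)
 show "\<forall>q\<in>Es. Psi (lam q) = q" using psi_lam by (simp add: lam_def Psi_phi)
 show "Psi ` (G0 G pr \<times> UNIV) \<subseteq> Es" by (intro image_subsetI) (simp only: Psi_def psi_E(2))
 show "lam ` Es \<subseteq> G0 G pr \<times> UNIV" using endp_G0 by (auto simp: lam_def)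
qed

lemma inv_Psi: "q \<in> Es ==> inv_into (G0 G pr \<times> UNIV) Psi q = lam q"
proof -
 assume q: "q \<in> Es"
 have "lam q \<in> G0 G pr \<times> UNIV" using endp_G0 by (simp add: lam_def)
 moreover have "Psi (lam q) = q" using psi_lam[OF q] by (simp add: lam_def Psi_phi)
 ultimately show ?thesis using inv_into_f_f[OF bij_betw_imp_inj_on[OF bij_Psi]] by metis
qed

lemma monodromy_Psi: "g \<in> G0 G pr ==> monodromy G pr (Psi (g, h)) = g"
proof -
 assume "g \<in> G0 G pr"
 then obtain c where c: "fst c > 0" "g = phi c" unfolding G0_phi by blast
 show ?thesis using tgt_end[OF c(1), of h] unfolding c(2) Psi_phi psi_E(1) monodromy_F by (simp add: endp_def)
qed

lemma smooth_psi: "smooth tsp NE ((Wm \<theta>0 \<inter> {A. fst (om \<theta>0 A) > 0}) \<times> UNIV) (%z. psi (om \<theta>0 (fst z)) (snd z))"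
 (is "smooth tsp NE ?D _")
proof -
 note N = nspace_NE nspace_S nspace_tsp
 have f: "smooth tsp tsp ?D fst" and s: "smooth tsp tsp ?D snd"
  by (rule smooth_linear[OF nspace_tsp nspace_tsp nlinear_bl], simp_all add: bounded_linear_fst bounded_linear_snd)+
 have o: "smooth tsp tsp ?D (%z. fst (om \<theta>0 (fst z)))" "smooth tsp tsp ?D (%z. fst (snd (om \<theta>0 (fst z))))" "smooth tsp tsp ?D (%z. snd (snd (om \<theta>0 (fst z))))"
  by (rule smooth_comp[OF nspace_tsp _ f], rule smooth_om, auto)+
 have cl: "nlinear tsp NE (%a. a *\<^sub>R c)" if "c \<in> Es" for c
  using that nspace_NE Es_closed unfolding nlinear_def nspace_def by (auto simp: scaleR_add_left intro!: exI[of _ "sobolev_norm p c"])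
 have kl: "nlinear tsp NE kap" using kapE(1) kap kap_norm unfolding nlinear_def by (auto intro!: exI[of _ 1])
 let ?b = "%z. base (fst (snd (om \<theta>0 (fst z)))) (snd (snd (om \<theta>0 (fst z)))) (snd z)"
 have b: "smooth tsp NE ?D ?b" unfolding base_def
  by (intro smooth_add smooth_lin[OF _ _ _ cl] smooth_lin[OF _ _ _ kl] o s N cE)
 have X: "smooth tsp (S p) ?D (%z. X0 (g z))" if g: "smooth tsp NE ?D g" for g
  using smooth_compose[OF N(3,1,2) X0s g] smooth_mem[OF g] by (auto simp: o_def)
 have xb: "smooth tsp tsp ?D (%z. X0 (?b z))" by (rule smooth_lin[OF N(3,2,3) nlinear_L2 X[OF b]])
 have "bounded_linear (%a :: real. (a, 0 :: ltwo))" "bounded_linear (%x :: ltwo. (0 :: real, x))"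
  by (intro bounded_linear_Pair bounded_linear_ident bounded_linear_zero)+
 from smooth_add[OF N(3,3) smooth_bl[OF N(3) this(1) o(1)] smooth_bl[OF N(3) this(2) xb]]
 have pr: "smooth tsp tsp ?D (%z. (fst (om \<theta>0 (fst z)), X0 (?b z)))" by simp
 have sg: "smooth tsp tsp ?D (%z. sg (fst (om \<theta>0 (fst z)), X0 (?b z)))"
  by (rule smooth_comp[OF N(3) bump.smooth_sigma pr]) auto
 have t: "smooth tsp NE ?D (%z. tgt (om \<theta>0 (fst z)) (snd z))" unfolding tgt_def
  by (rule smooth_add[OF N(3,1) b smooth_lin[OF N(3,3,1) cl[OF cE(3)] sg]])
 have "smooth tsp (S p) ?D (%z. F (X0 (tgt (om \<theta>0 (fst z)) (snd z))))"
  using smooth_compose[OF N(3,2,2) smooth_F X[OF t]] smooth_mem[OF X[OF t]] by (auto simp: o_def)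
 from smooth_lin[OF N(3,2,1) Qn this] show ?thesis unfolding psi_def .
qed

lemma from_cover: "smooth_from_cover pr (G0 G pr) Es (sobolev_norm p) Psi"
 unfolding smooth_from_cover_def
proof (intro ballI allI)
 fix g h assume g: "g \<in> G0 G pr"
 let ?t = "fst (crd g)"
 let ?W = "Wm ?t \<inter> {A. fst (om ?t A) > 0}"
 obtain U where U: "openin (top_of_set (G0 G pr)) U" "g \<in> U" "pr ` U \<subseteq> ?W" "\<forall>g'\<in>U. crd g' = om ?t (pr g')"
  using local_coordinates[OF g] by blast
 have "open (Wm ?t \<inter> (%A. fst (om ?t A)) -` {0<..})"
  by (rule continuous_open_preimage[OF continuous_on_fst[OF cont_om] open_Wm]) simp
 moreover have "Wm ?t \<inter> (%A. fst (om ?t A)) -` {0<..} = ?W" by auto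
 ultimately have oW: "open ?W" by simp
 have "nopen tsp (?W \<times> (UNIV :: 'h set))" using oW by (intro nopen_tsp open_Times) auto
 from smooth_imp_smooth_map[OF nspace_tsp nspace_NE this smooth_psi]
 have sm: "smooth_map UNIV norm Es (sobolev_norm p) (?W \<times> (UNIV :: 'h set)) (%z. psi (om ?t (fst z)) (snd z))" by simp
 show "\<exists>U V W k. openin (top_of_set (G0 G pr)) U \<and> g \<in> U \<and> open V \<and> h \<in> V \<and> open W \<and> pr ` U \<subseteq> W \<and>
   smooth_map UNIV norm Es (sobolev_norm p) (W \<times> V) k \<and> (\<forall>g'\<in>U. \<forall>h'\<in>V. Psi (g', h') = k (pr g', h'))"
 proof (intro exI conjI)
  show "openin (top_of_set (G0 G pr)) U" "g \<in> U" "pr ` U \<subseteq> ?W" by (fact U)+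
  show "open (UNIV :: 'h set)" "h \<in> UNIV" by simp_all
  show "open ?W" by (rule oW)
  show "smooth_map UNIV norm Es (sobolev_norm p) (?W \<times> (UNIV :: 'h set)) (%z. psi (om ?t (fst z)) (snd z))" by (rule sm)
  show "\<forall>g'\<in>U. \<forall>h'\<in>UNIV. Psi (g', h') = psi (om ?t (fst (pr g', h'))) (snd (pr g', h'))"
   unfolding Psi_def fst_conv snd_conv using U(4) by metis
 qed
qed

lemma nlinear_E: "nlinear NE (S p) (%x. x)"
 using subE(2) by (auto simp: nlinear_def intro!: exI[of _ 1])

text \<open>Linearity and boundedness of the projection \<open>prj\<close> are transported through
  the isometry \<open>kap\<close>.\<close>

lemma nlinear_hpt: "nlinear NE tsp hpt"
proof -
 have S: "c1 \<in> fst (S p)" "c2 \<in> fst (S p)" "c3 \<in> fst (S p)" using cE subE(2) by auto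
 have 2: "nlinear (S p) (S p) prj2" unfolding prj2_def[abs_def]
  by (intro nlinear_minus_proj nspace_S nlinear_I_end nlinear_W_end S) (auto simp: nlinear_def intro!: exI[of _ 1])
 have "nlinear (S p) tsp \<psi>3" unfolding \<psi>3_def[abs_def]
  by (rule nlinear_compose[OF nspace_S nspace_tsp nspace_tsp nlinear_ipS nlinear_bl[OF bounded_linear_divide]])
 from nlinear_minus_proj[OF nspace_S nspace_S 2 nlinear_compose[OF nspace_S nspace_S nspace_tsp 2 this] S(3)]
 have prj: "nlinear (S p) (S p) prj" unfolding prj_def[abs_def] .
 then obtain C where C: "\<forall>x\<in>sobolev p. sobolev_norm p (prj x) \<le> C * sobolev_norm p x" unfolding nlinear_def by auto
 have "norm (hpt y) \<le> C * sobolev_norm p y" if "y \<in> Es" for y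
  using bspec[OF C subsetD[OF subE(2) that]] kap_norm[of "hpt y"] kap_hpt[OF that] by simp
 moreover have "hpt (a *\<^sub>R x + b *\<^sub>R y) = a *\<^sub>R hpt x + b *\<^sub>R hpt y" if x: "x \<in> Es" and y: "y \<in> Es" for a b x y
 proof (rule inj_kap)
  have xy: "a *\<^sub>R x + b *\<^sub>R y \<in> Es" using x y by (intro Es_closed)
  have "prj (a *\<^sub>R x + b *\<^sub>R y) = a *\<^sub>R prj x + b *\<^sub>R prj y" using prj subsetD[OF subE(2) x] subsetD[OF subE(2) y] unfolding nlinear_def S_simps by blast
  then show "kap (hpt (a *\<^sub>R x + b *\<^sub>R y)) = kap (a *\<^sub>R hpt x + b *\<^sub>R hpt y)"
   unfolding kap(2,3) kap_hpt[OF x] kap_hpt[OF y] kap_hpt[OF xy] .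
 qed
 ultimately show ?thesis unfolding nlinear_def by auto
qed

lemma endp_cont: "continuous_on UNIV (%q. endp (X q))"
proof -
 have "smooth tsp tsp UNIV (%q. ev (I (emb (yexp (W (X q))))))" "smooth tsp tsp UNIV (%q. ev (W (X q)))" "smooth tsp tsp UNIV (%q. ev (I (X q)))"
  by (intro smooth_bl[OF nspace_tsp bounded_linear_ev] smooth_bl[OF nspace_tsp bounded_linear_I] smooth_bl[OF nspace_tsp bounded_linear_emb]
    smooth_comp[OF nspace_tsp smooth_yexp] smooth_W smooth_X_tsp nspace_tsp subset_UNIV)+
 from this[THEN smooth_imp_continuous_on]
 show ?thesis unfolding endp_def Th_def E_def ev_def by (intro continuous_on_Pair)
qed

lemma metric_NE: "Metric_space Es (%x y. sobolev_norm p (x - y))"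
proof
 note N = nspace_NE[unfolded nspace_def fst_conv snd_conv]
 show "0 \<le> sobolev_norm p (x - y)" for x y by (rule sobolev_norm_nonneg)
 show "sobolev_norm p (x - y) = sobolev_norm p (y - x)" for x y
  by (rule sobolev_norm_commute)
 show "sobolev_norm p (x - y) = 0 \<longleftrightarrow> x = y" if "x \<in> Es" "y \<in> Es" for x y
  using N Es_closed(2)[OF that] nspace_norm0[OF nspace_S, of p] by auto
 show "sobolev_norm p (x - z) \<le> sobolev_norm p (x - y) + sobolev_norm p (y - z)" if "x \<in> Es" "y \<in> Es" "z \<in> Es" for x y z
 proof -
  have "sobolev_norm p ((x - y) + (y - z)) \<le> sobolev_norm p (x - y) + sobolev_norm p (y - z)"
   using N Es_closed(2)[OF that(1,2)] Es_closed(2)[OF that(2,3)] by blast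
  then show ?thesis by simp
 qed
qed

lemma to_cover: "smooth_to_cover pr (G0 G pr) Es (sobolev_norm p) (inv_into (G0 G pr \<times> UNIV) Psi)"
 unfolding smooth_to_cover_def
proof (intro conjI)
 interpret M: Metric_space Es "%x y. sobolev_norm p (x - y)" by (rule metric_NE)
 let ?f = "%q. phi (endp (X q))" and ?inv = "inv_into (G0 G pr \<times> UNIV) Psi"
 have fe: "fst (?inv q) = ?f q" "snd (?inv q) = hpt (Qp (X q))" if "q \<in> Es" for q
  using inv_Psi[OF that] by (simp_all add: lam_def)
 have cf: "continuous_on UNIV ?f" by (rule continuous_on_compose2[OF phi(1) endp_cont]) simp
 have fM: "?f q \<in> G0 G pr" for q by (rule endp_G0)
 show "continuous_map M.mtopology (top_of_set (G0 G pr)) (%x. fst (?inv x))"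
  unfolding continuous_map_def
 proof (intro conjI allI impI)
  show "(%x. fst (?inv x)) \<in> topspace M.mtopology \<rightarrow> topspace (top_of_set (G0 G pr))"
   using fM by (auto simp: fe)
  fix U assume "openin (top_of_set (G0 G pr)) U"
  then obtain O1 where O1: "open O1" "U = G0 G pr \<inter> O1" by (auto simp: openin_open)
  have oV: "open (?f -` O1)" using cf O1(1) by (intro open_vimage) auto
  have eq: "{x \<in> topspace M.mtopology. fst (?inv x) \<in> U} = Es \<inter> ?f -` O1"
   using fM O1(2) by (auto simp: fe)
  \<comment> \<open>The L2 norm is at most the Sobolev norm, so continuity in L2
    (\<open>endp_cont\<close>) is enough.\<close>
  have "openin M.mtopology (Es \<inter> ?f -` O1)" unfolding M.openin_mtopology
  proof (intro conjI allI impI)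
   fix x assume x: "x \<in> Es \<inter> ?f -` O1"
   then obtain e where e: "e > 0" "ball x e \<subseteq> ?f -` O1" using oV by (meson IntE openE)
   have "M.mball x e \<subseteq> Es \<inter> ?f -` O1"
   proof
    fix y assume y: "y \<in> M.mball x e"
    then have "norm (x - y) < e" using norm_le_sobolev_norm[of "x - y" p] by simp
    then have "y \<in> ball x e" by (simp add: dist_norm)
    then show "y \<in> Es \<inter> ?f -` O1" using y e by auto
   qed
   then show "\<exists>r>0. M.mball x r \<subseteq> Es \<inter> ?f -` O1" using e by blast
  qed simp
  then show "openin M.mtopology {x \<in> topspace M.mtopology. fst (?inv x) \<in> U}" unfolding eq .
 qed
 have op: "nopen NE Es" unfolding nopen_def by (auto intro: Es_closed intro!: exI[of _ 1])
 have id: "smooth NE (S p) Es (%x. x)" by (rule smooth_linear[OF nspace_NE nspace_S nlinear_E]) simp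
 have Ph: "smooth NE tsp Es (%q. Phi q TT)"
  by (rule smooth_comp[OF nspace_NE smooth_Phi smooth_lin[OF nspace_NE nspace_S nspace_tsp nlinear_L2 id]]) simp
 \<comment> \<open>The matrix under the group component is the end value of the fundamental
   solution, which is known to be smooth in q; no chart of \<open>G\<close> enters here.\<close>
 have prq: "pr (?f q) = Phi q TT" for q
  using Mt_kepler[of "X q" TT] by (simp only: phi(3) endp_def F_X)
 have "pr (fst (?inv q)) = Phi q TT" if "q \<in> Es" for q unfolding fe(1)[OF that] by (rule prq)
 from smooth_cong[OF nspace_NE this Ph] have "smooth NE tsp Es (%q. pr (fst (?inv q)))" .
 from smooth_imp_smooth_map[OF nspace_NE nspace_tsp op this]
 show "smooth_map Es (sobolev_norm p) UNIV norm Es (%x. pr (fst (?inv x)))" by simp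
 have "smooth NE (S p) Es (%q. X q)"
  using smooth_compose[OF nspace_NE nspace_S nspace_S smooth_X id] subE(2) by (auto simp: o_def)
 note hp = smooth_lin[OF nspace_NE nspace_NE nspace_tsp nlinear_hpt smooth_lin[OF nspace_NE nspace_S nspace_NE Qn this]]
 from smooth_cong[OF nspace_NE fe(2) hp] have "smooth NE tsp Es (%q. snd (?inv q))" .
 from smooth_imp_smooth_map[OF nspace_NE nspace_tsp op this]
 show "smooth_map Es (sobolev_norm p) UNIV norm Es (%x. snd (?inv x))" by simp
qed

lemma diffeo: "smooth_diffeo pr (G0 G pr) Es (sobolev_norm p) Psi"
 unfolding smooth_diffeo_def using bij_Psi from_cover to_cover by blast

end

lemma ex_isometry:
 assumes "hilbert_sub (UNIV :: 'h::real_inner set) (\<bullet>)" and V: "hilbert_sub V (ipS p)"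
 shows "\<exists>kap :: 'h => ltwo. bij_betw kap UNIV V \<and> (\<forall>x y. kap (x + y) = kap x + kap y) \<and> (\<forall>c x. kap (c *\<^sub>R x) = c *\<^sub>R kap x) \<and> (\<forall>x. ipS p (kap x) (kap x) = x \<bullet> x)"
 using hilbert_isometry[OF assms] by simp

theorem theorem3:
  fixes G :: "('g::topological_space, 'm) monoid_scheme"
    and pr :: "'g \<Rightarrow> real^2^2"
    and p :: nat
  assumes "universal_cover_SL2 G pr"
    and separable: "separable_space (euclidean :: 'h::{real_inner, complete_space} topology)"
    and infinite_dim: "\<not> (\<exists>B :: 'h set. finite B \<and> span B = UNIV)"
  shows "\<exists>\<Psi>_int \<Psi>_circ :: 'g \<times> 'h \<Rightarrow> ltwo.
    smooth_diffeo pr (G0 G pr) (sobolev p) (sobolev_norm p) \<Psi>_int \<and>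
    smooth_diffeo pr (G0 G pr) (sobolev_circle p) (sobolev_norm p) \<Psi>_circ \<and>
    (\<forall>g \<in> G0 G pr. \<forall>h. monodromy G pr (\<Psi>_int (g, h)) = g \<and> monodromy G pr (\<Psi>_circ (g, h)) = g)"
proof -
 note H = hilbert_UNIV[OF separable infinite_dim]
 interpret cov: cover_SL2 G pr by unfold_locales (rule assms(1))
 obtain c1 c2 c3 where c1: "c1 \<in> Zs p" "c1 \<in> sobolev p" "I c1 TT = 1" "W c1 TT = 0" and c2: "c2 \<in> Zs p" "c2 \<in> sobolev p" "I c2 TT = 0" "W c2 TT = 1"
  and c3: "c3 \<in> Zs p" "c3 \<in> sobolev p" "I c3 TT = 0" "W c3 TT = 0" and bump: "!!t. 0 < t ==> t < TT ==> 0 < W c3 t"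
  using ex_directions[of p] by blast
 obtain d where d: "!!j. j < p ==> dual_at p d j" using ex_dual by blast
 interpret jd: jump_dual p d by unfold_locales (rule d)
 have c3n: "ipS p c3 c3 \<noteq> 0"
 proof
  assume "ipS p c3 c3 = 0"
  then have "c3 = 0" using c3(2) nspace_S[of p] unfolding ipS_self nspace_def by auto
  then show False using bump[of pi] by (simp add: W_lin)
 qed
 note Ss = subspace_add[OF subspace_sobolev, of _ p] subspace_diff[OF subspace_sobolev, of _ p] subspace_scale[OF subspace_sobolev, of _ p]
 let ?\<Phi> = "{%x. I x TT, %x. W x TT, %x. ipS p x c3}"
 let ?V = "{x \<in> sobolev p. \<forall>f\<in>?\<Phi>. f x = 0}" let ?V' = "{x \<in> sobolev p. \<forall>f\<in>?\<Phi> \<union> J ` {..<p}. f x = 0}"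
 \<comment> \<open>The end functionals form an identity matrix on \<open>c1\<close> and
   \<open>c2\<close>, and \<open>c3\<close> is invisible to them. So the three components can be
   removed one after the other.\<close>
 have dec: "\<exists>a b s. y - a *\<^sub>R c1 - b *\<^sub>R c2 - s *\<^sub>R c3 \<in> ?V" if y: "y \<in> sobolev p" for y
 proof -
  let ?y = "y - I y TT *\<^sub>R c1 - W y TT *\<^sub>R c2" let ?s = "ipS p ?y c3 / ipS p c3 c3"
  have y2: "?y \<in> sobolev p" using y c1 c2 by (intro Ss)
  have "ipS p (1 *\<^sub>R ?y + (- ?s) *\<^sub>R c3) c3 = 1 * ipS p ?y c3 + (- ?s) * ipS p c3 c3" by (rule ipS_lin[OF y2 c3(2)])
  then have "ipS p (?y - ?s *\<^sub>R c3) c3 = 0" using c3n by simp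
  moreover have "?y - ?s *\<^sub>R c3 \<in> sobolev p" by (rule Ss(2)[OF y2 Ss(3)[OF c3(2)]])
  ultimately have "?y - ?s *\<^sub>R c3 \<in> ?V" using c1 c2 c3 by (simp add: I_lin W_lin)
  then show ?thesis by blast
 qed
 have "hilbert_sub ?V (ipS p)"
 proof (rule hilbert_kernel[where C = "{c1, c2, c3}"])
  show "sobolev p \<subseteq> span (?V \<union> {c1, c2, c3})"
  proof
   fix y assume "y \<in> sobolev p"
   then obtain a b s where v: "y - a *\<^sub>R c1 - b *\<^sub>R c2 - s *\<^sub>R c3 \<in> ?V" using dec by blast
   have "(y - a *\<^sub>R c1 - b *\<^sub>R c2 - s *\<^sub>R c3) + a *\<^sub>R c1 + b *\<^sub>R c2 + s *\<^sub>R c3 \<in> span (?V \<union> {c1, c2, c3})"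
    by (intro span_add span_scale) (use v in \<open>blast intro: span_base\<close>)+
   then show "y \<in> span (?V \<union> {c1, c2, c3})" by (simp add: algebra_simps)
  qed
 qed (use nlinear_I_end nlinear_W_end nlinear_ipS in auto)
 then obtain kap :: "'h => ltwo" where kap: "bij_betw kap UNIV ?V" "!!x y. kap (x + y) = kap x + kap y" "!!c x. kap (c *\<^sub>R x) = c *\<^sub>R kap x"
   "!!x. ipS p (kap x) (kap x) = x \<bullet> x"
  using ex_isometry[OF H] by blast
 have V: "?V = {x \<in> sobolev p. I x TT = 0 \<and> W x TT = 0 \<and> ipS p x c3 = 0}" by auto
 \<comment> \<open>On the interval there is no boundary condition to solve.\<close>
 interpret A: target G pr p "sobolev p" "%x. x" "%x. x" c1 c2 c3 kap
 proof
  show "smooth (sobolev p, sobolev_norm p) (S p) (sobolev p) (%x. x)" unfolding S_def[symmetric] by (rule smooth_id) simp_all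
  show "bij_betw kap UNIV {x \<in> sobolev p. I x TT = 0 \<and> W x TT = 0 \<and> ipS p x c3 = 0}" using kap(1) unfolding V .
  show "nlinear (S p) (sobolev p, sobolev_norm p) (%x. x)" by (auto simp: nlinear_def intro!: exI[of _ 1])
  show "F y \<in> sobolev p" if "y \<in> sobolev p" for y by (rule jd.F_sobolev[OF that])
 qed (simp_all add: subspace_sobolev c1 c2 c3 bump kap(2-4))
 have cc: "c \<in> sobolev_circle p" if "c \<in> Zs p" "c \<in> sobolev p" for c using that Zs_J by (simp add: circle_iff)
 \<comment> \<open>The periodic kernel is treated inside \<open>sobolev p\<close>, with the jumps as
   further functionals; the dual elements \<open>d\<close> complete the complement.\<close>
 have "hilbert_sub ?V' (ipS p)"
 proof (rule hilbert_kernel[where C = "{c1, c2, c3} \<union> d ` {..<p}"])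
  show "sobolev p \<subseteq> span (?V' \<union> ({c1, c2, c3} \<union> d ` {..<p}))" (is "_ \<subseteq> span ?T")
  proof
   fix x assume x: "x \<in> sobolev p"
   let ?y = "jd.Pd x"
   have y: "?y \<in> sobolev_circle p" by (rule jd.Pd_circle[OF x])
   then obtain a b s where v: "?y - a *\<^sub>R c1 - b *\<^sub>R c2 - s *\<^sub>R c3 \<in> ?V" using dec circle_iff by blast
   have "?y - a *\<^sub>R c1 - b *\<^sub>R c2 - s *\<^sub>R c3 \<in> sobolev_circle p"
    using y cc c1 c2 c3 by (intro subspace_diff[OF subspace_circle] subspace_scale[OF subspace_circle]) auto
   then have v': "?y - a *\<^sub>R c1 - b *\<^sub>R c2 - s *\<^sub>R c3 \<in> ?V'" using v by (auto simp: circle_iff)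
   have "jd.dsum (%j. J j x) \<in> span ?T" unfolding jd.dsum_def by (intro span_sum span_scale span_base) auto
   moreover have "(?y - a *\<^sub>R c1 - b *\<^sub>R c2 - s *\<^sub>R c3) + a *\<^sub>R c1 + b *\<^sub>R c2 + s *\<^sub>R c3 \<in> span ?T"
    by (intro span_add span_scale) (use v' in \<open>blast intro: span_base\<close>)+
   then have "?y \<in> span ?T" by (simp add: algebra_simps)
   ultimately have "?y + jd.dsum (%j. J j x) \<in> span ?T" by (intro span_add)
   then show "x \<in> span ?T" by (simp add: jd.Pd_def)
  qed
 qed (use nlinear_I_end nlinear_W_end nlinear_ipS nlinear_J in auto)
 then obtain kap' :: "'h => ltwo" where kap': "bij_betw kap' UNIV ?V'" "!!x y. kap' (x + y) = kap' x + kap' y" "!!c x. kap' (c *\<^sub>R x) = c *\<^sub>R kap' x"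
   "!!x. ipS p (kap' x) (kap' x) = x \<bullet> x"
  using ex_isometry[OF H] by blast
 have V': "?V' = {x \<in> sobolev_circle p. I x TT = 0 \<and> W x TT = 0 \<and> ipS p x c3 = 0}" by (auto simp: circle_iff)
 have sub: "y \<in> sobolev_circle p ==> y \<in> sobolev p" for y by (simp add: circle_iff)
 have c3D: "c3 \<in> jd.Dz p" using c3 by (simp add: jd.Dz_def)
 \<comment> \<open>On the circle the stationary iteration and the jump projection take over the
   roles of \<open>X0\<close> and \<open>Qp\<close>.\<close>
 interpret B: target G pr p "sobolev_circle p" jd.X0 jd.Pd c1 c2 c3 kap'
 proof
  show "smooth (sobolev_circle p, sobolev_norm p) (S p) (sobolev_circle p) jd.X0" using jd.smooth_X0 by (simp add: SC_def)
  show "nlinear (S p) (sobolev_circle p, sobolev_norm p) jd.Pd" using jd.nlinear_Pd by (simp add: SC_def)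
  show "jd.X0 (y + s *\<^sub>R c3) = jd.X0 y + s *\<^sub>R c3" if "y \<in> sobolev_circle p" for y s by (rule jd.X0_shift[OF sub[OF that] c3D])
  show "bij_betw kap' UNIV {x \<in> sobolev_circle p. I x TT = 0 \<and> W x TT = 0 \<and> ipS p x c3 = 0}" using kap'(1) unfolding V' .
  show "sobolev_circle p \<subseteq> sobolev p" using sub by blast
 qed (simp_all add: subspace_circle sub cc c1 c2 c3 bump kap'(2-4) jd.Pd_id jd.Pd_X0 jd.X0_Pd jd.F_X0 jd.X0_ends)
 show ?thesis
  by (rule exI[of _ A.Psi], rule exI[of _ B.Psi]) (simp add: A.diffeo B.diffeo A.monodromy_Psi B.monodromy_Psi)
qed

end
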